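(* Let $\Phi$ be an irreducible reduced root system, $j \in J \setminus \{0\}$, and $\omega := \omega_j \in W_{A_\circ}$, with order $o(\omega)$. Define a periodic function $c : \mathbb{Z}_{>0} \to \mathbb{Z}$ by $c(q) = 0$ if $q \notin o(\omega)\mathbb{Z}$ and $c(q) = \varphi(o(\omega))$ if $q \in o(\omega)\mathbb{Z}$, where $\varphi$ is Euler's totient function. Let $\Phi^\omega_{\mathrm{re}}$ be the folded root system, $M$ its coweight lattice, and let the root system $\Phi'$ and the integer $d \in \mathbb{Z}_{>0}$ be given by the following table (where $\Phi'$ is realized in $E^\omega$ from $\Phi^\omega_{\mathrm{re}}$ as described in the context): - $\Phi = A_\ell$ ($\ell\ge 1$), $\gcd\{\ell+1,j\} = 1$: $\Phi^\omega_{\mathrm{re}} = \varnothing$, $\Phi' = \varnothing$, $d = 1$. - $\Phi = A_\ell$, $g := \gcd\{\ell+1,j\} \ne 1$: $\Phi^\omega_{\mathrm{re}}$ of type $A_{g-1}$, $\Phi'$ of type $A_{g-1}$, $d = o(\omega_j) = \frac{\ell+1}{g}$. - $\Phi = B_2$, $j=1$: $\Phi^\omega_{\mathrm{re}}$ of type $A_1$, $\Phi'$ of type $A_1$, $d = 2$. - $\Phi = B_\ell$ ($\ell \ge 3$), $j = 1$: $\Phi^\omega_{\mathrm{re}}$ of type $B_{\ell-1}$, $\Phi'$ of type $C_{\ell-1}$, $d=1$. - $\Phi = C_\ell$ ($\ell \ge 3$ odd), $j = \ell$: $\Phi^\omega_{\mathrm{re}}$ of type $BC_{(\ell-1)/2}$,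 $\Phi'$ of type $BC_{(\ell-1)/2}$, $d = 2$. - $\Phi = C_\ell$ ($\ell \ge 4$ even), $j = \ell$: $\Phi^\omega_{\mathrm{re}}$ of type $C_{\ell/2}$, $\Phi'$ of type $C_{\ell/2}$, $d = 2$. - $\Phi = D_\ell$ ($\ell \ge 4$), $j = 1$: $\Phi^\omega_{\mathrm{re}}$ of type $B_{\ell-2}$, $\Phi'$ of type $C_{\ell-2}$, $d = 1$. - $\Phi = D_\ell$ ($\ell \ge 4$ even), $j \in \{\ell-1,\ell\}$: $\Phi^\omega_{\mathrm{re}}$ of type $C_{\ell/2}$, $\Phi'$ of type $B_{\ell/2}$, $d = 2$. - $\Phi = D_\ell$ ($\ell \ge 5$ odd), $j \in \{\ell-1,\ell\}$: $\Phi^\omega_{\mathrm{re}}$ of type $BC_{(\ell-3)/2}$, $\Phi'$ of type $C_{(\ell-3)/2}$, $d = 2$. - $\Phi = E_6$, $j \in \{1,6\}$: $\Phi^\omega_{\mathrm{re}}$ of type $G_2$, $\Phi' = (\Phi^\omega_{\mathrm{re}})^\vee$, $d = 1$. - $\Phi = E_7$, $j = 7$: $\Phi^\omega_{\mathrm{re}}$ of type $F_4$, $\Phi' = (\Phi^\omega_{\mathrm{re}})^\vee$, $d = 1$. Then for every $q \in \mathbb{Z}_{>0}$, $$\chi_{\Phi,q}(\omega) = c(q)\cdot \chi^{\mathrm{quasi}}_{d\Phi',\,M}(q).$$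
   Context: Let $E$ be a Euclidean space of dimension $\ell$ with inner product $(\cdot,\cdot)$, $\Phi \subset E$ an irreducible reduced (crystallographic) root system with Weyl group $W$ and simple roots $\alpha_1,\dots,\alpha_\ell$ (Bourbaki numbering). The coweight lattice is $Z := \{x \in E : (\alpha,x)\in\mathbb{Z}\ \forall \alpha \in \Phi\}$. For $q \in \mathbb{Z}_{>0}$, $M(\Phi;q) := \{x+qZ \in Z/qZ : (\beta,x)\not\equiv 0 \pmod q\ \forall \beta\in\Phi\}$; $W$ acts on it via $w(x+qZ) = w(x)+qZ$, and $\chi_{\Phi,q}(w) := \#\{t\in M(\Phi;q): w(t)=t\}$ is the permutation character. Let $\tilde\alpha = \sum_{i=1}^\ell n_i\alpha_i$ be the highest root, $n_0 := 1$, $J := \{i\in\{0,\dots,\ell\} : n_i = 1\}$. Let $w_0$ be the longest element of $W$; for $j \in J\setminus\{0\}$ let $w_j$ be the longest element of the subgroup of $W$ generated by the simple reflections $s_{\alpha_i}$, $i\neq j$, and put $\omega_j := w_jw_0$; $\omega_0 := 1$. Let $A_\circ = \{x\in E : (\alpha_i,x)>0\ \forall i,\ (\tilde\alpha,x)<1\}$ be the fundamental alcove, and let $W_{A_\circ}$ be the subgroup of $w \in W$ mapping the image of $A_\circ$ in $E/Z$ to itself; $W_{A_\circ} = \{\omega_j : j\in J\}$. (For types $E_8,F_4,G_2$ one has $J=\{0\}$, so there is nothing to consider.) For $x\in E$ put $x^\omega := \frac{1}{o(\omega)}\sum_{t=1}^{o(\omega)}\omega^t(x)$, lying in the fixed space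 $E^\omega := \{x\in E : \omega(x)=x\}$. The folded root system is $\Phi^\omega_{\mathrm{re}} := \{\beta^\omega : \beta\in\Phi,\ \beta^\omega\ne 0\}\subset E^\omega$ (it is known to be an irreducible, not necessarily reduced, root system in $E^\omega$, or empty when $E^\omega = 0$), and $M := \{x\in E^\omega : (\beta,x)\in\mathbb{Z}\ \forall\beta\in\Phi^\omega_{\mathrm{re}}\}$ is its coweight lattice. Realization of $\Phi'$ in $E^\omega$: for type $A_\ell$, for $B_2$ and for type $C_\ell$, $\Phi' = \Phi^\omega_{\mathrm{re}}$. For $B_\ell$ ($\ell\ge3$, $j=1$) and for $D_\ell$ with $j=1$, $\Phi' = \{2\beta : \beta\in\Phi^\omega_{\mathrm{re}}\text{ short}\}\cup\{\beta : \beta\in\Phi^\omega_{\mathrm{re}}\text{ long}\}$. For $D_\ell$, $\ell$ even, $j\in\{\ell-1,\ell\}$, $\Phi' = \{\beta : \beta\in\Phi^\omega_{\mathrm{re}}\text{ short}\}\cup\{\tfrac12\beta : \beta\in\Phi^\omega_{\mathrm{re}}\text{ long}\}$. For $D_\ell$, $\ell$ odd, $j\in\{\ell-1,\ell\}$, $\Phi' = \{2\beta : \beta\in\Phi^\omega_{\mathrm{re}}\text{ short}\}\cup\{\beta : \beta\in\Phi^\omega_{\mathrm{re}}\text{ not short}\}$ (here short roots of $BC_m$ are those of the smallest length). For $E_6$ and $E_7$, $\Phi' = (\Phi^\omega_{\mathrm{re}})^\vee = \{2\beta/(\beta,\beta) : \beta \in \Phi^\omega_{\mathrm{re}}\}$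 with $(\cdot,\cdot)$ normalized so that roots of $\Phi$ satisfy $(\alpha,\alpha)=2$; explicitly $\Phi' = \{3\beta : \beta\text{ short}\}\cup\{\beta : \beta\text{ long}\}$ for $E_6$ and $\Phi' = \{2\beta : \beta\text{ short}\}\cup\{\beta : \beta\text{ long}\}$ for $E_7$. For $d\in\mathbb{Z}_{>0}$, $d\Phi' := \{d\beta : \beta\in\Phi'\}$, and for a set of vectors $\Psi\subset E^\omega$ taking integer values on $M$, $$\chi^{\mathrm{quasi}}_{\Psi,M}(q) := \#\{x+qM\in M/qM : (\beta,x)\not\equiv0 \pmod q\ \forall\beta\in\Psi\},$$ so $\chi^{\mathrm{quasi}}_{\varnothing,\{0\}}(q)=1$. *)

theory Defs
  imports
    "HOL-Analysis.Analysis"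
    "HOL-Library.Real_Mod"
    "HOL-Number_Theory.Totient"
begin

section \<open>Root systems\<close>

definition cartan_integer :: "'a::euclidean_space \<Rightarrow> 'a \<Rightarrow> real" where
  "cartan_integer \<beta> \<alpha> = 2 * (\<beta> \<bullet> \<alpha>) / (\<alpha> \<bullet> \<alpha>)"

definition root_reflection :: "'a::euclidean_space \<Rightarrow> 'a \<Rightarrow> 'a" where
  "root_reflection \<alpha> x = x - cartan_integer x \<alpha> *\<^sub>R \<alpha>"

text \<open>
  Root systems are crystallographic but not necessarily reduced or irreducible.  The ambient space
  is a subspace \<open>V\<close>, because folded root systems live in the fixed space of a Weyl group element;
  the empty set is a root system in \<open>{0}\<close>.
\<close>

definition root_system_in :: "'a::euclidean_space set \<Rightarrow> 'a set \<Rightarrow> bool" where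
  "root_system_in V \<Phi> \<longleftrightarrow>
     finite \<Phi> \<and> span \<Phi> = V \<and> 0 \<notin> \<Phi> \<and>
     (\<forall>\<alpha>\<in>\<Phi>. root_reflection \<alpha> ` \<Phi> = \<Phi>) \<and>
     (\<forall>\<alpha>\<in>\<Phi>. \<forall>\<beta>\<in>\<Phi>. cartan_integer \<beta> \<alpha> \<in> \<int>)"

definition reduced_roots :: "'a::euclidean_space set \<Rightarrow> bool" where
  "reduced_roots \<Phi> \<longleftrightarrow> (\<forall>\<alpha>\<in>\<Phi>. \<forall>c::real. c *\<^sub>R \<alpha> \<in> \<Phi> \<longrightarrow> c = 1 \<or> c = -1)"

definition irreducible_roots :: "'a::euclidean_space set \<Rightarrow> bool" where
  "irreducible_roots \<Phi> \<longleftrightarrow> \<Phi> \<noteq> {} \<and>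
     \<not> (\<exists>\<Phi>1 \<Phi>2. \<Phi> = \<Phi>1 \<union> \<Phi>2 \<and> \<Phi>1 \<noteq> {} \<and> \<Phi>2 \<noteq> {} \<and> (\<forall>\<alpha>\<in>\<Phi>1. \<forall>\<beta>\<in>\<Phi>2. \<alpha> \<bullet> \<beta> = 0))"

text \<open>The simple roots are \<open>\<alpha> 1, \<dots>, \<alpha> l\<close>; values of \<open>\<alpha>\<close> outside \<open>{1..l}\<close> are irrelevant.\<close>

definition simple_roots :: "nat \<Rightarrow> 'a::euclidean_space set \<Rightarrow> (nat \<Rightarrow> 'a) \<Rightarrow> bool" where
  "simple_roots l \<Phi> \<alpha> \<longleftrightarrow>
     \<alpha> ` {1..l} \<subseteq> \<Phi> \<and> inj_on \<alpha> {1..l} \<and> independent (\<alpha> ` {1..l}) \<and>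
     (\<forall>\<beta>\<in>\<Phi>. \<exists>c :: nat \<Rightarrow> nat.
        \<beta> = (\<Sum>i=1..l. real (c i) *\<^sub>R \<alpha> i) \<or> \<beta> = - (\<Sum>i=1..l. real (c i) *\<^sub>R \<alpha> i))"


section \<open>Types in Bourbaki numbering\<close>

datatype root_type =
  Type_Empty | Type_A nat | Type_B nat | Type_C nat | Type_D nat | Type_E nat
  | Type_F4 | Type_G2 | Type_BC nat

fun type_rank :: "root_type \<Rightarrow> nat" where
  "type_rank Type_Empty = 0"
| "type_rank (Type_A n) = n"
| "type_rank (Type_B n) = n"
| "type_rank (Type_C n) = n"
| "type_rank (Type_D n) = n"
| "type_rank (Type_E n) = n"
| "type_rank Type_F4 = 4"
| "type_rank Type_G2 = 2"
| "type_rank (Type_BC n) = n"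

definition simply_laced_matrix :: "(nat \<times> nat) set \<Rightarrow> nat \<Rightarrow> nat \<Rightarrow> int" where
  "simply_laced_matrix E i k = (if i = k then 2 else if (i, k) \<in> E \<or> (k, i) \<in> E then -1 else 0)"

definition path_matrix :: "nat \<Rightarrow> nat \<Rightarrow> int" where
  "path_matrix = simply_laced_matrix {(i, Suc i) |i. True}"

text \<open>
  Entry \<open>(i, k)\<close> of the Cartan matrix is \<open>cartan_integer (\<alpha> i) (\<alpha> k)\<close>; only indices in
  \<open>{1..type_rank T}\<close> matter.  For \<open>BC\<close> this is the matrix of the base, i.e. that of type \<open>B\<close>.
\<close>

fun cartan_matrix :: "root_type \<Rightarrow> nat \<Rightarrow> nat \<Rightarrow> int" where
  "cartan_matrix Type_Empty i k = 0"
| "cartan_matrix (Type_A n) i k = path_matrix i k"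
| "cartan_matrix (Type_B n) i k = (if Suc i = n \<and> k = n then -2 else path_matrix i k)"
| "cartan_matrix (Type_C n) i k = (if i = n \<and> Suc k = n then -2 else path_matrix i k)"
| "cartan_matrix (Type_D n) i k =
     simply_laced_matrix ({(i, Suc i) |i. i + 2 \<le> n} \<union> {(n - 2, n)}) i k"
| "cartan_matrix (Type_E n) i k =
     simply_laced_matrix ({(1, 3), (2, 4)} \<union> {(i, Suc i) |i. 3 \<le> i}) i k"
| "cartan_matrix Type_F4 i k = (if i = 2 \<and> k = 3 then -2 else path_matrix i k)"
| "cartan_matrix Type_G2 i k = (if i = 2 \<and> k = 1 then -3 else path_matrix i k)"
| "cartan_matrix (Type_BC n) i k = (if Suc i = n \<and> k = n then -2 else path_matrix i k)"

definition bourbaki_simple_roots ::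
  "root_type \<Rightarrow> 'a::euclidean_space set \<Rightarrow> (nat \<Rightarrow> 'a) \<Rightarrow> bool" where
  "bourbaki_simple_roots T \<Phi> \<alpha> \<longleftrightarrow> simple_roots (type_rank T) \<Phi> \<alpha> \<and>
     (\<forall>i\<in>{1..type_rank T}. \<forall>k\<in>{1..type_rank T}.
        cartan_integer (\<alpha> i) (\<alpha> k) = of_int (cartan_matrix T i k))"

text \<open>The irreducible reduced types, each listed once up to isomorphism.\<close>

fun irreducible_reduced_type :: "root_type \<Rightarrow> bool" where
  "irreducible_reduced_type Type_Empty \<longleftrightarrow> False"
| "irreducible_reduced_type (Type_A n) \<longleftrightarrow> 1 \<le> n"
| "irreducible_reduced_type (Type_B n) \<longleftrightarrow> 2 \<le> n"
| "irreducible_reduced_type (Type_C n) \<longleftrightarrow> 3 \<le> n"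
| "irreducible_reduced_type (Type_D n) \<longleftrightarrow> 4 \<le> n"
| "irreducible_reduced_type (Type_E n) \<longleftrightarrow> n \<in> {6, 7, 8}"
| "irreducible_reduced_type Type_F4 \<longleftrightarrow> True"
| "irreducible_reduced_type Type_G2 \<longleftrightarrow> True"
| "irreducible_reduced_type (Type_BC n) \<longleftrightarrow> False"

text \<open>
  Here the low rank coincidences \<open>C 1 = A 1\<close> and \<open>C 2 = B 2\<close> are allowed.  A non-reduced root
  system with a base of type \<open>B n\<close> is \<open>BC n\<close>: only the short roots of \<open>B n\<close> can be doubled, and
  they form a single Weyl orbit.
\<close>

definition root_system_of_type ::
  "'a::euclidean_space set \<Rightarrow> 'a set \<Rightarrow> root_type \<Rightarrow> bool" where
  "root_system_of_type V \<Psi> T \<longleftrightarrow> root_system_in V \<Psi> \<and>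
     (reduced_roots \<Psi> \<longleftrightarrow> (\<forall>n. T \<noteq> Type_BC n)) \<and>
     (\<exists>\<alpha>. bourbaki_simple_roots T \<Psi> \<alpha>)"


section \<open>The Weyl group and the elements \<open>\<omega>\<^sub>j\<close>\<close>

text \<open>Reflections are involutions, so closure under multiplication by reflections gives a group.\<close>

inductive_set reflection_group :: "'a::euclidean_space set \<Rightarrow> ('a \<Rightarrow> 'a) set"
  for S :: "'a set" where
  id: "id \<in> reflection_group S"
| step: "\<alpha> \<in> S \<Longrightarrow> w \<in> reflection_group S \<Longrightarrow> root_reflection \<alpha> \<circ> w \<in> reflection_group S"

abbreviation (input) weyl_group :: "'a::euclidean_space set \<Rightarrow> ('a \<Rightarrow> 'a) set" where
  "weyl_group \<equiv> reflection_group"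

definition word_length :: "'a::euclidean_space set \<Rightarrow> ('a \<Rightarrow> 'a) \<Rightarrow> nat" where
  "word_length S w = (LEAST n. \<exists>\<beta>s. length \<beta>s = n \<and> set \<beta>s \<subseteq> S \<and>
     w = foldr (\<lambda>\<beta> f. root_reflection \<beta> \<circ> f) \<beta>s id)"

text \<open>The longest element of the reflection group \<open>G\<close> with simple system \<open>S\<close>.\<close>

definition longest_element :: "('a \<Rightarrow> 'a) set \<Rightarrow> 'a::euclidean_space set \<Rightarrow> 'a \<Rightarrow> 'a" where
  "longest_element G S = (THE w. w \<in> G \<and> (\<forall>v\<in>G. word_length S v \<le> word_length S w))"

definition highest_root :: "nat \<Rightarrow> 'a::euclidean_space set \<Rightarrow> (nat \<Rightarrow> 'a) \<Rightarrow> 'a" where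
  "highest_root l \<Phi> \<alpha> = (THE \<theta>. \<theta> \<in> \<Phi> \<and>
     (\<forall>\<beta>\<in>\<Phi>. \<exists>c :: nat \<Rightarrow> nat. \<theta> - \<beta> = (\<Sum>i=1..l. real (c i) *\<^sub>R \<alpha> i)))"

definition mark :: "nat \<Rightarrow> 'a::euclidean_space set \<Rightarrow> (nat \<Rightarrow> 'a) \<Rightarrow> nat \<Rightarrow> real" where
  "mark l \<Phi> \<alpha> i =
     (if i = 0 then 1 else representation (\<alpha> ` {1..l}) (highest_root l \<Phi> \<alpha>) (\<alpha> i))"

definition minuscule_indices :: "nat \<Rightarrow> 'a::euclidean_space set \<Rightarrow> (nat \<Rightarrow> 'a) \<Rightarrow> nat set" where
  "minuscule_indices l \<Phi> \<alpha> = {i \<in> {0..l}. mark l \<Phi> \<alpha> i = 1}"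

definition omega ::
  "nat \<Rightarrow> 'a::euclidean_space set \<Rightarrow> (nat \<Rightarrow> 'a) \<Rightarrow> nat \<Rightarrow> 'a \<Rightarrow> 'a" where
  "omega l \<Phi> \<alpha> j =
     (if j = 0 then id
      else let S\<^sub>j = \<alpha> ` ({1..l} - {j})
           in longest_element (reflection_group S\<^sub>j) S\<^sub>j \<circ>
              longest_element (weyl_group \<Phi>) (\<alpha> ` {1..l}))"

definition map_order :: "('a \<Rightarrow> 'a) \<Rightarrow> nat" where
  "map_order w = (LEAST n. 0 < n \<and> w ^^ n = id)"


section \<open>Lattices and counting functions\<close>

definition coweight_lattice :: "'a::euclidean_space set \<Rightarrow> 'a set \<Rightarrow> 'a set" where
  "coweight_lattice V \<Psi> = {x \<in> V. \<forall>\<beta>\<in>\<Psi>. \<beta> \<bullet> x \<in> \<int>}"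

definition lattice_coset :: "nat \<Rightarrow> 'a::euclidean_space set \<Rightarrow> 'a \<Rightarrow> 'a set" where
  "lattice_coset q L x = (\<lambda>z. x + real q *\<^sub>R z) ` L"

definition arrangement_complement ::
  "'a::euclidean_space set \<Rightarrow> 'a set \<Rightarrow> nat \<Rightarrow> 'a set set" where
  "arrangement_complement \<Psi> L q =
     {lattice_coset q L x |x. x \<in> L \<and> (\<forall>\<beta>\<in>\<Psi>. \<not> [\<beta> \<bullet> x = 0] (rmod real q))}"

text \<open>\<open>w\<close> is linear and preserves \<open>L\<close>, so the image of \<open>x + qL\<close> under \<open>w\<close> is \<open>w x + qL\<close>.\<close>

definition perm_character :: "'a::euclidean_space set \<Rightarrow> nat \<Rightarrow> ('a \<Rightarrow> 'a) \<Rightarrow> nat" where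
  "perm_character \<Phi> q w =
     card {t \<in> arrangement_complement \<Phi> (coweight_lattice UNIV \<Phi>) q. w ` t = t}"

definition chi_quasi :: "'a::euclidean_space set \<Rightarrow> 'a set \<Rightarrow> nat \<Rightarrow> nat" where
  "chi_quasi \<Psi> L q = card (arrangement_complement \<Psi> L q)"

definition c_factor :: "nat \<Rightarrow> nat \<Rightarrow> int" where
  "c_factor n q = (if n dvd q then int (totient n) else 0)"


section \<open>Folding\<close>

definition fixed_space :: "('a \<Rightarrow> 'a) \<Rightarrow> 'a set" where
  "fixed_space w = {x. w x = x}"

definition orbit_average :: "('a \<Rightarrow> 'a) \<Rightarrow> 'a::euclidean_space \<Rightarrow> 'a" where
  "orbit_average w x = (1 / real (map_order w)) *\<^sub>R (\<Sum>t=1..map_order w. (w ^^ t) x)"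

definition folded_roots :: "'a::euclidean_space set \<Rightarrow> ('a \<Rightarrow> 'a) \<Rightarrow> 'a set" where
  "folded_roots \<Phi> w = {orbit_average w \<beta> |\<beta>. \<beta> \<in> \<Phi> \<and> orbit_average w \<beta> \<noteq> 0}"

definition scaled :: "real \<Rightarrow> 'a::euclidean_space set \<Rightarrow> 'a set" where
  "scaled r \<Psi> = (\<lambda>\<beta>. r *\<^sub>R \<beta>) ` \<Psi>"

definition short_roots :: "'a::euclidean_space set \<Rightarrow> 'a set" where
  "short_roots \<Psi> = {\<beta> \<in> \<Psi>. \<forall>\<gamma>\<in>\<Psi>. norm \<beta> \<le> norm \<gamma>}"

definition long_roots :: "'a::euclidean_space set \<Rightarrow> 'a set" where
  "long_roots \<Psi> = {\<beta> \<in> \<Psi>. \<forall>\<gamma>\<in>\<Psi>. norm \<gamma> \<le> norm \<beta>}"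

text \<open>
  The multiple of the inner product for which the longest roots of \<open>\<Phi>\<close> have squared length 2.
  It is only used for the simply laced types \<open>E\<^sub>6\<close> and \<open>E\<^sub>7\<close>, where all roots are longest.
\<close>

definition normalized_inner :: "'a::euclidean_space set \<Rightarrow> 'a \<Rightarrow> 'a \<Rightarrow> real" where
  "normalized_inner \<Phi> x y = 2 / Max ((\<lambda>\<alpha>. \<alpha> \<bullet> \<alpha>) ` \<Phi>) * (x \<bullet> y)"

definition dual_roots :: "'a::euclidean_space set \<Rightarrow> 'a set \<Rightarrow> 'a set" where
  "dual_roots \<Phi> \<Psi> = {(2 / normalized_inner \<Phi> \<beta> \<beta>) *\<^sub>R \<beta> |\<beta>. \<beta> \<in> \<Psi>}"

text \<open>
  \<open>folding_table \<Phi> \<Psi> n T j T\<^sub>r\<^sub>e \<Phi>' T' d\<close>: for \<open>\<Phi>\<close> of type \<open>T\<close>, \<open>\<Psi>\<close> its folding by \<open>\<omega>\<^sub>j\<close> and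
  \<open>n\<close> the order of \<open>\<omega>\<^sub>j\<close>, the row of the table gives the type \<open>T\<^sub>r\<^sub>e\<close> of \<open>\<Psi>\<close>, the realization
  \<open>\<Phi>'\<close>, its type \<open>T'\<close> and the integer \<open>d\<close>.  The duals of \<open>G\<^sub>2\<close> and \<open>F\<^sub>4\<close> are again of types
  \<open>G\<^sub>2\<close> and \<open>F\<^sub>4\<close>.  In the second row both expressions for \<open>d\<close> are required to hold.
\<close>

inductive folding_table ::
  "'a::euclidean_space set \<Rightarrow> 'a set \<Rightarrow> nat \<Rightarrow> root_type \<Rightarrow> nat \<Rightarrow>
   root_type \<Rightarrow> 'a set \<Rightarrow> root_type \<Rightarrow> nat \<Rightarrow> bool"
  for \<Phi> \<Psi> :: "'a set" and n :: nat where
  A_coprime: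
    "1 \<le> l \<Longrightarrow> gcd (l + 1) j = 1 \<Longrightarrow>
     folding_table \<Phi> \<Psi> n (Type_A l) j Type_Empty {} Type_Empty 1"
| A:
    "1 \<le> l \<Longrightarrow> g = gcd (l + 1) j \<Longrightarrow> g \<noteq> 1 \<Longrightarrow>
     d = n \<Longrightarrow> d = (l + 1) div g \<Longrightarrow>
     folding_table \<Phi> \<Psi> n (Type_A l) j (Type_A (g - 1)) \<Psi> (Type_A (g - 1)) d"
| B2:
    "folding_table \<Phi> \<Psi> n (Type_B 2) 1 (Type_A 1) \<Psi> (Type_A 1) 2"
| B:
    "3 \<le> l \<Longrightarrow>
     folding_table \<Phi> \<Psi> n (Type_B l) 1
       (Type_B (l - 1)) (scaled 2 (short_roots \<Psi>) \<union> long_roots \<Psi>) (Type_C (l - 1)) 1"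
| C_odd:
    "3 \<le> l \<Longrightarrow> odd l \<Longrightarrow>
     folding_table \<Phi> \<Psi> n (Type_C l) l
       (Type_BC ((l - 1) div 2)) \<Psi> (Type_BC ((l - 1) div 2)) 2"
| C_even:
    "4 \<le> l \<Longrightarrow> even l \<Longrightarrow>
     folding_table \<Phi> \<Psi> n (Type_C l) l (Type_C (l div 2)) \<Psi> (Type_C (l div 2)) 2"
| D_vector:
    "4 \<le> l \<Longrightarrow>
     folding_table \<Phi> \<Psi> n (Type_D l) 1
       (Type_B (l - 2)) (scaled 2 (short_roots \<Psi>) \<union> long_roots \<Psi>) (Type_C (l - 2)) 1"
| D_even:
    "4 \<le> l \<Longrightarrow> even l \<Longrightarrow> j \<in> {l - 1, l} \<Longrightarrow>
     folding_table \<Phi> \<Psi> n (Type_D l) j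
       (Type_C (l div 2)) (short_roots \<Psi> \<union> scaled (1 / 2) (long_roots \<Psi>)) (Type_B (l div 2)) 2"
| D_odd:
    "5 \<le> l \<Longrightarrow> odd l \<Longrightarrow> j \<in> {l - 1, l} \<Longrightarrow>
     folding_table \<Phi> \<Psi> n (Type_D l) j
       (Type_BC ((l - 3) div 2)) (scaled 2 (short_roots \<Psi>) \<union> (\<Psi> - short_roots \<Psi>))
       (Type_C ((l - 3) div 2)) 2"
| E6:
    "j \<in> {1, 6} \<Longrightarrow>
     folding_table \<Phi> \<Psi> n (Type_E 6) j Type_G2 (dual_roots \<Phi> \<Psi>) Type_G2 1"
| E7:
    "folding_table \<Phi> \<Psi> n (Type_E 7) 7 Type_F4 (dual_roots \<Phi> \<Psi>) Type_F4 1"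

lemma folding_table_unique:
  assumes "folding_table \<Phi> \<Psi> n T j T1 \<Phi>1 T1' d1" and "folding_table \<Phi> \<Psi> n T j T2 \<Phi>2 T2' d2"
  shows "T1 = T2 \<and> \<Phi>1 = \<Phi>2 \<and> T1' = T2' \<and> d1 = d2"
  using assms by (auto elim!: folding_table.cases)

end

theory Submission
	imports Defs
begin

text \<open>
	Put \<open>t = x / q\<close>.  The classes counted by the permutation character are the points \<open>t\<close> of the torus
	\<open>E / Z\<close> with \<open>q t = 0\<close> that avoid the toric arrangement \<open>(\<beta>, t) \<in> \<int>\<close> and satisfy \<open>t - \<omega> t \<in> Z\<close>.  The
	points fixed by \<open>\<omega>\<close> form finitely many translates of the subtorus \<open>E\<^sup>\<omega> / M\<close>.  Let \<open>n\<close> be the order of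
	\<open>\<omega>\<close>.  In every type the translates that are not swallowed by the arrangement are \<open>p\<^sub>k + E\<^sup>\<omega> / M\<close> for
	\<open>k\<close> prime to \<open>n\<close>, where \<open>n p\<^sub>k \<in> Z\<close>, and an explicit root \<open>lam\<close>, a character of the torus that is
	trivial on \<open>E\<^sup>\<omega>\<close>, takes the value \<open>k / n\<close> on the \<open>k\<close>-th one.  So the translates are different, and
	one of them contains a point with \<open>q t = 0\<close> only if \<open>n\<close> divides \<open>q\<close>; then all do, and \<open>x - q p\<^sub>k\<close> runs
	through the lattice \<open>M\<close>.  This is the factor \<open>c(q)\<close>.  On each translate the arrangement restricts to the one of
	\<open>d \<Phi>'\<close>: the roots \<open>\<beta>\<close> with the same orbit average impose conditions \<open>(\<beta>\<^sup>\<omega>, y) \<noteq> - (\<beta>, p\<^sub>k)\<close>, the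
	constants \<open>(\<beta>, p\<^sub>k)\<close> are multiples of \<open>1 / n\<close>, and together these conditions say that certain multiples
	of the \<open>(\<beta>\<^sup>\<omega>, y)\<close> are not integers.  The lemma \<open>folding_statementI\<close> is this argument.

	To work with \<open>\<omega>\<^sub>j\<close> one needs it explicitly.  By \<open>omega_eqI\<close> it is recognized from its action on the
	simple roots: they go to simple roots other than \<open>\<alpha>\<^sub>j\<close>, except for one that goes to minus a root
	above \<open>\<alpha>\<^sub>j\<close>.  The classical root systems are determined by their simple roots, so they are the usual coordinate
	models; there \<open>\<omega>\<^sub>j\<close> is a rotation of the coordinates (type A), changes the signs of one or two coordinates
	(\<open>j = 1\<close> in types B and D), or reverses the coordinates up to sign.  For \<open>E\<^sub>6\<close> and \<open>E\<^sub>7\<close> the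
	same facts are checked on the lists of positive roots.  Indices \<open>j\<close> outside the table are excluded by
	a root with coefficient at least 2 at \<open>\<alpha>\<^sub>j\<close>.  Diagram automorphisms reduce \<open>j = l - 1\<close> in type D and \<open>j = 1\<close> in
	type \<open>E\<^sub>6\<close> to the last index.
\<close>

section \<open>Notation\<close>

notation (input) scaleR (infixr "*R" 75)

abbreviation (input) iff_ascii (infixr "<->" 25) where "A <-> B == (A = B)"

abbreviation (input) coweights :: "'a::euclidean_space set => 'a set" where
	"coweights == coweight_lattice UNIV"

section \<open>Reflections and reflection groups\<close>

lemma exists_prescribed_inner:
	fixes S :: "'a::euclidean_space set"
	assumes "independent S"
	shows "EX t. ALL s:S. s \<bullet> t = g s"
proof -
	obtain h where h: "linear h" "ALL s:S. h s = (g s :: real)"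
		using linear_independent_extend[OF assms] by blast
	have "s \<bullet> adjoint h 1 = g s" if "s : S" for s
		using adjoint_works[OF h(1), of s 1] h(2) that by simp
	then show ?thesis by blast
qed

lemma linear_root_reflection: "linear (root_reflection \<a>)"
	unfolding root_reflection_def cartan_integer_def
	by (intro linearI) (auto simp: algebra_simps inner_add_left add_divide_distrib)

lemma orthogonal_root_reflection: "orthogonal_transformation (root_reflection \<a>)"
proof (cases "\<a> = 0")
	case False
	then have "\<a> \<bullet> \<a> ~= 0" by simp
	then have "root_reflection \<a> v \<bullet> root_reflection \<a> w = v \<bullet> w" for v w
		unfolding root_reflection_def cartan_integer_def
		by (simp add: inner_diff_left inner_diff_right inner_commute field_simps)
	then show ?thesis by (simp add: orthogonal_transformation_def linear_root_reflection)
qed (simp add: orthogonal_transformation_def linear_root_reflection root_reflection_def)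

lemma root_reflection_involution [simp]: "root_reflection \<a> (root_reflection \<a> x) = x"
proof (cases "\<a> = 0")
	case False
	then have "\<a> \<bullet> \<a> ~= 0" by simp
	then show ?thesis
		unfolding root_reflection_def cartan_integer_def
		by (simp add: inner_diff_left algebra_simps flip: scaleR_add_left)
qed (simp add: root_reflection_def)

lemma root_reflection_comp_self [simp]: "root_reflection \<a> \<circ> root_reflection \<a> = id"
	by (simp add: fun_eq_iff)

lemma root_reflection_self: "\<a> ~= 0 ==> root_reflection \<a> \<a> = - \<a>"
	unfolding root_reflection_def cartan_integer_def by (simp add: scaleR_2 flip: scaleR_scaleR)

lemma root_reflection_conj:
	assumes "orthogonal_transformation w"
	shows "root_reflection (w \<a>) (w x) = w (root_reflection \<a> x)"
	using assms unfolding root_reflection_def cartan_integer_def orthogonal_transformation_def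
	by (simp add: linear_diff linear_scale)

lemma cartan_integer_orthogonal:
	"orthogonal_transformation w ==> cartan_integer (w x) (w y) = cartan_integer x y"
	unfolding cartan_integer_def orthogonal_transformation_def by simp

lemma reflection_group_orthogonal:
	"w : reflection_group S ==> orthogonal_transformation w"
proof (induction rule: reflection_group.induct)
	case (step \<a> w)
	then show ?case using orthogonal_transformation_compose[OF orthogonal_root_reflection] by blast
qed (simp add: id_def)

lemma reflection_in_group: "s : S ==> root_reflection s : reflection_group S"
	using reflection_group.step[OF _ reflection_group.id, of s S] by simp

lemma reflection_group_comp:
	assumes "w : reflection_group S" "v : reflection_group S"
	shows "w \<circ> v : reflection_group S"
	using assms by (induction rule: reflection_group.induct) (auto simp: comp_assoc intro: reflection_group.step)

lemma reflection_group_funpow: "w : reflection_group S ==> (w ^^ n) : reflection_group S"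
	by (induction n) (auto intro: reflection_group.id reflection_group_comp)

lemma reflection_group_inverse:
	assumes "w : reflection_group S"
	shows "EX v:reflection_group S. v \<circ> w = id & w \<circ> v = id"
	using assms
proof (induction rule: reflection_group.induct)
	case id
	show ?case by (rule bexI[OF _ reflection_group.id]) simp
next
	case (step \<a> w)
	then obtain v where v: "v : reflection_group S" "v \<circ> w = id" "w \<circ> v = id" by blast
	then have "v \<circ> root_reflection \<a> : reflection_group S"
		using step reflection_in_group reflection_group_comp by blast
	then show ?case
		using v by (intro bexI[of _ "v \<circ> root_reflection \<a>"]) (auto simp: fun_eq_iff)
qed

lemma reflection_group_mono: "S \<subseteq> T ==> w : reflection_group S ==> w : reflection_group T"
	by (rotate_tac, induction rule: reflection_group.induct) (auto intro: reflection_group.intros)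

lemma root_system_in_reflection:
	"root_system_in V \<Phi> ==> \<a> : \<Phi> ==> \<beta> : \<Phi> ==> root_reflection \<a> \<beta> : \<Phi>"
	unfolding root_system_in_def by blast

lemma root_system_in_uminus:
	assumes "root_system_in V \<Phi>" "\<beta> : \<Phi>" shows "- \<beta> : \<Phi>"
	using root_system_in_reflection[OF assms(1,2,2)] root_reflection_self[of \<beta>] assms
	unfolding root_system_in_def by metis

lemma root_system_in_cartan:
	"root_system_in V \<Phi> ==> \<a> : \<Phi> ==> \<beta> : \<Phi> ==> cartan_integer \<beta> \<a> : Ints"
	unfolding root_system_in_def by blast

lemma reflection_group_roots:
	assumes "root_system_in V \<Phi>" "S \<subseteq> \<Phi>" "w : reflection_group S" "\<beta> : \<Phi>"
	shows "w \<beta> : \<Phi>"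
	using assms(3,2,4)
	by (induction rule: reflection_group.induct) (auto intro: root_system_in_reflection[OF assms(1)])

section \<open>Simple systems, lengths and longest elements\<close>

definition fundamental_coweight :: "'a::euclidean_space set => 'a => 'a" where
	"fundamental_coweight S s = (SOME d. ALL u:S. u \<bullet> d = (if u = s then 1 else 0))"

lemma fundamental_coweight:
	assumes "independent S" "u : S"
	shows "u \<bullet> fundamental_coweight S s = (if u = s then 1 else 0)"
	using someI_ex[OF exists_prescribed_inner[OF assms(1), of "%u. if u = s then 1 else 0"]] assms(2)
	unfolding fundamental_coweight_def by blast

lemma coweight_expansion:
	assumes "independent S" "x : span S"
	shows "x = (\<Sum>s\<in>S. (x \<bullet> fundamental_coweight S s) *R s)"
	using assms(2)
proof (induction rule: span_induct_alt)
	case (step c u y)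
	have "finite S" using assms(1) by (simp add: finiteI_independent)
	have "(\<Sum>s\<in>S. ((c *R u + y) \<bullet> fundamental_coweight S s) *R s) =
		 (\<Sum>s\<in>S. (c * (if u = s then 1 else 0)) *R s) + (\<Sum>s\<in>S. (y \<bullet> fundamental_coweight S s) *R s)"
		using step(1) by (simp add: fundamental_coweight[OF assms(1)] inner_add_left scaleR_add_left sum.distrib)
	also have "(\<Sum>s\<in>S. (c * (if u = s then 1 else 0)) *R s) = (\<Sum>s\<in>S. if u = s then c *R u else 0)"
		by (rule sum.cong) auto
	also have "\<dots> = c *R u" using \<open>finite S\<close> step(1) by simp
	finally show ?case using step(2) by simp
qed simp

definition reflection_word :: "'a::euclidean_space list => 'a => 'a" where
	"reflection_word \<beta>s = foldr (%\<beta> f. root_reflection \<beta> \<circ> f) \<beta>s id"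

lemma reflection_word_simps [simp]:
	"reflection_word [] = id" "reflection_word (s # xs) = root_reflection s \<circ> reflection_word xs"
	by (simp_all add: reflection_word_def)

lemma reflection_word_append: "reflection_word (xs @ ys) = reflection_word xs \<circ> reflection_word ys"
	by (induction xs) (auto simp: comp_assoc)

lemma reflection_word_in_group: "set xs \<subseteq> S ==> reflection_word xs : reflection_group S"
	by (induction xs) (auto intro: reflection_group.intros)

lemma reflection_group_word:
	"w : reflection_group S ==> EX xs. set xs \<subseteq> S & w = reflection_word xs"
proof (induction rule: reflection_group.induct)
	case id show ?case by (rule exI[of _ "[]"]) auto
next
	case (step \<a> w)
	then obtain xs where "set xs \<subseteq> S" "w = reflection_word xs" by auto
	with step(1) show ?case by (intro exI[of _ "\<a> # xs"]) auto
qed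

locale simple_system =
	fixes \<Phi> S :: "'a::euclidean_space set"
	assumes roots: "root_system_in (span S) \<Phi>" and reduced: "reduced_roots \<Phi>"
		and simple_subset: "S \<subseteq> \<Phi>" and independent_simple: "independent S"
		and sign: "\<beta> : \<Phi> ==> (ALL s:S. 0 <= \<beta> \<bullet> fundamental_coweight S s) |
											 (ALL s:S. \<beta> \<bullet> fundamental_coweight S s <= 0)"
begin

abbreviation coeff :: "'a => 'a => real" where
	"coeff s x \<equiv> x \<bullet> fundamental_coweight S s"

definition pos :: "'a => bool" where
	"pos \<beta> <-> \<beta> : \<Phi> & (ALL s:S. 0 <= coeff s \<beta>)"

lemma finite_simple: "finite S"
	using independent_simple by (simp add: finiteI_independent)

lemma finite_roots: "finite \<Phi>" and roots_nonzero: "0 ~: \<Phi>" and roots_span: "\<beta> : \<Phi> ==> \<beta> : span S"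
	using roots span_superset[of \<Phi>] unfolding root_system_in_def by auto

lemma coeff_simple: "u : S ==> coeff s u = (if u = s then 1 else 0)"
	by (rule fundamental_coweight[OF independent_simple])

lemma expansion: "x : span S ==> x = (\<Sum>s\<in>S. coeff s x *R s)"
	by (rule coweight_expansion[OF independent_simple])

lemma coeff_zero_imp_zero: "x : span S ==> (!!s. s : S ==> coeff s x = 0) ==> x = 0"
	by (subst expansion) auto

lemma pos_or_neg: "\<beta> : \<Phi> ==> pos \<beta> | pos (- \<beta>)"
	using sign[of \<beta>] root_system_in_uminus[OF roots] by (auto simp: pos_def)

lemma not_pos_uminus: "pos \<beta> ==> ~ pos (- \<beta>)"
proof
	assume a: "pos \<beta>" "pos (- \<beta>)"
	have "\<beta> = 0"
		by (rule coeff_zero_imp_zero) (use a roots_span in \<open>auto simp: pos_def intro: antisym\<close>)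
	then show False using a roots_nonzero by (auto simp: pos_def)
qed

lemma pos_uminus_iff: "\<beta> : \<Phi> ==> pos (- \<beta>) <-> ~ pos \<beta>"
	using pos_or_neg not_pos_uminus by blast

lemma pos_simple: "s : S ==> pos s"
	using simple_subset by (auto simp: pos_def coeff_simple)

lemma posI: "\<beta> : \<Phi> ==> s : S ==> 0 < coeff s \<beta> ==> pos \<beta>"
	using sign[of \<beta>] by (force simp: pos_def)

lemma reflect_simple: "s : S ==> root_reflection s s = - s"
	using simple_subset roots_nonzero by (metis root_reflection_self subsetD)

lemma group_linear: "w : reflection_group S ==> linear w"
	by (simp add: reflection_group_orthogonal orthogonal_transformation_linear)

lemma group_roots: "w : reflection_group S ==> \<beta> : \<Phi> ==> w \<beta> : \<Phi>"
	using reflection_group_roots[OF roots simple_subset] .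

lemma coeff_reflection:
	"s : S ==> u ~= s ==> coeff u (root_reflection s x) = coeff u x"
	by (simp add: root_reflection_def inner_diff_left coeff_simple)

lemma simple_reflection_pos:
	assumes "s : S" "pos \<beta>" "\<beta> ~= s"
	shows "pos (root_reflection s \<beta>)"
proof -
	have b: "\<beta> : \<Phi>" using assms by (simp add: pos_def)
	have "EX u:S. u ~= s & 0 < coeff u \<beta>"
	proof (rule ccontr)
		assume "~ ?thesis"
		then have z: "coeff u \<beta> = 0" if "u : S" "u ~= s" for u
			using that assms by (force simp: pos_def)
		have "\<beta> = (\<Sum>u\<in>S. coeff u \<beta> *R u)" using b roots_span expansion by blast
		also have "\<dots> = (\<Sum>u\<in>S. if u = s then coeff s \<beta> *R s else 0)" by (rule sum.cong) (auto simp: z)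
		also have "\<dots> = coeff s \<beta> *R s" using finite_simple assms by simp
		finally have e: "\<beta> = coeff s \<beta> *R s" .
		then have "coeff s \<beta> = 1 | coeff s \<beta> = -1"
			using reduced b simple_subset assms(1) unfolding reduced_roots_def by (metis subsetD)
		moreover have "0 <= coeff s \<beta>" using assms by (auto simp: pos_def)
		ultimately show False using e assms(3) by auto
	qed
	then obtain u where "u : S" "u ~= s" "0 < coeff u \<beta>" by blast
	then show ?thesis
		using posI[of "root_reflection s \<beta>" u] coeff_reflection assms simple_subset b
			root_system_in_reflection[OF roots] by auto
qed

text \<open>
	Exchange condition: following the image of \<open>s\<close> through the word, the first reflection that makes
	it negative must be the reflection in that image, and it can be cancelled against \<open>s\<close>.
\<close>

lemma exchange:
	assumes "set xs \<subseteq> S" "s : S" "~ pos (reflection_word xs s)"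
	shows "EX ys. length ys < length xs & set ys \<subseteq> S & reflection_word xs \<circ> root_reflection s = reflection_word ys"
	using assms(1,3)
proof (induction xs)
	case Nil
	then show ?case using pos_simple[OF assms(2)] by simp
next
	case (Cons t zs)
	let ?w = "reflection_word zs"
	have w: "?w : reflection_group S" using Cons by (intro reflection_word_in_group) auto
	show ?case
	proof (cases "pos (?w s)")
		case False
		then obtain ys where "length ys < length zs" "set ys \<subseteq> S" "?w \<circ> root_reflection s = reflection_word ys"
			using Cons by (metis list.set_intros(2) set_subset_Cons subset_trans)
		then show ?thesis using Cons.prems by (intro exI[of _ "t # ys"]) (simp add: comp_assoc del: o_apply)
	next
		case True
		then have "?w s = t" using Cons simple_reflection_pos[of t "?w s"] by auto
		then have "root_reflection t (?w (root_reflection s x)) = ?w x" for x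
			using root_reflection_conj[OF reflection_group_orthogonal[OF w], of s "root_reflection s x"] by simp
		then show ?thesis using Cons by (intro exI[of _ zs]) (auto simp: fun_eq_iff)
	qed
qed

lemma pos_simple_imp_id:
	assumes "w : reflection_group S" "!!s. s : S ==> pos (w s)"
	shows "w = id"
proof -
	define n where "n = (LEAST n. EX xs. length xs = n & set xs \<subseteq> S & w = reflection_word xs)"
	have ex: "EX n xs. length xs = n & set xs \<subseteq> S & w = reflection_word xs"
		using reflection_group_word[OF assms(1)] by auto
	have min: "n <= length xs" if "set xs \<subseteq> S" "w = reflection_word xs" for xs
		unfolding n_def by (rule Least_le) (use that in auto)
	obtain xs where xs: "length xs = n" "set xs \<subseteq> S" "w = reflection_word xs"
		using LeastI_ex[OF ex] unfolding n_def by auto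
	show ?thesis
	proof (cases xs rule: rev_cases)
		case (snoc ys s)
		then have s: "s : S" "set ys \<subseteq> S" using xs by auto
		have w: "w = reflection_word ys \<circ> root_reflection s"
			using xs snoc by (simp add: reflection_word_append)
		have "linear (reflection_word ys)"
			using s reflection_word_in_group reflection_group_orthogonal orthogonal_transformation_linear by blast
		then have "w s = - reflection_word ys s"
			by (simp add: w reflect_simple[OF s(1)] linear_neg)
		then have "~ pos (reflection_word ys s)"
			using assms(2)[OF s(1)] not_pos_uminus by fastforce
		from exchange[OF s(2,1) this] obtain zs where
			"length zs < length ys" "set zs \<subseteq> S" "w = reflection_word zs"
			using w by auto
		then show ?thesis using min[of zs] xs snoc by auto
	qed (use xs in auto)
qed

definition inversions :: "('a => 'a) => 'a set" where
	"inversions w = {\<beta>. pos \<beta> & ~ pos (w \<beta>)}"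

lemma finite_inversions: "finite (inversions w)"
	by (rule finite_subset[OF _ finite_roots]) (auto simp: inversions_def pos_def)

lemma card_inversions_comp:
	assumes w: "w : reflection_group S" and s: "s : S" "pos (w s)"
	shows "card (inversions (w \<circ> root_reflection s)) = Suc (card (inversions w))"
proof -
	have lin: "linear w" using w reflection_group_orthogonal orthogonal_transformation_linear by blast
	have ss: "root_reflection s s = - s" by (rule reflect_simple[OF s(1)])
	have s_in: "~ pos (w (root_reflection s s))"
		using not_pos_uminus[OF s(2)] by (simp add: ss linear_neg[OF lin])
	have "inversions (w \<circ> root_reflection s) = insert s (root_reflection s ` inversions w)"
	proof safe
		fix \<beta> assume b: "\<beta> : inversions (w \<circ> root_reflection s)" "\<beta> ~: root_reflection s ` inversions w"
		show "\<beta> = s"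
		proof (rule ccontr)
			assume "\<beta> ~= s"
			then have "pos (root_reflection s \<beta>)" using b s by (auto simp: inversions_def intro: simple_reflection_pos)
			then have "root_reflection s \<beta> : inversions w" using b by (auto simp: inversions_def)
			then show False using b(2) by (metis image_eqI root_reflection_involution)
		qed
	next
		show "s : inversions (w \<circ> root_reflection s)"
			using s_in pos_simple[OF s(1)] by (auto simp: inversions_def)
	next
		fix \<gamma> assume g: "\<gamma> : inversions w"
		then have "\<gamma> ~= s" using s by (auto simp: inversions_def)
		then show "root_reflection s \<gamma> : inversions (w \<circ> root_reflection s)"
			using g s by (auto simp: inversions_def intro: simple_reflection_pos)
	qed
	moreover have "s ~: root_reflection s ` inversions w"
	proof
		assume "s : root_reflection s ` inversions w"
		then obtain \<gamma> where g: "\<gamma> : inversions w" "s = root_reflection s \<gamma>" by auto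
		then have "\<gamma> = - s" by (metis root_reflection_involution ss)
		then show False using g pos_simple[OF s(1)] not_pos_uminus by (auto simp: inversions_def)
	qed
	moreover have "inj (root_reflection s)"
		by (metis injI root_reflection_involution)
	ultimately show ?thesis
		by (simp add: finite_inversions card_image inj_on_subset[OF _ subset_UNIV])
qed

lemma card_inversions_comp':
	assumes w: "w : reflection_group S" and s: "s : S" "~ pos (w s)"
	shows "card (inversions w) = Suc (card (inversions (w \<circ> root_reflection s)))"
proof -
	let ?v = "w \<circ> root_reflection s"
	have v: "?v : reflection_group S" using w s reflection_in_group reflection_group_comp by blast
	have "?v s = - w s"
		using s linear_neg[OF group_linear[OF w]] by (simp add: reflect_simple)
	then have "pos (?v s)" using pos_uminus_iff s simple_subset group_roots[OF w] by (metis subsetD)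
	moreover have "?v \<circ> root_reflection s = w" by (simp add: fun_eq_iff)
	ultimately show ?thesis using card_inversions_comp[OF v s(1)] by metis
qed

lemma card_inversions_word:
	"set xs \<subseteq> S ==> card (inversions (reflection_word xs)) <= length xs"
proof (induction xs rule: rev_induct)
	case Nil
	then show ?case by (simp add: inversions_def)
next
	case (snoc s xs)
	let ?w = "reflection_word xs"
	have w: "?w : reflection_group S" and s: "s : S" using snoc by (auto intro: reflection_word_in_group)
	show ?case
		using card_inversions_comp[OF w s] card_inversions_comp'[OF w s] snoc
		unfolding reflection_word_append
		by (cases "pos (?w s)") (auto simp del: o_apply)
qed

lemma inversion_word_exists:
	"w : reflection_group S ==> EX xs. length xs = card (inversions w) & set xs \<subseteq> S & w = reflection_word xs"
proof (induction "card (inversions w)" arbitrary: w)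
	case 0
	then have e: "inversions w = {}" using finite_inversions by simp
	have "pos (w s)" if "s : S" for s
		using e pos_simple[OF that] unfolding inversions_def by blast
	then have "w = id" by (rule pos_simple_imp_id[OF 0(2)])
	then show ?case using 0 by (intro exI[of _ "[]"]) auto
next
	case (Suc n)
	then have "w ~= id" by (auto simp: inversions_def)
	then obtain s where s: "s : S" "~ pos (w s)" using pos_simple_imp_id[OF Suc(3)] by auto
	let ?v = "w \<circ> root_reflection s"
	have v: "?v : reflection_group S" using Suc s reflection_in_group reflection_group_comp by blast
	have c: "card (inversions w) = Suc (card (inversions ?v))" by (rule card_inversions_comp'[OF Suc(3) s])
	then obtain xs where "length xs = card (inversions ?v)" "set xs \<subseteq> S" "?v = reflection_word xs"
		using Suc(1)[of ?v] Suc(2) v by auto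
	moreover have "w = ?v \<circ> root_reflection s" by (simp add: comp_assoc)
	ultimately show ?case using s c
		by (intro exI[of _ "xs @ [s]"]) (auto simp: reflection_word_append)
qed

lemma word_length_eq:
	assumes "w : reflection_group S"
	shows "word_length S w = card (inversions w)"
	unfolding word_length_def reflection_word_def[symmetric]
	by (rule Least_equality) (use inversion_word_exists[OF assms] card_inversions_word in auto)

lemma longest_exists: "EX w:reflection_group S. ALL s:S. ~ pos (w s)"
proof -
	have "card (inversions w) <= card \<Phi>" for w
		by (rule card_mono[OF finite_roots]) (auto simp: inversions_def pos_def)
	then obtain w where w: "w : reflection_group S"
			"!!v. v : reflection_group S ==> card (inversions v) <= card (inversions w)"
		using ex_has_greatest_nat[of "%w. w : reflection_group S" id "%w. card (inversions w)" "card \<Phi> + 1"]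
			reflection_group.id by (metis (no_types, lifting) add.commute le_imp_less_Suc plus_1_eq_Suc)
	have "~ pos (w s)" if "s : S" for s
	proof
		assume "pos (w s)"
		then have "card (inversions (w \<circ> root_reflection s)) = Suc (card (inversions w))"
			using card_inversions_comp w that by blast
		moreover have "w \<circ> root_reflection s : reflection_group S"
			using w that reflection_in_group reflection_group_comp by blast
		ultimately show False using w(2) by fastforce
	qed
	then show ?thesis using w by blast
qed

lemma all_negative:
	assumes "w : reflection_group S" "ALL s:S. ~ pos (w s)" "pos \<beta>"
	shows "~ pos (w \<beta>)"
proof -
	have lin: "linear w" using assms reflection_group_orthogonal orthogonal_transformation_linear by blast
	have bp: "\<beta> : \<Phi>" using assms by (simp add: pos_def)
	have sc: "coeff u (w s) <= 0" if "s : S" "u : S" for s u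
	proof -
		have "pos (- w s)"
			using assms that pos_or_neg[of "w s"] group_roots[of w s] simple_subset by blast
		then show ?thesis using that by (auto simp: pos_def)
	qed
	have "w \<beta> = (\<Sum>s\<in>S. coeff s \<beta> *R w s)"
		using expansion[OF roots_span[OF bp]] linear_sum[OF lin] linear_scale[OF lin] by (metis (no_types, lifting) sum.cong)
	then have "coeff u (w \<beta>) <= 0" if "u : S" for u
		using that assms sc by (auto simp: inner_sum_left pos_def intro!: sum_nonpos mult_nonneg_nonpos)
	then have "pos (- w \<beta>)"
		using group_roots[OF assms(1) bp] root_system_in_uminus[OF roots] by (auto simp: pos_def)
	then show ?thesis using not_pos_uminus by fastforce
qed

lemma longest_element_eq:
	assumes w: "w : reflection_group S" "!!s. s : S ==> ~ pos (w s)"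
	shows "longest_element (reflection_group S) S = w"
	unfolding longest_element_def
proof (rule the_equality)
	have inv: "inversions w = {\<beta>. pos \<beta>}"
		using all_negative w by (auto simp: inversions_def)
	have fin: "finite {\<beta>. pos \<beta>}" by (rule finite_subset[OF _ finite_roots]) (auto simp: pos_def)
	have "card (inversions v) <= card (inversions w)" for v
		unfolding inv by (rule card_mono[OF fin]) (auto simp: inversions_def)
	then show "w : reflection_group S & (ALL v:reflection_group S. word_length S v <= word_length S w)"
		using w by (simp add: word_length_eq)
	fix v assume v: "v : reflection_group S & (ALL u:reflection_group S. word_length S u <= word_length S v)"
	then have "card (inversions w) <= card (inversions v)" using w by (auto simp: word_length_eq)
	then have "inversions v = {\<beta>. pos \<beta>}"
		unfolding inv by (metis (no_types, lifting) card_seteq fin inversions_def mem_Collect_eq subsetI)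
	then have neg: "~ pos (v \<beta>)" if "pos \<beta>" for \<beta> using that by (auto simp: inversions_def)
	obtain u where u: "u : reflection_group S" "u \<circ> w = id" "w \<circ> u = id" using reflection_group_inverse w by blast
	have uv: "u \<circ> v : reflection_group S" using u v reflection_group_comp by blast
	have lu: "linear u" using u reflection_group_orthogonal orthogonal_transformation_linear by blast
	have "pos ((u \<circ> v) s)" if "s : S" for s
	proof (rule ccontr)
		assume "~ pos ((u \<circ> v) s)"
		moreover have "(u \<circ> v) s : \<Phi>" using group_roots[OF uv] that simple_subset by auto
		ultimately have p: "pos (- u (v s))" using pos_uminus_iff by auto
		then have "~ pos (w (- u (v s)))" using all_negative w by blast
		moreover have "w (- u (v s)) = - v s"
			using u(3) linear_neg[OF lu, of "v s"] by (metis comp_apply id_apply)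
		ultimately have "~ pos (- v s)" by simp
		then show False using neg[OF pos_simple[OF that]] pos_uminus_iff group_roots v that simple_subset by blast
	qed
	then have "u \<circ> v = id" using pos_simple_imp_id[OF uv] by blast
	then show "v = w" using u by (metis comp_assoc comp_id id_comp)
qed

lemma longest_element_props:
	"longest_element (reflection_group S) S : reflection_group S"
	"pos \<beta> ==> ~ pos (longest_element (reflection_group S) S \<beta>)"
	using longest_exists longest_element_eq all_negative by metis+

lemma longest_element_involution:
	"longest_element (reflection_group S) S \<circ> longest_element (reflection_group S) S = id"
proof -
	let ?w = "longest_element (reflection_group S) S"
	obtain u where u: "u : reflection_group S" "u \<circ> ?w = id" "?w \<circ> u = id"
		using reflection_group_inverse[OF longest_element_props(1)] by blast
	have "~ pos (u s)" if "s : S" for s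
	proof
		assume "pos (u s)"
		then have "~ pos (?w (u s))" by (rule longest_element_props(2))
		then show False using u(3) pos_simple[OF that] by (metis comp_apply id_apply)
	qed
	then have "?w = u" using longest_element_eq u by blast
	then show ?thesis using u by simp
qed

text \<open>
	Every root is conjugate to a simple one: a positive root of least height in its orbit has
	positive inner product with some simple root, and reflecting in it would lower the height.
\<close>

lemma pos_conj_simple:
	assumes "pos \<beta>"
	shows "EX w:reflection_group S. EX s:S. \<beta> = w s"
proof -
	define h where "h x = (\<Sum>s\<in>S. coeff s x)" for x
	define Orb where "Orb = {w \<beta> |w. w : reflection_group S & pos (w \<beta>)}"
	have "finite Orb" by (rule finite_subset[OF _ finite_roots]) (auto simp: Orb_def pos_def)
	moreover have "\<beta> : Orb"
		unfolding Orb_def mem_Collect_eq using assms reflection_group.id[of S] by (intro exI[of _ id]) simp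
	ultimately obtain \<gamma> where g: "\<gamma> : Orb" "!!\<delta>. \<delta> : Orb ==> h \<gamma> <= h \<delta>"
		using arg_min_least[where f = h and S = Orb] arg_min_if_finite(1)[where f = h and S = Orb] by (metis empty_iff)
	then obtain w where w: "w : reflection_group S" "\<gamma> = w \<beta>" "pos \<gamma>" by (auto simp: Orb_def)
	have gs: "\<gamma> = (\<Sum>s\<in>S. coeff s \<gamma> *R s)" using w roots_span expansion by (auto simp: pos_def)
	have "EX s:S. 0 < \<gamma> \<bullet> s"
	proof (rule ccontr)
		assume "~ ?thesis"
		then have le: "\<gamma> \<bullet> s <= 0" if "s : S" for s using that by force
		have "\<gamma> \<bullet> \<gamma> = \<gamma> \<bullet> (\<Sum>s\<in>S. coeff s \<gamma> *R s)" using gs by simp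
		also have "\<dots> = (\<Sum>s\<in>S. coeff s \<gamma> * (\<gamma> \<bullet> s))" by (simp add: inner_sum_right)
		also have "\<dots> <= 0" using w le by (auto simp: pos_def intro!: sum_nonpos mult_nonneg_nonpos)
		finally have "\<gamma> = 0" by (metis inner_ge_zero antisym inner_eq_zero_iff)
		then show False using w roots_nonzero unfolding pos_def by blast
	qed
	then obtain s where s: "s : S" "0 < \<gamma> \<bullet> s" by blast
	have "\<gamma> = s"
	proof (rule ccontr)
		assume "\<gamma> ~= s"
		then have "pos (root_reflection s \<gamma>)" using simple_reflection_pos s w by blast
		moreover have "root_reflection s \<gamma> = (root_reflection s \<circ> w) \<beta>" using w by simp
		ultimately have "root_reflection s \<gamma> : Orb"
			unfolding Orb_def using reflection_group.step[OF s(1) w(1)] by fastforce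
		then have "h \<gamma> <= h (root_reflection s \<gamma>)" using g by blast
		also have "h (root_reflection s \<gamma>) = h \<gamma> - cartan_integer \<gamma> s * h s"
			by (simp add: h_def root_reflection_def inner_diff_left sum_subtractf sum_distrib_left)
		also have "h s = 1" using s finite_simple by (simp add: h_def coeff_simple)
		finally have "cartan_integer \<gamma> s <= 0" by simp
		moreover have "s \<bullet> s > 0" using s simple_subset roots_nonzero by auto
		ultimately show False using s by (simp add: cartan_integer_def field_simps)
	qed
	moreover obtain v where "v : reflection_group S" "v \<circ> w = id" using reflection_group_inverse w by blast
	ultimately show ?thesis using s w by (metis comp_apply id_apply)
qed

lemma root_conj_simple:
	assumes "\<beta> : \<Phi>"
	shows "EX w:reflection_group S. EX s:S. \<beta> = w s"
proof (cases "pos \<beta>")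
	case False
	then have "pos (- \<beta>)" using assms pos_or_neg by blast
	then obtain w s where w: "w : reflection_group S" "s : S" "- \<beta> = w s" using pos_conj_simple by blast
	then have "\<beta> = (w \<circ> root_reflection s) s"
		using linear_neg[OF group_linear[OF w(1)]] reflect_simple by (metis comp_apply minus_minus)
	then show ?thesis using w reflection_group_comp reflection_in_group by blast
qed (rule pos_conj_simple)

lemma root_induct [consumes 1, case_names simple reflect]:
	assumes "\<beta> : \<Phi>" and base: "!!s. s : S ==> P s"
		and step: "!!s \<gamma>. s : S ==> \<gamma> : \<Phi> ==> P \<gamma> ==> P (root_reflection s \<gamma>)"
	shows "P \<beta>"
proof -
	obtain w s where w: "w : reflection_group S" "s : S" "\<beta> = w s" using root_conj_simple assms(1) by blast
	have "P (w s)" using w(1)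
		by (induction rule: reflection_group.induct)
			(use w(2) base step group_roots simple_subset in auto)
	then show ?thesis using w by simp
qed

lemma weyl_group_eq: "weyl_group \<Phi> = reflection_group S"
proof (rule set_eqI, rule iffI)
	fix w assume "w : reflection_group \<Phi>"
	then show "w : reflection_group S"
	proof (induction rule: reflection_group.induct)
		case (step \<beta> w)
		then obtain u s where u: "u : reflection_group S" "s : S" "\<beta> = u s" using root_conj_simple by blast
		then obtain v where v: "v : reflection_group S" "v \<circ> u = id" "u \<circ> v = id"
			using reflection_group_inverse by blast
		have "root_reflection \<beta> x = u (root_reflection s (v x))" for x
			using root_reflection_conj[OF reflection_group_orthogonal[OF u(1)], of s "v x"] u v
			by (metis comp_apply id_apply)
		then have "root_reflection \<beta> = u \<circ> root_reflection s \<circ> v" by (auto simp: fun_eq_iff)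
		then show ?case using step u v reflection_group_comp reflection_in_group by metis
	qed (rule reflection_group.id)
qed (rule reflection_group_mono[OF simple_subset])

end

text \<open>
	Both root systems are the orbit of the simple roots under the group that the simple reflections
	generate.
\<close>

lemma simple_system_roots_unique:
	assumes "simple_system \<Phi> S" "simple_system \<Phi>' S"
	shows "\<Phi> = \<Phi>'"
proof -
	have "\<beta> : \<Psi>'" if a: "simple_system \<Psi> S" "simple_system \<Psi>' S" "\<beta> : \<Psi>" for \<Psi> \<Psi>' \<beta>
	proof -
		obtain w s where w: "w : reflection_group S" "s : S" "\<beta> = w s"
			using simple_system.root_conj_simple[OF a(1,3)] by blast
		then show ?thesis
			using simple_system.group_roots[OF a(2) w(1)] simple_system.simple_subset[OF a(2)] w by blast
	qed
	then show ?thesis using assms by blast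
qed

section \<open>The highest root\<close>

context simple_system
begin

definition height :: "'a => real" where
	"height x = (\<Sum>s\<in>S. coeff s x)"

definition dominant :: "'a => bool" where
	"dominant \<beta> <-> \<beta> : \<Phi> & (ALL s:S. 0 <= \<beta> \<bullet> s)"

lemma inner_expansion: "x : span S ==> y \<bullet> x = (\<Sum>s\<in>S. coeff s x * (y \<bullet> s))"
	using arg_cong[OF expansion, of x "%z. y \<bullet> z"] by (simp add: inner_sum_right)

lemma simple_obtuse:
	assumes "s : S" "t : S" "s ~= t" shows "s \<bullet> t <= 0"
proof -
	have "pos (root_reflection s t)" using assms pos_simple simple_reflection_pos by blast
	then have "0 <= coeff s (root_reflection s t)" using assms by (simp add: pos_def)
	then have "cartan_integer t s <= 0"
		using assms by (simp add: root_reflection_def inner_diff_left coeff_simple)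
	moreover have "s \<bullet> s > 0" using assms simple_subset roots_nonzero by auto
	ultimately show ?thesis by (simp add: cartan_integer_def field_simps inner_commute)
qed

text \<open>
	Among the roots above \<open>\<beta>\<close> take one of largest height; a simple reflection
	that raised it would give a higher one.
\<close>

lemma dominant_above:
	assumes "\<beta> : \<Phi>"
	shows "EX \<gamma>. dominant \<gamma> & (ALL s:S. coeff s \<beta> <= coeff s \<gamma>)"
proof -
	define A where "A = {\<gamma> : \<Phi>. ALL s:S. coeff s \<beta> <= coeff s \<gamma>}"
	have "finite A" "\<beta> : A" using assms finite_roots by (auto simp: A_def)
	then obtain \<gamma> where g: "\<gamma> : A" "!!\<delta>. \<delta> : A ==> height \<delta> <= height \<gamma>"
		using arg_min_least[where f = "%x. - height x" and S = A]
			arg_min_if_finite(1)[where f = "%x. - height x" and S = A] by (metis empty_iff neg_le_iff_le)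
	have "0 <= \<gamma> \<bullet> s" if s: "s : S" for s
	proof (rule ccontr)
		assume "~ 0 <= \<gamma> \<bullet> s"
		moreover have "s \<bullet> s > 0" using s simple_subset roots_nonzero by auto
		ultimately have c: "cartan_integer \<gamma> s < 0"
			unfolding cartan_integer_def by (simp add: divide_neg_pos)
		have co: "coeff u (root_reflection s \<gamma>) = coeff u \<gamma> - cartan_integer \<gamma> s * (if s = u then 1 else 0)" for u
			using s by (simp add: root_reflection_def inner_diff_left coeff_simple)
		have "root_reflection s \<gamma> : A"
			using g(1) c s simple_subset root_system_in_reflection[OF roots] unfolding A_def by (auto simp: co)
		moreover have "height (root_reflection s \<gamma>) = height \<gamma> - cartan_integer \<gamma> s"
			unfolding height_def co using s finite_simple by (simp add: sum_subtractf flip: sum_distrib_left)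
		ultimately show False using g(2) c by force
	qed
	then show ?thesis using g(1) by (auto simp: A_def dominant_def)
qed

lemma dominant_pos:
	assumes "dominant \<beta>" shows "pos \<beta>"
proof (rule ccontr)
	assume "~ pos \<beta>"
	then have "pos (- \<beta>)" using assms pos_or_neg by (auto simp: dominant_def)
	then have "(\<Sum>s\<in>S. coeff s \<beta> * (\<beta> \<bullet> s)) <= 0"
		using assms unfolding dominant_def pos_def by (auto intro!: sum_nonpos mult_nonpos_nonneg)
	then have "\<beta> \<bullet> \<beta> <= 0"
		using inner_expansion[OF roots_span, of \<beta> \<beta>] assms by (simp add: dominant_def)
	then have "\<beta> = 0" by (metis inner_ge_zero antisym inner_eq_zero_iff)
	then show False using assms roots_nonzero by (auto simp: dominant_def)
qed

text \<open>
	The support of a dominant root is closed under adjacency: a simple root outside the support but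
	not orthogonal to it would have negative product with the root.  By irreducibility the support
	is everything.
\<close>

lemma dominant_full_support:
	assumes irr: "irreducible_roots \<Phi>" and dom: "dominant \<beta>" and t: "t : S"
	shows "0 < coeff t \<beta>"
proof (rule ccontr)
	assume nt: "~ 0 < coeff t \<beta>"
	have p: "pos \<beta>" using dom dominant_pos by blast
	then have b: "\<beta> : \<Phi>" "\<beta> : span S" using roots_span by (auto simp: pos_def)
	define I where "I = {s:S. 0 < coeff s \<beta>}"
	have "I ~= {}"
	proof
		assume "I = {}"
		then have "\<beta> = 0" using p b by (intro coeff_zero_imp_zero) (force simp: I_def pos_def)+
		then show False using b roots_nonzero by auto
	qed
	then obtain s0 where s0: "s0 : I" by blast
	have orth: "s \<bullet> u = 0" if "s : I" "u : S - I" for s u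
	proof -
		have ne: "coeff r \<beta> * (u \<bullet> r) <= 0" if "r : S" for r
		proof (cases "r = u")
			case True
			then have "coeff r \<beta> = 0" using p that \<open>u : S - I\<close> by (force simp: I_def pos_def)
			then show ?thesis by simp
		next
			case False
			then show ?thesis using simple_obtuse[of u r] p that \<open>u : S - I\<close>
				by (auto simp: pos_def intro: mult_nonneg_nonpos)
		qed
		have "0 <= u \<bullet> \<beta>" using dom that unfolding dominant_def by (metis DiffD1 inner_commute)
		also have "u \<bullet> \<beta> = (\<Sum>r\<in>S. coeff r \<beta> * (u \<bullet> r))" using inner_expansion b by blast
		finally have z: "(\<Sum>r\<in>S. coeff r \<beta> * (u \<bullet> r)) = 0" using sum_nonpos[of S] ne by (metis (no_types, lifting) antisym)
		have "(\<Sum>r\<in>S. - (coeff r \<beta> * (u \<bullet> r))) = 0" using z by (simp add: sum_negf)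
		then have "ALL r:S. - (coeff r \<beta> * (u \<bullet> r)) = 0"
			by (subst (asm) sum_nonneg_eq_0_iff) (use finite_simple ne in auto)
		then have "coeff s \<beta> * (u \<bullet> s) = 0" using that by (force simp: I_def)
		then show ?thesis using that by (auto simp: I_def inner_commute)
	qed
	have orth': "x \<bullet> y = 0" if x: "x : span I" and y: "y : span (S - I)" for x y
	proof -
		have 1: "x \<bullet> u = 0" if "u : S - I" for u
			using x by (induction rule: span_induct_alt) (use orth that in \<open>auto simp: inner_add_left\<close>)
		show ?thesis using y by (induction rule: span_induct_alt) (use 1 in \<open>auto simp: inner_add_right\<close>)
	qed
	have split: "\<gamma> : span I | \<gamma> : span (S - I)" if "\<gamma> : \<Phi>" for \<gamma>
		using that
	proof (induction rule: root_induct)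
		case (simple s)
		then show ?case using span_base[of s I] span_base[of s "S - I"] by blast
	next
		case (reflect s \<gamma>)
		have "root_reflection s \<gamma> = \<gamma>" if "\<gamma> \<bullet> s = 0"
			using that by (simp add: root_reflection_def cartan_integer_def)
		moreover have "s : span I | s : span (S - I)" using reflect(1) span_base[of s I] span_base[of s "S - I"] by blast
		moreover have "root_reflection s \<gamma> : span A" if "\<gamma> : span A" "s : span A" for A
			using that unfolding root_reflection_def by (intro span_diff span_scale)
		ultimately show ?case using reflect(3) orth' by (metis inner_commute)
	qed
	have "\<Phi> = (\<Phi> \<inter> span I) \<union> (\<Phi> \<inter> span (S - I))" using split by blast
	moreover have "\<Phi> \<inter> span I ~= {}" using s0 simple_subset span_base[of s0 I] by (auto simp: I_def)
	moreover have "\<Phi> \<inter> span (S - I) ~= {}"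
		using t nt simple_subset span_base[of t "S - I"] by (auto simp: I_def)
	moreover have "ALL a:\<Phi> \<inter> span I. ALL b:\<Phi> \<inter> span (S - I). a \<bullet> b = 0" using orth' by blast
	ultimately show False using irr unfolding irreducible_roots_def by blast
qed

text \<open>
	One of the two Cartan integers of the pair is 1, since their product is less than 4; the
	corresponding reflection produces the difference up to sign.
\<close>

lemma root_difference:
	assumes "\<beta> : \<Phi>" "\<gamma> : \<Phi>" "\<beta> ~= \<gamma>" "0 < \<beta> \<bullet> \<gamma>"
	shows "\<beta> - \<gamma> : \<Phi>"
proof -
	let ?m = "cartan_integer \<beta> \<gamma>" and ?n = "cartan_integer \<gamma> \<beta>"
	have nz: "0 < \<beta> \<bullet> \<beta>" "0 < \<gamma> \<bullet> \<gamma>" using assms roots_nonzero by auto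
	have strict: "\<beta> \<bullet> \<gamma> < norm \<beta> * norm \<gamma>"
	proof (rule ccontr)
		assume "~ ?thesis"
		then have "\<beta> \<bullet> \<gamma> = norm \<beta> * norm \<gamma>" using norm_cauchy_schwarz[of \<beta> \<gamma>] by linarith
		then have e: "norm \<beta> *R \<gamma> = norm \<gamma> *R \<beta>" by (simp add: norm_cauchy_schwarz_eq)
		have nb: "norm \<beta> > 0" "norm \<gamma> > 0" using nz by auto
		have "\<gamma> = (norm \<gamma> / norm \<beta>) *R \<beta>"
			using arg_cong[OF e, of "%x. (1 / norm \<beta>) *R x"] nb by simp
		then have "norm \<gamma> / norm \<beta> = 1 | norm \<gamma> / norm \<beta> = -1"
			using reduced assms unfolding reduced_roots_def by metis
		moreover have "norm \<gamma> / norm \<beta> > 0" using nb by simp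
		ultimately have "\<gamma> = \<beta>" using \<open>\<gamma> = (norm \<gamma> / norm \<beta>) *R \<beta>\<close> by (metis neg_0_less_iff_less not_one_less_zero scaleR_one)
		then show False using assms by simp
	qed
	have "(\<beta> \<bullet> \<gamma>)\<^sup>2 < (norm \<beta> * norm \<gamma>)\<^sup>2" using strict assms by (intro power_strict_mono) auto
	then have "(\<beta> \<bullet> \<gamma>)\<^sup>2 < (\<beta> \<bullet> \<beta>) * (\<gamma> \<bullet> \<gamma>)" by (simp add: power_mult_distrib power2_norm_eq_inner)
	then have mn: "?m * ?n < 4"
		using nz by (simp add: cartan_integer_def field_simps power2_eq_square inner_commute)
	have pos: "?m > 0" "?n > 0" using assms nz by (auto simp: cartan_integer_def inner_commute)
	obtain a b :: int where ab: "?m = of_int a" "?n = of_int b"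
		using root_system_in_cartan[OF roots] assms by (meson Ints_cases)
	have "a * b < 4" using mn unfolding ab by (metis of_int_less_iff of_int_mult of_int_numeral)
	moreover have "a > 0" "b > 0" using pos ab by auto
	ultimately have "a = 1 | b = 1"
		using mult_mono[of 2 a 2 b] by linarith
	then show ?thesis
	proof
		assume "a = 1"
		then have "root_reflection \<gamma> \<beta> = \<beta> - \<gamma>" using ab by (simp add: root_reflection_def)
		then show ?thesis using root_system_in_reflection[OF roots assms(2,1)] by simp
	next
		assume "b = 1"
		then have "root_reflection \<beta> \<gamma> = \<gamma> - \<beta>" using ab by (simp add: root_reflection_def)
		then show ?thesis using root_system_in_uminus[OF roots root_system_in_reflection[OF roots assms(1,2)]] by simp
	qed
qed

text \<open>
	A root of largest height is dominant; two dominant roots have a positive product, so if one were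
	not above the other their difference would be a root that raises the height.
\<close>

lemma highest_root_exists:
	assumes irr: "irreducible_roots \<Phi>"
	shows "EX \<theta>:\<Phi>. ALL \<beta>:\<Phi>. ALL s:S. coeff s \<beta> <= coeff s \<theta>"
proof -
	have "\<Phi> ~= {}" using irr by (auto simp: irreducible_roots_def)
	then obtain \<theta>0 where t0: "\<theta>0 : \<Phi>" "!!\<delta>. \<delta> : \<Phi> ==> height \<delta> <= height \<theta>0"
		using arg_min_least[where f = "%x. - height x" and S = \<Phi>] finite_roots
			arg_min_if_finite(1)[where f = "%x. - height x" and S = \<Phi>] by (metis neg_le_iff_le)
	obtain \<theta> where th: "dominant \<theta>" "ALL s:S. coeff s \<theta>0 <= coeff s \<theta>" using dominant_above t0 by blast
	have "height \<theta>0 <= height \<theta>" using th unfolding height_def by (intro sum_mono) auto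
	then have max: "height \<delta> <= height \<theta>" if "\<delta> : \<Phi>" for \<delta> using t0 that by force
	have thp: "\<theta> : \<Phi>" using th by (simp add: dominant_def)
	have "coeff s \<beta> <= coeff s \<theta>" if b: "\<beta> : \<Phi>" and s: "s : S" for \<beta> s
	proof -
		obtain \<gamma> where g: "dominant \<gamma>" "ALL s:S. coeff s \<beta> <= coeff s \<gamma>" using dominant_above b by blast
		have gp: "\<gamma> : \<Phi>" using g by (simp add: dominant_def)
		have "coeff s \<gamma> <= coeff s \<theta>"
		proof (cases "\<gamma> = \<theta>")
			case False
			have nn: "0 <= coeff u \<gamma> * (\<theta> \<bullet> u)" if "u : S" for u
				using dominant_full_support[OF irr g(1) that] th(1) that
				unfolding dominant_def by (intro mult_nonneg_nonneg) auto
			have "EX u:S. \<theta> \<bullet> u ~= 0"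
			proof (rule ccontr)
				assume "~ ?thesis"
				then have "\<theta> \<bullet> \<theta> = 0" using inner_expansion[OF roots_span[OF thp], of \<theta>] by simp
				then show False using thp roots_nonzero by auto
			qed
			then obtain u where u: "u : S" "\<theta> \<bullet> u ~= 0" by blast
			then have "0 < coeff u \<gamma> * (\<theta> \<bullet> u)"
				using dominant_full_support[OF irr g(1)] th by (intro mult_pos_pos) (auto simp: dominant_def order_less_le)
			then have "0 < (\<Sum>u\<in>S. coeff u \<gamma> * (\<theta> \<bullet> u))" using nn u finite_simple by (meson sum_pos2)
			then have "0 < \<theta> \<bullet> \<gamma>" using inner_expansion[OF roots_span[OF gp]] by simp
			then have d: "\<theta> - \<gamma> : \<Phi>" using root_difference thp gp False by metis
			show ?thesis
			proof (cases "pos (\<theta> - \<gamma>)")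
				case True
				then show ?thesis using s by (auto simp: pos_def inner_diff_left)
			next
				case neg: False
				then have np: "pos (\<gamma> - \<theta>)" using pos_or_neg[OF d] by simp
				have "height (\<gamma> - \<theta>) <= 0" using max[OF gp] by (simp add: height_def inner_diff_left sum_subtractf)
				then have "(\<Sum>s\<in>S. coeff s (\<gamma> - \<theta>)) = 0"
					using np unfolding height_def pos_def by (intro antisym sum_nonneg) auto
				then have "ALL s:S. coeff s (\<gamma> - \<theta>) = 0"
					using np finite_simple by (subst (asm) sum_nonneg_eq_0_iff) (auto simp: pos_def)
				then show ?thesis using s by (auto simp: inner_diff_left)
			qed
		qed auto
		then show ?thesis using g s by force
	qed
	then show ?thesis using thp by blast
qed

end

section \<open>Bases indexed by numbers\<close>

declare One_nat_def [simp del]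

definition nat_cone :: "nat => (nat => 'a::real_vector) => 'a set" where
	"nat_cone l \<a> = range (%c :: nat => nat. \<Sum>i=1..l. real (c i) *R \<a> i)"

lemma nat_cone_0: "0 : nat_cone l \<a>"
	unfolding nat_cone_def by (intro range_eqI[of _ _ "%_. 0"]) simp

lemma nat_cone_add:
	assumes "x : nat_cone l \<a>" "y : nat_cone l \<a>" shows "x + y : nat_cone l \<a>"
proof -
	obtain c d :: "nat => nat" where "x = (\<Sum>i=1..l. real (c i) *R \<a> i)" "y = (\<Sum>i=1..l. real (d i) *R \<a> i)"
		using assms by (auto simp: nat_cone_def)
	then have "x + y = (\<Sum>i=1..l. real (c i + d i) *R \<a> i)"
		by (simp add: scaleR_add_left sum.distrib)
	then show ?thesis unfolding nat_cone_def by (rule range_eqI[where x = "%i. c i + d i"])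
qed

lemma nat_cone_base: assumes "i : {1..l}" shows "\<a> i : nat_cone l \<a>"
proof -
	have "(\<Sum>k=1..l. real (if k = i then 1 else 0) *R \<a> k) = (\<Sum>k=1..l. if k = i then \<a> k else 0)"
		by (rule sum.cong) auto
	then have "(\<Sum>k=1..l. real (if k = i then 1 else 0) *R \<a> k) = \<a> i"
		using assms by simp
	then show ?thesis unfolding nat_cone_def by (intro range_eqI[where x = "%k. if k = i then 1 else 0"]) simp
qed

lemma nat_cone_sum: "(!!i. i : A ==> f i : nat_cone l \<a>) ==> sum f A : nat_cone l \<a>"
	by (induction A rule: infinite_finite_induct) (auto intro: nat_cone_0 nat_cone_add)

lemma simple_roots_cone:
	"simple_roots l \<Phi> \<a> ==> \<beta> : \<Phi> ==> \<beta> : nat_cone l \<a> | - \<beta> : nat_cone l \<a>"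
	unfolding simple_roots_def nat_cone_def by fastforce

lemma simple_roots_indexed_coeff:
	fixes \<a> :: "nat => 'a::euclidean_space"
	assumes "inj_on \<a> {1..l}" "independent (\<a> ` {1..l})" "i : {1..l}"
	shows "(\<Sum>k=1..l. c k *R \<a> k) \<bullet> fundamental_coweight (\<a> ` {1..l}) (\<a> i) = c i"
proof -
	have "(\<Sum>k=1..l. c k *R \<a> k) \<bullet> fundamental_coweight (\<a> ` {1..l}) (\<a> i) = (\<Sum>k=1..l. c k * (if k = i then 1 else 0))"
		unfolding inner_sum_left
		by (rule sum.cong) (use assms in \<open>auto simp: fundamental_coweight inj_on_eq_iff\<close>)
	also have "\<dots> = (\<Sum>k=1..l. if k = i then c k else 0)" by (rule sum.cong) auto
	also have "\<dots> = c i" using assms(3) by simp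
	finally show ?thesis .
qed

lemma nat_cone_coeff:
	assumes "simple_roots l \<Phi> \<a>" "x : nat_cone l \<a>" "i : {1..l}"
	shows "x \<bullet> fundamental_coweight (\<a> ` {1..l}) (\<a> i) : \<nat>"
proof -
	obtain c :: "nat => nat" where "x = (\<Sum>i=1..l. real (c i) *R \<a> i)" using assms(2) by (auto simp: nat_cone_def)
	then show ?thesis using simple_roots_indexed_coeff[of \<a> l i "%i. real (c i)"] assms
		by (simp add: simple_roots_def)
qed

lemma nat_cone_coeff_nonneg:
	"simple_roots l \<Phi> \<a> ==> x : nat_cone l \<a> ==> i : {1..l} ==>
		 0 <= x \<bullet> fundamental_coweight (\<a> ` {1..l}) (\<a> i)"
	by (drule (2) nat_cone_coeff) (auto elim: Nats_cases)

lemma simple_roots_system: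
	assumes "root_system_in V \<Phi>" "reduced_roots \<Phi>" "simple_roots l \<Phi> \<a>"
	shows "simple_system \<Phi> (\<a> ` {1..l})"
proof
	have sub: "\<Phi> \<subseteq> span (\<a> ` {1..l})"
	proof
		fix \<beta> assume "\<beta> : \<Phi>"
		moreover have "x : span (\<a> ` {1..l})" if "x : nat_cone l \<a>" for x
			using that unfolding nat_cone_def by (auto intro!: span_sum span_scale intro: span_base)
		ultimately show "\<beta> : span (\<a> ` {1..l})"
			using simple_roots_cone[OF assms(3)] by (metis minus_minus span_neg)
	qed
	moreover have "\<a> ` {1..l} \<subseteq> \<Phi>" using assms(3) by (simp add: simple_roots_def)
	ultimately have "span (\<a> ` {1..l}) = span \<Phi>" by (metis span_mono span_span subset_antisym)
	then show "root_system_in (span (\<a> ` {1..l})) \<Phi>" using assms(1) by (simp add: root_system_in_def)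
	show "(ALL s:\<a> ` {1..l}. 0 <= \<beta> \<bullet> fundamental_coweight (\<a> ` {1..l}) s) |
				(ALL s:\<a> ` {1..l}. \<beta> \<bullet> fundamental_coweight (\<a> ` {1..l}) s <= 0)" if "\<beta> : \<Phi>" for \<beta>
		using simple_roots_cone[OF assms(3) that]
	proof
		assume "\<beta> : nat_cone l \<a>"
		then show ?thesis using nat_cone_coeff_nonneg[OF assms(3), of \<beta>] by auto
	next
		assume "- \<beta> : nat_cone l \<a>"
		then show ?thesis using nat_cone_coeff_nonneg[OF assms(3), of "- \<beta>"] by auto
	qed
qed (use assms in \<open>auto simp: simple_roots_def\<close>)

text \<open>
	The highest root dominates all coefficients, so its mark at \<open>\<alpha>\<^sub>j\<close>
	would be at least 2.
\<close>

lemma minuscule_no_coefficient_two: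
	assumes "root_system_in V \<Phi>" "reduced_roots \<Phi>" "irreducible_roots \<Phi>" "simple_roots l \<Phi> \<a>"
		and j: "j : minuscule_indices l \<Phi> \<a>" "j ~= 0"
		and b: "\<beta> : \<Phi>" "\<beta> - 2 *R \<a> j : nat_cone l \<a>"
	shows False
proof -
	let ?S = "\<a> ` {1..l}"
	interpret simple_system \<Phi> ?S by (rule simple_roots_system[OF assms(1,2,4)])
	have inj: "inj_on \<a> {1..l}" and ind: "independent ?S" using assms(4) by (auto simp: simple_roots_def)
	have jl: "j : {1..l}" using j by (auto simp: minuscule_indices_def)
	obtain \<theta> where th: "\<theta> : \<Phi>" "ALL \<beta>:\<Phi>. ALL s:?S. coeff s \<beta> <= coeff s \<theta>"
		using highest_root_exists[OF assms(3)] by blast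
	have int: "coeff (\<a> i) \<gamma> : Ints" if "\<gamma> : \<Phi>" "i : {1..l}" for \<gamma> i
		using simple_roots_cone[OF assms(4) that(1)]
	proof
		assume "- \<gamma> : nat_cone l \<a>"
		from nat_cone_coeff[OF assms(4) this that(2)] obtain n where "- coeff (\<a> i) \<gamma> = real n"
			by (auto elim!: Nats_cases)
		then have "coeff (\<a> i) \<gamma> = - real n" by simp
		then show ?thesis by (metis Ints_minus Ints_of_nat)
	qed (use nat_cone_coeff[OF assms(4) _ that(2)] Nats_subset_Ints in blast)
	have dom: "\<theta> - \<gamma> = (\<Sum>i=1..l. real (nat \<lfloor>coeff (\<a> i) (\<theta> - \<gamma>)\<rfloor>) *R \<a> i)" if "\<gamma> : \<Phi>" for \<gamma>
	proof -
		have "\<theta> - \<gamma> = (\<Sum>s\<in>?S. coeff s (\<theta> - \<gamma>) *R s)"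
			by (rule expansion) (use that th roots_span in \<open>blast intro: span_diff\<close>)
		also have "\<dots> = (\<Sum>i=1..l. coeff (\<a> i) (\<theta> - \<gamma>) *R \<a> i)" using inj by (simp add: sum.reindex)
		also have "\<dots> = (\<Sum>i=1..l. real (nat \<lfloor>coeff (\<a> i) (\<theta> - \<gamma>)\<rfloor>) *R \<a> i)"
		proof (rule sum.cong)
			fix i assume i: "i : {1..l}"
			have "coeff (\<a> i) (\<theta> - \<gamma>) : Ints" using int[OF th(1) i] int[OF that i] by (simp add: inner_diff_left)
			moreover have "0 <= coeff (\<a> i) (\<theta> - \<gamma>)" using th(2) that i by (simp add: inner_diff_left)
			ultimately show "coeff (\<a> i) (\<theta> - \<gamma>) *R \<a> i = real (nat \<lfloor>coeff (\<a> i) (\<theta> - \<gamma>)\<rfloor>) *R \<a> i"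
				by (auto elim!: Ints_cases)
		qed simp
		finally show ?thesis .
	qed
	have hr: "highest_root l \<Phi> \<a> = \<theta>"
		unfolding highest_root_def
	proof (rule the_equality)
		show "\<theta> : \<Phi> & (ALL \<beta>:\<Phi>. EX c :: nat => nat. \<theta> - \<beta> = (\<Sum>i=1..l. real (c i) *R \<a> i))"
			using th(1) dom by (auto intro!: exI)
		fix \<eta> assume e: "\<eta> : \<Phi> & (ALL \<beta>:\<Phi>. EX c :: nat => nat. \<eta> - \<beta> = (\<Sum>i=1..l. real (c i) *R \<a> i))"
		then have "\<eta> - \<theta> : nat_cone l \<a>" using th(1) unfolding nat_cone_def by blast
		then have le: "coeff s \<theta> <= coeff s \<eta>" if "s : ?S" for s
			using that nat_cone_coeff_nonneg[OF assms(4), of "\<eta> - \<theta>"] by (auto simp: inner_diff_left)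
		have "\<eta> - \<theta> = 0"
			by (rule coeff_zero_imp_zero)
				(use e th le roots_span in \<open>auto simp: inner_diff_left intro!: span_diff antisym\<close>)
		then show "\<eta> = \<theta>" by simp
	qed
	have "(\<Sum>s\<in>?S. representation ?S \<theta> s *R s) = \<theta>"
		using ind roots_span[OF th(1)] finite_simple by (intro sum_representation_eq) auto
	then have "\<theta> = (\<Sum>i=1..l. representation ?S \<theta> (\<a> i) *R \<a> i)" using inj by (simp add: sum.reindex)
	then have "coeff (\<a> j) \<theta> = representation ?S \<theta> (\<a> j)"
		using simple_roots_indexed_coeff[OF inj ind jl] by metis
	moreover have "mark l \<Phi> \<a> j = 1" using j by (simp add: minuscule_indices_def)
	ultimately have one: "coeff (\<a> j) \<theta> = 1" using j hr by (simp add: mark_def)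
	have "0 <= coeff (\<a> j) (\<beta> - 2 *R \<a> j)"
		by (rule nat_cone_coeff_nonneg[OF assms(4) b(2) jl])
	then have "2 <= coeff (\<a> j) \<beta>" using jl by (simp add: inner_diff_left coeff_simple)
	then show False using th(2) b(1) jl one by force
qed

lemma minuscule_index_range:
	"j : minuscule_indices l \<Phi> \<a> - {0} ==> j : {1..l}"
	by (auto simp: minuscule_indices_def)

section \<open>Recognizing \<open>\<omega>\<^sub>j\<close>\<close>

text \<open>
	Since \<open>w\<^sub>j\<close> is an involution, \<open>\<omega>\<^sub>j = v\<close> means \<open>w\<^sub>j v = w\<^sub>0\<close>, that is, \<open>w\<^sub>j v\<close> makes every simple root
	negative.  The element \<open>w\<^sub>j\<close> makes \<open>\<alpha>\<^sub>k\<close> negative for \<open>k \<noteq> j\<close> and does not change coefficients at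
	\<open>\<alpha>\<^sub>j\<close>, so it suffices to look at the images of the simple roots under \<open>v\<close>.
\<close>

lemma omega_eqI:
	assumes rs: "root_system_in V \<Phi>" "reduced_roots \<Phi>" "simple_roots l \<Phi> \<a>"
		and j: "j : {1..l}" and v: "v : weyl_group \<Phi>"
		and im: "!!i. i : {1..l} ==> (EX k:{1..l} - {j}. v (\<a> i) = \<a> k) | - v (\<a> i) - \<a> j : nat_cone l \<a>"
	shows "omega l \<Phi> \<a> j = v"
proof -
	let ?S = "\<a> ` {1..l}" and ?Sj = "\<a> ` ({1..l} - {j})"
	interpret A: simple_system \<Phi> ?S by (rule simple_roots_system[OF rs])
	have inj: "inj_on \<a> {1..l}" using rs(3) by (simp add: simple_roots_def)
	have sub: "?Sj \<subseteq> ?S" by auto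
	have ind: "independent ?Sj" using A.independent_simple sub independent_mono by blast
	have jn: "\<a> j ~: ?Sj" using inj j by (auto simp: inj_on_eq_iff)
	have coeff_eq: "x \<bullet> fundamental_coweight ?Sj s = A.coeff s x" if "x : span ?Sj" "s : ?Sj" for x s
		using that(1)
	proof (induction rule: span_induct_alt)
		case (step c u y)
		then have "u : ?S" using sub by blast
		then show ?case using step that(2)
			by (simp add: inner_add_left fundamental_coweight[OF ind step(1)] A.coeff_simple)
	qed simp
	let ?P = "\<Phi> \<inter> span ?Sj"
	interpret B: simple_system ?P ?Sj
	proof
		show "?Sj \<subseteq> ?P" using A.simple_subset sub span_superset[of ?Sj] by fast
		then have "span ?P = span ?Sj" by (metis inf_le2 span_mono span_span subset_antisym)
		moreover have "root_reflection a ` ?P = ?P" if "a : ?P" for a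
		proof -
			have "root_reflection a x : ?P" if "x : ?P" for x
				using that \<open>a : ?P\<close> root_system_in_reflection[OF A.roots, of a x]
				by (auto simp: root_reflection_def intro: span_diff span_scale)
			then show ?thesis by (metis image_eqI image_subsetI root_reflection_involution subsetI subset_antisym)
		qed
		ultimately show "root_system_in (span ?Sj) ?P"
			using A.roots unfolding root_system_in_def by auto
		show "reduced_roots ?P" using A.reduced unfolding reduced_roots_def by blast
		show "(ALL s:?Sj. 0 <= \<beta> \<bullet> fundamental_coweight ?Sj s) | (ALL s:?Sj. \<beta> \<bullet> fundamental_coweight ?Sj s <= 0)"
			if "\<beta> : ?P" for \<beta>
			using A.sign[of \<beta>] that coeff_eq sub by auto
	qed (rule ind)
	let ?wj = "longest_element (reflection_group ?Sj) ?Sj"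
	have wj: "?wj : reflection_group ?Sj" by (rule B.longest_element_props)
	then have wjS: "?wj : reflection_group ?S" using reflection_group_mono[OF sub] by blast
	have coeff_j: "A.coeff (\<a> j) (w x) = A.coeff (\<a> j) x" if "w : reflection_group ?Sj" for w x
		using that
	proof (induction rule: reflection_group.induct)
		case (step s w)
		have "s : ?S" "\<a> j ~= s" using step(1) sub jn by auto
		from A.coeff_reflection[OF this, of "w x"] show ?case using step(3) by simp
	qed simp
	have vS: "v : reflection_group ?S" using v A.weyl_group_eq by simp
	have "~ A.pos ((?wj \<circ> v) s)" if s: "s : ?S" for s
	proof -
		obtain i where i: "i : {1..l}" "s = \<a> i" using s by blast
		from im[OF i(1)] show ?thesis
		proof
			assume "EX k:{1..l} - {j}. v (\<a> i) = \<a> k"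
			then obtain k where k: "\<a> k : ?Sj" "v (\<a> i) = \<a> k" by blast
			have "~ B.pos (?wj (\<a> k))" using B.longest_element_props(2) B.pos_simple k by blast
			moreover have "?wj (\<a> k) : ?P" using B.group_roots[OF wj] k B.simple_subset by blast
			ultimately show ?thesis using k i coeff_eq sub by (auto simp: A.pos_def B.pos_def)
		next
			assume "- v (\<a> i) - \<a> j : nat_cone l \<a>"
			then have "0 <= A.coeff (\<a> j) (- v (\<a> i) - \<a> j)"
				by (rule nat_cone_coeff_nonneg[OF rs(3) _ j])
			then have "A.coeff (\<a> j) (v (\<a> i)) < 0" using j by (simp add: inner_diff_left A.coeff_simple)
			then have "A.coeff (\<a> j) ((?wj \<circ> v) s) < 0" using coeff_j[OF wj, of "v (\<a> i)"] i by simp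
			then show ?thesis using j unfolding A.pos_def by (meson imageI not_le)
		qed
	qed
	then have "longest_element (reflection_group ?S) ?S = ?wj \<circ> v"
		by (intro A.longest_element_eq reflection_group_comp[OF wjS vS])
	then have "omega l \<Phi> \<a> j = ?wj \<circ> (?wj \<circ> v)"
		using j unfolding omega_def Let_def A.weyl_group_eq by simp
	also have "\<dots> = v" using B.longest_element_involution by (metis comp_assoc id_comp)
	finally show ?thesis .
qed

section \<open>Coordinate models of the classical root systems\<close>

lemma spanning_family_independent:
	fixes \<a> :: "nat => 'a::euclidean_space"
	assumes "\<a> ` {1..m} \<subseteq> V" "V \<subseteq> span (\<a> ` {1..m})" "m <= dim V"
	shows "inj_on \<a> {1..m}" "independent (\<a> ` {1..m})"
proof -
	have c: "card (\<a> ` {1..m}) <= m" using card_image_le[of "{1..m}" \<a>] by simp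
	show "independent (\<a> ` {1..m})"
		by (rule card_le_dim_spanning[OF assms(1,2)]) (use c assms(3) in auto)
	have "dim V <= card (\<a> ` {1..m})" by (rule dim_le_card[OF assms(2)]) simp
	then show "inj_on \<a> {1..m}" using c assms(3) by (intro eq_card_imp_inj_on) auto
qed

lemma dual_family_independent:
	fixes \<a> :: "nat => 'a::real_inner"
	assumes "!!i k. i : I ==> k : I ==> \<a> i \<bullet> d k = (if i = k then 1 else 0)"
	shows "inj_on \<a> I" "independent (\<a> ` I)"
proof -
	show inj: "inj_on \<a> I"
		by (rule inj_onI) (metis assms zero_neq_one)
	show "independent (\<a> ` I)"
		unfolding dependent_def
	proof safe
		fix i assume i: "i : I" "\<a> i : span (\<a> ` I - {\<a> i})"
		have "\<a> i \<bullet> d i = 0" using i(2)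
		proof (induction rule: span_induct_alt)
			case (step c x y)
			then obtain k where "k : I" "x = \<a> k" "k ~= i" by auto
			then show ?case using step assms[of k i] i(1) by (simp add: inner_add_left)
		qed simp
		then show False using assms[OF i(1,1)] by simp
	qed
qed

definition signed_roots :: "nat => (nat => 'a::real_vector) => real set => 'a set" where
	"signed_roots m f A =
		 {a *R f i + b *R f k |i k a b. i : {1..m} & k : {1..m} & i ~= k & \<bar>a\<bar> = 1 & \<bar>b\<bar> = 1} \<union>
		 {c *R f i |i c. i : {1..m} & \<bar>c\<bar> : A}"

lemma signed_rootsI:
	"i : {1..m} ==> k : {1..m} ==> i ~= k ==> \<bar>a\<bar> = 1 ==> \<bar>b\<bar> = 1 ==> a *R f i + b *R f k : signed_roots m f A"
	"i : {1..m} ==> \<bar>c\<bar> : A ==> c *R f i : signed_roots m f A"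
	unfolding signed_roots_def by blast+

lemma signed_rootsE:
	assumes "\<beta> : signed_roots m f A"
	obtains (pair) i k a b where "i : {1..m}" "k : {1..m}" "i ~= k" "\<bar>a\<bar> = 1" "\<bar>b\<bar> = 1" "\<beta> = a *R f i + b *R f k"
	| (single) i c where "i : {1..m}" "\<bar>c\<bar> : A" "\<beta> = c *R f i"
	using assms unfolding signed_roots_def by blast

lemma abs_one_cases: "\<bar>a\<bar> = (1::real) ==> (a = 1 ==> P) ==> (a = -1 ==> P) ==> P"
	by linarith

lemma short_roots_union:
	assumes "!!x. x : S ==> x \<bullet> x = a" "!!x. x : L ==> a < x \<bullet> x" "EX x. x : S"
	shows "short_roots (S \<union> L) = S"
proof -
	obtain s where s: "s : S" using assms(3) by blast
	have "x : S" if "x : S \<union> L" "x \<bullet> x <= s \<bullet> s" for x using that assms(1)[OF s] assms(2) by fastforce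
	moreover have "x \<bullet> x <= y \<bullet> y" if "x : S" "y : S \<union> L" for x y
		using that assms(1)[of x] assms(1)[of y] assms(2)[of y] by auto
	ultimately show ?thesis using s unfolding short_roots_def norm_le by blast
qed

lemma long_roots_union:
	assumes "!!x. x : L ==> x \<bullet> x = a" "!!x. x : S ==> x \<bullet> x < a" "EX x. x : L"
	shows "long_roots (S \<union> L) = L"
proof -
	obtain s where s: "s : L" using assms(3) by blast
	have "x : L" if "x : S \<union> L" "s \<bullet> s <= x \<bullet> x" for x using that assms(1)[OF s] assms(2) by fastforce
	moreover have "y \<bullet> y <= x \<bullet> x" if "x : L" "y : S \<union> L" for x y
		using that assms(1)[of x] assms(1)[of y] assms(2)[of y] by auto
	ultimately show ?thesis using s unfolding long_roots_def norm_le by blast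
qed

locale orthogonal_family =
	fixes m :: nat and f :: "nat => 'a::euclidean_space" and N :: real
	assumes N_pos: "0 < N"
		and inner_family: "!!i k. i : {1..m} ==> k : {1..m} ==> f i \<bullet> f k = (if i = k then N else 0)"
begin

lemma family_dual: "i : {1..m} ==> k : {1..m} ==> f i \<bullet> ((1 / N) *R f k) = (if i = k then 1 else 0)"
	using inner_family N_pos by simp

lemma family_inj: "inj_on f {1..m}" and family_independent: "independent (f ` {1..m})"
	using dual_family_independent[of "{1..m}" f "%k. (1 / N) *R f k"] family_dual by auto

lemma dim_family: "dim (span (f ` {1..m})) = m"
	using dim_eq_card_independent[OF family_independent] card_image[OF family_inj] by simp

lemma finite_signed_roots: "finite A ==> finite (signed_roots m f A)"
proof (rule finite_subset)
	show "signed_roots m f A \<subseteq>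
			(%(i, k, a, b). a *R f i + b *R f k) ` ({1..m} \<times> {1..m} \<times> {1,-1} \<times> {1,-1}) \<union>
			(%(i, c). c *R f i) ` ({1..m} \<times> (A \<union> uminus ` A))"
	proof
		fix \<beta> assume "\<beta> : signed_roots m f A"
		then show "\<beta> : (%(i, k, a, b). a *R f i + b *R f k) ` ({1..m} \<times> {1..m} \<times> {1,-1} \<times> {1,-1}) \<union>
			(%(i, c). c *R f i) ` ({1..m} \<times> (A \<union> uminus ` A))"
		proof (cases rule: signed_rootsE)
			case (pair i k a b)
			then have "(i, k, a, b) : {1..m} \<times> {1..m} \<times> {1,-1} \<times> {1,-1}" by (auto simp: abs_if split: if_splits)
			then show ?thesis using pair(6) by (intro UnI1 image_eqI[where x = "(i, k, a, b)"]) auto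
		next
			case (single i c)
			then have "c : A \<union> uminus ` A" by (cases "c >= 0") (auto simp: image_iff intro: bexI[of _ "- c"])
			then show ?thesis using single by (intro UnI2 image_eqI[where x = "(i, c)"]) auto
		qed
	qed
qed auto

lemma pair_inner:
	"i : {1..m} ==> k : {1..m} ==> p : {1..m} ==>
	 (a *R f i + b *R f k) \<bullet> f p = N * ((if i = p then a else 0) + (if k = p then b else 0))"
	using inner_family by (simp add: inner_add_left algebra_simps)

lemma single_inner:
	"i : {1..m} ==> p : {1..m} ==> (c *R f i) \<bullet> f p = N * (if i = p then c else 0)"
	using inner_family by simp

lemma signed_roots_nonzero:
	assumes "0 ~: A" shows "0 ~: signed_roots m f A"
proof
	assume "0 : signed_roots m f A"
	then show False
	proof (cases rule: signed_rootsE)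
		case (pair i k a b)
		then have "(a *R f i + b *R f k) \<bullet> f i = 0" by (metis inner_zero_left)
		then show False using pair_inner[of i k i a b] pair N_pos by auto
	next
		case (single i c)
		then have "(c *R f i) \<bullet> f i = 0" by (metis inner_zero_left)
		then show False using single_inner[of i i c] single N_pos assms by auto
	qed
qed

lemma signed_roots_map:
	assumes w: "linear w" "inj w" and im: "!!i. i : {1..m} ==> EX k:{1..m}. EX a. \<bar>a\<bar> = 1 & w (f i) = a *R f k"
		and b: "\<beta> : signed_roots m f A"
	shows "w \<beta> : signed_roots m f A"
	using b
proof (cases rule: signed_rootsE)
	case (pair i k a b)
	obtain i' a' where i: "i' : {1..m}" "\<bar>a'\<bar> = 1" "w (f i) = a' *R f i'" using im pair by blast
	obtain k' b' where k: "k' : {1..m}" "\<bar>b'\<bar> = 1" "w (f k) = b' *R f k'" using im pair by blast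
	have "i' ~= k'"
	proof
		assume e: "i' = k'"
		have "w ((a' * b') *R f k) = (a' * b' * b') *R f k'" using k w by (simp add: linear_scale)
		also have "a' * b' * b' = a'" using k(2) by (auto elim: abs_one_cases)
		finally have "w ((a' * b') *R f k) = w (f i)" using i e by simp
		then have "(a' * b') *R f k = f i" using w by (simp add: inj_eq)
		then have "f i \<bullet> f i = (a' * b') * (f k \<bullet> f i)" by (metis inner_scaleR_left)
		then show False using inner_family pair N_pos by simp
	qed
	moreover have "w \<beta> = (a * a') *R f i' + (b * b') *R f k'"
		using pair i k w by (simp add: linear_add linear_scale)
	ultimately show ?thesis using i k pair by (auto simp: abs_mult intro!: signed_rootsI(1))
next
	case (single i c)
	obtain i' a' where i: "i' : {1..m}" "\<bar>a'\<bar> = 1" "w (f i) = a' *R f i'" using im single by blast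
	have "w \<beta> = (c * a') *R f i'" using single i w by (simp add: linear_scale)
	then show ?thesis using i single by (auto simp: abs_mult intro!: signed_rootsI(2))
qed

lemma reflection_pair:
	assumes "i : {1..m}" "k : {1..m}" "i ~= k" "\<bar>a\<bar> = 1" "\<bar>b\<bar> = 1" "p : {1..m}"
	shows "root_reflection (a *R f i + b *R f k) (f p) =
		(if p = i then - (a * b) *R f k else if p = k then - (a * b) *R f i else f p)"
proof -
	have n: "(a *R f i + b *R f k) \<bullet> (a *R f i + b *R f k) = 2 * N"
		using assms by (auto simp: inner_add_right inner_add_left inner_family elim!: abs_one_cases)
	have c: "cartan_integer (f p) (a *R f i + b *R f k) = (if i = p then a else 0) + (if k = p then b else 0)"
		unfolding cartan_integer_def n using pair_inner[of i k p a b] assms N_pos by (simp add: inner_commute)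
	show ?thesis
		unfolding root_reflection_def c using assms
		by (auto simp: scaleR_add_right elim!: abs_one_cases)
qed

lemma reflection_single:
	assumes "i : {1..m}" "c ~= 0" "p : {1..m}"
	shows "root_reflection (c *R f i) (f p) = (if p = i then - f p else f p)"
	unfolding root_reflection_def cartan_integer_def
	using assms N_pos by (auto simp: inner_family scaleR_2 power2_eq_square)

lemma signed_roots_span:
	assumes "A ~= {} | 2 <= m" "A \<subseteq> {1,2}"
	shows "span (signed_roots m f A) = span (f ` {1..m})"
proof
	have "signed_roots m f A \<subseteq> span (f ` {1..m})"
		by (auto elim!: signed_rootsE intro!: span_add span_scale intro: span_base)
	then show "span (signed_roots m f A) \<subseteq> span (f ` {1..m})" by (metis span_mono span_span)
	have "f i : span (signed_roots m f A)" if i: "i : {1..m}" for i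
	proof (cases "A = {}")
		case False
		then obtain c where c: "c : A" by blast
		then have "c = 1 | c = 2" using assms(2) by auto
		with c have c: "c : A" "0 < c" by auto
		then have "(1 / c) *R (c *R f i) : span (signed_roots m f A)"
			using i by (intro span_scale span_base signed_rootsI(2)) auto
		then show ?thesis using c by simp
	next
		case True
		then have "2 <= m" using assms by simp
		then obtain k where k: "k : {1..m}" "k ~= i"
			by (cases "i = 1") (auto intro: that[of 2] that[of 1])
		have "(1 / 2) *R ((1 *R f i + 1 *R f k) + (1 *R f i + (-1) *R f k)) : span (signed_roots m f A)"
			using i k by (intro span_scale span_add[of "1 *R f i + 1 *R f k"] span_base signed_rootsI(1)) auto
		then show ?thesis by (simp add: algebra_simps flip: scaleR_2)
	qed
	then show "span (f ` {1..m}) \<subseteq> span (signed_roots m f A)" by (metis image_subsetI span_mono span_span)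
qed

lemma signed_roots_integral:
	assumes A: "A \<subseteq> {1,2}" and "\<a> : signed_roots m f A" "\<beta> : signed_roots m f A"
	shows "cartan_integer \<beta> \<a> : Ints"
proof -
	have int: "EX k :: int. \<beta> \<bullet> f p = N * of_int k" if "p : {1..m}" for p
		using assms(3)
	proof (cases rule: signed_rootsE)
		case (pair i k a b)
		then have "(if i = p then a else 0) + (if k = p then b else 0) = of_int ((if i = p then \<lfloor>a\<rfloor> else 0) + (if k = p then \<lfloor>b\<rfloor> else 0))"
			by (auto elim!: abs_one_cases)
		then show ?thesis using pair_inner[of i k p a b] pair that by metis
	next
		case (single i c)
		then have "c = 1 | c = -1 | c = 2 | c = -2" using A by (auto simp: abs_if split: if_splits)
		then have "c = of_int \<lfloor>c\<rfloor>" by auto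
		then have "(if i = p then c else 0) = of_int (if i = p then \<lfloor>c\<rfloor> else 0)" by simp
		then show ?thesis using single_inner[of i p c] single that by metis
	qed
	show ?thesis
		using assms(2)
	proof (cases rule: signed_rootsE)
		case (pair i k a b)
		obtain x where x: "\<beta> \<bullet> f i = N * of_int x" using int pair by blast
		obtain y where y: "\<beta> \<bullet> f k = N * of_int y" using int pair by blast
		have n: "\<a> \<bullet> \<a> = 2 * N"
			using pair by (auto simp: inner_add_right inner_add_left inner_family elim!: abs_one_cases)
		have "cartan_integer \<beta> \<a> = a * of_int x + b * of_int y"
			unfolding cartan_integer_def n using pair x y N_pos by (simp add: inner_add_right field_simps)
		then show ?thesis using pair by (auto elim!: abs_one_cases)
	next
		case (single i c)
		obtain x where x: "\<beta> \<bullet> f i = N * of_int x" using int single by blast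
		have n: "\<a> \<bullet> \<a> = c * c * N" using single inner_family by simp
		have "c ~= 0" using single A by auto
		then have e: "cartan_integer \<beta> \<a> = 2 * of_int x / c"
			unfolding cartan_integer_def n using single x N_pos by (simp add: field_simps)
		have "c = 1 | c = -1 | c = 2 | c = -2" using single A by (auto simp: abs_if split: if_splits)
		then show ?thesis unfolding e by auto
	qed
qed

text \<open>
	Reflections in \<open>\<plusminus> f i \<plusminus> f k\<close> exchange two coordinates up to
	sign, the others change one sign, and both preserve the shape of the set.
\<close>

lemma signed_roots_root_system:
	assumes A: "A \<subseteq> {1,2}" and ne: "A ~= {} | 2 <= m"
	shows "root_system_in (span (f ` {1..m})) (signed_roots m f A)"
proof -
	have A0: "0 ~: A" "finite A" using A finite_subset by auto
	have "root_reflection \<a> \<beta> : signed_roots m f A"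
		if a: "\<a> : signed_roots m f A" and b: "\<beta> : signed_roots m f A" for \<a> \<beta>
	proof (rule signed_roots_map[OF linear_root_reflection _ _ b])
		show "inj (root_reflection \<a>)" by (metis injI root_reflection_involution)
		fix p assume p: "p : {1..m}"
		show "EX k:{1..m}. EX a. \<bar>a\<bar> = 1 & root_reflection \<a> (f p) = a *R f k"
			using a
		proof (cases rule: signed_rootsE)
			case (pair i k a b)
			have ab: "\<bar>- (a * b)\<bar> = 1" using pair by (simp add: abs_mult)
			have r: "root_reflection \<a> (f p) = (if p = i then - (a * b) *R f k else if p = k then - (a * b) *R f i else f p)"
				using reflection_pair[of i k a b p] pair p by simp
			consider "p = i" | "p ~= i" "p = k" | "p ~= i" "p ~= k" by blast
			then show ?thesis
			proof cases
				case 1 then show ?thesis using r ab pair by (intro bexI[of _ k] exI[of _ "- (a * b)"]) auto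
			next
				case 2 then show ?thesis using r ab pair by (intro bexI[of _ i] exI[of _ "- (a * b)"]) auto
			next
				case 3 then show ?thesis using r p by (intro bexI[of _ p] exI[of _ 1]) auto
			qed
		next
			case (single i c)
			then have "c ~= 0" using A0 by auto
			then have "root_reflection \<a> (f p) = (if p = i then -1 else 1) *R f p"
				using reflection_single[of i c p] single p by simp
			then show ?thesis using p by (intro bexI[of _ p] exI[of _ "if p = i then -1 else 1"]) auto
		qed
	qed
	then have "root_reflection \<a> ` signed_roots m f A = signed_roots m f A" if "\<a> : signed_roots m f A" for \<a>
		using that by (metis image_eqI image_subsetI root_reflection_involution subsetI subset_antisym)
	then show ?thesis
		unfolding root_system_in_def
		using finite_signed_roots[OF A0(2)] signed_roots_nonzero[OF A0(1)] signed_roots_span[OF ne A]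
			signed_roots_integral[OF A] by blast
qed

lemma signed_roots_reduced:
	assumes A: "A \<subseteq> {d}" "0 < d"
	shows "reduced_roots (signed_roots m f A)"
	unfolding reduced_roots_def
proof (intro ballI allI impI)
	fix \<a> c assume a: "\<a> : signed_roots m f A" and ca: "c *R \<a> : signed_roots m f A"
	have "0 ~: A" using A by auto
	then have c0: "c ~= 0" using signed_roots_nonzero[of A] ca by auto
	show "c = 1 | c = -1" using a
	proof (cases rule: signed_rootsE)
		case (pair i k a b)
		have ni: "(c *R \<a>) \<bullet> f i = N * (c * a)" "(c *R \<a>) \<bullet> f k = N * (c * b)"
			using pair_inner[of i k i a b] pair_inner[of i k k a b] pair by auto
		have nz: "c * a ~= 0" "c * b ~= 0" using c0 pair by auto
		show ?thesis using ca
		proof (cases rule: signed_rootsE)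
			case p2: (pair i' k' a' b')
			have "N * (c * a) = N * ((if i' = i then a' else 0) + (if k' = i then b' else 0))"
				by (simp only: ni(1)[symmetric] p2(6) pair_inner[OF p2(1,2) pair(1)])
			then have "c * a = (if i' = i then a' else 0) + (if k' = i then b' else 0)" using N_pos by simp
			then have "\<bar>c * a\<bar> = 1" using nz p2 by (auto split: if_splits)
			then show ?thesis using pair by (auto simp: abs_mult)
		next
			case (single i' c')
			have "N * (c * a) = N * (if i' = i then c' else 0)" "N * (c * b) = N * (if i' = k then c' else 0)"
				by (simp_all only: ni[symmetric] single(3) single_inner[OF single(1) pair(1)] single_inner[OF single(1) pair(2)])
			then show ?thesis using nz N_pos pair(3) by (auto split: if_splits)
		qed
	next
		case (single i e)
		have ni: "(c *R \<a>) \<bullet> f p = N * (if i = p then c * e else 0)" if "p : {1..m}" for p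
			by (simp add: single(3) inner_family[OF single(1) that])
		show ?thesis using ca
		proof (cases rule: signed_rootsE)
			case (pair i' k' a' b')
			have "N * (if i = i' then c * e else 0) = N * a'" "N * (if i = k' then c * e else 0) = N * b'"
				by (simp_all only: pair(3) pair(3)[THEN not_sym] ni[OF pair(1), symmetric] ni[OF pair(2), symmetric] pair(6)
					pair_inner[OF pair(1,2,1)] pair_inner[OF pair(1,2,2)] if_True if_False add_0_left add_0_right simp_thms)
			then show ?thesis using pair N_pos by (auto split: if_splits)
		next
			case s2: (single i' e')
			have "N * (c * e) = N * (if i' = i then e' else 0)"
				using ni[OF single(1)] by (simp only: s2(3) single_inner[OF s2(1) single(1)] if_True simp_thms)
			then have "c * e = (if i' = i then e' else 0)" using N_pos by simp
			moreover have "\<bar>e\<bar> = d" "\<bar>e'\<bar> = d" using A single s2 by auto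
			moreover have "c * e ~= 0" using c0 \<open>\<bar>e\<bar> = d\<close> A by auto
			ultimately have "\<bar>c\<bar> * d = d" by (metis abs_mult)
			then show ?thesis using A by auto
		qed
	qed
qed

lemma signed_roots_not_reduced:
	assumes "1 <= m" shows "~ reduced_roots (signed_roots m f {1,2})"
proof
	assume r: "reduced_roots (signed_roots m f {1,2})"
	have "1 *R f 1 : signed_roots m f {1,2}" "2 *R f 1 : signed_roots m f {1,2}"
		using assms by (intro signed_rootsI(2); simp)+
	then have "(2::real) = 1 | (2::real) = -1" using r unfolding reduced_roots_def by fastforce
	then show False by simp
qed

lemma difference_cone:
	assumes "!!i. i : {1..<m} ==> \<a> i = f i - f (Suc i)" "1 <= i" "i <= k" "k <= m"
	shows "f i - f k : nat_cone m \<a>"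
proof -
	have "f i - f k = (\<Sum>t=i..<k. \<a> t)"
		using assms(3,4)
	proof (induction k rule: dec_induct)
		case (step k)
		then show ?case using assms(1)[of k] assms(2) by (simp add: algebra_simps)
	qed simp
	also have "\<dots> : nat_cone m \<a>" using assms by (intro nat_cone_sum nat_cone_base) auto
	finally show ?thesis .
qed

text \<open>
	All simple systems needed here consist of the differences of consecutive vectors and one more
	root; what that root contributes is that the sums and the multiples of single vectors are
	nonnegative combinations.
\<close>

lemma signed_roots_simple:
	assumes diff: "!!i. i : {1..<m} ==> \<a> i = f i - f (Suc i)"
		and sub: "\<a> ` {1..m} \<subseteq> signed_roots m f A" and A: "A \<subseteq> {1,2}" "A ~= {} | 2 <= m"
		and last: "f m : span (\<a> ` {1..m})"
		and plus: "!!i k. i : {1..m} ==> k : {1..m} ==> i < k ==> f i + f k : nat_cone m \<a>"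
		and mult: "!!i c. i : {1..m} ==> c : A ==> c *R f i : nat_cone m \<a>"
	shows "simple_roots m (signed_roots m f A) \<a>"
proof -
	have cone_span: "x : span (\<a> ` {1..m})" if "x : nat_cone m \<a>" for x
		using that unfolding nat_cone_def by (auto intro!: span_sum span_scale intro: span_base)
	have "f i : span (\<a> ` {1..m})" if "i : {1..m}" for i
		using span_add[OF cone_span[OF difference_cone[OF diff, where i = i and k = m]] last] that by auto
	then have 1: "span (f ` {1..m}) \<subseteq> span (\<a> ` {1..m})" by (metis image_subsetI span_mono span_span)
	have 2: "\<a> ` {1..m} \<subseteq> span (f ` {1..m})"
		using sub signed_roots_span[OF A(2,1)] span_superset by blast
	have dim: "m <= dim (span (f ` {1..m}))" using dim_family by simp
	have pairs: "a *R f i + b *R f k : nat_cone m \<a> | - (a *R f i + b *R f k) : nat_cone m \<a>"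
		if "i : {1..m}" "k : {1..m}" "i < k" "\<bar>a\<bar> = 1" "\<bar>b\<bar> = 1" for i k a b
		using that(4,5) plus[OF that(1-3)] difference_cone[OF diff, where i = i and k = k] that
		by (auto elim!: abs_one_cases simp: add.commute)
	have "\<beta> : nat_cone m \<a> | - \<beta> : nat_cone m \<a>" if "\<beta> : signed_roots m f A" for \<beta>
		using that
	proof (cases rule: signed_rootsE)
		case (pair i k a b)
		from pairs[of i k a b] pairs[of k i b a] show ?thesis
			using pair by (cases "i < k") (simp_all add: add.commute)
	next
		case (single i c)
		then show ?thesis using mult[of i "\<bar>c\<bar>"] by (cases "c >= 0") auto
	qed
	then show ?thesis
		using spanning_family_independent[OF 2 1 dim] sub
		unfolding simple_roots_def nat_cone_def by (auto simp: image_iff) (metis minus_minus)+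
qed

lemma single_cone:
	assumes diff: "!!i. i : {1..<m} ==> \<a> i = f i - f (Suc i)" and last: "\<a> m = f m" and i: "i : {1..m}"
	shows "f i : nat_cone m \<a>"
	using nat_cone_add[OF difference_cone[OF diff, where i = i and k = m] nat_cone_base[of m m \<a>]] i last by auto

lemma sum_cone_C:
	assumes diff: "!!i. i : {1..<m} ==> \<a> i = f i - f (Suc i)" and last: "\<a> m = 2 *R f m"
		and ik: "i : {1..m}" "k : {1..m}"
	shows "f i + f k : nat_cone m \<a>"
proof -
	have am: "f m + f m : nat_cone m \<a>" using nat_cone_base[of m m \<a>] ik last by (simp add: scaleR_2)
	show ?thesis
		using nat_cone_add[OF nat_cone_add[OF difference_cone[OF diff, where i = i and k = m]
			difference_cone[OF diff, where i = k and k = m]] am] ik by (auto simp: algebra_simps)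
qed

lemma sum_cone_D:
	assumes diff: "!!i. i : {1..<m} ==> \<a> i = f i - f (Suc i)" and last: "\<a> m = f (m - 1) + f m"
		and ik: "i : {1..<m}" "k : {1..m}"
	shows "f i + f k : nat_cone m \<a>"
proof -
	have am: "f (m - 1) + f m : nat_cone m \<a>" using nat_cone_base[of m m \<a>] ik last by simp
	show ?thesis
		using nat_cone_add[OF nat_cone_add[OF difference_cone[OF diff, where i = i and k = "m - 1"]
			difference_cone[OF diff, where i = k and k = m]] am] ik by (auto simp: algebra_simps)
qed

lemma consecutive_simple_B:
	assumes diff: "!!i. i : {1..<m} ==> \<a> i = f i - f (Suc i)" and last: "\<a> m = f m"
		and A: "1 : A" "A \<subseteq> {1,2}" and m: "1 <= m"
	shows "simple_roots m (signed_roots m f A) \<a>"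
proof (rule signed_roots_simple[OF diff])
	have single: "f i : nat_cone m \<a>" if "i : {1..m}" for i
		by (rule single_cone[OF diff last that])
	show "f i + f k : nat_cone m \<a>" if "i : {1..m}" "k : {1..m}" for i k
		using that single nat_cone_add by blast
	show "c *R f i : nat_cone m \<a>" if "i : {1..m}" "c : A" for i c
		using that single[of i] nat_cone_add[of "f i" m \<a> "f i"] A by (auto simp: scaleR_2)
	show "f m : span (\<a> ` {1..m})" unfolding last[symmetric] using m by (intro span_base imageI) simp
	show "\<a> ` {1..m} \<subseteq> signed_roots m f A"
	proof safe
		fix i assume i: "i : {1..m}"
		show "\<a> i : signed_roots m f A"
		proof (cases "i = m")
			case True
			then show ?thesis using signed_rootsI(2)[of m m 1 A f] A m last by simp
		next
			case False
			then show ?thesis using signed_rootsI(1)[of i m "Suc i" 1 "-1" f A] i diff[of i] by simp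
		qed
	qed
qed (use A in auto)

lemma consecutive_simple_C:
	assumes diff: "!!i. i : {1..<m} ==> \<a> i = f i - f (Suc i)" and last: "\<a> m = 2 *R f m" and m: "1 <= m"
	shows "simple_roots m (signed_roots m f {2}) \<a>"
proof (rule signed_roots_simple[OF diff])
	show sum: "f i + f k : nat_cone m \<a>" if "i : {1..m}" "k : {1..m}" for i k
		by (rule sum_cone_C[OF diff last that])
	show "c *R f i : nat_cone m \<a>" if "i : {1..m}" "c : {2}" for i c
		using that sum[of i i] by (auto simp: scaleR_2)
	have "(1 / 2) *R \<a> m : span (\<a> ` {1..m})" using m by (intro span_scale span_base imageI) simp
	then show "f m : span (\<a> ` {1..m})" by (simp add: last)
	show "\<a> ` {1..m} \<subseteq> signed_roots m f {2}"
	proof safe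
		fix i assume i: "i : {1..m}"
		show "\<a> i : signed_roots m f {2}"
		proof (cases "i = m")
			case True
			then show ?thesis using signed_rootsI(2)[of m m 2 "{2}" f] m last by simp
		next
			case False
			then show ?thesis using signed_rootsI(1)[of i m "Suc i" 1 "-1" f "{2}"] i diff[of i] by simp
		qed
	qed
qed auto

lemma consecutive_simple_D:
	assumes diff: "!!i. i : {1..<m} ==> \<a> i = f i - f (Suc i)" and last: "\<a> m = f (m - 1) + f m" and m: "2 <= m"
	shows "simple_roots m (signed_roots m f {}) \<a>"
proof (rule signed_roots_simple[OF diff])
	show "f i + f k : nat_cone m \<a>" if "i : {1..m}" "k : {1..m}" "i < k" for i k
		by (rule sum_cone_D[OF diff last]) (use that in auto)
	have "\<a> (m - 1) = f (m - 1) - f m" using diff[of "m - 1"] m by simp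
	moreover have "(1 / 2) *R (\<a> m - \<a> (m - 1)) : span (\<a> ` {1..m})"
		using m by (intro span_scale span_diff span_base imageI) auto
	ultimately show "f m : span (\<a> ` {1..m})" by (simp add: last flip: scaleR_2)
	show "\<a> ` {1..m} \<subseteq> signed_roots m f {}"
	proof safe
		fix i assume i: "i : {1..m}"
		show "\<a> i : signed_roots m f {}"
		proof (cases "i = m")
			case True
			then show ?thesis using signed_rootsI(1)[of "m - 1" m m 1 1 f "{}"] m last by simp
		next
			case False
			then show ?thesis using signed_rootsI(1)[of i m "Suc i" 1 "-1" f "{}"] i diff[of i] by simp
		qed
	qed
qed (use m in auto)

lemma consecutive_inner:
	assumes "i : {1..<m}" "k : {1..<m}"
	shows "(f i - f (Suc i)) \<bullet> (f k - f (Suc k)) = N * of_int (path_matrix i k)"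
	using assms N_pos inner_family[of i k] inner_family[of i "Suc k"] inner_family[of "Suc i" k] inner_family[of "Suc i" "Suc k"]
	by (auto simp: inner_diff_left inner_diff_right path_matrix_def simply_laced_matrix_def)

lemma consecutive_inner_last:
	assumes "i : {1..<m}"
	shows "(f i - f (Suc i)) \<bullet> f m = (if Suc i = m then - N else 0)"
	using assms inner_family[of i m] inner_family[of "Suc i" m] by (auto simp: inner_diff_left)

lemma consecutive_cartan:
	assumes m: "1 <= m" and diff: "!!i. i : {1..<m} ==> \<a> i = f i - f (Suc i)" and last: "\<a> m = c *R f m"
		and ik: "i : {1..m}" "k : {1..m}"
	shows "c = 1 ==> cartan_integer (\<a> i) (\<a> k) = of_int (cartan_matrix (Type_B m) i k)"
		and "c = 2 ==> cartan_integer (\<a> i) (\<a> k) = of_int (cartan_matrix (Type_C m) i k)"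
proof -
	have fm: "f m \<bullet> f m = N" using inner_family m by simp
	have path: "path_matrix i i = 2" for i by (simp add: path_matrix_def simply_laced_matrix_def)
	consider "i < m" "k < m" | "i < m" "k = m" | "i = m" "k < m" | "i = m" "k = m" using ik by force
	then have "(c = 1 --> cartan_integer (\<a> i) (\<a> k) = of_int (cartan_matrix (Type_B m) i k)) &
		 (c = 2 --> cartan_integer (\<a> i) (\<a> k) = of_int (cartan_matrix (Type_C m) i k))"
	proof cases
		case 1
		then have "cartan_integer (\<a> i) (\<a> k) = of_int (path_matrix i k)"
			using ik diff consecutive_inner[of i k] consecutive_inner[of k k] N_pos
			by (simp add: cartan_integer_def path)
		then show ?thesis using 1 by simp
	next
		case 2
		then show ?thesis
			using ik diff consecutive_inner_last[of i] N_pos last fm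
			by (auto simp: cartan_integer_def path_matrix_def simply_laced_matrix_def)
	next
		case 3
		then show ?thesis
			using ik diff consecutive_inner_last[of k] consecutive_inner[of k k] N_pos last
			by (auto simp: cartan_integer_def path path_matrix_def simply_laced_matrix_def inner_commute)
	next
		case 4
		then show ?thesis
			using N_pos last fm by (auto simp: cartan_integer_def path)
	qed
	then show "c = 1 ==> cartan_integer (\<a> i) (\<a> k) = of_int (cartan_matrix (Type_B m) i k)"
		and "c = 2 ==> cartan_integer (\<a> i) (\<a> k) = of_int (cartan_matrix (Type_C m) i k)" by blast+
qed

lemma type_B: "1 <= m ==> root_system_of_type (span (f ` {1..m})) (signed_roots m f {1}) (Type_B m)"
	and type_BC: "1 <= m ==> root_system_of_type (span (f ` {1..m})) (signed_roots m f {1,2}) (Type_BC m)"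
	and type_A1: "m = 1 ==> root_system_of_type (span (f ` {1..m})) (signed_roots m f {1}) (Type_A 1)"
proof -
	define \<a> where "\<a> i = (if i < m then f i - f (Suc i) else f i)" for i
	assume m: "1 <= m"
	have diff: "\<a> i = f i - f (Suc i)" if "i : {1..<m}" for i using that by (simp add: \<a>_def)
	have last: "\<a> m = f m" "\<a> m = 1 *R f m" by (simp_all add: \<a>_def)
	have cartan: "cartan_integer (\<a> i) (\<a> k) = of_int (cartan_matrix (Type_B m) i k)"
		if "i : {1..m}" "k : {1..m}" for i k
		by (rule consecutive_cartan(1)[OF m diff last(2) that]) simp_all
	have s: "simple_roots m (signed_roots m f A) \<a>" if "1 : A" "A \<subseteq> {1,2}" for A
		by (rule consecutive_simple_B[OF diff last(1) that m])
	show "root_system_of_type (span (f ` {1..m})) (signed_roots m f {1}) (Type_B m)"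
		unfolding root_system_of_type_def bourbaki_simple_roots_def
		using signed_roots_root_system[of "{1}"] signed_roots_reduced[of "{1}" 1] s[of "{1}"] cartan
		by (auto intro!: exI[of _ \<a>])
	show "root_system_of_type (span (f ` {1..m})) (signed_roots m f {1,2}) (Type_BC m)"
		unfolding root_system_of_type_def bourbaki_simple_roots_def
		using signed_roots_root_system[of "{1,2}"] signed_roots_not_reduced[OF m] s[of "{1,2}"] cartan
		by (auto intro!: exI[of _ \<a>])
next
	assume m: "m = 1"
	have s: "simple_roots m (signed_roots m f {1}) f"
		by (rule consecutive_simple_B) (use m in auto)
	have "cartan_integer (f 1) (f 1) = 2" using inner_family[of 1 1] N_pos m by (simp add: cartan_integer_def)
	then show "root_system_of_type (span (f ` {1..m})) (signed_roots m f {1}) (Type_A 1)"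
		unfolding root_system_of_type_def bourbaki_simple_roots_def
		using signed_roots_root_system[of "{1}"] signed_roots_reduced[of "{1}" 1] s m
		by (auto intro!: exI[of _ f] simp: path_matrix_def simply_laced_matrix_def)
qed

lemma type_C: assumes m: "1 <= m"
	shows "root_system_of_type (span (f ` {1..m})) (signed_roots m f {2}) (Type_C m)"
proof -
	define \<a> where "\<a> i = (if i < m then f i - f (Suc i) else 2 *R f i)" for i
	have diff: "\<a> i = f i - f (Suc i)" if "i : {1..<m}" for i using that by (simp add: \<a>_def)
	have last: "\<a> m = 2 *R f m" by (simp add: \<a>_def)
	have cartan: "cartan_integer (\<a> i) (\<a> k) = of_int (cartan_matrix (Type_C m) i k)"
		if "i : {1..m}" "k : {1..m}" for i k
		by (rule consecutive_cartan(2)[OF m diff last that]) simp_all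
	show ?thesis
		unfolding root_system_of_type_def bourbaki_simple_roots_def
		using signed_roots_root_system[of "{2}"] signed_roots_reduced[of "{2}" 2]
			consecutive_simple_C[OF diff last m] cartan
		by (auto intro!: exI[of _ \<a>])
qed

definition singles :: "real => 'a set" where
	"singles d = {c *R f i |i c. i : {1..m} & \<bar>c\<bar> = d}"

lemma singlesI: "i : {1..m} ==> \<bar>c\<bar> = d ==> c *R f i : singles d"
	unfolding singles_def by blast

lemma signed_roots_decomp: "signed_roots m f A = signed_roots m f {} \<union> (\<Union>d\<in>A. singles d)"
	unfolding signed_roots_def singles_def by blast

lemma pairs_square: "\<beta> : signed_roots m f {} ==> \<beta> \<bullet> \<beta> = 2 * N"
	by (erule signed_rootsE)
		(auto simp: inner_add_right inner_add_left inner_family elim!: abs_one_cases)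

lemma singles_square: "\<beta> : singles d ==> \<beta> \<bullet> \<beta> = d\<^sup>2 * N"
	unfolding singles_def by (auto simp: inner_family power2_eq_square)

lemma pairs_nonempty: "2 <= m ==> EX \<beta>. \<beta> : signed_roots m f {}"
	using signed_rootsI(1)[of 1 m 2 1 1 f "{}"] by fastforce

lemma singles_nonempty: "1 <= m ==> 0 <= d ==> EX \<beta>. \<beta> : singles d"
	using singlesI[of 1 d d] by auto

lemma scaled_singles: "0 < c ==> scaled c (singles d) = singles (c * d)"
proof safe
	fix x assume c: "0 < c" "x : singles (c * d)"
	then obtain i b where "i : {1..m}" "\<bar>b\<bar> = c * d" "x = b *R f i" by (auto simp: singles_def)
	then have x: "x = c *R ((b / c) *R f i)" "(b / c) *R f i : singles d" using c by (auto intro!: singlesI)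
	show "x : scaled c (singles d)" unfolding scaled_def by (rule image_eqI, rule x(1), rule x(2))
next
	fix x assume c: "0 < c" "x : scaled c (singles d)"
	then obtain i b where "i : {1..m}" "\<bar>b\<bar> = d" "x = c *R (b *R f i)" by (auto simp: singles_def scaled_def)
	then show "x : singles (c * d)" using c singlesI[of i "c * b" "c * d"] by (simp add: abs_mult)
qed

lemma dual_B: assumes "2 <= m"
	shows "scaled 2 (short_roots (signed_roots m f {1})) \<union> long_roots (signed_roots m f {1}) = signed_roots m f {2}"
proof -
	have d: "signed_roots m f {1} = singles 1 \<union> signed_roots m f {}" using signed_roots_decomp[of "{1}"] by auto
	have "short_roots (signed_roots m f {1}) = singles 1"
		unfolding d by (rule short_roots_union[where a = N])
			(use singles_square[of _ 1] pairs_square N_pos singles_nonempty[of 1] assms in auto)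
	moreover have "long_roots (signed_roots m f {1}) = signed_roots m f {}"
		unfolding d by (rule long_roots_union[where a = "2 * N"])
			(use singles_square[of _ 1] pairs_square N_pos pairs_nonempty assms in auto)
	ultimately show ?thesis
		using scaled_singles[of 2 1] signed_roots_decomp[of "{2}"] by auto
qed

lemma dual_C: assumes "2 <= m"
	shows "short_roots (signed_roots m f {2}) \<union> scaled (1 / 2) (long_roots (signed_roots m f {2})) = signed_roots m f {1}"
proof -
	have d: "signed_roots m f {2} = signed_roots m f {} \<union> singles 2" using signed_roots_decomp[of "{2}"] by auto
	have "short_roots (signed_roots m f {2}) = signed_roots m f {}"
		unfolding d by (rule short_roots_union[where a = "2 * N"])
			(use singles_square[of _ 2] pairs_square N_pos pairs_nonempty assms in auto)
	moreover have "long_roots (signed_roots m f {2}) = singles 2"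
		unfolding d by (rule long_roots_union[where a = "4 * N"])
			(use singles_square[of _ 2] pairs_square N_pos singles_nonempty[of 2] assms in auto)
	ultimately show ?thesis
		using scaled_singles[of "1 / 2" 2] signed_roots_decomp[of "{1}"] by auto
qed

lemma doubled_short_BC: assumes "1 <= m"
	shows "scaled 2 (short_roots (signed_roots m f {1,2})) \<union> (signed_roots m f {1,2} - short_roots (signed_roots m f {1,2}))
		= signed_roots m f {2}"
proof -
	have d: "signed_roots m f {1,2} = singles 1 \<union> signed_roots m f {2}"
		using signed_roots_decomp[of "{1,2}"] signed_roots_decomp[of "{2}"] by auto
	have sq: "N < \<beta> \<bullet> \<beta>" if "\<beta> : signed_roots m f {2}" for \<beta>
		using that signed_roots_decomp[of "{2}"] pairs_square[of \<beta>] singles_square[of \<beta> 2] N_pos by auto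
	have "short_roots (signed_roots m f {1,2}) = singles 1"
		unfolding d by (rule short_roots_union[where a = N])
			(use singles_square[of _ 1] sq singles_nonempty[of 1] assms in auto)
	moreover have "signed_roots m f {2} \<inter> singles 1 = {}" using sq singles_square[of _ 1] by fastforce
	ultimately show ?thesis
		using d scaled_singles[of 2 1] signed_roots_decomp[of "{2}"] by auto
qed

end

definition difference_roots :: "nat => (nat => 'a::ab_group_add) => 'a set" where
	"difference_roots n f = {f i - f k |i k. i < n & k < n & i ~= k}"

text \<open>
	The vectors \<open>f i\<close> play the role of the standard basis vectors projected to the hyperplane of sum 0;
	only their inner products with differences matter.
\<close>

locale difference_family =
	fixes n :: nat and f :: "nat => 'a::euclidean_space" and N :: real
	assumes N_pos: "0 < N"
		and inner_difference: "!!i p q. i < n ==> p < n ==> q < n ==>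
			f i \<bullet> (f p - f q) = N * ((if i = p then 1 else 0) - (if i = q then 1 else 0))"
begin

lemma difference_square: "p < n ==> q < n ==> p ~= q ==> (f p - f q) \<bullet> (f p - f q) = 2 * N"
	using inner_difference[of p p q] inner_difference[of q p q] by (simp add: inner_diff_left)

lemma reflection_difference:
	assumes "p < n" "q < n" "p ~= q" "i < n"
	shows "root_reflection (f p - f q) (f i) = f (if i = p then q else if i = q then p else i)"
proof -
	have "cartan_integer (f i) (f p - f q) = (if i = p then 1 else 0) - (if i = q then 1 else 0)"
		unfolding cartan_integer_def using assms inner_difference N_pos by (simp add: difference_square)
	then show ?thesis using assms(3) by (simp add: root_reflection_def)
qed

lemma difference_roots_root_system:
	"root_system_in (span (difference_roots n f)) (difference_roots n f)"
proof -
	have fin: "finite (difference_roots n f)"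
		by (rule finite_subset[where B = "(%(i, k). f i - f k) ` ({..<n} \<times> {..<n})"]) (auto simp: difference_roots_def)
	have refl: "root_reflection \<a> \<beta> : difference_roots n f"
		if "\<a> : difference_roots n f" "\<beta> : difference_roots n f" for \<a> \<beta>
	proof -
		obtain p q where a: "p < n" "q < n" "p ~= q" "\<a> = f p - f q" using \<open>\<a> : _\<close> by (auto simp: difference_roots_def)
		obtain i k where b: "i < n" "k < n" "i ~= k" "\<beta> = f i - f k" using \<open>\<beta> : _\<close> by (auto simp: difference_roots_def)
		let ?t = "%i. if i = p then q else if i = q then p else i"
		have "root_reflection \<a> \<beta> = f (?t i) - f (?t k)"
			using reflection_difference a b linear_diff[OF linear_root_reflection] by metis
		moreover have "?t i < n" "?t k < n" "?t i ~= ?t k" using a b by auto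
		ultimately show ?thesis unfolding difference_roots_def by blast
	qed
	then have "root_reflection \<a> ` difference_roots n f = difference_roots n f" if "\<a> : difference_roots n f" for \<a>
		using that by (metis image_eqI image_subsetI root_reflection_involution subsetI subset_antisym)
	moreover have "cartan_integer \<beta> \<a> : Ints"
		if "\<a> : difference_roots n f" "\<beta> : difference_roots n f" for \<a> \<beta>
	proof -
		obtain p q where a: "p < n" "q < n" "p ~= q" "\<a> = f p - f q" using \<open>\<a> : _\<close> by (auto simp: difference_roots_def)
		obtain i k where b: "i < n" "k < n" "i ~= k" "\<beta> = f i - f k" using \<open>\<beta> : _\<close> by (auto simp: difference_roots_def)
		show ?thesis
			unfolding cartan_integer_def a(4) b(4) using a b inner_difference N_pos
			by (simp add: difference_square inner_diff_left)
	qed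
	moreover have "0 ~: difference_roots n f"
		using difference_square N_pos by (force simp: difference_roots_def)
	ultimately show ?thesis using fin by (auto simp: root_system_in_def)
qed

lemma difference_roots_reduced: "reduced_roots (difference_roots n f)"
	unfolding reduced_roots_def
proof (intro ballI allI impI)
	fix \<a> c assume "\<a> : difference_roots n f" "c *R \<a> : difference_roots n f"
	moreover have "\<beta> \<bullet> \<beta> = 2 * N" if "\<beta> : difference_roots n f" for \<beta>
		using that difference_square by (auto simp: difference_roots_def)
	ultimately have 1: "\<a> \<bullet> \<a> = 2 * N" and 2: "(c *R \<a>) \<bullet> (c *R \<a>) = 2 * N" by blast+
	have "(c * c) * (2 * N) = 2 * N" using 2 by (simp add: 1 mult.assoc)
	then have "c * c = 1" using N_pos by simp
	then show "c = 1 | c = -1" using square_eq_1_iff by blast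
qed

lemma difference_roots_cone:
	assumes \<a>: "!!i. i : {1..n - 1} ==> \<a> i = f (i - 1) - f i" and ik: "i <= k" "k < n"
	shows "f i - f k : nat_cone (n - 1) \<a>"
proof -
	have "f i - f k = (\<Sum>t=i..<k. \<a> (Suc t))"
		using ik
	proof (induction k rule: dec_induct)
		case (step k)
		then show ?case using \<a>[of "Suc k"] by (simp add: algebra_simps)
	qed simp
	also have "\<dots> : nat_cone (n - 1) \<a>" using ik by (intro nat_cone_sum nat_cone_base) auto
	finally show ?thesis .
qed

lemma difference_roots_simple:
	assumes "!!i. i : {1..n - 1} ==> \<a> i = f (i - 1) - f i"
	shows "simple_roots (n - 1) (difference_roots n f) \<a>"
proof -
	note cone = difference_roots_cone[OF assms]
	have "\<beta> : nat_cone (n - 1) \<a> | - \<beta> : nat_cone (n - 1) \<a>" if b: "\<beta> : difference_roots n f" for \<beta>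
	proof -
		obtain i k where "i < n" "k < n" "\<beta> = f i - f k" using b by (auto simp: difference_roots_def)
		then show ?thesis using cone[of i k] cone[of k i] by (cases "i <= k") auto
	qed
	moreover have "\<a> i \<bullet> ((1 / N) *R (\<Sum>p<k. f p)) = (if i = k then 1 else 0)"
		if "i : {1..n - 1}" "k : {1..n - 1}" for i k
	proof -
		have "\<a> i \<bullet> (\<Sum>p<k. f p) = (\<Sum>p<k. N * ((if p = i - 1 then 1 else 0) - (if p = i then 1 else 0)))"
			unfolding inner_sum_right using assms[OF that(1)] that inner_difference
			by (intro sum.cong) (auto simp: inner_commute)
		also have "\<dots> = N * ((if i - 1 < k then 1 else 0) - (if i < k then 1 else 0))"
			by (simp add: sum_subtractf flip: sum_distrib_left)
		finally show ?thesis using that N_pos by auto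
	qed
	then have "inj_on \<a> {1..n - 1}" "independent (\<a> ` {1..n - 1})"
		using dual_family_independent[of "{1..n - 1}" \<a> "%k. (1 / N) *R (\<Sum>p<k. f p)"] by blast+
	moreover have "\<a> ` {1..n - 1} \<subseteq> difference_roots n f"
		using assms by (fastforce simp: difference_roots_def)
	ultimately show ?thesis
		unfolding simple_roots_def nat_cone_def by (auto simp: image_iff) (metis minus_minus)+
qed

lemma type_A: assumes n: "2 <= n"
	shows "root_system_of_type (span (difference_roots n f)) (difference_roots n f) (Type_A (n - 1))"
proof -
	have "cartan_integer (f (i - 1) - f i) (f (k - 1) - f k) = of_int (path_matrix i k)"
		if "i : {1..n - 1}" "k : {1..n - 1}" for i k
	proof -
		have lt: "i - 1 < n" "i < n" "k - 1 < n" "k < n" "k - 1 ~= k" "i - 1 = k - 1 <-> i = k" using that n by auto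
		show ?thesis
			unfolding cartan_integer_def inner_diff_left[of "f (i - 1)"] difference_square[OF lt(3,4,5)]
				inner_difference[OF lt(1,3,4)] inner_difference[OF lt(2,3,4)]
			using that N_pos lt by (auto simp: path_matrix_def simply_laced_matrix_def)
	qed
	then show ?thesis
		unfolding root_system_of_type_def bourbaki_simple_roots_def
		using difference_roots_root_system difference_roots_reduced difference_roots_simple[of "%i. f (i - 1) - f i"]
		by (auto intro!: exI[of _ "%i. f (i - 1) - f i"])
qed

end

section \<open>Orbit averages and fixed spaces\<close>

lemma map_order_props:
	assumes "0 < k" "w ^^ k = id"
	shows "0 < map_order w" "w ^^ map_order w = id"
	using LeastI[of "%n. 0 < n & w ^^ n = id" k] assms unfolding map_order_def by auto

lemma map_order_eqI:
	assumes "0 < n" "w ^^ n = id" "!!k. 0 < k ==> k < n ==> w ^^ k ~= id"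
	shows "map_order w = n"
	unfolding map_order_def by (rule Least_equality) (use assms in \<open>auto simp: not_less[symmetric]\<close>)

lemma map_order_involution:
	assumes "!!x. w (w x) = x" "w y ~= y"
	shows "map_order w = 2"
proof (rule map_order_eqI)
	show "w ^^ 2 = id" using assms(1) by (auto simp: fun_eq_iff numeral_2_eq_2)
	fix k :: nat assume "0 < k" "k < 2"
	then have "k = 1" by simp
	then show "w ^^ k ~= id" using assms(2) by (auto simp: fun_eq_iff One_nat_def)
qed simp

lemma funpow_fixed: "w y = y ==> (w ^^ k) y = y"
	by (induction k) auto

lemma orthogonal_funpow:
	fixes w :: "'a::real_inner => 'a"
	shows "orthogonal_transformation w ==> (w ^^ k) x \<bullet> (w ^^ k) y = x \<bullet> y"
	by (induction k) (auto simp: orthogonal_transformation_def)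

context
	fixes w :: "'a::euclidean_space => 'a" and k :: nat
	assumes orth: "orthogonal_transformation w" and finite_order: "0 < k" "w ^^ k = id"
begin

lemma orbit_average_fixed: "w (orbit_average w x) = orbit_average w x"
proof -
	note n = map_order_props[OF finite_order]
	have lin: "linear w" using orth by (simp add: orthogonal_transformation_linear)
	have "(\<Sum>t=1..m. g (Suc t)) + g 1 = (\<Sum>t=1..m. g t) + g (Suc m)" for m and g :: "nat => 'a"
		by (induction m) (auto simp: algebra_simps One_nat_def)
	from this[of "%t. (w ^^ t) x" "map_order w"]
	have "(\<Sum>t=1..map_order w. (w ^^ Suc t) x) = (\<Sum>t=1..map_order w. (w ^^ t) x)"
		using n by (simp add: One_nat_def)
	then have "w (\<Sum>t=1..map_order w. (w ^^ t) x) = (\<Sum>t=1..map_order w. (w ^^ t) x)"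
		by (simp add: linear_sum[OF lin])
	then show ?thesis
		unfolding orbit_average_def linear_scale[OF lin] by (simp only:)
qed

lemma orbit_average_inner: assumes "w y = y" shows "orbit_average w x \<bullet> y = x \<bullet> y"
proof -
	note n = map_order_props[OF finite_order]
	have "(w ^^ t) x \<bullet> y = x \<bullet> y" for t
		using orthogonal_funpow[OF orth, of t x y] funpow_fixed[where w = w and y = y and k = t] assms by simp
	then show ?thesis
		unfolding orbit_average_def using n by (simp add: inner_sum_left)
qed

text \<open>The orbit average is the orthogonal projection to the fixed space.\<close>

lemma orbit_average_eqI:
	assumes "w u = u" "!!y. w y = y ==> u \<bullet> y = x \<bullet> y"
	shows "orbit_average w x = u"
proof -
	let ?v = "orbit_average w x - u"
	have "w ?v = ?v"
		using orbit_average_fixed assms(1) linear_diff[OF orthogonal_transformation_linear[OF orth]] by simp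
	then have "?v \<bullet> ?v = 0"
		using orbit_average_inner[of ?v x] assms(2)[of ?v] by (simp add: inner_diff_left)
	then show ?thesis by simp
qed

lemma orbit_average_linear: "linear (orbit_average w)"
proof -
	have lin: "linear w" using orth by (simp add: orthogonal_transformation_linear)
	show ?thesis
	proof (rule linearI)
		fix x y :: 'a and c :: real
		show "orbit_average w (x + y) = orbit_average w x + orbit_average w y"
			by (rule orbit_average_eqI)
				(simp_all add: linear_add[OF lin] orbit_average_fixed inner_add_left orbit_average_inner)
		show "orbit_average w (c *R x) = c *R orbit_average w x"
			by (rule orbit_average_eqI)
				(simp_all add: linear_scale[OF lin] orbit_average_fixed orbit_average_inner)
	qed
qed

text \<open>
	On the fixed space a root and its orbit average define the same functional, so \<open>M\<close>
	is the fixed part of \<open>Z\<close>.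
\<close>

lemma folded_coweight_lattice:
	"coweight_lattice (fixed_space w) (folded_roots \<Phi> w) = {y : coweights \<Phi>. w y = y}"
proof -
	have "(ALL \<gamma>:folded_roots \<Phi> w. \<gamma> \<bullet> y : Ints) <-> (ALL \<beta>:\<Phi>. \<beta> \<bullet> y : Ints)" if y: "w y = y" for y
	proof
		assume a: "ALL \<gamma>:folded_roots \<Phi> w. \<gamma> \<bullet> y : Ints"
		show "ALL \<beta>:\<Phi>. \<beta> \<bullet> y : Ints"
		proof
			fix \<beta> assume b: "\<beta> : \<Phi>"
			have e: "\<beta> \<bullet> y = orbit_average w \<beta> \<bullet> y" using orbit_average_inner[OF y] by simp
			show "\<beta> \<bullet> y : Ints"
			proof (cases "orbit_average w \<beta> = 0")
				case False
				then have "orbit_average w \<beta> : folded_roots \<Phi> w" using b by (auto simp: folded_roots_def)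
				then show ?thesis using a e by metis
			qed (simp add: e)
		qed
	next
		assume "ALL \<beta>:\<Phi>. \<beta> \<bullet> y : Ints"
		then show "ALL \<gamma>:folded_roots \<Phi> w. \<gamma> \<bullet> y : Ints"
			using orbit_average_inner[OF y] by (auto simp: folded_roots_def)
	qed
	then show ?thesis by (auto simp: coweight_lattice_def fixed_space_def)
qed

end

section \<open>Counting fixed points modulo \<open>q\<close>\<close>

lemma rcong_zero_iff:
	assumes "0 < (q :: nat)" shows "[x = 0] (rmod real q) <-> x / real q : Ints"
proof -
	have "[x = 0] (rmod real q) <-> (EX n::int. 0 = x + of_int n * real q)" by (rule rcong_altdef)
	also have "\<dots> <-> (EX n::int. x / real q = of_int n)"
	proof safe
		fix n :: int assume "0 = x + of_int n * real q"
		then have "x / real q = of_int (- n)" using assms by (simp add: field_simps)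
		then show "EX n::int. x / real q = of_int n" by blast
	next
		fix n :: int assume "x / real q = of_int n"
		then have "0 = x + of_int (- n) * real q" using assms by (simp add: field_simps)
		then show "EX n::int. 0 = x + of_int n * real q" by blast
	qed
	also have "\<dots> <-> x / real q : Ints" by (auto elim: Ints_cases)
	finally show ?thesis .
qed

lemma coweight_lattice_closed:
	shows coweight_lattice_0: "0 : coweights \<Phi>"
		and coweight_lattice_add: "x : coweights \<Phi> ==> y : coweights \<Phi> ==> x + y : coweights \<Phi>"
		and coweight_lattice_diff: "x : coweights \<Phi> ==> y : coweights \<Phi> ==> x - y : coweights \<Phi>"
		and coweight_lattice_scale: "x : coweights \<Phi> ==> real m *R x : coweights \<Phi>"
	by (auto simp: coweight_lattice_def inner_add_right inner_diff_right)

lemma lattice_coset_eq_iff: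
	assumes L: "0 : L" "!!x y. x : L ==> y : L ==> x + y : L" "!!x y. x : L ==> y : L ==> x - y : L"
	shows "lattice_coset q L x = lattice_coset q L x' <-> (EX z:L. x - x' = real q *R z)"
proof
	assume "lattice_coset q L x = lattice_coset q L x'"
	moreover have "x : lattice_coset q L x" unfolding lattice_coset_def by (rule image_eqI[of _ _ 0]) (use L in auto)
	ultimately show "EX z:L. x - x' = real q *R z" by (auto simp: lattice_coset_def)
next
	assume "EX z:L. x - x' = real q *R z"
	then obtain z where z: "z : L" "x = x' + real q *R z" by (auto simp: algebra_simps)
	have "x + real q *R y = x' + real q *R (z + y)" "x' + real q *R y = x + real q *R (y - z)" for y
		using z by (auto simp: algebra_simps)
	note sh = this
	show "lattice_coset q L x = lattice_coset q L x'"
		unfolding lattice_coset_def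
	proof (rule set_eqI, rule iffI; elim imageE)
		fix u y assume "u = x + real q *R y" "y : L"
		then show "u : (%z. x' + real q *R z) ` L" using sh(1) L(2) z(1) by (metis image_eqI)
	next
		fix u y assume "u = x' + real q *R y" "y : L"
		then show "u : (%z. x + real q *R z) ` L" using sh(2) L(3) z(1) by (metis image_eqI)
	qed
qed

lemma arrangement_complement_eq:
	assumes "0 < q"
	shows "arrangement_complement \<Psi> L q =
		{lattice_coset q L x |x. x : L & (ALL \<beta>:\<Psi>. \<beta> \<bullet> ((1 / real q) *R x) ~: Ints)}"
	unfolding arrangement_complement_def using rcong_zero_iff[OF assms] by simp

text \<open>
	Write \<open>t = x / q\<close>.  A regular class is fixed by \<open>w\<close> iff \<open>t - w t\<close> lies in the coweight lattice, so
	\<open>t\<close> lies in the fixed group of \<open>w\<close> on the torus \<open>E / Z\<close>.  The hypotheses say that the components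
	of this group that meet the complement of the toric arrangement are the cosets \<open>p k\<close> of its
	identity component, \<open>k\<close> prime to the order of \<open>w\<close>, and that on each of them the arrangement
	becomes the same arrangement \<open>\<Xi>\<close>.  The functional \<open>lam\<close>, a character of the torus that is
	trivial on the identity component, tells the components apart; its value \<open>k / n\<close> on \<open>p k\<close> also
	forces \<open>n\<close> to divide \<open>q\<close>.
\<close>

lemma card_fixed_regular_cosets:
	fixes \<Phi> \<Xi> :: "'a::euclidean_space set" and w :: "'a => 'a" and lam :: 'a and p :: "nat => 'a"
	assumes orth: "orthogonal_transformation w" and img: "w ` \<Phi> = \<Phi>"
		and Z: "Z = coweights \<Phi>" and M: "M = {y : Z. w y = y}"
		and n: "0 < n" and q: "0 < q"
		and p1: "!!k. k : totatives n ==> real n *R p k : Z"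
		and p2: "!!k. k : totatives n ==> p k - w (p k) : Z"
		and lam1: "!!z. z : Z ==> lam \<bullet> z : Ints" and lam2: "!!y. w y = y ==> lam \<bullet> y = 0"
		and lam3: "!!k. k : totatives n ==> lam \<bullet> p k - real k / real n : Ints"
		and cover: "!!t. t - w t : Z ==> (ALL \<beta>:\<Phi>. \<beta> \<bullet> t ~: Ints) ==>
			 EX k:totatives n. EX e z. w e = e & z : Z & t = p k + e + z"
		and reg: "!!k y. k : totatives n ==> w y = y ==>
			 (ALL \<beta>:\<Phi>. \<beta> \<bullet> (p k + y) ~: Ints) <-> (ALL \<beta>:\<Xi>. \<beta> \<bullet> y ~: Ints)"
	shows "int (perm_character \<Phi> q w) = c_factor n q * int (chi_quasi \<Xi> M q)"
proof -
	have lin: "linear w" using orth by (simp add: orthogonal_transformation_linear)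
	have Zc: "0 : Z" "!!x y. x : Z ==> y : Z ==> x + y : Z" "!!x y. x : Z ==> y : Z ==> x - y : Z"
		unfolding Z by (auto intro: coweight_lattice_closed)
	have Zs: "real m *R x : Z" if "x : Z" for m x using that unfolding Z by (rule coweight_lattice_scale)
	have Mc: "0 : M" "!!x y. x : M ==> y : M ==> x + y : M" "!!x y. x : M ==> y : M ==> x - y : M"
		unfolding M using Zc by (auto simp: linear_0[OF lin] linear_add[OF lin] linear_diff[OF lin])
	note Zcoset = lattice_coset_eq_iff[OF Zc] and Mcoset = lattice_coset_eq_iff[OF Mc]
	have winner: "w x \<bullet> w y = x \<bullet> y" for x y using orth by (simp add: orthogonal_transformation_def)
	have wZ: "w ` Z = Z"
	proof -
		obtain v where v: "!!x. w (v x) = x"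
			using orthogonal_transformation_surj[OF orth] by (metis surjD)
		have 1: "w x : Z" if "x : Z" for x
		proof -
			have "\<beta> \<bullet> w x : Ints" if b: "\<beta> : \<Phi>" for \<beta>
			proof -
				obtain \<gamma> where "\<gamma> : \<Phi>" "\<beta> = w \<gamma>" using img b by blast
				then show ?thesis using \<open>x : Z\<close> winner by (simp add: Z coweight_lattice_def)
			qed
			then show ?thesis by (simp add: Z coweight_lattice_def)
		qed
		have 2: "v x : Z" if "x : Z" for x
		proof -
			have "\<beta> \<bullet> v x = w \<beta> \<bullet> x" for \<beta> using winner[of \<beta> "v x"] v by simp
			then show ?thesis using that img by (auto simp: Z coweight_lattice_def)
		qed
		show ?thesis using 1 2 v by (metis image_eqI image_subsetI subsetI subset_antisym)
	qed
	have wcoset: "w ` lattice_coset q Z x = lattice_coset q Z (w x)" for x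
	proof -
		have "w ` lattice_coset q Z x = (%z. w x + real q *R z) ` (w ` Z)"
			unfolding lattice_coset_def image_image by (simp add: linear_add[OF lin] linear_scale[OF lin])
		then show ?thesis by (simp add: wZ lattice_coset_def)
	qed
	define R where "R x <-> x : Z & (ALL \<beta>:\<Phi>. \<beta> \<bullet> ((1 / real q) *R x) ~: Ints) & (EX z:Z. x - w x = real q *R z)" for x
	define F where "F = {t : arrangement_complement \<Phi> Z q. w ` t = t}"
	have pF: "perm_character \<Phi> q w = card F" by (simp add: perm_character_def F_def Z)
	have F: "F = lattice_coset q Z ` {x. R x}"
	proof -
		have "w ` lattice_coset q Z x = lattice_coset q Z x <-> (EX z:Z. x - w x = real q *R z)" for x
			unfolding wcoset using Zcoset[of q x "w x"] by (metis)
		then show ?thesis unfolding F_def arrangement_complement_eq[OF q] R_def by auto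
	qed
	have pZ: "real q *R p k : Z" if k: "k : totatives n" and dvd: "n dvd q" for k
	proof -
		obtain r where r: "q = n * r" using dvd by blast
		have "real q *R p k = real r *R (real n *R p k)" by (simp add: r mult.commute)
		also have "\<dots> : Z" by (rule Zs[OF p1[OF k]])
		finally show ?thesis .
	qed
	have decomp: "n dvd q & (EX k:totatives n. EX y z. y : M & z : Z & x = real q *R p k + y + real q *R z &
			(ALL \<beta>:\<Xi>. \<beta> \<bullet> ((1 / real q) *R y) ~: Ints))" if x: "R x" for x
	proof -
		let ?t = "(1 / real q) *R x"
		obtain z0 where z0: "z0 : Z" "x - w x = real q *R z0" using x by (auto simp: R_def)
		have "?t - w ?t = (1 / real q) *R (x - w x)" by (simp add: linear_scale[OF lin] algebra_simps)
		also have "\<dots> = z0" using z0 q by simp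
		finally have "?t - w ?t : Z" using z0 by simp
		then obtain k e z where k: "k : totatives n" "w e = e" "z : Z" "?t = p k + e + z"
			using cover[of ?t] x by (auto simp: R_def)
		have xq: "x = real q *R p k + real q *R e + real q *R z"
			using arg_cong[OF k(4), of "%u. real q *R u"] q by (simp add: algebra_simps)
		have "lam \<bullet> x = real q * (lam \<bullet> p k) + real q * (lam \<bullet> z)"
			unfolding xq using lam2[OF k(2)] by (simp add: inner_add_right)
		moreover have "lam \<bullet> x : Ints" "lam \<bullet> z : Ints" using x k lam1 by (auto simp: R_def)
		ultimately have "real q * (lam \<bullet> p k) : Ints"
			by (metis Ints_diff Ints_mult Ints_of_nat add_diff_cancel_right')
		moreover have "real q * (lam \<bullet> p k - real k / real n) : Ints" using lam3[OF k(1)] by simp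
		ultimately have "real q * (lam \<bullet> p k) - real q * (lam \<bullet> p k - real k / real n) : Ints" by (rule Ints_diff)
		then have "real q * (real k / real n) : Ints" by (simp add: algebra_simps)
		then obtain m :: int where "real q * (real k / real n) = of_int m" by (auto elim: Ints_cases)
		then have "real q * real k = of_int m * real n" using n by (simp add: field_simps)
		then have "of_int (int q * int k) = (of_int (m * int n) :: real)" by simp
		then have "int q * int k = m * int n" by (simp only: of_int_eq_iff)
		then have "int n dvd int (q * k)" by simp
		then have "n dvd q * k" by (simp only: int_dvd_int_iff)
		moreover have "coprime n k" using k(1) by (simp add: totatives_def coprime_commute)
		ultimately have nq: "n dvd q" by (simp add: coprime_dvd_mult_left_iff)
		have pk: "real q *R p k : Z" by (rule pZ[OF k(1) nq])
		have "real q *R e = x - real q *R p k - real q *R z" using xq by simp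
		also have "\<dots> : Z" using x by (intro Zc(3) pk Zs k(3)) (simp add: R_def)
		finally have y: "real q *R e : M" using k(2) by (simp add: M linear_scale[OF lin])
		have "\<beta> \<bullet> (p k + e) ~: Ints" if "\<beta> : \<Phi>" for \<beta>
		proof
			assume "\<beta> \<bullet> (p k + e) : Ints"
			moreover have "\<beta> \<bullet> z : Ints" using k that by (simp add: Z coweight_lattice_def)
			ultimately have "\<beta> \<bullet> ?t : Ints" using k(4) by (metis Ints_add inner_add_right)
			then show False using x that by (auto simp: R_def)
		qed
		then have "ALL \<beta>:\<Xi>. \<beta> \<bullet> e ~: Ints" using reg[OF k(1,2)] by blast
		then have "ALL \<beta>:\<Xi>. \<beta> \<bullet> ((1 / real q) *R (real q *R e)) ~: Ints" using q by simp
		then show ?thesis using k(1,3) y xq nq by blast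
	qed
	show ?thesis
	proof (cases "n dvd q")
		case False
		then have "F = {}" unfolding F using decomp by auto
		then show ?thesis using False by (simp add: pF c_factor_def)
	next
		case True
		define G where "G = (%(k, C). {real q *R p k + c + real q *R z |c z. c : C & z : Z})"
		have G: "G (k, lattice_coset q M y) = lattice_coset q Z (real q *R p k + y)" if "y : M" for k y
		proof safe
			fix x assume "x : G (k, lattice_coset q M y)"
			then obtain u z where "u : M" "z : Z" "x = real q *R p k + (y + real q *R u) + real q *R z"
				by (auto simp: G_def lattice_coset_def)
			then have "x = (real q *R p k + y) + real q *R (u + z)" "u + z : Z"
				using Zc by (auto simp: algebra_simps M)
			then show "x : lattice_coset q Z (real q *R p k + y)" unfolding lattice_coset_def by blast
		next
			fix x assume "x : lattice_coset q Z (real q *R p k + y)"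
			then obtain z where "z : Z" "x = real q *R p k + (y + real q *R 0) + real q *R z"
				by (auto simp: lattice_coset_def)
			moreover have "y + real q *R 0 : lattice_coset q M y" unfolding lattice_coset_def using Mc(1) by blast
			ultimately show "x : G (k, lattice_coset q M y)" unfolding G_def by blast
		qed
		have "bij_betw G (totatives n \<times> arrangement_complement \<Xi> M q) F"
			unfolding bij_betw_def
		proof
			show "inj_on G (totatives n \<times> arrangement_complement \<Xi> M q)"
			proof (rule inj_onI, clarify)
				fix k k' C C' assume k: "k : totatives n" "k' : totatives n"
					and C: "C : arrangement_complement \<Xi> M q" "C' : arrangement_complement \<Xi> M q"
					and eq: "G (k, C) = G (k', C')"
				obtain y where y: "y : M" "C = lattice_coset q M y" using C by (auto simp: arrangement_complement_def)
				obtain y' where y': "y' : M" "C' = lattice_coset q M y'" using C by (auto simp: arrangement_complement_def)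
				obtain z where z: "z : Z" "(real q *R p k + y) - (real q *R p k' + y') = real q *R z"
					using eq G y y' Zcoset by auto
				have "lam \<bullet> y = 0" "lam \<bullet> y' = 0" using y y' lam2 by (auto simp: M)
				then have "real q * (lam \<bullet> p k - lam \<bullet> p k') = real q * (lam \<bullet> z)"
					using arg_cong[OF z(2), of "%u. lam \<bullet> u"] by (simp add: inner_add_right inner_diff_right algebra_simps)
				then have "lam \<bullet> p k - lam \<bullet> p k' = lam \<bullet> z" using q by simp
				then have "lam \<bullet> p k - lam \<bullet> p k' : Ints" using lam1 z by simp
				moreover have "(lam \<bullet> p k - real k / real n) - (lam \<bullet> p k' - real k' / real n) : Ints"
					by (rule Ints_diff[OF lam3[OF k(1)] lam3[OF k(2)]])
				ultimately have "(lam \<bullet> p k - lam \<bullet> p k') - ((lam \<bullet> p k - real k / real n) - (lam \<bullet> p k' - real k' / real n)) : Ints"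
					by (rule Ints_diff)
				then have "real k / real n - real k' / real n : Ints" by simp
				then obtain m :: int where "real k / real n - real k' / real n = of_int m" by (auto elim: Ints_cases)
				then have "real k - real k' = of_int m * real n" using n by (simp add: field_simps)
				then have "of_int (int k - int k') = (of_int (m * int n) :: real)" by simp
				then have m: "int k - int k' = m * int n" by (simp only: of_int_eq_iff)
				have "0 < k" "k <= n" "0 < k'" "k' <= n" using k by (auto simp: totatives_def)
				then have "\<bar>int k - int k'\<bar> < int n" by auto
				then have "\<bar>m\<bar> * int n < 1 * int n" unfolding m abs_mult by simp
				then have "m = 0" unfolding mult_less_cancel_right using n by auto
				then have kk: "k = k'" using m by simp
				have yz: "y - y' = real q *R z" using z kk by simp
				then have "z = (1 / real q) *R (y - y')" using q by simp
				then have "w z = z" using y y' by (simp add: M linear_scale[OF lin] linear_diff[OF lin])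
				then have "C = C'" using y y' z yz Mcoset by (auto simp: M)
				then show "k = k' & C = C'" using kk by simp
			qed
		next
			show "G ` (totatives n \<times> arrangement_complement \<Xi> M q) = F"
			proof safe
				fix k C assume k: "k : totatives n" and "C : arrangement_complement \<Xi> M q"
				then obtain y where y: "y : M" "C = lattice_coset q M y" "ALL \<beta>:\<Xi>. \<beta> \<bullet> ((1 / real q) *R y) ~: Ints"
					unfolding arrangement_complement_eq[OF q] by auto
				let ?x = "real q *R p k + y"
				have pk: "real q *R p k : Z" by (rule pZ[OF k True])
				have wy: "w y = y" "y : Z" using y by (auto simp: M)
				have "w ((1 / real q) *R y) = (1 / real q) *R y" using wy by (simp add: linear_scale[OF lin])
				then have "ALL \<beta>:\<Phi>. \<beta> \<bullet> (p k + (1 / real q) *R y) ~: Ints" using reg[OF k] y by blast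
				moreover have "p k + (1 / real q) *R y = (1 / real q) *R ?x" using q by (simp add: algebra_simps)
				moreover have "?x - w ?x = real q *R (p k - w (p k))"
					using wy by (simp add: linear_add[OF lin] linear_scale[OF lin] algebra_simps)
				ultimately have "R ?x" unfolding R_def using pk wy Zc p2[OF k] by auto
				then show "G (k, C) : F" unfolding F y(2) G[OF y(1)] by blast
			next
				fix t assume "t : F"
				then obtain x where x: "R x" "t = lattice_coset q Z x" unfolding F by blast
				obtain k y z where k: "k : totatives n" "y : M" "z : Z" "x = real q *R p k + y + real q *R z"
					"ALL \<beta>:\<Xi>. \<beta> \<bullet> ((1 / real q) *R y) ~: Ints" using decomp[OF x(1)] by blast
				have "EX z:Z. x - (real q *R p k + y) = real q *R z" using k(3,4) by auto
				then have "t = lattice_coset q Z (real q *R p k + y)"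
					using Zcoset[of q x "real q *R p k + y"] x(2) by simp
				then have "t = G (k, lattice_coset q M y)" using G k by simp
				moreover have "lattice_coset q M y : arrangement_complement \<Xi> M q"
					unfolding arrangement_complement_eq[OF q] using k by blast
				ultimately show "t : G ` (totatives n \<times> arrangement_complement \<Xi> M q)" using k by blast
			qed
		qed
		then have "card F = totient n * card (arrangement_complement \<Xi> M q)"
			unfolding totient_def card_cartesian_product[symmetric] by (rule bij_betw_same_card[symmetric])
		then show ?thesis using True
			by (simp add: pF c_factor_def chi_quasi_def)
	qed
qed

lemma weyl_group_image:
	assumes "root_system_in V \<Phi>" "w : weyl_group \<Phi>"
	shows "w ` \<Phi> = \<Phi>"
proof (rule endo_inj_surj)
	show "finite \<Phi>" using assms by (simp add: root_system_in_def)
	show "w ` \<Phi> \<subseteq> \<Phi>" using reflection_group_roots[OF assms(1) order_refl assms(2)] by blast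
	show "inj_on w \<Phi>"
		using orthogonal_transformation_inj[OF reflection_group_orthogonal[OF assms(2)]] inj_on_subset by blast
qed

section \<open>The statement for one type\<close>

definition folding_statement ::
	"'a::euclidean_space set => root_type => nat => ('a => 'a) => bool" where
	"folding_statement \<Phi> T j w <-> (EX Tr \<Phi>' T' d.
		 folding_table \<Phi> (folded_roots \<Phi> w) (map_order w) T j Tr \<Phi>' T' d &
		 root_system_of_type (fixed_space w) (folded_roots \<Phi> w) Tr &
		 root_system_of_type (fixed_space w) \<Phi>' T' &
		 (ALL q>0. int (perm_character \<Phi> q w) = c_factor (map_order w) q *
				int (chi_quasi (scaled (real d) \<Phi>') (coweight_lattice (fixed_space w) (folded_roots \<Phi> w)) q)))"

text \<open>
	The scheme of proof for all types: find representatives \<open>p k\<close> of the translates, a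
	character \<open>lam\<close> that separates them, show that every regular fixed point lies on
	one of them, and compare the arrangements.
\<close>

lemma folding_statementI:
	fixes \<Phi> :: "'a::euclidean_space set" and w :: "'a => 'a" and p :: "nat => 'a"
	assumes rs: "root_system_in UNIV \<Phi>" and w: "w : weyl_group \<Phi>"
		and fo: "0 < k" "w ^^ k = id" and n: "map_order w = n"
		and table: "folding_table \<Phi> (folded_roots \<Phi> w) n T j Tr \<Phi>' T' d"
		and types: "root_system_of_type (fixed_space w) (folded_roots \<Phi> w) Tr"
			 "root_system_of_type (fixed_space w) \<Phi>' T'"
		and Z: "Z = coweights \<Phi>"
		and p: "!!k. k : totatives n ==> real n *R p k : Z" "!!k. k : totatives n ==> p k - w (p k) : Z"
		and lam: "!!z. z : Z ==> lam \<bullet> z : Ints" "!!y. w y = y ==> lam \<bullet> y = 0"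
			 "!!k. k : totatives n ==> lam \<bullet> p k - real k / real n : Ints"
		and cover: "!!t. t - w t : Z ==> (ALL \<beta>:\<Phi>. \<beta> \<bullet> t ~: Ints) ==>
			 EX k:totatives n. EX e z. w e = e & z : Z & t = p k + e + z"
		and reg: "!!k y. k : totatives n ==> w y = y ==>
			 (ALL \<beta>:\<Phi>. \<beta> \<bullet> (p k + y) ~: Ints) <-> (ALL \<beta>:\<Phi>'. real d * (\<beta> \<bullet> y) ~: Ints)"
	shows "folding_statement \<Phi> T j w"
proof -
	have orth: "orthogonal_transformation w" using w by (rule reflection_group_orthogonal)
	have M: "coweight_lattice (fixed_space w) (folded_roots \<Phi> w) = {y : Z. w y = y}"
		unfolding Z by (rule folded_coweight_lattice[OF orth fo])
	have n0: "0 < n" using map_order_props(1)[OF fo] n by simp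
	have reg': "(ALL \<beta>:\<Phi>. \<beta> \<bullet> (p k + y) ~: Ints) <-> (ALL \<beta>:scaled (real d) \<Phi>'. \<beta> \<bullet> y ~: Ints)"
		if "k : totatives n" "w y = y" for k y
		using reg[OF that] by (simp add: scaled_def)
	have "int (perm_character \<Phi> q w) = c_factor n q * int (chi_quasi (scaled (real d) \<Phi>') {y : Z. w y = y} q)"
		if "0 < q" for q
		by (rule card_fixed_regular_cosets[OF orth weyl_group_image[OF rs w] Z refl n0 that p lam cover reg'])
	then show ?thesis
		unfolding folding_statement_def M n using table types by blast
qed

section \<open>Classical types in coordinates\<close>

lemma inner_ext:
	assumes "span B = (UNIV :: 'a::real_inner set)" "!!b. b : B ==> b \<bullet> x = b \<bullet> y"
	shows "x = y"
proof -
	have "z \<bullet> (x - y) = 0" if "z : span B" for z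
		using that
	proof (induction rule: span_induct_alt)
		case (step c b z)
		then show ?case using assms(2)[of b] by (simp add: inner_add_left inner_diff_right)
	qed simp
	then have "(x - y) \<bullet> (x - y) = 0" using assms(1) by blast
	then show ?thesis by simp
qed

lemma exists_prescribed_coordinates:
	fixes \<a> :: "nat => 'a::euclidean_space"
	assumes "inj_on \<a> I" "independent (\<a> ` I)"
	shows "EX t. ALL i:I. \<a> i \<bullet> t = a i"
proof -
	obtain t where "ALL s:\<a> ` I. s \<bullet> t = a (inv_into I \<a> s)"
		using exists_prescribed_inner[OF assms(2), of "%s. a (inv_into I \<a> s)"] by blast
	then show ?thesis using assms(1) by (intro exI[of _ t]) auto
qed

lemma displacement_inner:
	"orthogonal_transformation w ==> w x \<bullet> (t - w t) = w x \<bullet> t - x \<bullet> t"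
	by (simp add: inner_diff_right orthogonal_transformation_def)

text \<open>
	By orthogonality, \<open>t = w t\<close> can be tested with the vectors \<open>w b\<close>,
	which avoids the inverse of \<open>w\<close>.
\<close>

lemma fixed_iff_inner:
	fixes w :: "'a::euclidean_space => 'a"
	assumes w: "orthogonal_transformation w" and B: "span B = UNIV"
	shows "w t = t <-> (ALL b:B. w b \<bullet> t = b \<bullet> t)"
proof
	assume "w t = t"
	then show "ALL b:B. w b \<bullet> t = b \<bullet> t" using displacement_inner[OF w, of _ t] by fastforce
next
	assume a: "ALL b:B. w b \<bullet> t = b \<bullet> t"
	have "span (w ` B) = UNIV"
		using B orthogonal_transformation_surj[OF w]
		by (simp add: linear_span_image[OF orthogonal_transformation_linear[OF w]])
	then have "t - w t = 0"
		by (rule inner_ext) (use a displacement_inner[OF w, of _ t] in auto)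
	then show "w t = t" by simp
qed

lemma half_integer_iff: "2 * (x::real) : Ints <-> x : Ints | x + 1 / 2 : Ints"
proof
	assume "2 * x : Ints"
	then obtain a where a: "2 * x = of_int a" by (auto elim: Ints_cases)
	show "x : Ints | x + 1 / 2 : Ints"
	proof (cases "even a")
		case True
		then obtain b where "a = 2 * b" by blast
		then have "x = of_int b" using a by simp
		then show ?thesis by simp
	next
		case False
		then obtain b where "a = 2 * b + 1" by (elim oddE)
		then have "x + 1 / 2 = of_int (b + 1)" using a by simp
		then show ?thesis by (metis Ints_of_int)
	qed
next
	assume "x : Ints | x + 1 / 2 : Ints"
	then show "2 * x : Ints"
	proof
		assume "x + 1 / 2 : Ints"
		then have "2 * (x + 1 / 2) - 1 : Ints" by (intro Ints_diff Ints_mult) auto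
		then show ?thesis by simp
	qed simp
qed

lemma Ints_minus_iff: "- x : Ints <-> (x::'a::ring_1) : Ints"
	by (metis Ints_minus minus_minus)

lemma Ints_add_int_iff: "y : Ints ==> x + y : Ints <-> (x::'a::ring_1) : Ints"
	by (metis Ints_add Ints_diff add_diff_cancel_right')

lemma half_not_integer: "(1 / 2 :: real) ~: Ints"
proof
	assume "(1 / 2 :: real) : Ints"
	then obtain a :: int where "(1 / 2 :: real) = of_int a" by (auto elim: Ints_cases)
	then have "(of_int (2 * a) :: real) = of_int 1" by simp
	then have "2 * a = 1" by (simp only: of_int_eq_iff)
	then show False by presburger
qed

lemma totatives_2: "totatives 2 = {1}"
	by (auto simp: totatives_def coprime_iff_gcd_eq_1 One_nat_def numeral_2_eq_2 le_Suc_eq)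

lemma shifted_ball: "(ALL i:{1..m}. P (Suc i)) <-> (ALL i:{2..Suc m}. P i)"
proof -
	have e: "{2..Suc m} = Suc ` {1..m}" by (simp add: image_Suc_atLeastAtMost One_nat_def numeral_2_eq_2)
	show ?thesis unfolding e by blast
qed

context orthogonal_family
begin

lemma signed_roots_ball:
	assumes P: "!!x. P (- x) = P x" and A: "A \<subseteq> {1,2}"
	shows "(ALL \<beta>:signed_roots m f A. P (\<beta> \<bullet> t)) <->
		(ALL i:{1..m}. ALL k:{1..m}. i ~= k --> P (f i \<bullet> t + f k \<bullet> t) & P (f i \<bullet> t - f k \<bullet> t)) &
		(ALL i:{1..m}. ALL c:A. P (c * (f i \<bullet> t)))" (is "?L <-> ?R")
proof
	assume L: ?L
	have "P (f i \<bullet> t + f k \<bullet> t)" "P (f i \<bullet> t - f k \<bullet> t)" if "i : {1..m}" "k : {1..m}" "i ~= k" for i k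
		using L signed_rootsI(1)[OF that, of 1 1 f A] signed_rootsI(1)[OF that, of 1 "-1" f A]
		by (force simp: inner_add_left inner_diff_left)+
	moreover have "P (c * (f i \<bullet> t))" if "i : {1..m}" "c : A" for i c
	proof -
		have "\<bar>c\<bar> : A" using that A by auto
		then have "c *R f i : signed_roots m f A" using that by (intro signed_rootsI(2))
		then show ?thesis using L by force
	qed
	ultimately show ?R by blast
next
	assume R: ?R
	show ?L
	proof
		fix \<beta> assume "\<beta> : signed_roots m f A"
		then show "P (\<beta> \<bullet> t)"
		proof (cases rule: signed_rootsE)
			case (pair i k a b)
			have 1: "P (f i \<bullet> t + f k \<bullet> t)" "P (f i \<bullet> t - f k \<bullet> t)" using R pair by blast+
			have 2: "P (- (f i \<bullet> t) - f k \<bullet> t)" "P (f k \<bullet> t - f i \<bullet> t)"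
				using 1 P[of "f i \<bullet> t + f k \<bullet> t"] P[of "f i \<bullet> t - f k \<bullet> t"] by (simp_all add: algebra_simps)
			show ?thesis
				using pair(4,5) 1 2 unfolding pair(6)
				by (auto elim!: abs_one_cases simp: inner_add_left inner_diff_left)
		next
			case (single i c)
			have "P (\<bar>c\<bar> * (f i \<bullet> t))" using R single by blast
			then show ?thesis using P[of "c * (f i \<bullet> t)"] unfolding single(3) by (cases "c >= 0") auto
		qed
	qed
qed

text \<open>
	Folding a classical root system along signed identifications (and deletions) of coordinates
	gives a classical root system on the remaining coordinates: short roots appear when a coordinate
	is deleted, doubled ones when two coordinates are identified.
\<close>

lemma folded_signed_roots:
	fixes w :: "'a => 'a" and F :: "nat => 'a"
	assumes w: "orthogonal_transformation w" "0 < (r::nat)" "w ^^ r = id" and full: "span (f ` {1..m}) = UNIV"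
		and F: "orthogonal_family h F N'" and A: "A \<subseteq> {1,2}" and B: "B \<subseteq> {1,2}" and AB: "A \<subseteq> B"
		and avg: "!!i. i : {1..m} ==> orbit_average w (f i) = 0 |
			 (EX p:{1..h}. EX a. \<bar>a\<bar> = 1 & orbit_average w (f i) = a *R F p)"
		and lift: "!!p. p : {1..h} ==> EX i:{1..m}. orbit_average w (f i) = F p"
		and one1: "!!i. i : {1..m} ==> orbit_average w (f i) = 0 ==> 1 : B"
		and one2: "1 : B ==> 1 : A | (EX i:{1..m}. orbit_average w (f i) = 0)"
		and two1: "!!i k p a b. i : {1..m} ==> k : {1..m} ==> i ~= k ==> p : {1..h} ==>
			 orbit_average w (f i) = a *R F p ==> orbit_average w (f k) = b *R F p ==> \<bar>a\<bar> = 1 ==> \<bar>b\<bar> = 1 ==> 2 : B"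
		and two2: "!!p. 2 : B ==> p : {1..h} ==> 2 : A |
			 (EX i:{1..m}. EX k:{1..m}. i ~= k & orbit_average w (f i) = F p & orbit_average w (f k) = - F p)"
	shows "folded_roots (signed_roots m f A) w = signed_roots h F B & fixed_space w = span (F ` {1..h})"
proof -
	interpret F: orthogonal_family h F N' by (rule F)
	let ?a = "orbit_average w"
	note lin = orbit_average_linear[OF w]
	have F0: "F p ~= 0" if "p : {1..h}" for p using F.inner_family[OF that that] F.N_pos by auto
	have B0: "0 ~: B" using B by auto
	have "folded_roots (signed_roots m f A) w = signed_roots h F B"
	proof (rule set_eqI, rule iffI)
		fix \<gamma> assume "\<gamma> : folded_roots (signed_roots m f A) w"
		then obtain \<beta> where b: "\<beta> : signed_roots m f A" "\<gamma> = ?a \<beta>" "\<gamma> ~= 0" by (auto simp: folded_roots_def)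
		from b(1) show "\<gamma> : signed_roots h F B"
		proof (cases rule: signed_rootsE)
			case (pair i k a b)
			have g: "\<gamma> = a *R ?a (f i) + b *R ?a (f k)"
				unfolding \<open>\<gamma> = ?a \<beta>\<close> pair(6) by (simp add: linear_add[OF lin] linear_scale[OF lin])
			have sgl: "c *R ?a (f t) : signed_roots h F B"
				if "t : {1..m}" "\<bar>c\<bar> = 1" "?a (f t) ~= 0" "1 : B" for c t
			proof -
				obtain p a' where "p : {1..h}" "\<bar>a'\<bar> = 1" "?a (f t) = a' *R F p" using avg[OF \<open>t : {1..m}\<close>] \<open>?a (f t) ~= 0\<close> by blast
				then show ?thesis using signed_rootsI(2)[of p h "c * a'" B F] \<open>\<bar>c\<bar> = 1\<close> \<open>1 : B\<close> by (simp add: abs_mult)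
			qed
			consider "?a (f i) = 0" | "?a (f k) = 0" | "?a (f i) ~= 0" "?a (f k) ~= 0" by blast
			then show ?thesis
			proof cases
				case 1
				then show ?thesis using sgl[of k b] one1[OF pair(1)] g \<open>\<gamma> ~= 0\<close> pair by auto
			next
				case 2
				then show ?thesis using sgl[of i a] one1[OF pair(2)] g \<open>\<gamma> ~= 0\<close> pair by auto
			next
				case 3
				obtain p a' where p: "p : {1..h}" "\<bar>a'\<bar> = 1" "?a (f i) = a' *R F p" using avg[OF pair(1)] 3 by blast
				obtain s b' where s: "s : {1..h}" "\<bar>b'\<bar> = 1" "?a (f k) = b' *R F s" using avg[OF pair(2)] 3 by blast
				show ?thesis
				proof (cases "p = s")
					case False
					then show ?thesis
						using signed_rootsI(1)[of p h s "a * a'" "b * b'" F B] p s pair g by (simp add: abs_mult)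
				next
					case True
					have two: "2 : B" using two1[OF pair(1-3) p(1) p(3) _ p(2) s(2)] s(3) True by simp
					have e: "\<gamma> = (a * a' + b * b') *R F p" using g p s True by (simp add: scaleR_add_left)
					have nz: "a * a' + b * b' ~= 0" using e \<open>\<gamma> ~= 0\<close> by auto
					have "\<bar>a * a' + b * b'\<bar> = 2"
						using pair(4,5) p(2) s(2) nz by (auto elim!: abs_one_cases)
					then show ?thesis using e two p by (simp add: signed_rootsI(2))
				qed
			qed
		next
			case (single i c)
			have g: "\<gamma> = c *R ?a (f i)" unfolding \<open>\<gamma> = ?a \<beta>\<close> single(3) by (simp add: linear_scale[OF lin])
			then have "?a (f i) ~= 0" using \<open>\<gamma> ~= 0\<close> by auto
			then obtain p a' where p: "p : {1..h}" "\<bar>a'\<bar> = 1" "?a (f i) = a' *R F p" using avg[OF single(1)] by blast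
			have "\<bar>c * a'\<bar> : B" using p single AB by (auto simp: abs_mult)
			then show ?thesis using signed_rootsI(2)[OF p(1)] g p by simp
		qed
	next
		fix \<gamma> assume g: "\<gamma> : signed_roots h F B"
		have nz: "\<gamma> ~= 0" using g F.signed_roots_nonzero[OF B0] by auto
		have "EX \<beta>:signed_roots m f A. ?a \<beta> = \<gamma>"
			using g
		proof (cases rule: signed_rootsE)
			case (pair p s a b)
			obtain i where i: "i : {1..m}" "?a (f i) = F p" using lift pair by blast
			obtain k where k: "k : {1..m}" "?a (f k) = F s" using lift pair by blast
			have "F p ~= F s" using F.family_inj pair by (metis inj_onD)
			then have "i ~= k" using i k by auto
			then have "a *R f i + b *R f k : signed_roots m f A" using i k pair by (intro signed_rootsI(1))
			moreover have "?a (a *R f i + b *R f k) = \<gamma>"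
				using i k pair by (simp add: linear_add[OF lin] linear_scale[OF lin])
			ultimately show ?thesis by blast
		next
			case (single p c)
			obtain i where i: "i : {1..m}" "?a (f i) = F p" using lift single by blast
			show ?thesis
			proof (cases "\<bar>c\<bar> : A")
				case True
				then show ?thesis using i single
					by (intro bexI[of _ "c *R f i"] signed_rootsI(2)) (auto simp: linear_scale[OF lin])
			next
				case False
				have "\<bar>c\<bar> = 1 | \<bar>c\<bar> = 2" using single B by blast
				then show ?thesis
				proof
					assume c: "\<bar>c\<bar> = 1"
					then obtain k where k: "k : {1..m}" "?a (f k) = 0" using one2 False single by auto
					then have "i ~= k" using i F0 single by auto
					then have "c *R f i + 1 *R f k : signed_roots m f A" using i k c by (intro signed_rootsI(1)) auto
					moreover have "?a (c *R f i + 1 *R f k) = \<gamma>"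
						using i k single by (simp add: linear_add[OF lin] linear_scale[OF lin])
					ultimately show ?thesis by blast
				next
					assume c: "\<bar>c\<bar> = 2"
					then obtain i k where k: "i : {1..m}" "k : {1..m}" "i ~= k" "?a (f i) = F p" "?a (f k) = - F p"
						using two2[of p] False single by auto
					then have "(c / 2) *R f i + (- c / 2) *R f k : signed_roots m f A" using c by (intro signed_rootsI(1)) auto
					moreover have "?a ((c / 2) *R f i + (- c / 2) *R f k) = \<gamma>"
						using k single by (simp add: linear_add[OF lin] linear_scale[OF lin] linear_diff[OF lin] flip: scaleR_add_left)
					ultimately show ?thesis by blast
				qed
			qed
		qed
		then show "\<gamma> : folded_roots (signed_roots m f A) w" using nz by (auto simp: folded_roots_def)
	qed
	moreover have "fixed_space w = span (F ` {1..h})"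
	proof
		have "F p : fixed_space w" if "p : {1..h}" for p
			using lift[OF that] orbit_average_fixed[OF w] by (metis (mono_tags, lifting) fixed_space_def mem_Collect_eq)
		moreover have "subspace (fixed_space w)"
			using orthogonal_transformation_linear[OF w(1)]
			by (auto simp: subspace_def fixed_space_def linear_add linear_scale linear_0)
		ultimately show "span (F ` {1..h}) \<subseteq> fixed_space w" by (intro span_minimal) auto
		show "fixed_space w \<subseteq> span (F ` {1..h})"
		proof
			fix x assume "x : fixed_space w"
			then have "?a x = x" by (intro orbit_average_eqI[OF w]) (auto simp: fixed_space_def)
			moreover have "?a x : span (F ` {1..h})" if "x : span (f ` {1..m})" for x
				using that
			proof (induction rule: span_induct_alt)
				case base
				then show ?case by (simp add: linear_0[OF lin] span_zero)
			next
				case (step c u y)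
				then obtain i where i: "i : {1..m}" "u = f i" by blast
				have "?a u : span (F ` {1..h})"
				proof (cases "?a u = 0")
					case False
					then obtain p a where "p : {1..h}" "?a u = a *R F p" using avg[OF i(1)] i(2) by blast
					then show ?thesis by (simp add: span_scale span_base)
				qed (simp add: span_zero)
				then show ?case using step by (simp add: linear_add[OF lin] linear_scale[OF lin] span_add span_scale)
			qed
			ultimately show "x : span (F ` {1..h})" using full by (metis UNIV_I)
		qed
	qed
	ultimately show ?thesis by blast
qed

end

locale signed_system = orthogonal_family m f N
	for m :: nat and f :: "nat => 'a::euclidean_space" and N :: real +
	fixes \<Phi> :: "'a set" and A :: "real set" and \<a> :: "nat => 'a"
	assumes root_system: "root_system_in UNIV \<Phi>" and reduced: "reduced_roots \<Phi>"
		and roots_eq: "\<Phi> = signed_roots m f A" and A: "A \<subseteq> {1,2}" "A ~= {} | 2 <= m"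
		and simple: "simple_roots m \<Phi> \<a>"
		and diff: "!!i. i : {1..<m} ==> \<a> i = f i - f (Suc i)"
begin

lemma full: "span (f ` {1..m}) = UNIV"
	using root_system signed_roots_span[OF A(2,1)] unfolding roots_eq root_system_in_def by simp

lemma exists_coordinates: "EX t. ALL i:{1..m}. f i \<bullet> t = a i"
	by (rule exists_prescribed_coordinates[OF family_inj family_independent])

lemma lattice_iff: "t : coweights \<Phi> <->
		(ALL i:{1..m}. ALL k:{1..m}. i ~= k --> f i \<bullet> t + f k \<bullet> t : Ints & f i \<bullet> t - f k \<bullet> t : Ints) &
		(ALL i:{1..m}. ALL c:A. c * (f i \<bullet> t) : Ints)"
	unfolding coweight_lattice_def roots_eq
	using signed_roots_ball[where P = "%x. x : Ints" and A = A and t = t] A(1) Ints_minus_iff by auto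

lemma regular_iff: "(ALL \<beta>:\<Phi>. \<beta> \<bullet> t ~: Ints) <->
		(ALL i:{1..m}. ALL k:{1..m}. i ~= k --> f i \<bullet> t + f k \<bullet> t ~: Ints & f i \<bullet> t - f k \<bullet> t ~: Ints) &
		(ALL i:{1..m}. ALL c:A. c * (f i \<bullet> t) ~: Ints)"
	unfolding roots_eq
	by (rule signed_roots_ball[where P = "%x. x ~: Ints"]) (use A(1) Ints_minus_iff in auto)

lemma fixed_iff: "orthogonal_transformation w ==> w t = t <-> (ALL i:{1..m}. w (f i) \<bullet> t = f i \<bullet> t)"
	using fixed_iff_inner[OF _ full, of w t] by simp

lemma reflection_in_weyl: "\<beta> : signed_roots m f A ==> root_reflection \<beta> : weyl_group \<Phi>"
	by (rule reflection_in_group) (simp add: roots_eq)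

lemma linear_ext: "linear u ==> linear v ==> (!!i. i : {1..m} ==> u (f i) = v (f i)) ==> u = v"
	using linear_eq_on_span[of u v "f ` {1..m}"] full by (intro ext) blast

lemma in_weyl_linear: "w : weyl_group \<Phi> ==> linear w"
	by (simp add: reflection_group_orthogonal orthogonal_transformation_linear)

end

lemma path_matrix_eq: "path_matrix i k = (if i = k then 2 else if k = Suc i | i = Suc k then -1 else 0)"
	by (auto simp: path_matrix_def simply_laced_matrix_def)

text \<open>
	In types B, C, D the first simple roots form a path of equal lengths; given a suitable last vector
	\<open>v\<close> they are the consecutive differences of an orthogonal family ending in \<open>v\<close>.
\<close>

lemma path_gram:
	fixes \<a> :: "nat => 'a::euclidean_space"
	assumes N: "0 < N" and nz: "!!i. i : {1..<m} ==> \<a> i ~= 0"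
		and cartan: "!!i k. i : {1..<m} ==> k : {1..<m} ==> cartan_integer (\<a> i) (\<a> k) = of_int (path_matrix i k)"
		and top: "\<a> (m - 1) \<bullet> \<a> (m - 1) = 2 * N"
		and ik: "i : {1..<m}" "k : {1..<m}"
	shows "\<a> i \<bullet> \<a> k = N * of_int (path_matrix i k)"
proof -
	have step: "\<a> i \<bullet> \<a> i = \<a> (Suc i) \<bullet> \<a> (Suc i)" if "1 <= i" "Suc i < m" for i
	proof -
		have "cartan_integer (\<a> i) (\<a> (Suc i)) = -1" "cartan_integer (\<a> (Suc i)) (\<a> i) = -1"
			using cartan[of i "Suc i"] cartan[of "Suc i" i] that by (auto simp: path_matrix_eq)
		moreover have "\<a> i \<bullet> \<a> i ~= 0" "\<a> (Suc i) \<bullet> \<a> (Suc i) ~= 0" using nz[of i] nz[of "Suc i"] that by auto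
		ultimately show ?thesis by (simp add: cartan_integer_def field_simps inner_commute)
	qed
	have sq: "\<a> i \<bullet> \<a> i = 2 * N" if "1 <= i" "i <= m - 1" for i
		using that(2,1)
	proof (induction i rule: inc_induct)
		case base
		then show ?case using top by simp
	next
		case (step i)
		then show ?case using \<open>!!i. 1 <= i ==> Suc i < m ==> \<a> i \<bullet> \<a> i = \<a> (Suc i) \<bullet> \<a> (Suc i)\<close>[of i] by simp
	qed
	have "\<a> k \<bullet> \<a> k = 2 * N" using sq[of k] ik by auto
	then show ?thesis using cartan[OF ik] N by (simp add: cartan_integer_def field_simps)
qed

lemma path_orthogonal_family:
	fixes \<a> :: "nat => 'a::euclidean_space"
	assumes m: "2 <= m" and N: "0 < N" and nz: "!!i. i : {1..<m} ==> \<a> i ~= 0"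
		and cartan: "!!i k. i : {1..<m} ==> k : {1..<m} ==> cartan_integer (\<a> i) (\<a> k) = of_int (path_matrix i k)"
		and top: "\<a> (m - 1) \<bullet> \<a> (m - 1) = 2 * N"
		and v: "v \<bullet> v = N" "!!t. t : {1..<m} ==> v \<bullet> \<a> t = (if Suc t = m then - N else 0)"
	shows "EX f. orthogonal_family m f N & f m = v & (ALL i:{1..<m}. \<a> i = f i - f (Suc i))"
proof -
	have gram: "\<a> i \<bullet> \<a> k = N * of_int (path_matrix i k)" if "i : {1..<m}" "k : {1..<m}" for i k
		by (rule path_gram[OF N nz cartan top that])
	have sq: "\<a> i \<bullet> \<a> i = 2 * N" if "1 <= i" "i < m" for i
		using gram[of i i] that by (simp add: path_matrix_eq)
	define f where "f i = v + (\<Sum>t=i..<m. \<a> t)" for i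
	have fm: "f m = v" by (simp add: f_def)
	have fS: "f i = \<a> i + f (Suc i)" if "i : {1..<m}" for i
		using that by (simp add: f_def sum.atLeast_Suc_lessThan)
	have fa: "f i \<bullet> \<a> t = N * ((if i = t then 1 else 0) - (if i = Suc t then 1 else 0))"
		if "i <= m" "1 <= i" "t : {1..<m}" for i t
		using that
	proof (induction i rule: inc_induct)
		case base
		then show ?case using v(2)[of t] fm by auto
	next
		case (step i)
		then have "f i \<bullet> \<a> t = \<a> i \<bullet> \<a> t + f (Suc i) \<bullet> \<a> t" using fS[of i] by (simp add: inner_add_left)
		then show ?case using step gram[of i t]
			by (auto simp: path_matrix_eq)
	qed
	have ff: "f i \<bullet> f k = (if i = k then N else 0)" if "i <= k" "1 <= i" "k <= m" for i k
	proof -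
		have sqf: "f k \<bullet> f k = N" if "k <= m" "1 <= k" for k
			using that
		proof (induction k rule: inc_induct)
			case base
			then show ?case using v fm by simp
		next
			case (step k)
			have "f k \<bullet> f k = \<a> k \<bullet> \<a> k + 2 * (f (Suc k) \<bullet> \<a> k) + f (Suc k) \<bullet> f (Suc k)"
				using fS[of k] step by (simp add: inner_add_left inner_add_right inner_commute)
			then show ?case using step fa[of "Suc k" k] sq[of k] by simp
		qed
		show ?thesis
			using that
		proof (induction i rule: inc_induct)
			case base
			then show ?case using sqf by simp
		next
			case (step i)
			have "f i \<bullet> f k = f k \<bullet> \<a> i + f (Suc i) \<bullet> f k"
				using fS[of i] step inner_commute[of "\<a> i" "f k"] by (simp add: inner_add_left)
			then show ?case using step fa[of k i] by auto
		qed
	qed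
	have "orthogonal_family m f N"
	proof
		fix i k assume "i : {1..m}" "k : {1..m}"
		then show "f i \<bullet> f k = (if i = k then N else 0)"
			using ff[of i k] ff[of k i] by (cases "i <= k") (auto simp: inner_commute)
	qed (rule N)
	then show ?thesis using fm fS by (intro exI[of _ f]) auto
qed

lemma simple_roots_mem:
	"simple_roots l \<Phi> \<a> ==> i : {1..l} ==> \<a> i : \<Phi>"
	by (auto simp: simple_roots_def)

lemma bourbaki_inner:
	assumes "root_system_in V \<Phi>" "bourbaki_simple_roots T \<Phi> \<a>" "i : {1..type_rank T}" "k : {1..type_rank T}"
	shows "2 * (\<a> i \<bullet> \<a> k) = of_int (cartan_matrix T i k) * (\<a> k \<bullet> \<a> k)"
proof -
	have "\<a> k : \<Phi>" using assms simple_roots_mem by (auto simp: bourbaki_simple_roots_def)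
	then have "\<a> k \<bullet> \<a> k ~= 0" using assms(1) by (auto simp: root_system_in_def)
	moreover have "cartan_integer (\<a> i) (\<a> k) = of_int (cartan_matrix T i k)"
		using assms by (auto simp: bourbaki_simple_roots_def)
	ultimately show ?thesis by (simp add: cartan_integer_def field_simps)
qed

lemma bourbaki_nonzero:
	assumes "root_system_in V \<Phi>" "bourbaki_simple_roots T \<Phi> \<a>" "i : {1..type_rank T}"
	shows "0 < \<a> i \<bullet> \<a> i" "\<a> i ~= 0"
proof -
	have "\<a> i : \<Phi>" using assms simple_roots_mem by (auto simp: bourbaki_simple_roots_def)
	then show "\<a> i ~= 0" "0 < \<a> i \<bullet> \<a> i" using assms(1) by (auto simp: root_system_in_def)
qed

lemma signed_systemI:
	assumes rs: "root_system_in UNIV \<Phi>" "reduced_roots \<Phi>" "simple_roots m \<Phi> \<a>"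
		and f: "orthogonal_family m f N" and A: "A \<subseteq> {d}" "d : {1,2}" "A ~= {} | 2 <= m"
		and simple: "simple_roots m (signed_roots m f A) \<a>"
		and diff: "!!i. i : {1..<m} ==> \<a> i = f i - f (Suc i)"
	shows "signed_system m f N \<Phi> A \<a>"
proof -
	interpret orthogonal_family m f N by (rule f)
	have A': "A \<subseteq> {1,2}" using A by auto
	have "simple_system (signed_roots m f A) (\<a> ` {1..m})"
		by (rule simple_roots_system[OF signed_roots_root_system[OF A' A(3)] signed_roots_reduced[OF A(1)] simple])
			(use A in auto)
	then have "\<Phi> = signed_roots m f A"
		by (rule simple_system_roots_unique[OF simple_roots_system[OF rs]])
	then show ?thesis using rs A' A(3) diff by unfold_locales auto
qed

lemma type_B_coordinates:
	assumes rs: "root_system_in UNIV \<Phi>" "reduced_roots \<Phi>" and b: "bourbaki_simple_roots (Type_B l) \<Phi> \<a>" and l: "2 <= l"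
	shows "EX f N. signed_system l f N \<Phi> {1} \<a> & \<a> l = f l"
proof -
	have s: "simple_roots l \<Phi> \<a>" using b by (simp add: bourbaki_simple_roots_def)
	let ?N = "\<a> l \<bullet> \<a> l"
	note inner = bourbaki_inner[OF rs(1) b] and nonzero = bourbaki_nonzero[OF rs(1) b]
	have l1: "1 <= l - 1" "l - 1 ~= l" "l ~= l - 1" "Suc (l - 1) = l" "l - 1 ~= Suc l" "l - 1 <= l" using l by auto
	have lm: "\<a> (l - 1) \<bullet> \<a> l = - ?N" "\<a> (l - 1) \<bullet> \<a> (l - 1) = 2 * ?N"
		using inner[of "l - 1" l] inner[of l "l - 1"] l1 l
		by (auto simp: path_matrix_eq inner_commute)
	have "EX f. orthogonal_family l f ?N & f l = \<a> l & (ALL i:{1..<l}. \<a> i = f i - f (Suc i))"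
	proof (rule path_orthogonal_family[OF l])
		show "0 < ?N" using nonzero(1)[of l] l by simp
		show "\<a> l \<bullet> \<a> t = (if Suc t = l then - ?N else 0)" if "t : {1..<l}" for t
			using that inner[of t l] lm(1) by (auto simp: path_matrix_eq inner_commute)
		show "cartan_integer (\<a> i) (\<a> k) = of_int (path_matrix i k)" if "i : {1..<l}" "k : {1..<l}" for i k
			using b that by (auto simp: bourbaki_simple_roots_def)
	qed (use lm nonzero(2) in auto)
	then obtain f where f: "orthogonal_family l f ?N" "f l = \<a> l" "!!i. i : {1..<l} ==> \<a> i = f i - f (Suc i)"
		by blast
	interpret orthogonal_family l f ?N by (rule f)
	have "simple_roots l (signed_roots l f {1}) \<a>"
		by (rule consecutive_simple_B[OF f(3) f(2)[symmetric]]) (use l in auto)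
	then have "signed_system l f ?N \<Phi> {1} \<a>"
		by (intro signed_systemI[OF rs s f(1), where d = 1]) (use f(3) in auto)
	then show ?thesis using f(2) by metis
qed

lemma type_C_coordinates:
	assumes rs: "root_system_in UNIV \<Phi>" "reduced_roots \<Phi>" and b: "bourbaki_simple_roots (Type_C l) \<Phi> \<a>" and l: "2 <= l"
	shows "EX f N. signed_system l f N \<Phi> {2} \<a> & \<a> l = 2 *R f l"
proof -
	have s: "simple_roots l \<Phi> \<a>" using b by (simp add: bourbaki_simple_roots_def)
	let ?v = "(1 / 2) *R \<a> l" and ?N = "(\<a> l \<bullet> \<a> l) / 4"
	note inner = bourbaki_inner[OF rs(1) b] and nonzero = bourbaki_nonzero[OF rs(1) b]
	have l1: "1 <= l - 1" "l - 1 ~= l" "l ~= l - 1" "Suc (l - 1) = l" "l - 1 ~= Suc l" "l - 1 <= l" using l by auto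
	have lm: "\<a> (l - 1) \<bullet> \<a> l = - 2 * ?N" "\<a> (l - 1) \<bullet> \<a> (l - 1) = 2 * ?N"
		using inner[of "l - 1" l] inner[of l "l - 1"] l1 l
		by (auto simp: path_matrix_eq inner_commute)
	have "EX f. orthogonal_family l f ?N & f l = ?v & (ALL i:{1..<l}. \<a> i = f i - f (Suc i))"
	proof (rule path_orthogonal_family[OF l])
		show "0 < ?N" using nonzero(1)[of l] l by simp
		show "?v \<bullet> \<a> t = (if Suc t = l then - ?N else 0)" if "t : {1..<l}" for t
			using that inner[of t l] lm(1) by (auto simp: path_matrix_eq inner_commute)
		show "cartan_integer (\<a> i) (\<a> k) = of_int (path_matrix i k)" if "i : {1..<l}" "k : {1..<l}" for i k
			using b that by (auto simp: bourbaki_simple_roots_def)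
	qed (use lm nonzero(2) in auto)
	then obtain f where f: "orthogonal_family l f ?N" "f l = ?v" "!!i. i : {1..<l} ==> \<a> i = f i - f (Suc i)"
		by blast
	interpret orthogonal_family l f ?N by (rule f)
	have last: "\<a> l = 2 *R f l" by (simp add: f(2))
	have "simple_roots l (signed_roots l f {2}) \<a>"
		by (rule consecutive_simple_C[OF f(3) last]) (use l in auto)
	then have "signed_system l f ?N \<Phi> {2} \<a>"
		by (intro signed_systemI[OF rs s f(1), where d = 2]) (use f(3) in auto)
	then show ?thesis using last by metis
qed

lemma type_D_coordinates:
	assumes rs: "root_system_in UNIV \<Phi>" "reduced_roots \<Phi>" and b: "bourbaki_simple_roots (Type_D l) \<Phi> \<a>" and l: "4 <= l"
	shows "EX f N. signed_system l f N \<Phi> {} \<a> & \<a> l = f (l - 1) + f l"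
proof -
	have s: "simple_roots l \<Phi> \<a>" using b by (simp add: bourbaki_simple_roots_def)
	let ?v = "(1 / 2) *R (\<a> l - \<a> (l - 1))" and ?N = "(\<a> l \<bullet> \<a> l) / 2"
	note inner = bourbaki_inner[OF rs(1) b] and nonzero = bourbaki_nonzero[OF rs(1) b]
	obtain k where k: "l = Suc (Suc k)" "2 <= k" using l by (intro that[of "l - 2"]) auto
	have lm: "\<a> k \<bullet> \<a> k = 2 * ?N" "\<a> (l - 1) \<bullet> \<a> (l - 1) = 2 * ?N" "\<a> k \<bullet> \<a> l = - ?N"
		 "\<a> k \<bullet> \<a> (l - 1) = - ?N" "\<a> (l - 1) \<bullet> \<a> l = 0"
		using inner[of k l] inner[of l k] inner[of k "l - 1"] inner[of "l - 1" k] inner[of "l - 1" l] k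
		by (auto simp: simply_laced_matrix_def inner_commute)
	have "EX f. orthogonal_family l f ?N & f l = ?v & (ALL i:{1..<l}. \<a> i = f i - f (Suc i))"
	proof (rule path_orthogonal_family)
		show "0 < ?N" using nonzero(1)[of l] l by simp
		show "?v \<bullet> ?v = ?N"
			using lm(2,5) by (simp add: inner_diff_left inner_diff_right inner_commute field_simps)
		show "?v \<bullet> \<a> t = (if Suc t = l then - ?N else 0)" if t: "t : {1..<l}" for t
		proof -
			consider "t = l - 1" | "t = k" | "t < k" using t k by force
			then show ?thesis
			proof cases
				case 1
				then show ?thesis using lm(2,5) l by (simp add: inner_diff_left inner_diff_right inner_commute)
			next
				case 2
				then show ?thesis using lm(3,4) k by (simp add: inner_diff_left inner_diff_right inner_commute)
			next
				case 3
				then show ?thesis using inner[of t l] inner[of t "l - 1"] t k lm(2) nonzero(1)[of l]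
					by (auto simp: inner_diff_left inner_diff_right inner_commute simply_laced_matrix_def)
			qed
		qed
		show "cartan_integer (\<a> i) (\<a> k) = of_int (path_matrix i k)" if "i : {1..<l}" "k : {1..<l}" for i k
		proof -
			have "cartan_matrix (Type_D l) i k = path_matrix i k"
				using that l by (auto simp: path_matrix_eq simply_laced_matrix_def)
			moreover have "cartan_integer (\<a> i) (\<a> k) = of_int (cartan_matrix (Type_D l) i k)"
				using b that by (auto simp: bourbaki_simple_roots_def simp del: cartan_matrix.simps)
			ultimately show ?thesis by simp
		qed
	qed (use lm nonzero(2) l in auto)
	then obtain f where f: "orthogonal_family l f ?N" "f l = ?v" "!!i. i : {1..<l} ==> \<a> i = f i - f (Suc i)"
		by blast
	interpret orthogonal_family l f ?N by (rule f)
	have "f (l - 1) = \<a> (l - 1) + f l" using f(3)[of "l - 1"] l by simp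
	moreover have "f l + f l = \<a> l - \<a> (l - 1)" unfolding f(2) by (simp flip: scaleR_2)
	ultimately have last: "\<a> l = f (l - 1) + f l" by (simp add: algebra_simps)
	have l2: "2 <= l" using l by simp
	have "simple_roots l (signed_roots l f {}) \<a>"
		by (rule consecutive_simple_D[OF f(3) last l2])
	then have "signed_system l f ?N \<Phi> {} \<a>"
		by (intro signed_systemI[OF rs s f(1), where d = 1]) (use f(3) l2 in auto)
	then show ?thesis using last by metis
qed

section \<open>Types B and D with the vector coweight\<close>

text \<open>
	The regularity condition of type C in the coordinates \<open>f 2, \<dots>, f (h + 1)\<close>.
\<close>

lemma (in orthogonal_family) shifted_family:
	assumes "Suc h <= m" shows "orthogonal_family h (%i. f (Suc i)) N"
	using assms inner_family N_pos by unfold_locales auto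

lemma (in orthogonal_family) shifted_type_C_regular:
	assumes "Suc h <= m"
	shows "(ALL \<beta>:signed_roots h (%i. f (Suc i)) {2}. \<beta> \<bullet> y ~: Ints) <->
		(ALL i:{2..Suc h}. ALL k:{2..Suc h}. i ~= k --> f i \<bullet> y + f k \<bullet> y ~: Ints & f i \<bullet> y - f k \<bullet> y ~: Ints) &
		(ALL i:{2..Suc h}. 2 * (f i \<bullet> y) ~: Ints)"
proof -
	interpret F: orthogonal_family h "%i. f (Suc i)" N by (rule shifted_family[OF assms])
	show ?thesis
		using F.signed_roots_ball[where P = "%x. x ~: Ints" and A = "{2}" and t = y]
			shifted_ball[where m = h and P = "%i. 2 * (f i \<bullet> y) ~: Ints"]
			shifted_ball[where m = h and P = "%i. ALL k:{1..h}. i ~= Suc k --> f i \<bullet> y + f (Suc k) \<bullet> y ~: Ints & f i \<bullet> y - f (Suc k) \<bullet> y ~: Ints"]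
			shifted_ball[where m = h and P = "%k. i ~= k --> f i \<bullet> y + f k \<bullet> y ~: Ints & f i \<bullet> y - f k \<bullet> y ~: Ints" for i]
			Ints_minus_iff by simp
qed

lemma not_half_integer:
	fixes x :: real
	assumes "2 * x ~: Ints" shows "x ~: Ints" "- x ~: Ints" "1 / 2 + x ~: Ints" "1 / 2 - x ~: Ints" "x + 1 / 2 ~: Ints" "x - 1 / 2 ~: Ints" "- x - 1 / 2 ~: Ints"
proof -
	show a: "x ~: Ints" "x + 1 / 2 ~: Ints" using assms half_integer_iff by auto
	then show "- x ~: Ints" "1 / 2 + x ~: Ints" by (simp_all add: Ints_minus_iff add.commute)
	show b: "x - 1 / 2 ~: Ints" using a(2) Ints_add_int_iff[of 1 "x - 1 / 2"] by (simp add: field_simps)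
	then show "1 / 2 - x ~: Ints" using Ints_minus_iff[of "x - 1 / 2"] by simp
	show "- x - 1 / 2 ~: Ints" using a(2) Ints_minus_iff[of "x + 1 / 2"] by simp
qed

lemma half_integer_shift:
	fixes x :: real
	assumes "2 * x : Ints" "x ~: Ints" shows "x + 1 / 2 : Ints" "x - 1 / 2 : Ints"
proof -
	show "x + 1 / 2 : Ints" using assms half_integer_iff by auto
	then show "x - 1 / 2 : Ints" using Ints_add_int_iff[of 1 "x - 1 / 2"] by (simp add: field_simps)
qed

text \<open>
	Here \<open>\<omega>\<close> changes the sign of \<open>f 1\<close>, and \<open>p\<close> is
	half of the first basis vector.  A fixed regular point has first coordinate a half integer
	modulo integers, and the short roots \<open>f i\<close> together with the pairs \<open>f i
	\<plusminus> f 1\<close> give the conditions \<open>y\<^sub>i \<notin> \<int>\<close> and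
	\<open>y\<^sub>i + 1/2 \<notin> \<int>\<close>, that is \<open>2 y\<^sub>i \<notin>
	\<int>\<close>.
\<close>

lemma folding_statement_B:
	assumes rs: "root_system_in UNIV \<Phi>" "reduced_roots \<Phi>" "irreducible_roots \<Phi>"
		and b: "bourbaki_simple_roots (Type_B l) \<Phi> \<a>" and l: "2 <= l"
		and j: "j : minuscule_indices l \<Phi> \<a> - {0}"
	shows "folding_statement \<Phi> (Type_B l) j (omega l \<Phi> \<a> j)"
proof -
	obtain f N where S: "signed_system l f N \<Phi> {1} \<a>" and last: "\<a> l = f l"
		using type_B_coordinates[OF rs(1,2) b l] by blast
	interpret signed_system l f N \<Phi> "{1}" \<a> by (rule S)
	have single: "f i : nat_cone l \<a>" if "i : {1..l}" for i by (rule single_cone[OF diff last that])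
	have le: "f i - f k : nat_cone l \<a>" if "1 <= i" "i <= k" "k <= l" for i k by (rule difference_cone[OF diff that])
	have jr: "j : {1..l}" by (rule minuscule_index_range[OF j])
	have j1: "j = 1"
	proof (rule ccontr)
		assume "j ~= 1"
		then have j2: "2 <= j" "j <= l" using jr by auto
		have r: "1 *R f 1 + 1 *R f 2 : \<Phi>" unfolding roots_eq using l by (intro signed_rootsI(1)) auto
		have "1 *R f 1 + 1 *R f 2 - 2 *R \<a> j : nat_cone l \<a>"
		proof (cases "j = l")
			case True
			have "(f 1 - f l) + (f 2 - f l) : nat_cone l \<a>" using l by (intro nat_cone_add le) auto
			then show ?thesis using last True by (simp add: scaleR_2 algebra_simps)
		next
			case False
			have "(f 1 - f j) + (f 2 - f j) + (f (Suc j) + f (Suc j)) : nat_cone l \<a>"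
				using j2 False by (intro nat_cone_add le single) auto
			moreover have "\<a> j = f j - f (Suc j)" using j2 False by (intro diff) auto
			then have "1 *R f 1 + 1 *R f 2 - 2 *R \<a> j = (f 1 - f j) + (f 2 - f j) + (f (Suc j) + f (Suc j))"
				by (simp only: scaleR_2 scaleR_one) (simp add: algebra_simps)
			ultimately show ?thesis by (simp only:)
		qed
		then show False using minuscule_no_coefficient_two[OF rs simple _ _ r] j by blast
	qed
	define w where "w = root_reflection (1 *R f 1)"
	have w: "w : weyl_group \<Phi>" unfolding w_def using l by (intro reflection_in_weyl signed_rootsI(2)) auto
	have wf: "w (f i) = (if i = 1 then - f 1 else f i)" if "i : {1..l}" for i
		using reflection_single[of 1 1 i] l that by (simp add: w_def)
	have lin: "linear w" by (rule in_weyl_linear[OF w])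
	have orth: "orthogonal_transformation w" by (rule reflection_group_orthogonal[OF w])
	have ww: "w (w x) = x" for x by (simp add: w_def)
	have om: "omega l \<Phi> \<a> j = w"
	proof (rule omega_eqI[OF root_system reduced simple jr w])
		fix i assume i: "i : {1..l}"
		show "(EX k:{1..l} - {j}. w (\<a> i) = \<a> k) | - w (\<a> i) - \<a> j : nat_cone l \<a>"
		proof (cases "i = 1")
			case True
			have "w (\<a> 1) = - f 1 - f 2" using diff[of 1] l wf[of 1] wf[of 2]
				by (simp add: linear_diff[OF lin] numeral_2_eq_2 One_nat_def)
			then have "- w (\<a> i) - \<a> j = f 2 + f 2" using True j1 diff[of 1] l
				by (simp add: numeral_2_eq_2 One_nat_def)
			also have "\<dots> : nat_cone l \<a>" using l by (intro nat_cone_add single) auto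
			finally show ?thesis by blast
		next
			case False
			have "w (\<a> i) = \<a> i"
			proof (cases "i = l")
				case True then show ?thesis using last wf[of l] False l by simp
			next
				case F2: False
				then show ?thesis using diff[of i] i wf[of i] wf[of "Suc i"] False by (simp add: linear_diff[OF lin] One_nat_def)
			qed
			then show ?thesis using i j1 False by blast
		qed
	qed
	have f1: "f 1 \<bullet> f 1 = N" using inner_family[of 1 1] l by simp
	have order: "map_order w = 2"
	proof (rule map_order_involution[OF ww, where y = "f 1"])
		have "w (f 1) \<bullet> f 1 = - N" using wf[of 1] l f1 by simp
		then show "w (f 1) ~= f 1" using f1 N_pos by auto
	qed
	have fo: "0 < (2::nat)" "w ^^ 2 = id" using ww by (auto simp: fun_eq_iff numeral_2_eq_2)
	have fixed: "w y = y <-> f 1 \<bullet> y = 0" for y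
		unfolding fixed_iff[OF orth] using wf l by (auto simp: One_nat_def)
	let ?F = "%i. f (Suc i)" and ?h = "l - 1"
	have h: "Suc ?h <= l" "1 <= ?h" "Suc ?h = l" using l by auto
	interpret F: orthogonal_family ?h ?F N by (rule shifted_family[OF h(1)])
	have avg: "orbit_average w (f i) = (if i = 1 then 0 else f i)" if "i : {1..l}" for i
	proof (rule orbit_average_eqI[OF orth fo])
		show "w (if i = 1 then 0 else f i) = (if i = 1 then 0 else f i)"
			using wf[OF that] linear_0[OF lin] by simp
		show "(if i = 1 then 0 else f i) \<bullet> y = f i \<bullet> y" if "w y = y" for y using that fixed by auto
	qed
	have fold: "folded_roots \<Phi> w = signed_roots ?h ?F {1}" "fixed_space w = span (?F ` {1..?h})"
	proof -
		have *: "folded_roots (signed_roots l f {1}) w = signed_roots ?h ?F {1} & fixed_space w = span (?F ` {1..?h})"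
		proof (rule folded_signed_roots[OF orth fo full F.orthogonal_family_axioms])
			fix i assume i: "i : {1..l}"
			show "orbit_average w (f i) = 0 | (EX p:{1..?h}. EX a. \<bar>a\<bar> = 1 & orbit_average w (f i) = a *R f (Suc p))"
			proof (cases "i = 1")
				case False
				then show ?thesis using avg[OF i] i by (intro disjI2 bexI[of _ "i - 1"] exI[of _ 1]) auto
			qed (use avg[OF i] in simp)
		next
			fix p assume "p : {1..?h}"
			then show "EX i:{1..l}. orbit_average w (f i) = f (Suc p)" using avg[of "Suc p"] by (intro bexI[of _ "Suc p"]) auto
		next
			fix i k p :: nat and a b :: real assume a: "i : {1..l}" "k : {1..l}" "i ~= k" "p : {1..?h}"
				"orbit_average w (f i) = a *R f (Suc p)" "orbit_average w (f k) = b *R f (Suc p)" "\<bar>a\<bar> = 1" "\<bar>b\<bar> = 1"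
			have sp: "Suc p : {1..l}" using a(4) by auto
			have "t = Suc p" if "t : {1..l}" "orbit_average w (f t) = c *R f (Suc p)" "\<bar>c\<bar> = 1" for t c
			proof (rule ccontr)
				assume "t ~= Suc p"
				then have "orbit_average w (f t) \<bullet> f (Suc p) = 0"
					using avg[OF that(1)] inner_family[OF that(1) sp] by auto
				then show False using that inner_family[OF sp sp] N_pos by auto
			qed
			from this[OF a(1,5,7)] this[OF a(2,6,8)] a(3) show "2 : {1::real}" by simp
		qed auto
		then show "folded_roots \<Phi> w = signed_roots ?h ?F {1}" "fixed_space w = span (?F ` {1..?h})"
			unfolding roots_eq by blast+
	qed
	obtain p where p: "ALL i:{1..l}. f i \<bullet> p = (if i = 1 then 1 / 2 else 0)"
		using exists_coordinates[of "%i. if i = 1 then 1 / 2 else 0"] by blast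
	define C where "C y <->
		(ALL i:{2..l}. ALL k:{2..l}. i ~= k --> f i \<bullet> y + f k \<bullet> y ~: Ints & f i \<bullet> y - f k \<bullet> y ~: Ints) &
		(ALL i:{2..l}. 2 * (f i \<bullet> y) ~: Ints)" for y
	have latI: "z : coweights \<Phi>" if "!!i. i : {1..l} ==> f i \<bullet> z : Ints" for z
		unfolding lattice_iff using that by auto
	have reg: "(ALL \<beta>:\<Phi>. \<beta> \<bullet> (p + y) ~: Ints) <-> C y" if y: "w y = y" for y
	proof -
		have c: "f i \<bullet> (p + y) = (if i = 1 then 1 / 2 else f i \<bullet> y)" if "i : {1..l}" for i
			using p that y fixed by (auto simp: inner_add_right)
		have split: "i = 1 | i : {2..l}" if "i : {1..l}" for i using that by auto
		show ?thesis
		proof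
			assume "ALL \<beta>:\<Phi>. \<beta> \<bullet> (p + y) ~: Ints"
			then have R: "f i \<bullet> (p + y) + f k \<bullet> (p + y) ~: Ints" "f i \<bullet> (p + y) - f k \<bullet> (p + y) ~: Ints" "f i \<bullet> (p + y) ~: Ints"
				if "i : {1..l}" "k : {1..l}" "i ~= k" for i k
				using that unfolding regular_iff by auto
			have "2 * (f i \<bullet> y) ~: Ints" if i: "i : {2..l}" for i
				using R(1)[of i 1] R(3)[of i 1] i c[of i] c[of 1] half_integer_iff by auto
			moreover have "f i \<bullet> y + f k \<bullet> y ~: Ints" "f i \<bullet> y - f k \<bullet> y ~: Ints" if "i : {2..l}" "k : {2..l}" "i ~= k" for i k
				using R(1,2)[of i k] c[of i] c[of k] that by auto
			ultimately show "C y" unfolding C_def by blast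
		next
			assume C: "C y"
			have yh: "2 * (f i \<bullet> y) ~: Ints" if "i : {2..l}" for i using C that unfolding C_def by blast
			have "f i \<bullet> (p + y) ~: Ints" if i: "i : {1..l}" for i
			proof (cases "i = 1")
				case False
				then have "i : {2..l}" using i by auto
				then show ?thesis using c[OF i] False not_half_integer(1)[OF yh] by simp
			next
				case True
				then show ?thesis using c[OF i] half_not_integer by metis
			qed
			moreover have "f i \<bullet> (p + y) + f k \<bullet> (p + y) ~: Ints & f i \<bullet> (p + y) - f k \<bullet> (p + y) ~: Ints"
				if ik: "i : {1..l}" "k : {1..l}" "i ~= k" for i k
			proof -
				consider "i : {2..l}" "k : {2..l}" | "i = 1" "k : {2..l}" | "i : {2..l}" "k = 1"
					using split[OF ik(1)] split[OF ik(2)] ik(3) by blast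
				then show ?thesis
				proof cases
					case 1
					then show ?thesis using c[OF ik(1)] c[OF ik(2)] C ik(3) unfolding C_def by auto
				next
					case 2
					then show ?thesis unfolding c[OF ik(1)] c[OF ik(2)] using not_half_integer[OF yh[OF 2(2)]] by auto
				next
					case 3
					then show ?thesis unfolding c[OF ik(1)] c[OF ik(2)] using not_half_integer[OF yh[OF 3(1)]] by auto
				qed
			qed
			ultimately show "ALL \<beta>:\<Phi>. \<beta> \<bullet> (p + y) ~: Ints" unfolding regular_iff by auto
		qed
	qed
	have p1: "real 2 *R p : coweights \<Phi>" by (rule latI) (use p in auto)
	have p2: "p - w p : coweights \<Phi>"
	proof (rule latI)
		fix i assume i: "i : {1..l}"
		have "f i \<bullet> w p = w (f i) \<bullet> p" using orth ww[of "f i"] unfolding orthogonal_transformation_def by metis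
		then show "f i \<bullet> (p - w p) : Ints" using p wf[OF i] i by (auto simp: inner_diff_right)
	qed
	have lam1: "f 1 \<bullet> z : Ints" if "z : coweights \<Phi>" for z
		using that l unfolding lattice_iff by auto
	have lam3: "f 1 \<bullet> p - real k / real 2 : Ints" if "k : totatives 2" for k
		using that p l by (auto simp: totatives_2)
	have cover: "EX k:totatives 2. EX e z. w e = e & z : coweights \<Phi> & t = p + e + z"
		if t: "t - w t : coweights \<Phi>" and r: "ALL \<beta>:\<Phi>. \<beta> \<bullet> t ~: Ints" for t
	proof -
		have "f 1 \<bullet> (t - w t) : Ints" by (rule lam1[OF t])
		moreover have "w (f 1) \<bullet> (t - w t) = w (f 1) \<bullet> t - f 1 \<bullet> t" by (rule displacement_inner[OF orth])
		ultimately have "2 * (f 1 \<bullet> t) : Ints" using wf[of 1] l by simp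
		moreover have "f 1 \<bullet> t ~: Ints" using r l unfolding regular_iff by auto
		ultimately have t1: "f 1 \<bullet> t - 1 / 2 : Ints" by (rule half_integer_shift)
		obtain e where e: "ALL i:{1..l}. f i \<bullet> e = (if i = 1 then 0 else f i \<bullet> t)"
			using exists_coordinates[of "%i. if i = 1 then 0 else f i \<bullet> t"] by blast
		have "w e = e" using e fixed l by auto
		moreover have "t - p - e : coweights \<Phi>"
			by (rule latI) (use e p t1 in \<open>auto simp: inner_diff_right\<close>)
		moreover have "t = p + e + (t - p - e)" by simp
		ultimately show ?thesis using totatives_2 by blast
	qed
	have Creg: "(ALL \<beta>:signed_roots ?h ?F {2}. \<beta> \<bullet> y ~: Ints) <-> C y" for y
		using shifted_type_C_regular[OF h(1), of y] unfolding C_def h(3) .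
	note facts = refl p1 p2 lam1 fixed[THEN iffD1] lam3 cover
	have "folding_statement \<Phi> (Type_B l) 1 w"
	proof (cases "l = 2")
		case True
		have t1: "root_system_of_type (fixed_space w) (folded_roots \<Phi> w) (Type_A 1)"
			unfolding fold by (rule F.type_A1) (use True in simp)
		show ?thesis
		proof (rule folding_statementI[OF root_system w fo order _ t1 t1 facts])
			show "folding_table \<Phi> (folded_roots \<Phi> w) 2 (Type_B l) 1 (Type_A 1) (folded_roots \<Phi> w) (Type_A 1) 2"
				using True folding_table.B2 by simp
			show "(ALL \<beta>:\<Phi>. \<beta> \<bullet> (p + y) ~: Ints) <-> (ALL \<beta>:folded_roots \<Phi> w. real 2 * (\<beta> \<bullet> y) ~: Ints)"
				if "w y = y" for y
				unfolding reg[OF that] fold C_def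
				using F.signed_roots_ball[where P = "%x. 2 * x ~: Ints" and A = "{1}" and t = y] True Ints_minus_iff
				by (auto simp: numeral_2_eq_2 One_nat_def)
		qed auto
	next
		case False
		then have l3: "3 <= l" using l by simp
		have d: "scaled 2 (short_roots (folded_roots \<Phi> w)) \<union> long_roots (folded_roots \<Phi> w) = signed_roots ?h ?F {2}"
			unfolding fold by (rule F.dual_B) (use l3 in simp)
		show ?thesis
		proof (rule folding_statementI[OF root_system w fo order _ _ _ facts])
			show "folding_table \<Phi> (folded_roots \<Phi> w) 2 (Type_B l) 1 (Type_B ?h) (signed_roots ?h ?F {2}) (Type_C ?h) 1"
				using folding_table.B[OF l3, of \<Phi> "folded_roots \<Phi> w" 2] unfolding d .
			show "root_system_of_type (fixed_space w) (folded_roots \<Phi> w) (Type_B ?h)"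
				unfolding fold by (rule F.type_B[OF h(2)])
			show "root_system_of_type (fixed_space w) (signed_roots ?h ?F {2}) (Type_C ?h)"
				unfolding fold by (rule F.type_C[OF h(2)])
			show "(ALL \<beta>:\<Phi>. \<beta> \<bullet> (p + y) ~: Ints) <-> (ALL \<beta>:signed_roots ?h ?F {2}. real 1 * (\<beta> \<bullet> y) ~: Ints)"
				if "w y = y" for y
				unfolding reg[OF that] using Creg[of y] by simp
		qed auto
	qed
	then show ?thesis using om j1 by simp
qed

lemma (in signed_system) lattice_integral:
	assumes "A \<subseteq> {2}" "2 <= m" "z : coweights \<Phi>" "i : {1..m}" "k : {1..m}"
	shows "f i \<bullet> z + f k \<bullet> z : Ints" "f i \<bullet> z - f k \<bullet> z : Ints"
proof -
	have ne: "f i \<bullet> z + f k \<bullet> z : Ints" "f i \<bullet> z - f k \<bullet> z : Ints" if "i : {1..m}" "k : {1..m}" "i ~= k" for i k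
		using assms(3) that unfolding lattice_iff by blast+
	show "f i \<bullet> z - f k \<bullet> z : Ints" using ne(2)[OF assms(4,5)] by (cases "i = k") auto
	show "f i \<bullet> z + f k \<bullet> z : Ints"
	proof (cases "i = k")
		case True
		obtain t where t: "t : {1..m}" "i ~= t" using assms(2,4) by (cases "i = 1") (auto intro: that[of 2] that[of 1])
		have "(f i \<bullet> z + f t \<bullet> z) + (f i \<bullet> z - f t \<bullet> z) : Ints" by (intro Ints_add ne assms(4) t)
		then show ?thesis using True by simp
	qed (use ne(1)[OF assms(4,5)] in simp)
qed

lemma (in signed_system) lattice_shifted:
	assumes "A \<subseteq> {2}" and d: "2 * d : Ints" "!!i. i : {1..m} ==> f i \<bullet> z - d : Ints"
	shows "z : coweights \<Phi>"
proof -
	have sum: "f i \<bullet> z + f k \<bullet> z : Ints" if "i : {1..m}" "k : {1..m}" for i k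
	proof -
		have "(f i \<bullet> z - d) + (f k \<bullet> z - d) + 2 * d : Ints" by (intro Ints_add d that)
		then show ?thesis by simp
	qed
	have diff: "f i \<bullet> z - f k \<bullet> z : Ints" if "i : {1..m}" "k : {1..m}" for i k
	proof -
		have "(f i \<bullet> z - d) - (f k \<bullet> z - d) : Ints" by (intro Ints_diff d that)
		then show ?thesis by simp
	qed
	have "c * (f i \<bullet> z) : Ints" if "i : {1..m}" "c : A" for i c
	proof -
		have "c = 2" using that assms(1) by blast
		then show ?thesis using sum[OF that(1,1)] by simp
	qed
	then show ?thesis unfolding lattice_iff using sum diff by blast
qed

lemma (in signed_system) orthogonal_inverse_inner:
	"orthogonal_transformation w ==> (!!x. w (w x) = x) ==> x \<bullet> w y = w x \<bullet> y"
	unfolding orthogonal_transformation_def by metis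

text \<open>
	Now \<open>\<omega>\<close> changes the signs of \<open>f 1\<close> and \<open>f l\<close>.  A
	regular fixed point has half integer or integer values there, one of each kind; the pairs with
	these two coordinates again give \<open>2 y\<^sub>i \<notin> \<int>\<close>.
\<close>

lemma folding_statement_D_vector:
	assumes rs: "root_system_in UNIV \<Phi>" "reduced_roots \<Phi>"
		and b: "bourbaki_simple_roots (Type_D l) \<Phi> \<a>" and l: "4 <= l"
	shows "folding_statement \<Phi> (Type_D l) 1 (omega l \<Phi> \<a> 1)"
proof -
	obtain f N where S: "signed_system l f N \<Phi> {} \<a>" and last: "\<a> l = f (l - 1) + f l"
		using type_D_coordinates[OF rs b l] by blast
	interpret signed_system l f N \<Phi> "{}" \<a> by (rule S)
	have l2: "2 <= l" using l by simp
	have jr: "1 : {1..l}" using l by simp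
	define sm where "sm = root_reflection (1 *R f 1 + (-1) *R f l)"
	define sp where "sp = root_reflection (1 *R f 1 + 1 *R f l)"
	define w where "w = sm \<circ> sp"
	have "sm : weyl_group \<Phi>" "sp : weyl_group \<Phi>"
		unfolding sm_def sp_def using l by (intro reflection_in_weyl signed_rootsI(1); simp)+
	then have w: "w : weyl_group \<Phi>" unfolding w_def by (rule reflection_group_comp)
	have wf: "w (f i) = (if i = 1 | i = l then - f i else f i)" if "i : {1..l}" for i
		using reflection_pair[of 1 l 1 1 i] reflection_pair[of 1 l 1 "-1" i] reflection_pair[of 1 l 1 "-1" 1]
			reflection_pair[of 1 l 1 "-1" l] l that linear_neg[OF linear_root_reflection, of "1 *R f 1 + (-1) *R f l"]
		by (auto simp: w_def sm_def sp_def)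
	have lin: "linear w" by (rule in_weyl_linear[OF w])
	have orth: "orthogonal_transformation w" by (rule reflection_group_orthogonal[OF w])
	have "w \<circ> w = id"
		by (rule linear_ext) (use lin wf in \<open>auto intro: linear_compose simp: linear_neg linear_id[unfolded id_def] id_def\<close>)
	then have ww: "w (w x) = x" for x by (metis comp_apply id_apply)
	have om: "omega l \<Phi> \<a> 1 = w"
	proof (rule omega_eqI[OF root_system reduced simple jr w])
		fix i assume i: "i : {1..l}"
		consider "i = 1" | "i : {2..l - 2}" | "i = l - 1" | "i = l" using i l by force
		then show "(EX k:{1..l} - {1}. w (\<a> i) = \<a> k) | - w (\<a> i) - \<a> 1 : nat_cone l \<a>"
		proof cases
			case 1
			have a1: "\<a> 1 = f 1 - f 2" using diff[of 1] l by (simp add: numeral_2_eq_2 One_nat_def)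
			then have "w (\<a> 1) = - f 1 - f 2" using wf[of 1] wf[of 2] l by (simp add: linear_diff[OF lin])
			then have "- w (\<a> i) - \<a> 1 = f 2 + f 2" using 1 a1 by simp
			also have "\<dots> : nat_cone l \<a>" by (rule sum_cone_D[OF diff last]) (use l in auto)
			finally show ?thesis by blast
		next
			case 2
			then have "w (\<a> i) = \<a> i" using diff[of i] wf[of i] wf[of "Suc i"] by (auto simp: linear_diff[OF lin])
			then show ?thesis using i 2 by auto
		next
			case 3
			then have "\<a> i = f (l - 1) - f l" using diff[of "l - 1"] l by simp
			then have "w (\<a> i) = \<a> l" using wf[of "l - 1"] wf[of l] l last by (auto simp: linear_diff[OF lin])
			then show ?thesis using l by auto
		next
			case 4
			have "\<a> (l - 1) = f (l - 1) - f l" using diff[of "l - 1"] l by simp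
			then have "w (\<a> i) = \<a> (l - 1)" using wf[of "l - 1"] wf[of l] l last 4 by (auto simp: linear_add[OF lin])
			then show ?thesis using l by (intro disjI1 bexI[of _ "l - 1"]) auto
		qed
	qed
	have f1: "f 1 \<bullet> f 1 = N" using inner_family[of 1 1] l by simp
	have order: "map_order w = 2"
	proof (rule map_order_involution[OF ww, where y = "f 1"])
		have "w (f 1) \<bullet> f 1 = - N" using wf[of 1] l f1 by simp
		then show "w (f 1) ~= f 1" using f1 N_pos by auto
	qed
	have fo: "0 < (2::nat)" "w ^^ 2 = id" using ww by (auto simp: fun_eq_iff numeral_2_eq_2)
	have fixed: "w y = y <-> f 1 \<bullet> y = 0 & f l \<bullet> y = 0" for y
		unfolding fixed_iff[OF orth] using wf l by auto
	let ?F = "%i. f (Suc i)" and ?h = "l - 2"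
	have h: "Suc ?h <= l" "1 <= ?h" "Suc ?h = l - 1" using l by auto
	interpret F: orthogonal_family ?h ?F N by (rule shifted_family[OF h(1)])
	have avg: "orbit_average w (f i) = (if i = 1 | i = l then 0 else f i)" if "i : {1..l}" for i
	proof (rule orbit_average_eqI[OF orth fo])
		show "w (if i = 1 | i = l then 0 else f i) = (if i = 1 | i = l then 0 else f i)"
			using wf[OF that] linear_0[OF lin] by simp
		show "(if i = 1 | i = l then 0 else f i) \<bullet> y = f i \<bullet> y" if "w y = y" for y using that fixed by auto
	qed
	have fold0: "folded_roots (signed_roots l f {}) w = signed_roots ?h ?F {1} & fixed_space w = span (?F ` {1..?h})"
	proof (rule folded_signed_roots[OF orth fo full F.orthogonal_family_axioms])
		fix i assume i: "i : {1..l}"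
		show "orbit_average w (f i) = 0 | (EX p:{1..?h}. EX a. \<bar>a\<bar> = 1 & orbit_average w (f i) = a *R f (Suc p))"
		proof (cases "i = 1 | i = l")
			case False
			then show ?thesis using avg[OF i] i by (intro disjI2 bexI[of _ "i - 1"] exI[of _ 1]) auto
		qed (use avg[OF i] in simp)
	next
		fix p assume "p : {1..?h}"
		then show "EX i:{1..l}. orbit_average w (f i) = f (Suc p)" using avg[of "Suc p"] by (intro bexI[of _ "Suc p"]) auto
	next
		show "1 : {} | (EX i:{1..l}. orbit_average w (f i) = 0)" using avg[of 1] l by (intro disjI2 bexI[of _ 1]) auto
	next
		fix i k p :: nat and a b :: real assume a: "i : {1..l}" "k : {1..l}" "i ~= k" "p : {1..?h}"
			"orbit_average w (f i) = a *R f (Suc p)" "orbit_average w (f k) = b *R f (Suc p)" "\<bar>a\<bar> = 1" "\<bar>b\<bar> = 1"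
		have sp: "Suc p : {1..l}" using a(4) by auto
		have "t = Suc p" if "t : {1..l}" "orbit_average w (f t) = c *R f (Suc p)" "\<bar>c\<bar> = 1" for t c
		proof (rule ccontr)
			assume "t ~= Suc p"
			then have "orbit_average w (f t) \<bullet> f (Suc p) = 0"
				using avg[OF that(1)] inner_family[OF that(1) sp] by auto
			then show False using that inner_family[OF sp sp] N_pos by auto
		qed
		from this[OF a(1,5,7)] this[OF a(2,6,8)] a(3) show "2 : {1::real}" by simp
	qed auto
	then have fold: "folded_roots \<Phi> w = signed_roots ?h ?F {1}" "fixed_space w = span (?F ` {1..?h})"
		unfolding roots_eq by blast+
	obtain p where p: "ALL i:{1..l}. f i \<bullet> p = (if i = 1 then 1 / 2 else 0)"
		using exists_coordinates[of "%i. if i = 1 then 1 / 2 else 0"] by blast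
	define C where "C y <->
		(ALL i:{2..l - 1}. ALL k:{2..l - 1}. i ~= k --> f i \<bullet> y + f k \<bullet> y ~: Ints & f i \<bullet> y - f k \<bullet> y ~: Ints) &
		(ALL i:{2..l - 1}. 2 * (f i \<bullet> y) ~: Ints)" for y
	have reg: "(ALL \<beta>:\<Phi>. \<beta> \<bullet> (p + y) ~: Ints) <-> C y" if y: "w y = y" for y
	proof -
		have c: "f i \<bullet> (p + y) = (if i = 1 then 1 / 2 else if i = l then 0 else f i \<bullet> y)" if "i : {1..l}" for i
			using p that y fixed l by (auto simp: inner_add_right)
		have split: "i = 1 | i = l | i : {2..l - 1}" if "i : {1..l}" for i using that by auto
		show ?thesis
		proof
			assume "ALL \<beta>:\<Phi>. \<beta> \<bullet> (p + y) ~: Ints"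
			then have R: "f i \<bullet> (p + y) + f k \<bullet> (p + y) ~: Ints" "f i \<bullet> (p + y) - f k \<bullet> (p + y) ~: Ints"
				if "i : {1..l}" "k : {1..l}" "i ~= k" for i k
				using that unfolding regular_iff by auto
			have "2 * (f i \<bullet> y) ~: Ints" if i: "i : {2..l - 1}" for i
			proof -
				have il: "i : {1..l}" "i ~= 1" "i ~= l" using i by auto
				have "f i \<bullet> y + 1 / 2 ~: Ints" using R(1)[of i 1] il c[of i] c[of 1] l by simp
				moreover have "f i \<bullet> y ~: Ints" using R(1)[of i l] il c[of i] c[of l] l by simp
				ultimately show ?thesis using half_integer_iff by blast
			qed
			moreover have "f i \<bullet> y + f k \<bullet> y ~: Ints" "f i \<bullet> y - f k \<bullet> y ~: Ints" if "i : {2..l - 1}" "k : {2..l - 1}" "i ~= k" for i k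
			proof -
				have "i : {1..l}" "i ~= 1" "i ~= l" "k : {1..l}" "k ~= 1" "k ~= l" using that by auto
				then show "f i \<bullet> y + f k \<bullet> y ~: Ints" "f i \<bullet> y - f k \<bullet> y ~: Ints"
					using R(1,2)[of i k] c[of i] c[of k] that(3) by simp_all
			qed
			ultimately show "C y" unfolding C_def by blast
		next
			assume C: "C y"
			have yh: "2 * (f i \<bullet> y) ~: Ints" if "i : {2..l - 1}" for i using C that unfolding C_def by blast
			have "f i \<bullet> (p + y) + f k \<bullet> (p + y) ~: Ints & f i \<bullet> (p + y) - f k \<bullet> (p + y) ~: Ints"
				if ik: "i : {1..l}" "k : {1..l}" "i ~= k" for i k
			proof -
				have mh: "- (1 / 2 :: real) ~: Ints" using half_not_integer by (simp add: Ints_minus_iff)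
				consider "i : {2..l - 1}" "k : {2..l - 1}" | "i : {1, l}" "k : {2..l - 1}" | "i : {2..l - 1}" "k : {1, l}"
					| "i : {1, l}" "k : {1, l}"
					using split[OF ik(1)] split[OF ik(2)] by blast
				then show ?thesis
				proof cases
					case 1
					then have "i ~= 1" "i ~= l" "k ~= 1" "k ~= l" by auto
					then show ?thesis using c[OF ik(1)] c[OF ik(2)] C ik(3) 1 unfolding C_def by simp
				next
					case 2
					then have "k ~= 1" "k ~= l" by auto
					then show ?thesis using c[OF ik(1)] c[OF ik(2)] not_half_integer[OF yh[OF 2(2)]] 2(1) by auto
				next
					case 3
					then have "i ~= 1" "i ~= l" by auto
					then show ?thesis using c[OF ik(1)] c[OF ik(2)] not_half_integer[OF yh[OF 3(1)]] 3(2) by auto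
				next
					case 4
					then show ?thesis using c[OF ik(1)] c[OF ik(2)] ik(3) half_not_integer mh l by auto
				qed
			qed
			then show "ALL \<beta>:\<Phi>. \<beta> \<bullet> (p + y) ~: Ints" unfolding regular_iff by auto
		qed
	qed
	have latI: "z : coweights \<Phi>" if "2 * d : Ints" "!!i. i : {1..l} ==> f i \<bullet> z - d : Ints" for z d
		by (rule lattice_shifted[OF _ that]) auto
	have p1: "real 2 *R p : coweights \<Phi>" by (rule latI[of 0]) (use p in auto)
	have p2: "p - w p : coweights \<Phi>"
	proof (rule latI[of 0])
		fix i assume i: "i : {1..l}"
		have "f i \<bullet> w p = w (f i) \<bullet> p" by (rule orthogonal_inverse_inner[OF orth ww])
		then show "f i \<bullet> (p - w p) - 0 : Ints" using p wf[OF i] i by (auto simp: inner_diff_right)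
	qed simp
	have lam1: "(f 1 - f l) \<bullet> z : Ints" if "z : coweights \<Phi>" for z
		using lattice_integral(2)[OF _ l2 that, of 1 l] l by (auto simp: inner_diff_left)
	have lam2: "(f 1 - f l) \<bullet> y = 0" if "w y = y" for y using that fixed by (simp add: inner_diff_left)
	have lam3: "(f 1 - f l) \<bullet> p - real k / real 2 : Ints" if "k : totatives 2" for k
		using that p l by (auto simp: totatives_2 inner_diff_left)
	have cover: "EX k:totatives 2. EX e z. w e = e & z : coweights \<Phi> & t = p + e + z"
		if t: "t - w t : coweights \<Phi>" and r: "ALL \<beta>:\<Phi>. \<beta> \<bullet> t ~: Ints" for t
	proof -
		have u: "f i \<bullet> (t - w t) = f i \<bullet> t - w (f i) \<bullet> t" for i
			using orthogonal_inverse_inner[OF orth ww, of "f i" t] by (simp add: inner_diff_right)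
		have two: "2 * (f i \<bullet> t) : Ints" if "i = 1 | i = l" for i
			using lattice_integral(1)[OF _ l2 t, of i 2] u[of i] u[of 2] wf[of i] wf[of 2] l that by auto
		have ne: "f 1 \<bullet> t + f l \<bullet> t ~: Ints" "f 1 \<bullet> t - f l \<bullet> t ~: Ints" using r l unfolding regular_iff by auto
		\<comment> \<open>Exactly one of the two coordinates is an integer; the half vector interchanges the two cases.\<close>
		have "EX d. 2 * d : Ints & f 1 \<bullet> t - 1 / 2 - d : Ints & f l \<bullet> t - d : Ints"
		proof (cases "f l \<bullet> t : Ints")
			case True
			then have "f 1 \<bullet> t ~: Ints" using ne by (meson Ints_add)
			then have "f 1 \<bullet> t - 1 / 2 : Ints" using half_integer_shift two[of 1] by simp
			then show ?thesis using True by (intro exI[of _ 0]) simp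
		next
			case False
			then have hl: "f l \<bullet> t - 1 / 2 : Ints" using half_integer_shift two[of l] by simp
			have "f 1 \<bullet> t : Ints"
			proof (rule ccontr)
				assume "f 1 \<bullet> t ~: Ints"
				then have "f 1 \<bullet> t - 1 / 2 : Ints" using half_integer_shift two[of 1] by simp
				then have "(f 1 \<bullet> t - 1 / 2) - (f l \<bullet> t - 1 / 2) : Ints" using hl by (rule Ints_diff)
				then show False using ne by simp
			qed
			then have "f 1 \<bullet> t - 1 / 2 - 1 / 2 : Ints" by simp
			then show ?thesis using hl by (intro exI[of _ "1 / 2"]) simp
		qed
		then obtain d where d: "2 * d : Ints" "f 1 \<bullet> t - 1 / 2 - d : Ints" "f l \<bullet> t - d : Ints" by blast
		obtain e where e: "ALL i:{1..l}. f i \<bullet> e = (if i = 1 | i = l then 0 else f i \<bullet> t - d)"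
			using exists_coordinates[of "%i. if i = 1 | i = l then 0 else f i \<bullet> t - d"] by blast
		have "w e = e" using e fixed l by auto
		moreover have "t - p - e : coweights \<Phi>"
			by (rule latI[OF d(1)]) (use e p d(2,3) l in \<open>auto simp: inner_diff_right\<close>)
		moreover have "t = p + e + (t - p - e)" by simp
		ultimately show ?thesis using totatives_2 by blast
	qed
	have Creg: "(ALL \<beta>:signed_roots ?h ?F {2}. \<beta> \<bullet> y ~: Ints) <-> C y" for y
		using shifted_type_C_regular[OF h(1), of y] unfolding C_def h(3) .
	have d: "scaled 2 (short_roots (folded_roots \<Phi> w)) \<union> long_roots (folded_roots \<Phi> w) = signed_roots ?h ?F {2}"
		unfolding fold by (rule F.dual_B) (use l in simp)
	have "folding_statement \<Phi> (Type_D l) 1 w"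
	proof (rule folding_statementI[OF root_system w fo order _ _ _ refl p1 p2 lam1 lam2 lam3 cover])
		show "folding_table \<Phi> (folded_roots \<Phi> w) 2 (Type_D l) 1 (Type_B ?h) (signed_roots ?h ?F {2}) (Type_C ?h) 1"
			using folding_table.D_vector[OF l, of \<Phi> "folded_roots \<Phi> w" 2] unfolding d .
		show "root_system_of_type (fixed_space w) (folded_roots \<Phi> w) (Type_B ?h)"
			unfolding fold by (rule F.type_B[OF h(2)])
		show "root_system_of_type (fixed_space w) (signed_roots ?h ?F {2}) (Type_C ?h)"
			unfolding fold by (rule F.type_C[OF h(2)])
		show "(ALL \<beta>:\<Phi>. \<beta> \<bullet> (p + y) ~: Ints) <-> (ALL \<beta>:signed_roots ?h ?F {2}. real 1 * (\<beta> \<bullet> y) ~: Ints)"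
			if "w y = y" for y
			unfolding reg[OF that] using Creg[of y] by simp
	qed auto
	then show ?thesis using om by simp
qed

text \<open>
	The roots \<open>f (j - 1) + f j\<close> have coefficient 2 at the inner nodes \<open>2,
	\<dots>, l - 2\<close>.
\<close>

lemma minuscule_D:
	assumes rs: "root_system_in UNIV \<Phi>" "reduced_roots \<Phi>" "irreducible_roots \<Phi>"
		and b: "bourbaki_simple_roots (Type_D l) \<Phi> \<a>" and l: "4 <= l"
		and j: "j : minuscule_indices l \<Phi> \<a> - {0}"
	shows "j : {1, l - 1, l}"
proof (rule ccontr)
	assume nj: "j ~: {1, l - 1, l}"
	obtain f N where S: "signed_system l f N \<Phi> {} \<a>" and last: "\<a> l = f (l - 1) + f l"
		using type_D_coordinates[OF rs(1,2) b l] by blast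
	interpret signed_system l f N \<Phi> "{}" \<a> by (rule S)
	have jr: "2 <= j" "Suc j <= l - 1" using minuscule_index_range[OF j] nj by auto
	have r: "1 *R f 1 + 1 *R f 2 : \<Phi>" unfolding roots_eq using l by (intro signed_rootsI(1)) auto
	have "(f 1 - f j) + (f 2 - f j) + (f (Suc j) + f (Suc j)) : nat_cone l \<a>"
		using jr l by (intro nat_cone_add difference_cone[OF diff] sum_cone_D[OF diff last]) auto
	moreover have "\<a> j = f j - f (Suc j)" using jr l by (intro diff) auto
	then have "1 *R f 1 + 1 *R f 2 - 2 *R \<a> j = (f 1 - f j) + (f 2 - f j) + (f (Suc j) + f (Suc j))"
		by (simp only: scaleR_2 scaleR_one) (simp add: algebra_simps)
	ultimately have "1 *R f 1 + 1 *R f 2 - 2 *R \<a> j : nat_cone l \<a>" by (simp only:)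
	then show False using minuscule_no_coefficient_two[OF rs simple _ _ r] j by blast
qed

section \<open>Types C and D with a spin coweight\<close>

text \<open>
	Elements \<open>t\<close> that are fixed up to the lattice have coordinates \<open>1/4 + Y i\<close> with \<open>Y\<close> antisymmetric
	under \<open>i \<mapsto> m + 1 - i\<close>.  The next two lemmas translate regularity to the first half of \<open>Y\<close>.
\<close>

declare eq_divide_eq_numeral1 [simp del]

lemma antisymmetric_representative:
	fixes Y :: "nat => real"
	assumes "!!i. i : {a..m + 1 - a} ==> Y (m + 1 - i) = - Y i" "1 <= a" "i : {a..m + 1 - a}"
	shows "2 * i = m + 1 & Y i = 0 | (EX r:{a..m div 2}. i = r & Y i = Y r | i = m + 1 - r & Y i = - Y r)"
proof -
	consider "2 * i = m + 1" | "i <= m div 2" | "m + 1 - i <= m div 2" by linarith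
	then show ?thesis
	proof cases
		case 1
		then have "m + 1 - i = i" by simp
		then show ?thesis using assms(1)[OF assms(3)] 1 by simp
	next
		case 2
		then show ?thesis using assms(3) by auto
	next
		case 3
		have "Y i = - Y (m + 1 - i)" using assms(1)[OF assms(3)] by simp
		moreover have "m + 1 - i : {a..m div 2}" "i = m + 1 - (m + 1 - i)" using 3 assms(2,3) by auto
		ultimately show ?thesis by blast
	qed
qed

lemma antisymmetric_pairs_iff:
	fixes Y :: "nat => real"
	assumes anti: "!!i. i : {a..m + 1 - a} ==> Y (m + 1 - i) = - Y i" and a: "1 <= a"
	shows "(ALL i:{a..m + 1 - a}. ALL k:{a..m + 1 - a}. i ~= k --> 1 / 2 + (Y i + Y k) ~: Ints & Y i - Y k ~: Ints) <->
		(ALL r:{a..m div 2}. ALL s:{a..m div 2}. r ~= s --> 2 * (Y r + Y s) ~: Ints & 2 * (Y r - Y s) ~: Ints) &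
		(ALL r:{a..m div 2}. 2 * Y r ~: Ints)" (is "?L <-> ?R1 & ?R2")
proof
	assume L: ?L
	have sub: "r : {a..m + 1 - a}" "m + 1 - r : {a..m + 1 - a}" if "r : {a..m div 2}" for r
		using that a by auto
	have "2 * (Y r + Y s) ~: Ints & 2 * (Y r - Y s) ~: Ints" if rs: "r : {a..m div 2}" "s : {a..m div 2}" "r ~= s" for r s
	proof -
		have "r ~= m + 1 - s" using rs a by auto
		then have "1 / 2 + (Y r + - Y s) ~: Ints" "Y r - - Y s ~: Ints"
			using L sub[OF rs(1)] sub[OF rs(2)] anti[OF sub(1)[OF rs(2)]] by metis+
		moreover have "1 / 2 + (Y r + Y s) ~: Ints" "Y r - Y s ~: Ints"
			using L sub[OF rs(1)] sub[OF rs(2)] rs(3) by blast+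
		ultimately show ?thesis unfolding half_integer_iff by (simp add: add.commute)
	qed
	moreover have "2 * Y r ~: Ints" if r: "r : {a..m div 2}" for r
	proof -
		have "r ~= m + 1 - r" using r a by auto
		then have "Y r - - Y r ~: Ints" using L sub[OF r] anti[OF sub(1)[OF r]] by metis
		then show ?thesis by simp
	qed
	ultimately show "?R1 & ?R2" by blast
next
	assume R: "?R1 & ?R2"
	have two: "2 * Y r ~: Ints" "2 * - Y r ~: Ints" if "r : {a..m div 2}" for r
		using R that Ints_minus_iff[of "2 * Y r"] by auto
	have zero: "1 / 2 + (x + 0) ~: Ints & x - 0 ~: Ints & 1 / 2 + (0 + x) ~: Ints & 0 - x ~: Ints" if "2 * x ~: Ints" for x :: real
		using not_half_integer[OF that] by simp
	have opp: "1 / 2 + (x + - x) ~: Ints & x - - x ~: Ints" if "2 * x ~: Ints" for x :: real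
		using that half_not_integer by simp
	have diff: "1 / 2 + (x + y) ~: Ints & x - y ~: Ints"
		if "2 * (u + v) ~: Ints" "2 * (u - v) ~: Ints" "x = u | x = - u" "y = v | y = - v" for x y u v :: real
		using that(3,4) not_half_integer[OF that(1)] not_half_integer[OF that(2)]
			Ints_minus_iff[of "u + v"] Ints_minus_iff[of "u - v"] Ints_minus_iff[of "u + v - 1 / 2"] Ints_minus_iff[of "u - v - 1 / 2"]
		by (elim disjE) (simp_all add: algebra_simps)
	show ?L
	proof (intro ballI impI)
		fix i k assume i: "i : {a..m + 1 - a}" and k: "k : {a..m + 1 - a}" and ik: "i ~= k"
		have ri: "2 * i = m + 1 & Y i = 0 | (EX r:{a..m div 2}. i = r & Y i = Y r | i = m + 1 - r & Y i = - Y r)"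
			by (rule antisymmetric_representative[where Y = Y and a = a and m = m, OF anti a i])
		have rk: "2 * k = m + 1 & Y k = 0 | (EX r:{a..m div 2}. k = r & Y k = Y r | k = m + 1 - r & Y k = - Y r)"
			by (rule antisymmetric_representative[where Y = Y and a = a and m = m, OF anti a k])
		have both: "1 / 2 + (Y i + Y k) ~: Ints & Y i - Y k ~: Ints"
			if r: "r : {a..m div 2}" "i = r & Y i = Y r | i = m + 1 - r & Y i = - Y r"
			 and s: "s : {a..m div 2}" "k = s & Y k = Y s | k = m + 1 - s & Y k = - Y s" for r s
		proof (cases "r = s")
			case True
			then have "Y k = - Y i" "2 * Y i ~: Ints" using r s ik two[OF r(1)] by auto
			then show ?thesis using opp[of "Y i"] by metis
		next
			case False
			then have "2 * (Y r + Y s) ~: Ints" "2 * (Y r - Y s) ~: Ints" using R r(1) s(1) by blast+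
			then show ?thesis by (rule diff) (use r(2) s(2) in auto)
		qed
		from ri show "1 / 2 + (Y i + Y k) ~: Ints & Y i - Y k ~: Ints"
		proof
			assume i0: "2 * i = m + 1 & Y i = 0"
			then obtain s where "s : {a..m div 2}" "Y k = Y s | Y k = - Y s" using rk ik by auto
			then have "2 * Y k ~: Ints" using two[of s] by auto
			then show ?thesis using zero[of "Y k"] i0 by metis
		next
			assume "EX r:{a..m div 2}. i = r & Y i = Y r | i = m + 1 - r & Y i = - Y r"
			then obtain r where r: "r : {a..m div 2}" "i = r & Y i = Y r | i = m + 1 - r & Y i = - Y r" by blast
			from rk show ?thesis
			proof
				assume k0: "2 * k = m + 1 & Y k = 0"
				have "2 * Y i ~: Ints" using two[OF r(1)] r(2) by auto
				then show ?thesis using zero[of "Y i"] k0 by metis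
			next
				assume "EX r:{a..m div 2}. k = r & Y k = Y r | k = m + 1 - r & Y k = - Y r"
				then show ?thesis using both[OF r] by blast
			qed
		qed
	qed
qed

lemma antisymmetric_singles_iff:
	fixes Y :: "nat => real"
	assumes anti: "!!i. i : {a..m + 1 - a} ==> Y (m + 1 - i) = - Y i" and a: "1 <= a"
		and two: "ALL r:{a..m div 2}. 2 * Y r ~: Ints"
	shows "(ALL i:{a..m + 1 - a}. 1 / 2 + 2 * Y i ~: Ints) <-> (ALL r:{a..m div 2}. 4 * Y r ~: Ints)"
proof
	assume L: "ALL i:{a..m + 1 - a}. 1 / 2 + 2 * Y i ~: Ints"
	show "ALL r:{a..m div 2}. 4 * Y r ~: Ints"
	proof
		fix r assume r: "r : {a..m div 2}"
		then have "1 / 2 + 2 * Y r ~: Ints" using L a by auto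
		then have "2 * (2 * Y r) ~: Ints" unfolding half_integer_iff[of "2 * Y r"] using two r by (simp add: add.commute)
		then show "4 * Y r ~: Ints" by simp
	qed
next
	assume R: "ALL r:{a..m div 2}. 4 * Y r ~: Ints"
	show "ALL i:{a..m + 1 - a}. 1 / 2 + 2 * Y i ~: Ints"
	proof
		fix i assume i: "i : {a..m + 1 - a}"
		have "1 / 2 + 2 * Y r ~: Ints" "1 / 2 - 2 * Y r ~: Ints" if "r : {a..m div 2}" for r
			using not_half_integer(3,4)[of "2 * Y r"] R that by auto
		then show "1 / 2 + 2 * Y i ~: Ints"
			using antisymmetric_representative[where Y = Y and a = a and m = m, OF anti a i] half_not_integer by auto
	qed
qed

text \<open>
	Every pair of coordinates is exchanged up to sign by one reflection.
\<close>

lemma (in signed_system) flip_partial: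
	assumes "2 * h <= m"
	shows "EX w:weyl_group \<Phi>. ALL i:{1..m}. w (f i) = (if i <= h | m < i + h then - f (m + 1 - i) else f i)"
	using assms
proof (induction h)
	case 0
	show ?case by (rule bexI[OF _ reflection_group.id]) auto
next
	case (Suc h)
	then obtain w where w: "w : weyl_group \<Phi>"
		"!!i. i : {1..m} ==> w (f i) = (if i <= h | m < i + h then - f (m + 1 - i) else f i)" by auto
	let ?s = "root_reflection (1 *R f (Suc h) + 1 *R f (m - h))"
	have s: "?s : weyl_group \<Phi>" using Suc.prems by (intro reflection_in_weyl signed_rootsI(1)) auto
	have sf: "?s (f p) = (if p = Suc h then - f (m - h) else if p = m - h then - f (Suc h) else f p)" if "p : {1..m}" for p
		using reflection_pair[of "Suc h" "m - h" 1 1 p] Suc.prems that by auto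
	have "(?s \<circ> w) (f i) = (if i <= Suc h | m < i + Suc h then - f (m + 1 - i) else f i)" if i: "i : {1..m}" for i
	proof -
		consider "i <= h | m < i + h" | "i = Suc h" | "i = m - h" | "Suc h < i" "i < m - h" by linarith
		then show ?thesis
		proof cases
			case 1
			then have "m + 1 - i : {1..m}" "m + 1 - i ~= Suc h" "m + 1 - i ~= m - h" using Suc.prems i by auto
			then show ?thesis using 1 w(2)[OF i] sf[of "m + 1 - i"] by (auto simp: linear_neg[OF linear_root_reflection])
		next
			case 2
			then show ?thesis using w(2)[OF i] sf[OF i] Suc.prems by auto
		next
			case 3
			then have "m + 1 - i = Suc h" using Suc.prems by auto
			then show ?thesis using 3 w(2)[OF i] sf[OF i] Suc.prems by (auto simp: plus_1_eq_Suc)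
		next
			case 4
			then show ?thesis using w(2)[OF i] sf[OF i] Suc.prems by auto
		qed
	qed
	then show ?case using reflection_group_comp[OF s w(1)] by blast
qed

lemma (in signed_system) flip_full:
	assumes "even m | 2 : A"
	shows "EX w:weyl_group \<Phi>. ALL i:{1..m}. w (f i) = - f (m + 1 - i)"
proof -
	have h: "2 * (m div 2) <= m" by simp
	obtain w where w: "w : weyl_group \<Phi>"
		"!!i. i : {1..m} ==> w (f i) = (if i <= m div 2 | m < i + m div 2 then - f (m + 1 - i) else f i)"
		using flip_partial[OF h] by auto
	show ?thesis
	proof (cases "even m")
		case True
		then have "i <= m div 2 | m < i + m div 2" for i by (auto elim!: evenE)
		then have "ALL i:{1..m}. w (f i) = - f (m + 1 - i)" using w(2) by (simp only: if_True) blast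
		then show ?thesis using w(1) by blast
	next
		case False
		then obtain r where r: "m = 2 * r + 1" by (elim oddE)
		let ?s = "root_reflection (2 *R f (Suc r))"
		have s: "?s : weyl_group \<Phi>" using assms False r by (intro reflection_in_weyl signed_rootsI(2)) auto
		have sf: "?s (f p) = (if p = Suc r then - f p else f p)" if "p : {1..m}" for p
			using reflection_single[of "Suc r" 2 p] r that by auto
		have "(?s \<circ> w) (f i) = - f (m + 1 - i)" if i: "i : {1..m}" for i
		proof (cases "i = Suc r")
			case True
			then show ?thesis using w(2)[OF i] sf[OF i] r by simp
		next
			case False
			then have "w (f i) = - f (m + 1 - i)" using w(2)[OF i] r i by auto
			moreover have "m + 1 - i : {1..m}" "m + 1 - i ~= Suc r" using False r i by auto
			ultimately show ?thesis using sf[of "m + 1 - i"] by (auto simp: linear_neg[OF linear_root_reflection])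
		qed
		then show ?thesis using reflection_group_comp[OF s w(1)] by blast
	qed
qed

text \<open>
	Type C and type D of even rank with \<open>j = l\<close>: \<open>\<omega>\<close> reverses the
	coordinates with a sign.
\<close>

locale flip_system = signed_system m f N \<Phi> A \<a>
	for m :: nat and f :: "nat => 'a::euclidean_space" and N :: real and \<Phi> :: "'a set" and A :: "real set"
		and \<a> :: "nat => 'a" +
	fixes w :: "'a => 'a"
	assumes w: "w : weyl_group \<Phi>" and wf: "!!i. i : {1..m} ==> w (f i) = - f (m + 1 - i)"
		and A2: "A \<subseteq> {2}" "odd m ==> A = {2}" and m3: "3 <= m"
begin

lemma lin: "linear w" and orth: "orthogonal_transformation w"
	using in_weyl_linear[OF w] reflection_group_orthogonal[OF w] by auto

lemma flip_index: "i : {1..m} ==> m + 1 - i : {1..m} & m + 1 - (m + 1 - i) = i"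
	by auto

lemma ww: "w (w x) = x"
proof -
	have "w (w (f i)) = f i" if "i : {1..m}" for i
		using wf[OF that] wf[of "m + 1 - i"] flip_index[OF that] by (simp add: linear_neg[OF lin])
	then have "w \<circ> w = id"
		using linear_ext[of "w \<circ> w" id] lin by (simp add: linear_compose linear_id[unfolded id_def] id_def)
	then show ?thesis by (metis comp_apply id_apply)
qed

lemma w_consecutive: "i : {1..<m} ==> w (\<a> i) = \<a> (m - i)"
proof -
	assume i: "i : {1..<m}"
	then have e: "Suc (m - i) = m + 1 - i" "m + 1 - Suc i = m - i" "m - i : {1..<m}" by auto
	then show ?thesis using diff[OF i] diff[OF e(3)] wf[of i] wf[of "Suc i"] i by (simp add: linear_diff[OF lin])
qed

lemma order: "map_order w = 2"
proof (rule map_order_involution[OF ww, where y = "f 1"])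
	have "w (f 1) \<bullet> f 1 = 0" using wf[of 1] inner_family[of m 1] m3 by simp
	then show "w (f 1) ~= f 1" using inner_family[of 1 1] m3 N_pos by auto
qed

lemma finite_order: "0 < (2::nat)" "w ^^ 2 = id"
	using ww by (auto simp: fun_eq_iff numeral_2_eq_2)

lemma fixed: "w y = y <-> (ALL i:{1..m}. f (m + 1 - i) \<bullet> y = - (f i \<bullet> y))"
proof -
	have "w (f i) \<bullet> y = f i \<bullet> y <-> f (m + 1 - i) \<bullet> y = - (f i \<bullet> y)" if "i : {1..m}" for i
		unfolding wf[OF that] inner_minus_left by linarith
	then show ?thesis unfolding fixed_iff[OF orth] by simp
qed

definition F :: "nat => 'a" where "F i = (1 / 2) *R (f i - f (m + 1 - i))"

lemma F_family: "orthogonal_family (m div 2) F (N / 2)"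
proof
	fix i k assume ik: "i : {1..m div 2}" "k : {1..m div 2}"
	then have "i : {1..m}" "k : {1..m}" "m + 1 - i : {1..m}" "m + 1 - k : {1..m}"
		"i ~= m + 1 - k" "m + 1 - i ~= k" "m + 1 - i = m + 1 - k <-> i = k" by auto
	then show "F i \<bullet> F k = (if i = k then N / 2 else 0)"
		by (simp add: F_def inner_diff_left inner_diff_right inner_family)
qed (use N_pos in simp)

lemma F_inner: "w y = y ==> i : {1..m} ==> F i \<bullet> y = f i \<bullet> y"
	using fixed by (simp add: F_def inner_diff_left)

lemma avg: "i : {1..m} ==> orbit_average w (f i) = F i"
proof (rule orbit_average_eqI[OF orth finite_order])
	assume i: "i : {1..m}"
	show "w (F i) = F i"
		using wf[OF i] wf[of "m + 1 - i"] flip_index[OF i] by (simp add: F_def linear_scale[OF lin] linear_diff[OF lin])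
	show "F i \<bullet> y = f i \<bullet> y" if "w y = y" for y by (rule F_inner[OF that i])
qed

lemma F_flip: "i : {1..m} ==> F (m + 1 - i) = - F i"
	using flip_index[of i] by (simp add: F_def algebra_simps)

lemma fold: "folded_roots \<Phi> w = signed_roots (m div 2) F (if odd m then {1,2} else {2})"
		"fixed_space w = span (F ` {1..m div 2})"
proof -
	interpret F: orthogonal_family "m div 2" F "N / 2" by (rule F_family)
	have F0: "2 * i = m + 1" if i: "i : {1..m}" "F i = 0" for i
	proof (rule ccontr)
		assume "2 * i ~= m + 1"
		then have "m + 1 - i ~= i" using i by auto
		then have "F i \<bullet> f i = N / 2" using i(1) flip_index[OF i(1)] by (simp add: F_def inner_diff_left inner_family)
		then show False using i N_pos by simp
	qed
	have "folded_roots (signed_roots m f A) w = signed_roots (m div 2) F (if odd m then {1,2} else {2}) &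
		fixed_space w = span (F ` {1..m div 2})"
	proof (rule folded_signed_roots[OF orth finite_order full F_family])
		fix i assume i: "i : {1..m}"
		consider "2 * i = m + 1" | "i <= m div 2" | "m + 1 - i <= m div 2" by linarith
		then show "orbit_average w (f i) = 0 | (EX p:{1..m div 2}. EX a. \<bar>a\<bar> = 1 & orbit_average w (f i) = a *R F p)"
		proof cases
			case 1
			then have "m + 1 - i = i" by simp
			then show ?thesis using avg[OF i] by (simp add: F_def)
		next
			case 2
			then show ?thesis using avg[OF i] i by (intro disjI2 bexI[of _ i] exI[of _ 1]) auto
		next
			case 3
			then show ?thesis using avg[OF i] i F_flip[OF i]
				by (intro disjI2 bexI[of _ "m + 1 - i"] exI[of _ "-1"]) auto
		qed
	next
		fix p assume "p : {1..m div 2}"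
		then show "EX i:{1..m}. orbit_average w (f i) = F p" using avg[of p] by (intro bexI[of _ p]) auto
	next
		fix i assume "i : {1..m}" "orbit_average w (f i) = 0"
		then have "2 * i = m + 1" using F0 avg by simp
		then have "odd m" by presburger
		then show "1 : (if odd m then {1,2} else {2::real})" by simp
	next
		assume "1 : (if odd m then {1,2} else {2::real})"
		then have "odd m" by (auto split: if_splits)
		then obtain r where r: "m = 2 * r + 1" by (elim oddE)
		then have "m + 1 - Suc r = Suc r" by simp
		then have "F (Suc r) = 0" by (simp add: F_def)
		then show "1 : A | (EX i:{1..m}. orbit_average w (f i) = 0)"
			using avg[of "Suc r"] r by (intro disjI2 bexI[of _ "Suc r"]) auto
	next
		fix p assume p: "p : {1..m div 2}"
		then have pm: "p : {1..m}" "m + 1 - p : {1..m}" "p ~= m + 1 - p" by auto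
		then show "2 : A | (EX i:{1..m}. EX k:{1..m}. i ~= k & orbit_average w (f i) = F p & orbit_average w (f k) = - F p)"
			using avg[OF pm(1)] avg[OF pm(2)] F_flip[OF pm(1)] by metis
	qed (use A(1) A2 in \<open>auto split: if_splits\<close>)
	then show "folded_roots \<Phi> w = signed_roots (m div 2) F (if odd m then {1,2} else {2})"
		"fixed_space w = span (F ` {1..m div 2})" unfolding roots_eq by blast+
qed

definition p :: 'a where "p = (SOME p. ALL i:{1..m}. f i \<bullet> p = 1 / 4)"

lemma p: "i : {1..m} ==> f i \<bullet> p = 1 / 4"
	unfolding p_def using someI_ex[OF exists_coordinates[of "%_. 1 / 4"]] by blast

lemma inner_w: "i : {1..m} ==> f i \<bullet> w t = - (f (m + 1 - i) \<bullet> t)"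
	using orthogonal_inverse_inner[OF orth ww, of "f i" t] wf by simp

lemma p_lattice: "real 2 *R p : coweights \<Phi>" "p - w p : coweights \<Phi>"
proof -
	show "real 2 *R p : coweights \<Phi>"
		by (rule lattice_shifted[OF A2(1), of "1 / 2"]) (simp_all add: p)
	show "p - w p : coweights \<Phi>"
	proof (rule lattice_shifted[OF A2(1), of "1 / 2"])
		fix i assume i: "i : {1..m}"
		then show "f i \<bullet> (p - w p) - 1 / 2 : Ints"
			using inner_w[OF i, of p] p[OF i] p[of "m + 1 - i"] flip_index[OF i] by (simp add: inner_diff_right)
	qed simp
qed

lemma lam: "z : coweights \<Phi> ==> (f 1 + f m) \<bullet> z : Ints"
		"w y = y ==> (f 1 + f m) \<bullet> y = 0"
		"k : totatives 2 ==> (f 1 + f m) \<bullet> p - real k / real 2 : Ints"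
proof -
	show "(f 1 + f m) \<bullet> z : Ints" if "z : coweights \<Phi>"
		using lattice_integral(1)[OF A2(1) _ that, of 1 m] m3 by (simp add: inner_add_left)
	show "(f 1 + f m) \<bullet> y = 0" if "w y = y"
	proof -
		have "f (m + 1 - 1) \<bullet> y = - (f 1 \<bullet> y)" by (rule bspec[OF that[unfolded fixed]]) (use m3 in simp)
		then show ?thesis by (simp add: inner_add_left)
	qed
	show "(f 1 + f m) \<bullet> p - real k / real 2 : Ints" if "k : totatives 2"
		using that p[of 1] p[of m] m3 by (simp add: totatives_2 inner_add_left)
qed

lemma cover:
	assumes t: "t - w t : coweights \<Phi>" and r: "ALL \<beta>:\<Phi>. \<beta> \<bullet> t ~: Ints"
	shows "EX k:totatives 2. EX e z. w e = e & z : coweights \<Phi> & t = p + e + z"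
proof -
	have m2: "2 <= m" using m3 by simp
	have u: "f i \<bullet> (t - w t) = f i \<bullet> t + f (m + 1 - i) \<bullet> t" if "i : {1..m}" for i
		using inner_w[OF that, of t] by (simp add: inner_diff_right)
	have u1: "f 1 \<bullet> (t - w t) ~: Ints" using u[of 1] r m3 unfolding regular_iff by auto
	have "2 * (f 1 \<bullet> (t - w t)) : Ints" using lattice_integral(1)[OF A2(1) m2 t, of 1 1] m3 by simp
	then have h1: "f 1 \<bullet> (t - w t) - 1 / 2 : Ints" using u1 half_integer_shift by blast
	have half: "f i \<bullet> t + f (m + 1 - i) \<bullet> t - 1 / 2 : Ints" if i: "i : {1..m}" for i
	proof -
		have "f i \<bullet> (t - w t) - f 1 \<bullet> (t - w t) : Ints" using lattice_integral(2)[OF A2(1) m2 t i, of 1] m3 by simp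
		then have "(f i \<bullet> (t - w t) - f 1 \<bullet> (t - w t)) + (f 1 \<bullet> (t - w t) - 1 / 2) : Ints" using h1 by (rule Ints_add)
		then show ?thesis using u[OF i] by (simp add: add_diff_eq)
	qed
	define d where "d = (if odd m then f (Suc (m div 2)) \<bullet> t - 1 / 4 else 0)"
	have mid: "f i \<bullet> t - 1 / 4 = d" if "2 * i = m + 1" for i
	proof -
		have "odd m" "i = Suc (m div 2)" using that by presburger+
		then show ?thesis by (simp add: d_def)
	qed
	have d2: "2 * d : Ints"
	proof (cases "odd m")
		case True
		then obtain r where rr: "m = 2 * r + 1" by (elim oddE)
		then show ?thesis using half[of "Suc r"] by (simp add: d_def algebra_simps)
	qed (simp add: d_def)
	obtain e where e: "ALL i:{1..m}. f i \<bullet> e = (if 2 * i < m + 1 then f i \<bullet> t - 1 / 4 - d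
			else if 2 * i = m + 1 then 0 else - (f (m + 1 - i) \<bullet> t - 1 / 4 - d))"
		using exists_coordinates[of "%i. if 2 * i < m + 1 then f i \<bullet> t - 1 / 4 - d
			else if 2 * i = m + 1 then 0 else - (f (m + 1 - i) \<bullet> t - 1 / 4 - d)"] by blast
	have "w e = e"
		unfolding fixed
	proof
		fix i assume i: "i : {1..m}"
		consider "2 * i < m + 1" | "2 * i = m + 1" | "m + 1 < 2 * i" by linarith
		then show "f (m + 1 - i) \<bullet> e = - (f i \<bullet> e)"
		proof cases
			case 1
			then have "~ 2 * (m + 1 - i) < m + 1" "2 * (m + 1 - i) ~= m + 1" using i by auto
			then show ?thesis using e i flip_index[OF i] 1 by auto
		next
			case 2
			then have "m + 1 - i = i" by simp
			then show ?thesis using e i 2 by auto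
		next
			case 3
			then have "2 * (m + 1 - i) < m + 1" using i by auto
			then show ?thesis using e i flip_index[OF i] 3 by auto
		qed
	qed
	moreover have "t - p - e : coweights \<Phi>"
	proof (rule lattice_shifted[OF A2(1) d2])
		fix i assume i: "i : {1..m}"
		consider "2 * i < m + 1" | "2 * i = m + 1" | "m + 1 < 2 * i" by linarith
		then show "f i \<bullet> (t - p - e) - d : Ints"
		proof cases
			case 1
			then show ?thesis using e i p[OF i] by (simp add: inner_diff_right)
		next
			case 2
			then show ?thesis using e i p[OF i] mid[OF 2] by (simp add: inner_diff_right)
		next
			case 3
			then have "f i \<bullet> (t - p - e) - d = (f i \<bullet> t + f (m + 1 - i) \<bullet> t - 1 / 2) - 2 * d"
				using e i p[OF i] by (simp add: inner_diff_right)
			also have "\<dots> : Ints" using half[OF i] d2 by (rule Ints_diff)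
			finally show ?thesis .
		qed
	qed
	moreover have "t = p + e + (t - p - e)" by simp
	ultimately show ?thesis using totatives_2 by blast
qed

lemma regular:
	assumes y: "w y = y"
	shows "(ALL \<beta>:\<Phi>. \<beta> \<bullet> (p + y) ~: Ints) <->
		((ALL i:{1..m div 2}. ALL k:{1..m div 2}. i ~= k --> 2 * (F i \<bullet> y + F k \<bullet> y) ~: Ints & 2 * (F i \<bullet> y - F k \<bullet> y) ~: Ints) &
		(ALL i:{1..m div 2}. 2 * (F i \<bullet> y) ~: Ints)) & (2 : A --> (ALL i:{1..m div 2}. 4 * (F i \<bullet> y) ~: Ints))"
proof -
	let ?Y = "%i. f i \<bullet> y"
	have anti: "f (m + 1 - i) \<bullet> y = - (f i \<bullet> y)" if "i : {1..m + 1 - 1}" for i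
		using y that unfolding fixed by simp
	have c: "f i \<bullet> (p + y) + f k \<bullet> (p + y) = 1 / 2 + (f i \<bullet> y + f k \<bullet> y)"
		"f i \<bullet> (p + y) - f k \<bullet> (p + y) = f i \<bullet> y - f k \<bullet> y" if "i : {1..m}" "k : {1..m}" for i k
		using p[OF that(1)] p[OF that(2)] by (simp_all add: inner_add_right)
	have c2: "2 * (f i \<bullet> (p + y)) = 1 / 2 + 2 * (f i \<bullet> y)" if "i : {1..m}" for i
		using p[OF that] by (simp add: inner_add_right)
	have FI: "F i \<bullet> y = f i \<bullet> y" if "i : {1..m div 2}" for i using F_inner[OF y, of i] that by auto
	have s: "(ALL i:{1..m}. ALL c:A. c * (f i \<bullet> (p + y)) ~: Ints) <-> (2 : A --> (ALL i:{1..m}. 1 / 2 + 2 * (f i \<bullet> y) ~: Ints))"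
	proof (cases "2 : A")
		case True
		then have "A = {2}" using A2(1) by blast
		then show ?thesis using c2 by simp
	next
		case False
		then have "A = {}" using A2(1) by blast
		then show ?thesis by simp
	qed
	have "(ALL \<beta>:\<Phi>. \<beta> \<bullet> (p + y) ~: Ints) <->
		(ALL i:{1..m + 1 - 1}. ALL k:{1..m + 1 - 1}. i ~= k --> 1 / 2 + (?Y i + ?Y k) ~: Ints & ?Y i - ?Y k ~: Ints) &
		(2 : A --> (ALL i:{1..m + 1 - 1}. 1 / 2 + 2 * ?Y i ~: Ints))"
		unfolding regular_iff s using c by simp
	also have "\<dots> <->
		((ALL i:{1..m div 2}. ALL k:{1..m div 2}. i ~= k --> 2 * (?Y i + ?Y k) ~: Ints & 2 * (?Y i - ?Y k) ~: Ints) &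
		(ALL i:{1..m div 2}. 2 * ?Y i ~: Ints)) & (2 : A --> (ALL i:{1..m div 2}. 4 * ?Y i ~: Ints))"
		using antisymmetric_pairs_iff[where a = 1 and m = m and Y = ?Y, OF anti]
			antisymmetric_singles_iff[where a = 1 and m = m and Y = ?Y, OF anti] by auto
	also have "\<dots> <->
		((ALL i:{1..m div 2}. ALL k:{1..m div 2}. i ~= k --> 2 * (F i \<bullet> y + F k \<bullet> y) ~: Ints & 2 * (F i \<bullet> y - F k \<bullet> y) ~: Ints) &
		(ALL i:{1..m div 2}. 2 * (F i \<bullet> y) ~: Ints)) & (2 : A --> (ALL i:{1..m div 2}. 4 * (F i \<bullet> y) ~: Ints))"
		using FI by simp
	finally show ?thesis .
qed

lemmas statement_facts = refl p_lattice lam cover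

end

text \<open>
	By the long root \<open>2 f 1\<close>, only \<open>j = l\<close> has mark 1.
\<close>

lemma folding_statement_C:
	assumes rs: "root_system_in UNIV \<Phi>" "reduced_roots \<Phi>" "irreducible_roots \<Phi>"
		and b: "bourbaki_simple_roots (Type_C l) \<Phi> \<a>" and l: "3 <= l"
		and j: "j : minuscule_indices l \<Phi> \<a> - {0}"
	shows "folding_statement \<Phi> (Type_C l) j (omega l \<Phi> \<a> j)"
proof -
	obtain f N where S: "signed_system l f N \<Phi> {2} \<a>" and last: "\<a> l = 2 *R f l"
		using type_C_coordinates[OF rs(1,2) b] l by auto
	interpret signed_system l f N \<Phi> "{2}" \<a> by (rule S)
	have jr: "j : {1..l}" by (rule minuscule_index_range[OF j])
	have jl: "j = l"
	proof (rule ccontr)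
		assume "j ~= l"
		then have j2: "1 <= j" "Suc j <= l" using jr by auto
		have r: "2 *R f 1 : \<Phi>" unfolding roots_eq using l by (intro signed_rootsI(2)) auto
		have "(f 1 - f j) + (f 1 - f j) + (f (Suc j) + f (Suc j)) : nat_cone l \<a>"
			using j2 by (intro nat_cone_add difference_cone[OF diff] sum_cone_C[OF diff last]) auto
		moreover have "\<a> j = f j - f (Suc j)" using j2 by (intro diff) auto
		then have "2 *R f 1 - 2 *R \<a> j = (f 1 - f j) + (f 1 - f j) + (f (Suc j) + f (Suc j))"
			by (simp only: scaleR_2) (simp add: algebra_simps)
		ultimately have "2 *R f 1 - 2 *R \<a> j : nat_cone l \<a>" by (simp only:)
		then show False using minuscule_no_coefficient_two[OF rs simple _ _ r] j by blast
	qed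
	obtain w where w: "w : weyl_group \<Phi>" "!!i. i : {1..l} ==> w (f i) = - f (l + 1 - i)"
		using flip_full by auto
	interpret flip_system l f N \<Phi> "{2}" \<a> w by unfold_locales (use w l in auto)
	interpret F: orthogonal_family "l div 2" F "N / 2" by (rule F_family)
	have om: "omega l \<Phi> \<a> l = w"
	proof (rule omega_eqI[OF root_system reduced simple _ w(1)])
		fix i assume i: "i : {1..l}"
		show "(EX k:{1..l} - {l}. w (\<a> i) = \<a> k) | - w (\<a> i) - \<a> l : nat_cone l \<a>"
		proof (cases "i = l")
			case True
			have "- w (\<a> i) - \<a> l = (f 1 - f l) + (f 1 - f l)"
				using True last wf[of l] l by (simp add: linear_add[OF lin] scaleR_2)
			also have "\<dots> : nat_cone l \<a>" using l by (intro nat_cone_add difference_cone[OF diff]) auto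
			finally show ?thesis by blast
		next
			case False
			then have "w (\<a> i) = \<a> (l - i)" using i by (intro w_consecutive) auto
			then show ?thesis using i False by (intro disjI1 bexI[of _ "l - i"]) auto
		qed
	qed (use l in auto)
	have h1: "1 <= l div 2" using l by simp
	have "folding_statement \<Phi> (Type_C l) l w"
	proof (cases "odd l")
		case True
		have e: "(l - 1) div 2 = l div 2" using True by presburger
		have t: "root_system_of_type (fixed_space w) (folded_roots \<Phi> w) (Type_BC (l div 2))"
			using F.type_BC[OF h1] True by (simp add: fold)
		show ?thesis
		proof (rule folding_statementI[OF root_system w(1) finite_order order _ t t statement_facts])
			show "folding_table \<Phi> (folded_roots \<Phi> w) 2 (Type_C l) l (Type_BC (l div 2)) (folded_roots \<Phi> w) (Type_BC (l div 2)) 2"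
				using folding_table.C_odd[OF l True, of \<Phi> "folded_roots \<Phi> w" 2] unfolding e .
			show "(ALL \<beta>:\<Phi>. \<beta> \<bullet> (p + y) ~: Ints) <-> (ALL \<beta>:folded_roots \<Phi> w. real 2 * (\<beta> \<bullet> y) ~: Ints)" if "w y = y" for y
				unfolding regular[OF that] fold
				using F.signed_roots_ball[where P = "%x. 2 * x ~: Ints" and A = "{1,2}" and t = y] True Ints_minus_iff by auto
		qed auto
	next
		case False
		then have l4: "4 <= l" "even l" using l by presburger+
		have t: "root_system_of_type (fixed_space w) (folded_roots \<Phi> w) (Type_C (l div 2))"
			using F.type_C[OF h1] l4 by (simp add: fold)
		have half: "2 * x ~: Ints" if "4 * x ~: Ints" for x :: real
			using that Ints_mult[of 2 "2 * x"] by auto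
		show ?thesis
		proof (rule folding_statementI[OF root_system w(1) finite_order order _ t t statement_facts])
			show "folding_table \<Phi> (folded_roots \<Phi> w) 2 (Type_C l) l (Type_C (l div 2)) (folded_roots \<Phi> w) (Type_C (l div 2)) 2"
				by (rule folding_table.C_even[OF l4])
			show "(ALL \<beta>:\<Phi>. \<beta> \<bullet> (p + y) ~: Ints) <-> (ALL \<beta>:folded_roots \<Phi> w. real 2 * (\<beta> \<bullet> y) ~: Ints)" if "w y = y" for y
				unfolding regular[OF that] fold
				using F.signed_roots_ball[where P = "%x. 2 * x ~: Ints" and A = "{2}" and t = y] l4 Ints_minus_iff half by auto
		qed auto
	qed
	then show ?thesis using om jl by simp
qed

lemma folding_statement_D_even:
	assumes rs: "root_system_in UNIV \<Phi>" "reduced_roots \<Phi>"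
		and b: "bourbaki_simple_roots (Type_D l) \<Phi> \<a>" and l: "4 <= l" "even l" and j: "j : {l - 1, l}"
	shows "folding_statement \<Phi> (Type_D l) j (omega l \<Phi> \<a> l)"
proof -
	obtain f N where S: "signed_system l f N \<Phi> {} \<a>" and last: "\<a> l = f (l - 1) + f l"
		using type_D_coordinates[OF rs b l(1)] by blast
	interpret signed_system l f N \<Phi> "{}" \<a> by (rule S)
	obtain w where w: "w : weyl_group \<Phi>" "!!i. i : {1..l} ==> w (f i) = - f (l + 1 - i)"
		using flip_full l by auto
	interpret flip_system l f N \<Phi> "{}" \<a> w by unfold_locales (use w l in auto)
	interpret F: orthogonal_family "l div 2" F "N / 2" by (rule F_family)
	have om: "omega l \<Phi> \<a> l = w"
	proof (rule omega_eqI[OF root_system reduced simple _ w(1)])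
		fix i assume i: "i : {1..l}"
		show "(EX k:{1..l} - {l}. w (\<a> i) = \<a> k) | - w (\<a> i) - \<a> l : nat_cone l \<a>"
		proof (cases "i = l")
			case True
			have "l + 1 - (l - 1) = 2" using l by simp
			then have "- w (\<a> i) - \<a> l = (f 1 - f (l - 1)) + (f 2 - f l)"
				using True last wf[of l] wf[of "l - 1"] l by (simp add: linear_add[OF lin])
			also have "\<dots> : nat_cone l \<a>" using l by (intro nat_cone_add difference_cone[OF diff]) auto
			finally show ?thesis by blast
		next
			case False
			then have "w (\<a> i) = \<a> (l - i)" using i by (intro w_consecutive) auto
			then show ?thesis using i False by (intro disjI1 bexI[of _ "l - i"]) auto
		qed
	qed (use l in auto)
	have h: "1 <= l div 2" "2 <= l div 2" using l by auto
	have fold': "folded_roots \<Phi> w = signed_roots (l div 2) F {2}" using fold l by simp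
	have d: "short_roots (folded_roots \<Phi> w) \<union> scaled (1 / 2) (long_roots (folded_roots \<Phi> w)) = signed_roots (l div 2) F {1}"
		unfolding fold' by (rule F.dual_C[OF h(2)])
	have "folding_statement \<Phi> (Type_D l) j w"
	proof (rule folding_statementI[OF root_system w(1) finite_order order _ _ _ statement_facts])
		show "folding_table \<Phi> (folded_roots \<Phi> w) 2 (Type_D l) j (Type_C (l div 2)) (signed_roots (l div 2) F {1}) (Type_B (l div 2)) 2"
			using folding_table.D_even[OF l j, of \<Phi> "folded_roots \<Phi> w" 2] unfolding d .
		show "root_system_of_type (fixed_space w) (folded_roots \<Phi> w) (Type_C (l div 2))"
			unfolding fold' fold(2) by (rule F.type_C[OF h(1)])
		show "root_system_of_type (fixed_space w) (signed_roots (l div 2) F {1}) (Type_B (l div 2))"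
			unfolding fold(2) by (rule F.type_B[OF h(1)])
		show "(ALL \<beta>:\<Phi>. \<beta> \<bullet> (p + y) ~: Ints) <-> (ALL \<beta>:signed_roots (l div 2) F {1}. real 2 * (\<beta> \<bullet> y) ~: Ints)" if "w y = y" for y
			unfolding regular[OF that]
			using F.signed_roots_ball[where P = "%x. 2 * x ~: Ints" and A = "{1}" and t = y] Ints_minus_iff by auto
	qed auto
	then show ?thesis using om by simp
qed

lemma totatives_4: "totatives 4 = {1,3}"
proof -
	have "{0<..4::nat} = {1,2,3,4}" by auto
	moreover have "coprime (3::nat) 4" "~ coprime (2::nat) 4" by (simp_all add: coprime_iff_gcd_eq_1 gcd_non_0_nat)
	ultimately show ?thesis unfolding totatives_def by auto
qed

text \<open>
	Here \<open>\<omega>\<close> has order 4: it reverses the inner coordinates up to sign and acts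
	as a quarter turn on the two outer ones.  The two translates differ in which of the outer
	coordinates of \<open>p\<close> is 0; the middle coordinate is \<open>1/4\<close>, so the pairs
	of it with the outer ones and of inner coordinates give conditions on \<open>4
	y\<^sub>i\<close>.
\<close>

lemma folding_statement_D_odd:
	assumes rs: "root_system_in UNIV \<Phi>" "reduced_roots \<Phi>"
		and b: "bourbaki_simple_roots (Type_D l) \<Phi> \<a>" and l: "5 <= l" "odd l" and j: "j : {l - 1, l}"
	shows "folding_statement \<Phi> (Type_D l) j (omega l \<Phi> \<a> l)"
proof -
	obtain f N where S: "signed_system l f N \<Phi> {} \<a>" and last: "\<a> l = f (l - 1) + f l"
		using type_D_coordinates[OF rs b] l by auto
	interpret signed_system l f N \<Phi> "{}" \<a> by (rule S)
	obtain r where lr: "l = 2 * r + 1" using l(2) by (elim oddE)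
	have r2: "2 <= r" using l lr by simp
	define c where "c = Suc r"
	have c: "c : {1..l}" "l + 1 - c = c" "1 < c" "c < l" "2 * c = l + 1" using lr r2 by (auto simp: c_def)
	have l2: "2 <= l" using l by simp
	obtain w1 where w1: "w1 : weyl_group \<Phi>"
		"!!i. i : {1..l} ==> w1 (f i) = (if i <= r | l < i + r then - f (l + 1 - i) else f i)"
		using flip_partial[of r] lr by auto
	define sm where "sm = root_reflection (1 *R f 1 + (-1) *R f c)"
	define sp where "sp = root_reflection (1 *R f 1 + 1 *R f c)"
	have sW: "sm : weyl_group \<Phi>" "sp : weyl_group \<Phi>"
		unfolding sm_def sp_def using c by (intro reflection_in_weyl signed_rootsI(1); simp)+
	have sf: "sm (sp (f i)) = (if i = 1 | i = c then - f i else f i)" if "i : {1..l}" for i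
		using reflection_pair[of 1 c 1 1 i] reflection_pair[of 1 c 1 "-1" i] reflection_pair[of 1 c 1 "-1" 1]
			reflection_pair[of 1 c 1 "-1" c] c that linear_neg[OF linear_root_reflection, of "1 *R f 1 + (-1) *R f c"]
		by (auto simp: sm_def sp_def)
	have slin: "linear (sm \<circ> sp)" using in_weyl_linear[OF reflection_group_comp[OF sW]] .
	define w where "w = (sm \<circ> sp) \<circ> w1"
	have w: "w : weyl_group \<Phi>" unfolding w_def by (intro reflection_group_comp sW w1(1))
	have wf: "w (f i) = (if i = l then f 1 else - f (l + 1 - i))" if i: "i : {1..l}" for i
	proof (cases "i = c")
		case True
		then have "~ (i <= r | l < i + r)" using lr by (auto simp: c_def)
		then have "w1 (f i) = f i" using w1(2)[OF i] by simp
		then show ?thesis using sf[OF c(1)] True c by (simp add: w_def)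
	next
		case False
		then have "i <= r | l < i + r" using lr i by (auto simp: c_def)
		then have "w1 (f i) = - f (l + 1 - i)" using w1(2)[OF i] by simp
		then have "w (f i) = - (sm (sp (f (l + 1 - i))))" using linear_neg[OF slin] by (simp add: w_def)
		moreover have "l + 1 - i : {1..l}" "l + 1 - i ~= c" "l + 1 - i = 1 <-> i = l" using False c i by auto
		ultimately show ?thesis using sf[of "l + 1 - i"] by auto
	qed
	have lin: "linear w" by (rule in_weyl_linear[OF w])
	have orth: "orthogonal_transformation w" by (rule reflection_group_orthogonal[OF w])
	have winner: "w x \<bullet> w y = x \<bullet> y" for x y using orth by (simp add: orthogonal_transformation_def)
	have index: "l + 1 - i : {1..l}" "l + 1 - (l + 1 - i) = i" if "i : {1..l}" for i using that by auto
	have wl: "w (f l) = f 1" "w (f 1) = - f l" using wf[of l] wf[of 1] l by simp_all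
	have wi: "w (f i) = - f (l + 1 - i)" if "i : {2..l - 1}" for i using wf[of i] that l by auto
	have ww: "w (w (f i)) = (if i = 1 | i = l then - f i else f i)" if i: "i : {1..l}" for i
	proof -
		consider "i = 1" | "i = l" | "i : {2..l - 1}" using i by force
		then show ?thesis
		proof cases
			case 3
			then have "l + 1 - i : {2..l - 1}" "i ~= 1" "i ~= l" by auto
			then show ?thesis using wi[OF 3] wi[of "l + 1 - i"] index[OF i] by (simp add: linear_neg[OF lin])
		qed (use wl in \<open>auto simp: linear_neg[OF lin]\<close>)
	qed
	have "w (w (w (w (f i)))) = f i" if i: "i : {1..l}" for i
		using ww[OF i] by (auto simp: linear_neg[OF lin])
	then have "w \<circ> w \<circ> w \<circ> w = id"
		using linear_ext[of "w \<circ> w \<circ> w \<circ> w" id] lin by (simp add: linear_compose linear_id[unfolded id_def] id_def)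
	then have four: "w (w (w (w x))) = x" for x by (metis comp_apply id_apply)
	have fo: "0 < (4::nat)" "w ^^ 4 = id" using four by (simp_all add: fun_eq_iff numeral_eq_Suc One_nat_def)
	have pow: "(w ^^ 2) x = w (w x)" "(w ^^ 3) x = w (w (w x))" for x
		unfolding numeral_2_eq_2 numeral_3_eq_3 funpow.simps by simp_all
	have f1: "f 1 \<bullet> f 1 = N" "f l \<bullet> f 1 = 0" using inner_family[of 1 1] inner_family[of l 1] l by auto
	have order: "map_order w = 4"
	proof (rule map_order_eqI[OF fo])
		fix k :: nat assume "0 < k" "k < 4"
		then consider "k = 1" | "k = 2" | "k = 3" by linarith
		then have "(w ^^ k) (f 1) \<bullet> f 1 ~= N"
		proof cases
			case 1
			then show ?thesis using wl f1 N_pos by (simp add: One_nat_def)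
		next
			case 2
			have "(w ^^ k) (f 1) = - f 1" unfolding 2 pow wl by (simp add: linear_neg[OF lin] wl)
			then show ?thesis using f1 N_pos by simp
		next
			case 3
			have "(w ^^ k) (f 1) = f l" unfolding 3 pow wl by (simp add: linear_neg[OF lin] wl)
			then show ?thesis using f1 N_pos by simp
		qed
		then show "w ^^ k ~= id" using f1 by auto
	qed
	have fixed: "w y = y <-> f 1 \<bullet> y = 0 & f l \<bullet> y = 0 & (ALL i:{2..l - 1}. f (l + 1 - i) \<bullet> y = - (f i \<bullet> y))" for y
	proof -
		have s: "{1..l} = insert 1 (insert l {2..l - 1})" using l by auto
		have "w (f i) \<bullet> y = f i \<bullet> y <-> f (l + 1 - i) \<bullet> y = - (f i \<bullet> y)" if "i : {2..l - 1}" for i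
			unfolding wi[OF that] inner_minus_left by linarith
		then have "(ALL i:{2..l - 1}. w (f i) \<bullet> y = f i \<bullet> y) <-> (ALL i:{2..l - 1}. f (l + 1 - i) \<bullet> y = - (f i \<bullet> y))" by blast
		moreover have "w (f 1) \<bullet> y = f 1 \<bullet> y & w (f l) \<bullet> y = f l \<bullet> y <-> f 1 \<bullet> y = 0 & f l \<bullet> y = 0"
			unfolding wl inner_minus_left by linarith
		ultimately show ?thesis unfolding fixed_iff[OF orth] s by auto
	qed
	have mid0: "f c \<bullet> y = 0" if "w y = y" for y
	proof -
		have "c : {2..l - 1}" using c by auto
		then have "f (l + 1 - c) \<bullet> y = - (f c \<bullet> y)" using that unfolding fixed by blast
		then show ?thesis using c by simp
	qed
	have om: "omega l \<Phi> \<a> l = w"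
	proof (rule omega_eqI[OF root_system reduced simple _ w])
		fix i assume i: "i : {1..l}"
		consider "i = 1" | "i : {2..l - 2}" | "i = l - 1" | "i = l" using i l by force
		then show "(EX k:{1..l} - {l}. w (\<a> i) = \<a> k) | - w (\<a> i) - \<a> l : nat_cone l \<a>"
		proof cases
			case 1
			have e: "Suc 1 = 2" "Suc (l - 1) = l" "l + 1 - 2 = l - 1" using l by auto
			have "\<a> 1 = f 1 - f 2" using diff[of 1] l e by simp
			then have "w (\<a> 1) = f (l - 1) - f l" using wl wi[of 2] l e by (simp add: linear_diff[OF lin])
			also have "\<dots> = \<a> (l - 1)" using diff[of "l - 1"] l e by simp
			finally show ?thesis using 1 l by (intro disjI1 bexI[of _ "l - 1"]) auto
		next
			case 2
			then have e: "Suc (l - i) = l + 1 - i" "l + 1 - Suc i = l - i" "l - i : {1..<l}" "i : {1..<l}"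
				"i : {2..l - 1}" "Suc i : {2..l - 1}" by auto
			then have "w (\<a> i) = \<a> (l - i)"
				using diff[OF e(4)] diff[OF e(3)] wi[OF e(5)] wi[OF e(6)] by (simp add: linear_diff[OF lin])
			then show ?thesis using 2 by (intro disjI1 bexI[of _ "l - i"]) auto
		next
			case 3
			have e: "Suc (l - 1) = l" "l + 1 - (l - 1) = 2" using l by auto
			have "\<a> (l - 1) = f (l - 1) - f l" using diff[of "l - 1"] l e by simp
			then have "w (\<a> i) = - f 2 - f 1" using 3 wl wi[of "l - 1"] l e by (simp add: linear_diff[OF lin])
			then have "- w (\<a> i) - \<a> l = (f 1 - f (l - 1)) + (f 2 - f l)" by (simp add: last)
			also have "\<dots> : nat_cone l \<a>" using l by (intro nat_cone_add difference_cone[OF diff]) auto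
			finally show ?thesis by blast
		next
			case 4
			have e: "Suc 1 = 2" "l + 1 - (l - 1) = 2" using l by auto
			have "w (\<a> i) = f 1 - f 2" using 4 last wl wi[of "l - 1"] l e by (simp add: linear_add[OF lin])
			also have "\<dots> = \<a> 1" using diff[of 1] l e by simp
			finally show ?thesis using l by (intro disjI1 bexI[of _ 1]) auto
		qed
	qed (use l in auto)
	define G where "G i = (1 / 2) *R (f i - f (l + 1 - i))" for i
	let ?F = "%i. G (Suc i)" and ?h = "(l - 3) div 2"
	have h: "?h = r - 1" "1 <= ?h" "Suc ?h = r" "l div 2 = r" using lr r2 by auto
	have inner2: "i : {2..r} ==> i : {2..l - 1} & l + 1 - i : {2..l - 1} & i : {1..l} & l + 1 - i : {1..l}" for i
		using lr by auto
	have G_flip: "G (l + 1 - i) = - G i" if "i : {1..l}" for i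
		using index[OF that] by (simp add: G_def algebra_simps)
	have G_inner: "G i \<bullet> y = f i \<bullet> y" if "w y = y" "i : {2..l - 1}" for i y
		using that unfolding fixed by (simp add: G_def inner_diff_left)
	have F_family: "orthogonal_family ?h ?F (N / 2)"
	proof
		fix i k assume ik: "i : {1..?h}" "k : {1..?h}"
		define i' k' where "i' = Suc i" and "k' = Suc k"
		have "i' : {2..r}" "k' : {2..r}" using ik h by (auto simp: i'_def k'_def)
		then have "i' : {1..l}" "k' : {1..l}" "l + 1 - i' : {1..l}" "l + 1 - k' : {1..l}"
			"i' ~= l + 1 - k'" "l + 1 - i' ~= k'" "l + 1 - i' = l + 1 - k' <-> i' = k'" using lr by auto
		then have "G i' \<bullet> G k' = (if i' = k' then N / 2 else 0)"
			by (simp add: G_def inner_diff_left inner_diff_right inner_family)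
		then show "?F i \<bullet> ?F k = (if i = k then N / 2 else 0)" by (simp add: i'_def k'_def)
	qed (use N_pos in simp)
	interpret F: orthogonal_family ?h ?F "N / 2" by (rule F_family)
	have avg: "orbit_average w (f i) = (if i = 1 | i = l then 0 else G i)" if i: "i : {1..l}" for i
	proof (rule orbit_average_eqI[OF orth fo])
		show "w (if i = 1 | i = l then 0 else G i) = (if i = 1 | i = l then 0 else G i)"
		proof (cases "i = 1 | i = l")
			case False
			then have "i : {2..l - 1}" "l + 1 - i : {2..l - 1}" using i by auto
			then show ?thesis using False wi[of i] wi[of "l + 1 - i"] index[OF i]
				by (simp add: G_def linear_scale[OF lin] linear_diff[OF lin])
		qed (simp add: linear_0[OF lin])
		show "(if i = 1 | i = l then 0 else G i) \<bullet> y = f i \<bullet> y" if y: "w y = y" for y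
		proof (cases "i = 1 | i = l")
			case False
			then have "i : {2..l - 1}" using i by auto
			then show ?thesis using G_inner[OF y] False by simp
		qed (use y fixed in auto)
	qed
	have fold0: "folded_roots (signed_roots l f {}) w = signed_roots ?h ?F {1,2} & fixed_space w = span (?F ` {1..?h})"
	proof (rule folded_signed_roots[OF orth fo full F_family])
		fix i assume i: "i : {1..l}"
		have "i = 1 | i = l | i = c | i : {2..r} | l + 1 - i : {2..r}"
			using i unfolding lr c_def atLeastAtMost_iff by linarith
		then consider "i = 1 | i = l" | "i = c" | "i : {2..r}" | "l + 1 - i : {2..r}" by blast
		then show "orbit_average w (f i) = 0 | (EX p:{1..?h}. EX a. \<bar>a\<bar> = 1 & orbit_average w (f i) = a *R G (Suc p))"
		proof cases
			case 1
			then show ?thesis using avg[OF i] by auto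
		next
			case 2
			then show ?thesis using avg[OF i] c by (simp add: G_def)
		next
			case 3
			then have "i ~= 1" "i ~= l" using lr by auto
			then show ?thesis using avg[OF i] 3 h by (intro disjI2 bexI[of _ "i - 1"] exI[of _ 1]) auto
		next
			case 4
			then have "i ~= 1" "i ~= l" using lr by auto
			then have "orbit_average w (f i) = - G (l + 1 - i)" using avg[OF i] G_flip[OF i] by simp
			moreover have "Suc (l - i) = l + 1 - i" using i unfolding atLeastAtMost_iff by linarith
			moreover have "l - i : {1..?h}" using 4 i unfolding h(1) atLeastAtMost_iff by linarith
			ultimately show ?thesis by (intro disjI2 bexI[of _ "l - i"] exI[of _ "-1"]) auto
		qed
	next
		fix p assume "p : {1..?h}"
		then have "Suc p : {1..l}" "Suc p ~= 1" "Suc p ~= l" using h lr by auto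
		then show "EX i:{1..l}. orbit_average w (f i) = G (Suc p)" using avg[of "Suc p"] by (intro bexI[of _ "Suc p"]) auto
	next
		show "1 : {} | (EX i:{1..l}. orbit_average w (f i) = 0)" using avg[of 1] l by (intro disjI2 bexI[of _ 1]) auto
	next
		fix p assume "p : {1..?h}"
		then have q: "Suc p : {1..l}" "l + 1 - Suc p : {1..l}" "Suc p ~= l + 1 - Suc p" "Suc p ~= 1" "Suc p ~= l"
			"l + 1 - Suc p ~= 1" "l + 1 - Suc p ~= l" using h lr by auto
		then have "orbit_average w (f (Suc p)) = G (Suc p)" "orbit_average w (f (l + 1 - Suc p)) = - G (Suc p)"
			using avg[OF q(1)] avg[OF q(2)] G_flip[OF q(1)] by simp_all
		then show "2 : {} | (EX i:{1..l}. EX k:{1..l}. i ~= k & orbit_average w (f i) = G (Suc p) & orbit_average w (f k) = - G (Suc p))"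
			using q by blast
	qed auto
	then have fold: "folded_roots \<Phi> w = signed_roots ?h ?F {1,2}" "fixed_space w = span (?F ` {1..?h})"
		unfolding roots_eq by blast+
	have "EX p. ALL k. ALL i:{1..l}. f i \<bullet> p k = (if i = 1 then (if k = 1 then 0 else 1 / 2) else
			if i = l then (if k = (1::nat) then 1 / 2 else 0) else 1 / 4)"
		by (intro choice allI exists_coordinates)
	then obtain p where p: "!!k i. i : {1..l} ==> f i \<bullet> p k = (if i = 1 then (if k = 1 then 0 else 1 / 2) else
			if i = l then (if k = (1::nat) then 1 / 2 else 0) else 1 / 4)" by blast
	have p1: "f 1 \<bullet> p k = (if k = 1 then 0 else 1 / 2)" "f l \<bullet> p k = (if k = 1 then 1 / 2 else 0)" for k
		using p[of 1 k] p[of l k] l by auto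
	have pi: "f i \<bullet> p k = 1 / 4" if "i : {2..l - 1}" for i k using p[of i k] that by auto
	have u1: "f 1 \<bullet> (t - w t) = f 1 \<bullet> t - f l \<bullet> t" for t
		using displacement_inner[OF orth, of "f l" t] wl by simp
	have ul: "f l \<bullet> (t - w t) = f l \<bullet> t + f 1 \<bullet> t" for t
		using displacement_inner[OF orth, of "f 1" t] wl by simp
	have ui: "f i \<bullet> (t - w t) = f i \<bullet> t + f (l + 1 - i) \<bullet> t" if "i : {2..l - 1}" for i t
	proof -
		have "l + 1 - i : {2..l - 1}" "l + 1 - (l + 1 - i) = i" using that by auto
		then show ?thesis using displacement_inner[OF orth, of "f (l + 1 - i)" t] wi[of "l + 1 - i"] by simp
	qed
	have split: "i = 1 | i = l | i : {2..l - 1}" if "i : {1..l}" for i using that by auto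
	have P1: "real 4 *R p k : coweights \<Phi>" for k
		by (rule lattice_shifted[where d = 0]) (use p in auto)
	have P2: "p k - w (p k) : coweights \<Phi>" for k
	proof (rule lattice_shifted[where d = "1 / 2"])
		fix i assume "i : {1..l}"
		then consider "i = 1" | "i = l" | "i : {2..l - 1}" using split by blast
		then show "f i \<bullet> (p k - w (p k)) - 1 / 2 : Ints"
		proof cases
			case 1
			then show ?thesis using u1[of "p k"] p1[of k] by simp
		next
			case 2
			then show ?thesis using ul[of "p k"] p1[of k] by simp
		next
			case 3
			then have "l + 1 - i : {2..l - 1}" by auto
			then show ?thesis using ui[OF 3, of "p k"] pi[OF 3] pi[of "l + 1 - i"] by simp
		qed
	qed auto
	have c2: "c : {2..l - 1}" using c by auto
	have lam1: "(f 1 + f c) \<bullet> z : Ints" if "z : coweights \<Phi>" for z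
		using lattice_integral(1)[OF _ l2 that, of 1 c] c by (auto simp: inner_add_left)
	have lam2: "(f 1 + f c) \<bullet> y = 0" if "w y = y" for y
		using mid0[OF that] that unfolding fixed by (simp add: inner_add_left)
	have lam3: "(f 1 + f c) \<bullet> p k - real k / real 4 : Ints" if "k : totatives 4" for k
		using that p1(1)[of k] pi[OF c2, of k] by (auto simp: totatives_4 inner_add_left)
	have cover: "EX k:totatives 4. EX e z. w e = e & z : coweights \<Phi> & t = p k + e + z"
		if t: "t - w t : coweights \<Phi>" and reg: "ALL \<beta>:\<Phi>. \<beta> \<bullet> t ~: Ints" for t
	proof -
		let ?u = "%i. f i \<bullet> (t - w t)"
		have "?u 1 ~: Ints" using u1[of t] reg l unfolding regular_iff by auto
		moreover have "2 * ?u 1 : Ints" using lattice_integral(1)[OF _ l2 t, of 1 1] l by simp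
		ultimately have h1: "?u 1 - 1 / 2 : Ints" using half_integer_shift by blast
		have half: "?u i - 1 / 2 : Ints" if i: "i : {1..l}" for i
		proof -
			have "?u i - ?u 1 : Ints" using lattice_integral(2)[OF _ l2 t i, of 1] l by simp
			then have "(?u i - ?u 1) + (?u 1 - 1 / 2) : Ints" using h1 by (rule Ints_add)
			then show ?thesis by simp
		qed
		define d where "d = f c \<bullet> t - 1 / 4"
		have d2: "2 * d : Ints" using half[OF c(1)] ui[OF c2, of t] c(2) by (simp add: d_def)
		have hd: "f 1 \<bullet> t - f l \<bullet> t - 1 / 2 : Ints" using half[of 1] u1[of t] l by simp
		have hs: "f 1 \<bullet> t + f l \<bullet> t - 1 / 2 : Ints" using half[of l] ul[of t] l by (simp add: add.commute)
		have "(f 1 \<bullet> t - f l \<bullet> t - 1 / 2) + (f 1 \<bullet> t + f l \<bullet> t - 1 / 2) + 1 - 2 * d : Ints"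
			by (rule Ints_diff[OF Ints_add[OF Ints_add[OF hd hs] Ints_1] d2])
		then have two: "2 * (f 1 \<bullet> t - d) : Ints" by (simp add: algebra_simps)
		have "EX k:totatives 4. f 1 \<bullet> t - f 1 \<bullet> p k - d : Ints & f l \<bullet> t - f l \<bullet> p k - d : Ints"
		proof (cases "f 1 \<bullet> t - d : Ints")
			case True
			have "(f 1 \<bullet> t - d) - (f 1 \<bullet> t - f l \<bullet> t - 1 / 2) - 1 : Ints"
				by (rule Ints_diff[OF Ints_diff[OF True hd] Ints_1])
			then have "f l \<bullet> t - 1 / 2 - d : Ints" by (simp add: algebra_simps)
			then show ?thesis using True p1[of 1] by (intro bexI[of _ 1]) (auto simp: totatives_4)
		next
			case False
			then have f: "f 1 \<bullet> t - d - 1 / 2 : Ints" using half_integer_shift[OF two] by simp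
			have "(f 1 \<bullet> t - d - 1 / 2) - (f 1 \<bullet> t - f l \<bullet> t - 1 / 2) : Ints" using f hd by (rule Ints_diff)
			then have "f l \<bullet> t - d : Ints" by (simp add: algebra_simps)
			then show ?thesis using f p1[of 3] by (intro bexI[of _ 3]) (auto simp: totatives_4 algebra_simps)
		qed
		then obtain k where k: "k : totatives 4" "f 1 \<bullet> t - f 1 \<bullet> p k - d : Ints" "f l \<bullet> t - f l \<bullet> p k - d : Ints" by blast
		obtain e where e: "!!i. i : {1..l} ==> f i \<bullet> e = (if i = 1 | i = l then 0 else if i < c then f i \<bullet> t - 1 / 4 - d
				else if i = c then 0 else - (f (l + 1 - i) \<bullet> t - 1 / 4 - d))"
			using exists_coordinates[of "%i. if i = 1 | i = l then 0 else if i < c then f i \<bullet> t - 1 / 4 - d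
				else if i = c then 0 else - (f (l + 1 - i) \<bullet> t - 1 / 4 - d)"] by blast
		have e': "f i \<bullet> e = (if i < c then f i \<bullet> t - 1 / 4 - d else if i = c then 0 else - (f (l + 1 - i) \<bullet> t - 1 / 4 - d))"
			if "i : {2..l - 1}" for i
			using e[of i] that by auto
		have "w e = e"
			unfolding fixed
		proof (intro conjI ballI)
			show "f 1 \<bullet> e = 0" "f l \<bullet> e = 0" using e[of 1] e[of l] l by auto
			fix i assume i: "i : {2..l - 1}"
			then have i': "l + 1 - i : {2..l - 1}" "l + 1 - (l + 1 - i) = i" by auto
			consider "i < c" | "i = c" | "c < i" by linarith
			then show "f (l + 1 - i) \<bullet> e = - (f i \<bullet> e)"
			proof cases
				case 1
				then have "~ l + 1 - i < c" "l + 1 - i ~= c" using c i by auto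
				then show ?thesis unfolding e'[OF i] e'[OF i'(1)] i'(2) using 1 by simp
			next
				case 2
				then show ?thesis using e'[OF c2] c(2) by simp
			next
				case 3
				then have "l + 1 - i < c" using c i by auto
				then show ?thesis unfolding e'[OF i] e'[OF i'(1)] using 3 by simp
			qed
		qed
		moreover have "t - p k - e : coweights \<Phi>"
		proof (rule lattice_shifted[OF _ d2])
			fix i assume i: "i : {1..l}"
			then consider "i = 1" | "i = l" | "i : {2..l - 1}" "i < c" | "i = c" | "i : {2..l - 1}" "c < i" using split by fastforce
			then show "f i \<bullet> (t - p k - e) - d : Ints"
			proof cases
				case 1
				then show ?thesis using e[OF i] k(2) by (simp add: inner_diff_right)
			next
				case 2
				then show ?thesis using e[OF i] k(3) by (simp add: inner_diff_right)
			next
				case 3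
				then show ?thesis using e'[OF 3(1)] pi[OF 3(1), of k] by (simp add: inner_diff_right)
			next
				case 4
				then show ?thesis using e'[OF c2] pi[OF c2, of k] by (simp add: inner_diff_right d_def)
			next
				case 5
				then have "f i \<bullet> (t - p k - e) - d = (f i \<bullet> (t - w t) - 1 / 2) - 2 * d"
					unfolding ui[OF 5(1)] using e'[OF 5(1)] pi[OF 5(1), of k] by (simp add: inner_diff_right)
				also have "\<dots> : Ints" using half[OF i] d2 by (rule Ints_diff)
				finally show ?thesis .
			qed
		qed auto
		moreover have "t = p k + e + (t - p k - e)" by simp
		ultimately show ?thesis using k(1) by blast
	qed
	define K where "K y <->
		(ALL i:{2..r}. ALL k:{2..r}. i ~= k --> 2 * (f i \<bullet> y + f k \<bullet> y) ~: Ints & 2 * (f i \<bullet> y - f k \<bullet> y) ~: Ints) &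
		(ALL i:{2..r}. 4 * (f i \<bullet> y) ~: Ints)" for y
	have regular: "(ALL \<beta>:\<Phi>. \<beta> \<bullet> (p k + y) ~: Ints) <-> K y" if y: "w y = y" for k y
	proof -
		let ?Y = "%i. f i \<bullet> y"
		have J: "{2..l + 1 - 2} = {2..l - 1}" by (simp add: One_nat_def)
		have anti: "f (l + 1 - i) \<bullet> y = - (f i \<bullet> y)" if "i : {2..l + 1 - 2}" for i
			using y that unfolding fixed J by blast
		have y0: "f 1 \<bullet> y = 0" "f l \<bullet> y = 0" using y unfolding fixed by auto
		have ci: "f i \<bullet> (p k + y) = 1 / 4 + ?Y i" if "i : {2..l - 1}" for i
			using pi[OF that] by (simp add: inner_add_right)
		have cl: "f 1 \<bullet> (p k + y) = (if k = 1 then 0 else 1 / 2)" "f l \<bullet> (p k + y) = (if k = 1 then 1 / 2 else 0)"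
			using p1 y0 by (auto simp: inner_add_right)
		have pairs: "(ALL i:{2..l - 1}. ALL k:{2..l - 1}. i ~= k --> 1 / 2 + (?Y i + ?Y k) ~: Ints & ?Y i - ?Y k ~: Ints) <->
			(ALL r':{2..r}. ALL s:{2..r}. r' ~= s --> 2 * (?Y r' + ?Y s) ~: Ints & 2 * (?Y r' - ?Y s) ~: Ints) &
			(ALL r':{2..r}. 2 * ?Y r' ~: Ints)"
			using antisymmetric_pairs_iff[where a = 2 and m = l and Y = ?Y, OF anti] unfolding J h(4) by simp
		have singles: "(ALL i:{2..l - 1}. 1 / 2 + 2 * ?Y i ~: Ints) <-> (ALL r':{2..r}. 4 * ?Y r' ~: Ints)"
			if "ALL r':{2..r}. 2 * ?Y r' ~: Ints"
			using antisymmetric_singles_iff[where a = 2 and m = l and Y = ?Y, OF anti] that unfolding J h(4) by simp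
		have sum: "f i \<bullet> (p k + y) + f s \<bullet> (p k + y) = 1 / 2 + (?Y i + ?Y s)"
			"f i \<bullet> (p k + y) - f s \<bullet> (p k + y) = ?Y i - ?Y s" if "i : {2..l - 1}" "s : {2..l - 1}" for i s
			using ci[OF that(1)] ci[OF that(2)] by simp_all
		show ?thesis
		proof
			assume "ALL \<beta>:\<Phi>. \<beta> \<bullet> (p k + y) ~: Ints"
			then have R: "f i \<bullet> (p k + y) + f s \<bullet> (p k + y) ~: Ints" "f i \<bullet> (p k + y) - f s \<bullet> (p k + y) ~: Ints"
				if "i : {1..l}" "s : {1..l}" "i ~= s" for i s
				using that unfolding regular_iff by auto
			have "1 / 2 + (?Y i + ?Y s) ~: Ints & ?Y i - ?Y s ~: Ints" if "i : {2..l - 1}" "s : {2..l - 1}" "i ~= s" for i s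
			proof -
				have "i : {1..l}" "s : {1..l}" using that by auto
				from R[OF this that(3)] show ?thesis unfolding sum[OF that(1,2)] by blast
			qed
			then have 1: "(ALL r':{2..r}. ALL s:{2..r}. r' ~= s --> 2 * (?Y r' + ?Y s) ~: Ints & 2 * (?Y r' - ?Y s) ~: Ints) &
				(ALL r':{2..r}. 2 * ?Y r' ~: Ints)" using pairs by blast
			have "1 / 2 + 2 * ?Y i ~: Ints" if i: "i : {2..l - 1}" for i
			proof -
				let ?x = "1 / 4 + ?Y i"
				have il: "i : {1..l}" "i ~= 1" "i ~= l" "1 : {1..l}" "l : {1..l}" using i by auto
				have "?x ~: Ints" "?x + 1 / 2 ~: Ints"
					using R(1)[OF il(1,4,2)] R(1)[OF il(1,5,3)] unfolding ci[OF i] cl by (auto split: if_splits)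
				then have "2 * ?x ~: Ints" unfolding half_integer_iff by simp
				then show ?thesis by (simp add: algebra_simps)
			qed
			then show "K y" unfolding K_def using 1 singles by blast
		next
			assume K: "K y"
			have two: "ALL r':{2..r}. 2 * ?Y r' ~: Ints"
			proof
				fix r' assume "r' : {2..r}"
				then have "4 * ?Y r' ~: Ints" using K unfolding K_def by blast
				then show "2 * ?Y r' ~: Ints" using Ints_mult[of 2 "2 * ?Y r'"] by auto
			qed
			have inner: "1 / 2 + (?Y i + ?Y s) ~: Ints & ?Y i - ?Y s ~: Ints" if "i : {2..l - 1}" "s : {2..l - 1}" "i ~= s" for i s
				using pairs K two that unfolding K_def by blast
			have edge: "?Y i + 1 / 4 ~: Ints & ?Y i + 3 / 4 ~: Ints & ?Y i - 1 / 4 ~: Ints & - ?Y i - 1 / 4 ~: Ints & 1 / 4 - ?Y i ~: Ints"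
				if i: "i : {2..l - 1}" for i
			proof -
				have "1 / 2 + 2 * ?Y i ~: Ints" using singles[OF two] K i unfolding K_def by blast
				then have "2 * (?Y i + 1 / 4) ~: Ints" by (simp add: algebra_simps)
				from not_half_integer[OF this] show ?thesis by (simp add: algebra_simps)
			qed
			have mh: "- (1 / 2 :: real) ~: Ints" using half_not_integer by (simp add: Ints_minus_iff)
			have "f i \<bullet> (p k + y) + f s \<bullet> (p k + y) ~: Ints & f i \<bullet> (p k + y) - f s \<bullet> (p k + y) ~: Ints"
				if ij: "i : {1..l}" "s : {1..l}" "i ~= s" for i s
			proof -
				consider "i : {2..l - 1}" "s : {2..l - 1}" | "i : {1, l}" "s : {2..l - 1}" | "i : {2..l - 1}" "s : {1, l}"
					| "i = 1" "s = l" | "i = l" "s = 1"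
					using split[OF ij(1)] split[OF ij(2)] ij(3) by blast
				then show ?thesis
				proof cases
					case 1
					then show ?thesis unfolding sum[OF 1] using inner[OF 1 ij(3)] by simp
				next
					case 2
					obtain v where v: "f i \<bullet> (p k + y) = v" "v = 0 | v = 1 / 2" using 2(1) cl by (auto split: if_splits)
					show ?thesis unfolding ci[OF 2(2)] v(1) using v(2) edge[OF 2(2)] by (auto simp: algebra_simps)
				next
					case 3
					obtain v where v: "f s \<bullet> (p k + y) = v" "v = 0 | v = 1 / 2" using 3(2) cl by (auto split: if_splits)
					show ?thesis unfolding ci[OF 3(1)] v(1) using v(2) edge[OF 3(1)] by (auto simp: algebra_simps)
				next
					case 4
					then show ?thesis using cl half_not_integer mh by auto
				next
					case 5
					then show ?thesis using cl half_not_integer mh by auto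
				qed
			qed
			then show "ALL \<beta>:\<Phi>. \<beta> \<bullet> (p k + y) ~: Ints" unfolding regular_iff by auto
		qed
	qed
	have d: "scaled 2 (short_roots (folded_roots \<Phi> w)) \<union> (folded_roots \<Phi> w - short_roots (folded_roots \<Phi> w)) = signed_roots ?h ?F {2}"
		unfolding fold by (rule F.doubled_short_BC[OF h(2)])
	have "folding_statement \<Phi> (Type_D l) j w"
	proof (rule folding_statementI[OF root_system w fo order _ _ _ refl P1 P2 lam1 lam2 lam3 cover])
		show "folding_table \<Phi> (folded_roots \<Phi> w) 4 (Type_D l) j (Type_BC ?h) (signed_roots ?h ?F {2}) (Type_C ?h) 2"
			using folding_table.D_odd[OF l j, of \<Phi> "folded_roots \<Phi> w" 4] unfolding d .
		show "root_system_of_type (fixed_space w) (folded_roots \<Phi> w) (Type_BC ?h)"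
			unfolding fold by (rule F.type_BC[OF h(2)])
		show "root_system_of_type (fixed_space w) (signed_roots ?h ?F {2}) (Type_C ?h)"
			unfolding fold by (rule F.type_C[OF h(2)])
		show "(ALL \<beta>:\<Phi>. \<beta> \<bullet> (p k + y) ~: Ints) <-> (ALL \<beta>:signed_roots ?h ?F {2}. real 2 * (\<beta> \<bullet> y) ~: Ints)" if "w y = y" for k y
		proof -
			have G: "G i \<bullet> y = f i \<bullet> y" if "i : {2..Suc ?h}" for i
				using G_inner[OF \<open>w y = y\<close>, of i] inner2[of i] that h by auto
			have "(ALL \<beta>:signed_roots ?h ?F {2}. 2 * (\<beta> \<bullet> y) ~: Ints) <->
				(ALL i:{1..?h}. ALL k:{1..?h}. i ~= k --> 2 * (?F i \<bullet> y + ?F k \<bullet> y) ~: Ints & 2 * (?F i \<bullet> y - ?F k \<bullet> y) ~: Ints) &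
				(ALL i:{1..?h}. ALL c:{2}. 2 * (c * (?F i \<bullet> y)) ~: Ints)"
				by (rule F.signed_roots_ball[where P = "%x. 2 * x ~: Ints"]) (use Ints_minus_iff in auto)
			also have "\<dots> <-> (ALL i:{2..Suc ?h}. ALL k:{2..Suc ?h}. i ~= k --> 2 * (G i \<bullet> y + G k \<bullet> y) ~: Ints & 2 * (G i \<bullet> y - G k \<bullet> y) ~: Ints) &
				(ALL i:{2..Suc ?h}. 4 * (G i \<bullet> y) ~: Ints)"
				unfolding shifted_ball[symmetric] by simp
			also have "\<dots> <-> K y" unfolding K_def using G h(3) by simp
			finally show ?thesis using regular[OF that] by simp
		qed
	qed auto
	then show ?thesis using om by simp
qed

section \<open>Type A\<close>

lemma difference_inner_eq:
	assumes "!!t. t : {1..<n} ==> x \<bullet> (f (t - 1) - f t) = c * ((if i = t - 1 then 1 else 0) - (if i = t then 1 else 0))"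
		"p < n" "q < n"
	shows "x \<bullet> (f p - f q) = c * ((if i = p then 1 else 0) - (if i = (q::nat) then 1 else 0))"
proof -
	have up: "x \<bullet> (f p - f q) = c * ((if i = p then 1 else 0) - (if i = q then 1 else 0))" if "p <= q" "q < n" for p q
		using that
	proof (induction q rule: dec_induct)
		case (step q)
		have "x \<bullet> (f p - f (Suc q)) = x \<bullet> (f p - f q) + x \<bullet> (f (Suc q - 1) - f (Suc q))" by (simp add: inner_diff_right)
		then show ?case using step assms(1)[of "Suc q"] by (simp add: algebra_simps)
	qed simp
	show ?thesis
	proof (cases "p <= q")
		case False
		then have "x \<bullet> (f q - f p) = c * ((if i = q then 1 else 0) - (if i = p then 1 else 0))" using up[of q p] assms by simp
		then show ?thesis by (simp add: inner_diff_right algebra_simps)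
	qed (use up assms in simp)
qed

text \<open>
	Type A with the indices \<open>0, \<dots>, n - 1\<close>, so that rotations are additions modulo
	\<open>n\<close>.
\<close>

locale cyclic_system = difference_family n f N
	for n :: nat and f :: "nat => 'a::euclidean_space" and N :: real +
	fixes \<Phi> :: "'a set" and \<a> :: "nat => 'a"
	assumes n2: "2 <= n" and root_system: "root_system_in UNIV \<Phi>" and reduced: "reduced_roots \<Phi>"
		and roots_eq: "\<Phi> = difference_roots n f"
		and simple: "simple_roots (n - 1) \<Phi> \<a>"
		and \<a>: "!!i. i : {1..n - 1} ==> \<a> i = f (i - 1) - f i"

text \<open>
	The sums of the simple roots from a given index on, minus their mean, are the projected basis
	vectors.
\<close>

lemma type_A_coordinates:
	assumes rs: "root_system_in UNIV \<Phi>" "reduced_roots \<Phi>" and b: "bourbaki_simple_roots (Type_A l) \<Phi> \<a>" and l: "1 <= l"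
	shows "EX f N. cyclic_system (Suc l) f N \<Phi> \<a>"
proof -
	have s: "simple_roots l \<Phi> \<a>" using b by (simp add: bourbaki_simple_roots_def)
	let ?N = "(\<a> l \<bullet> \<a> l) / 2"
	note inner = bourbaki_inner[OF rs(1) b] and nonzero = bourbaki_nonzero[OF rs(1) b]
	have N: "0 < ?N" using nonzero(1)[of l] l by simp
	have gram: "\<a> i \<bullet> \<a> k = ?N * of_int (path_matrix i k)" if "i : {1..<Suc l}" "k : {1..<Suc l}" for i k
		by (rule path_gram[OF N _ _ _ that]) (use nonzero b in \<open>auto simp: bourbaki_simple_roots_def\<close>)
	define g where "g i = (\<Sum>t=Suc i..<Suc l. \<a> t)" for i
	have gS: "g i = \<a> (Suc i) + g (Suc i)" if "i < l" for i
		using that sum.atLeast_Suc_lessThan[of "Suc i" "Suc l" \<a>] by (simp add: g_def del: sum.op_ivl_Suc)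
	have ga: "g i \<bullet> \<a> t = ?N * ((if i = t - 1 then 1 else 0) - (if i = t then 1 else 0) + (if t = l then 1 else 0))"
		if "i <= l" "t : {1..l}" for i t
		using that
	proof (induction i rule: inc_induct)
		case base
		then show ?case by (auto simp: g_def)
	next
		case (step i)
		have "g i \<bullet> \<a> t = \<a> (Suc i) \<bullet> \<a> t + g (Suc i) \<bullet> \<a> t" using gS[of i] step by (simp add: inner_add_left)
		moreover have "\<a> (Suc i) \<bullet> \<a> t = ?N * of_int (path_matrix (Suc i) t)" using gram[of "Suc i" t] step by simp
		moreover have "g (Suc i) \<bullet> \<a> t = ?N * ((if Suc i = t - 1 then 1 else 0) - (if Suc i = t then 1 else 0) + (if t = l then 1 else 0))"
			using step by blast
		moreover obtain t' where "t = Suc t'" using step by (cases t) auto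
		ultimately show ?case by (auto simp: path_matrix_eq algebra_simps)
	qed
	define m where "m = (1 / real (Suc l)) *R (\<Sum>i\<le>l. g i)"
	have ma: "m \<bullet> \<a> t = ?N * (if t = l then 1 else 0)" if t: "t : {1..l}" for t
	proof -
		have "(\<Sum>i\<le>l. g i) \<bullet> \<a> t = (\<Sum>i\<le>l. ?N * ((if i = t - 1 then 1 else 0) - (if i = t then 1 else 0) + (if t = l then 1 else 0)))"
			unfolding inner_sum_left using ga t by (intro sum.cong) auto
		also have "\<dots> = ?N * ((\<Sum>i\<le>l. if i = t - 1 then 1 else 0) - (\<Sum>i\<le>l. if i = t then 1 else 0) + (\<Sum>i\<le>l. if t = l then 1 else 0))"
			by (simp only: sum_distrib_left[symmetric] sum.distrib sum_subtractf)
		also have "\<dots> = ?N * (real (Suc l) * (if t = l then 1 else 0))" using t by auto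
		finally show ?thesis by (simp add: m_def field_simps del: of_nat_Suc)
	qed
	define f where "f i = g i - m" for i
	have fa: "f i - f (Suc i) = \<a> (Suc i)" if "i < l" for i using gS[OF that] by (simp add: f_def)
	have family: "difference_family (Suc l) f ?N"
	proof
		fix i p q assume ipq: "i < Suc l" "p < Suc l" "q < Suc l"
		show "f i \<bullet> (f p - f q) = ?N * ((if i = p then 1 else 0) - (if i = q then 1 else 0))"
		proof (rule difference_inner_eq[OF _ ipq(2,3)])
			fix t assume t: "t : {1..<Suc l}"
			then have "t - 1 < l" "Suc (t - 1) = t" unfolding atLeastLessThan_iff by linarith+
			then have "f (t - 1) - f t = \<a> t" using fa[of "t - 1"] by simp
			then show "f i \<bullet> (f (t - 1) - f t) = ?N * ((if i = t - 1 then 1 else 0) - (if i = t then 1 else 0))"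
				using ga[of i t] ma[of t] t ipq by (simp add: f_def inner_diff_left algebra_simps)
		qed
	qed (rule N)
	interpret difference_family "Suc l" f ?N by (rule family)
	have \<a>: "\<a> i = f (i - 1) - f i" if "i : {1..Suc l - 1}" for i
	proof -
		have "i - 1 < l" "Suc (i - 1) = i" using that unfolding atLeastAtMost_iff by linarith+
		then show ?thesis using fa[of "i - 1"] by simp
	qed
	have s': "simple_roots (Suc l - 1) \<Phi> \<a>" using s by simp
	have "simple_system (difference_roots (Suc l) f) (\<a> ` {1..Suc l - 1})"
		by (rule simple_roots_system[OF difference_roots_root_system difference_roots_reduced difference_roots_simple[OF \<a>]])
	then have "\<Phi> = difference_roots (Suc l) f"
		by (rule simple_system_roots_unique[OF simple_roots_system[OF rs s']])
	then have "cyclic_system (Suc l) f ?N \<Phi> \<a>"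
		using rs s' \<a> l by unfold_locales auto
	then show ?thesis by blast
qed

lemma iterate_shift_mod:
	fixes A :: "nat => real"
	assumes "!!i. A (i + j) - A i - a : Ints"
	shows "A (i + j * u) - A i - real u * a : Ints"
proof (induction u)
	case (Suc u)
	have "(A (i + j * u + j) - A (i + j * u) - a) + (A (i + j * u) - A i - real u * a) : Ints"
		by (rule Ints_add[OF assms Suc])
	then show ?case by (simp add: algebra_simps)
qed simp

lemma iterate_shift:
	fixes A :: "nat => 'b"
	assumes "!!i. A (i + j) = A i" shows "A (i + j * u) = A i"
proof (induction u)
	case (Suc u)
	then show ?case using assms[of "i + j * u"] by (simp add: algebra_simps)
qed simp

lemma exists_multiple_mod_gcd:
	assumes "j ~= (0::nat)" shows "EX u v. j * u = gcd n j + n * v"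
proof -
	obtain x y where "j * x = n * y + gcd j n" using bezout_nat[OF assms, of n] by blast
	then show ?thesis by (intro exI[of _ x] exI[of _ y]) (simp add: gcd.commute)
qed

context cyclic_system
begin

lemma f_inj: "i < n ==> k < n ==> f i = f k ==> i = k"
	using difference_square[of i k] N_pos by (cases "i = k") auto

lemma full: "span (f ` {..<n}) = UNIV"
proof -
	have "difference_roots n f \<subseteq> span (f ` {..<n})"
		by (auto simp: difference_roots_def intro!: span_diff intro: span_base)
	then have "span (difference_roots n f) \<subseteq> span (f ` {..<n})" by (metis span_mono span_span)
	then show ?thesis using root_system unfolding root_system_in_def roots_eq by blast
qed

lemma cone: assumes "i <= k" "k < n" shows "f i - f k : nat_cone (n - 1) \<a>"
	by (rule difference_roots_cone[OF \<a> assms])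

lemma lattice_iff: "t : coweights \<Phi> <-> (ALL i<n. ALL k<n. f i \<bullet> t - f k \<bullet> t : Ints)"
proof -
	have "(ALL \<beta>:difference_roots n f. \<beta> \<bullet> t : Ints) <-> (ALL i<n. ALL k<n. i ~= k --> f i \<bullet> t - f k \<bullet> t : Ints)"
		unfolding difference_roots_def inner_diff_left[symmetric] by blast
	also have "\<dots> <-> (ALL i<n. ALL k<n. f i \<bullet> t - f k \<bullet> t : Ints)" by force
	finally show ?thesis unfolding coweight_lattice_def roots_eq by blast
qed

lemma regular_iff: "(ALL \<beta>:\<Phi>. \<beta> \<bullet> t ~: Ints) <-> (ALL i<n. ALL k<n. i ~= k --> f i \<bullet> t - f k \<bullet> t ~: Ints)"
	unfolding roots_eq difference_roots_def inner_diff_left[symmetric] by blast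

lemma prescribed_differences: "EX t. ALL i<n. ALL k<n. f i \<bullet> t - f k \<bullet> t = P i - P k"
proof -
	obtain t where t: "ALL i:{1..n - 1}. \<a> i \<bullet> t = P (i - 1) - P i"
		using exists_prescribed_coordinates[of \<a> "{1..n - 1}" "%i. P (i - 1) - P i"] simple
		by (auto simp: simple_roots_def)
	have up: "f i \<bullet> t - f k \<bullet> t = P i - P k" if "i <= k" "k < n" for i k
		using that
	proof (induction k rule: dec_induct)
		case (step k)
		have k: "Suc k : {1..n - 1}" using step(4) unfolding atLeastAtMost_iff by linarith
		have "\<a> (Suc k) \<bullet> t = P k - P (Suc k)" "\<a> (Suc k) = f k - f (Suc k)" using bspec[OF t k] \<a>[OF k] by simp_all
		then show ?case using step by (simp add: inner_diff_left)
	qed simp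
	have "f i \<bullet> t - f k \<bullet> t = P i - P k" if "i < n" "k < n" for i k
		using up[of i k] up[of k i] that by (cases "i <= k") auto
	then show ?thesis by blast
qed

text \<open>
	A product of adjacent transpositions moves one index past the others.
\<close>

lemma cycle_partial: "k < n ==> EX w:weyl_group \<Phi>. ALL i<n. w (f i) = f (if i < k then Suc i else if i = k then 0 else i)"
proof (induction k)
	case 0
	show ?case by (rule bexI[OF _ reflection_group.id]) auto
next
	case (Suc k)
	then obtain w where w: "w : weyl_group \<Phi>" "!!i. i < n ==> w (f i) = f (if i < k then Suc i else if i = k then 0 else i)"
		by auto
	let ?s = "root_reflection (f k - f (Suc k))"
	have "f k - f (Suc k) : difference_roots n f"
		unfolding difference_roots_def mem_Collect_eq using Suc.prems by (intro exI[of _ k] exI[of _ "Suc k"]) auto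
	then have s: "?s : weyl_group \<Phi>" unfolding roots_eq by (rule reflection_in_group)
	have sf: "?s (f i) = f (if i = k then Suc k else if i = Suc k then k else i)" if "i < n" for i
		using reflection_difference[of k "Suc k" i] Suc.prems that by auto
	have "(w \<circ> ?s) (f i) = f (if i < Suc k then Suc i else if i = Suc k then 0 else i)" if "i < n" for i
		using sf[OF that] w(2)[of i] w(2)[of k] w(2)[of "Suc k"] that Suc.prems by auto
	then show ?case using reflection_group_comp[OF w(1) s] by blast
qed

lemma cycle_exists: "EX c:weyl_group \<Phi>. ALL i<n. c (f i) = f (Suc i mod n)"
proof -
	obtain w where w: "w : weyl_group \<Phi>" "!!i. i < n ==> w (f i) = f (if i < n - 1 then Suc i else if i = n - 1 then 0 else i)"
		using cycle_partial[of "n - 1"] n2 by auto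
	have "w (f i) = f (Suc i mod n)" if "i < n" for i
	proof (cases "i = n - 1")
		case True
		then have "Suc i mod n = 0" using n2 by simp
		then show ?thesis using w(2)[OF that] True by simp
	next
		case False
		then have "i < n - 1" using that by simp
		then show ?thesis using w(2)[OF that] by simp
	qed
	then show ?thesis using w(1) by blast
qed

end

text \<open>
	With \<open>g = gcd n j\<close>, the rotation by \<open>j\<close> generates the same group as
	the rotation by \<open>g\<close>, so fixed vectors are \<open>g\<close>-periodic.  A fixed point
	of the torus has coordinates that increase by a constant \<open>k / r\<close> from each period
	to the next, where \<open>r = n / g\<close> is the order; if \<open>k\<close> were not prime to
	\<open>r\<close>, two coordinates would agree modulo integers.
\<close>

lemma folding_statement_A:
	assumes rs: "root_system_in UNIV \<Phi>" "reduced_roots \<Phi>"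
		and b: "bourbaki_simple_roots (Type_A l) \<Phi> \<a>" and l: "1 <= l" and j: "j : {1..l}"
	shows "folding_statement \<Phi> (Type_A l) j (omega l \<Phi> \<a> j)"
proof -
	define n where "n = Suc l"
	obtain f N where "cyclic_system (Suc l) f N \<Phi> \<a>" using type_A_coordinates[OF rs b l] by blast
	then interpret cyclic_system n f N \<Phi> \<a> by (simp add: n_def)
	have n0: "0 < n" by (simp add: n_def)
	define g where "g = gcd n j"
	define r where "r = n div g"
	define j' where "j' = j div g"
	have g0: "0 < g" using n0 by (simp add: g_def)
	have nr: "n = g * r" and jj: "j = g * j'" by (simp_all add: g_def r_def j'_def)
	have gj: "g <= j" using j gcd_le2_nat[of j n] by (auto simp: g_def)
	have jn: "0 < j" "j < n" using j by (auto simp: n_def)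
	have gn: "g < n" using gj jn by simp
	have r1: "1 < r" using gn nr by (metis less_one linorder_neqE_nat mult.right_neutral mult_0_right n0 nat_neq_iff)
	have cop: "coprime r j'" unfolding r_def j'_def g_def using n0 by (intro div_gcd_coprime) auto
	obtain c where c: "c : weyl_group \<Phi>" "!!i. i < n ==> c (f i) = f (Suc i mod n)" using cycle_exists by blast
	define h where "h i = f (i mod n)" for i
	have hf: "h i = f i" if "i < n" for i using that by (simp add: h_def)
	have hper: "h (i + n) = h i" "h (i mod n) = h i" for i by (simp_all add: h_def)
	have ch: "c (h i) = h (Suc i)" for i
		using c(2)[of "i mod n"] n0 by (simp add: h_def mod_Suc_eq)
	have chp: "(c ^^ k) (h i) = h (i + k)" for i k
		by (induction k) (simp_all add: ch)
	define w where "w = c ^^ j"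
	have w: "w : weyl_group \<Phi>" unfolding w_def by (rule reflection_group_funpow[OF c(1)])
	have wh: "w (h i) = h (i + j)" for i by (simp add: w_def chp)
	have lin: "linear w" and orth: "orthogonal_transformation w"
		using reflection_group_orthogonal[OF w] by (auto simp: orthogonal_transformation_linear)
	have om: "omega l \<Phi> \<a> j = w"
	proof -
		have simple': "simple_roots l \<Phi> \<a>" using simple by (simp add: n_def)
		show ?thesis
		proof (rule omega_eqI[OF root_system reduced simple' j w])
			fix i assume i: "i : {1..l}"
			have "i - 1 < n" "i < n" "i : {1..n - 1}" using i unfolding n_def atLeastAtMost_iff by linarith+
			then have ai: "\<a> i = h (i - 1) - h i" using \<a>[of i] hf[of i] hf[of "i - 1"] by simp
			have wa: "w (\<a> i) = h (i - 1 + j) - h (i + j)" unfolding ai by (simp add: linear_diff[OF lin] wh)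
			consider "i + j < n" | "i + j = n" | "n < i + j" by linarith
			then show "(EX k:{1..l} - {j}. w (\<a> i) = \<a> k) | - w (\<a> i) - \<a> j : nat_cone l \<a>"
			proof cases
				case 1
				then have "i + j : {1..l} - {j}" using i by (auto simp: n_def)
				moreover have "w (\<a> i) = \<a> (i + j)"
					using wa \<a>[of "i + j"] 1 i hf[of "i + j"] hf[of "i + j - 1"] by (simp add: n_def)
				ultimately show ?thesis by blast
			next
				case 2
				have e: "i - 1 + j = n - 1" using 2 i by auto
				have "(n - 1) mod n = n - 1" by (rule mod_less[OF diff_less[OF zero_less_one n0]])
				then have "w (\<a> i) = f (n - 1) - f 0" using wa e 2 by (simp add: h_def)
				moreover have "\<a> j = f (j - 1) - f j" using \<a>[of j] j by (simp add: n_def)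
				ultimately have "- w (\<a> i) - \<a> j = (f 0 - f (j - 1)) + (f j - f (n - 1))" by simp
				also have "\<dots> : nat_cone (n - 1) \<a>" using jn by (intro nat_cone_add cone) auto
				finally show ?thesis by (simp add: n_def)
			next
				case 3
				define k where "k = i + j - n"
				have k: "i + j = k + n" "i - 1 + j = (k - 1) + n" "1 <= k" "k <= l" "k ~= j" "k < n" using 3 i jn by (auto simp: k_def n_def)
				have "w (\<a> i) = h (k - 1) - h k" using wa unfolding k(1,2) hper .
				then have "w (\<a> i) = \<a> k" using \<a>[of k] k hf[of k] hf[of "k - 1"] by (simp add: n_def)
				then show ?thesis using k by auto
			qed
		qed
	qed
	have whp: "(w ^^ k) (h i) = h (i + j * k)" for i k
		by (induction k arbitrary: i) (simp_all add: wh algebra_simps)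
	have linp: "linear (w ^^ k)" for k
		by (induction k) (auto simp: linear_id[unfolded id_def] id_def intro: linear_compose[OF _ lin, unfolded o_def] simp: o_def)
	have powid: "w ^^ k = id <-> r dvd k" for k
	proof
		assume "w ^^ k = id"
		then have "h (0 + j * k) = h 0" using whp[of k 0] by simp
		then have "j * k mod n = 0" using f_inj[of "j * k mod n" 0] n0 by (simp add: h_def)
		then have "g * r dvd g * (j' * k)" unfolding nr[symmetric] by (simp add: jj mult.assoc mod_eq_0_iff_dvd)
		then have "r dvd j' * k" using g0 by simp
		then show "r dvd k" using cop by (simp add: coprime_dvd_mult_right_iff)
	next
		assume "r dvd k"
		then obtain s where "k = r * s" by blast
		then have jk: "j * k = n * (j' * s)" using jj nr by simp
		have "(w ^^ k) x = id x" for x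
		proof (rule linear_eq_on_span[of "w ^^ k" id "f ` {..<n}"])
			show "x : span (f ` {..<n})" using full by simp
			fix b assume "b : f ` {..<n}"
			then obtain i where "i < n" "b = h i" using hf by fastforce
			then show "(w ^^ k) b = id b" using whp[of k i] jk by (simp add: h_def)
		qed (simp_all add: linp linear_id[unfolded id_def] id_def)
		then show "w ^^ k = id" by (simp add: fun_eq_iff)
	qed
	have fo: "0 < r" "w ^^ r = id" using r1 powid by auto
	have order: "map_order w = r"
		by (rule map_order_eqI[OF fo]) (use powid nat_dvd_not_less in blast)
	obtain u v where uv: "j * u = g + n * v" using exists_multiple_mod_gcd[of j n] jn by (auto simp: g_def)
	have hmul: "h (i + n * s) = h i" for i s by (simp add: h_def)
	have fixed_shift: "h (i + j) \<bullet> y = h i \<bullet> y" if "w y = y" for y i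
		using fixed_iff_inner[OF orth full, of y] that n0 wh[of "i mod n"] hper(2)
		by (metis (no_types, lifting) h_def image_eqI lessThan_iff mod_add_left_eq mod_less_divisor mod_mod_trivial)
	have fixed: "w y = y <-> (ALL i. h (i + g) \<bullet> y = h i \<bullet> y)" for y
	proof
		assume y: "w y = y"
		show "ALL i. h (i + g) \<bullet> y = h i \<bullet> y"
		proof
			fix i
			have "h (i + j * u) \<bullet> y = h i \<bullet> y" by (rule iterate_shift[where A = "%i. h i \<bullet> y"]) (rule fixed_shift[OF y])
			then show "h (i + g) \<bullet> y = h i \<bullet> y" using hmul[of "i + g" v] by (simp add: uv add.assoc)
		qed
	next
		assume a: "ALL i. h (i + g) \<bullet> y = h i \<bullet> y"
		have "h (i + g * j') \<bullet> y = h i \<bullet> y" for i by (rule iterate_shift[where A = "%i. h i \<bullet> y"]) (use a in blast)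
		then have "w (f i) \<bullet> y = f i \<bullet> y" if "i < n" for i using wh[of i] hf[OF that] jj by metis
		then show "w y = y" unfolding fixed_iff_inner[OF orth full] by blast
	qed
	have fixed_mod: "h i \<bullet> y = h (i mod g) \<bullet> y" if "w y = y" for y i
	proof -
		have "h (i mod g + g * (i div g)) \<bullet> y = h (i mod g) \<bullet> y"
			by (rule iterate_shift[where A = "%i. h i \<bullet> y"]) (use that fixed in blast)
		then show ?thesis by simp
	qed
	define F where "F i = (1 / real r) *R (\<Sum>s<r. h (i + g * s))" for i
	have idx: "i + g * s < n" if "i < g" "s < r" for i s
	proof -
		have "i + g * s < g * Suc s" using that by simp
		also have "\<dots> <= n" unfolding nr using that by (intro mult_le_mono2) simp
		finally show ?thesis .
	qed
	have F_family: "difference_family g F (N / real r)"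
	proof
		fix i p q assume ipq: "i < g" "p < g" "q < g"
		have inj: "a + g * s = b + g * s' <-> a = b & s = s'" if "a < g" "b < g" for a b s s'
		proof
			assume e: "a + g * s = b + g * s'"
			have "a = (a + g * s) mod g" "b = (b + g * s') mod g" using that by simp_all
			then have "a = b" using e by metis
			then show "a = b & s = s'" using e g0 by simp
		qed simp
		have one: "h (i + g * s) \<bullet> (\<Sum>s'<r. h (p + g * s') - h (q + g * s')) = N * ((if i = p then 1 else 0) - (if i = q then 1 else 0))"
			if s: "s < r" for s
		proof -
			have "h (i + g * s) \<bullet> (\<Sum>s'<r. h (p + g * s') - h (q + g * s')) =
				(\<Sum>s'<r. N * ((if i = p then (if s = s' then 1 else 0) else 0) - (if i = q then (if s = s' then 1 else 0) else 0)))"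
				unfolding inner_sum_right
			proof (rule sum.cong)
				fix s' assume "s' : {..<r}"
				then have s': "s' < r" by simp
				show "h (i + g * s) \<bullet> (h (p + g * s') - h (q + g * s')) =
					 N * ((if i = p then (if s = s' then 1 else 0) else 0) - (if i = q then (if s = s' then 1 else 0) else 0))"
					unfolding hf[OF idx[OF ipq(1) s]] hf[OF idx[OF ipq(2) s']] hf[OF idx[OF ipq(3) s']]
						inner_difference[OF idx[OF ipq(1) s] idx[OF ipq(2) s'] idx[OF ipq(3) s']]
						inj[OF ipq(1,2)] inj[OF ipq(1,3)] by auto
			qed simp
			also have "\<dots> = N * ((if i = p then 1 else 0) - (if i = q then 1 else 0))"
				using s by (auto simp: sum_subtractf simp flip: sum_distrib_left)
			finally show ?thesis .
		qed
		have "F i \<bullet> (F p - F q) = (1 / real r) * (1 / real r) * (\<Sum>s<r. h (i + g * s) \<bullet> (\<Sum>s'<r. h (p + g * s') - h (q + g * s')))"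
			by (simp add: F_def inner_sum_left inner_diff_right sum_subtractf algebra_simps flip: scaleR_diff_right)
		also have "\<dots> = (1 / real r) * (1 / real r) * (\<Sum>s<r. N * ((if i = p then 1 else 0) - (if i = q then 1 else 0)))"
			using one by simp
		also have "\<dots> = N / real r * ((if i = p then 1 else 0) - (if i = q then 1 else 0))" using r1 by simp
		finally show "F i \<bullet> (F p - F q) = N / real r * ((if i = p then 1 else 0) - (if i = q then 1 else 0))" .
	qed (use N_pos r1 in simp)
	interpret F: difference_family g F "N / real r" by (rule F_family)
	have F_inner: "F i \<bullet> y = h i \<bullet> y" if "w y = y" for i y
	proof -
		have "h (i + g * s) \<bullet> y = h i \<bullet> y" for s
			by (rule iterate_shift[where A = "%i. h i \<bullet> y"]) (use that fixed in blast)
		then show ?thesis using r1 by (simp add: F_def inner_sum_left)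
	qed
	have avg: "orbit_average w (h i) = F (i mod g)" for i
	proof (rule orbit_average_eqI[OF orth fo])
		let ?C = "c ^^ g"
		have linC: "linear ?C" using reflection_group_orthogonal[OF reflection_group_funpow[OF c(1)]]
			by (simp add: orthogonal_transformation_linear)
		have shift: "(\<Sum>s<m. a (Suc s)) + a 0 = (\<Sum>s<m. a s) + a m" for m and a :: "nat => 'a"
			by (induction m) (auto simp: algebra_simps)
		let ?i = "i mod g"
		have "h (?i + g * r) = h ?i" using hper(1) nr by metis
		then have "(\<Sum>s<r. h (?i + g * Suc s)) = (\<Sum>s<r. h (?i + g * s))"
			using shift[of "%s. h (?i + g * s)" r] by simp
		then have "?C (F ?i) = F ?i"
			by (simp add: F_def linear_scale[OF linC] linear_sum[OF linC] chp algebra_simps)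
		then have "(?C ^^ j') (F ?i) = F ?i" by (rule funpow_fixed)
		then show "w (F ?i) = F ?i" unfolding w_def jj by (simp add: funpow_mult)
		show "F ?i \<bullet> y = h i \<bullet> y" if "w y = y" for y using F_inner[OF that] fixed_mod[OF that, of i] by simp
	qed
	note alin = orbit_average_linear[OF orth fo]
	have fold: "folded_roots \<Phi> w = difference_roots g F"
	proof (rule set_eqI, rule iffI)
		fix x assume "x : folded_roots \<Phi> w"
		then obtain i k where ik: "i < n" "k < n" "x = orbit_average w (f i - f k)" "x ~= 0"
			by (auto simp: folded_roots_def roots_eq difference_roots_def)
		then have "x = F (i mod g) - F (k mod g)" using avg[of i] avg[of k] hf by (simp add: linear_diff[OF alin])
		moreover have "i mod g ~= k mod g" using calculation ik(4) by auto
		ultimately show "x : difference_roots g F" using g0 unfolding difference_roots_def by fastforce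
	next
		fix x assume x: "x : difference_roots g F"
		then obtain i k where ik: "i < g" "k < g" "i ~= k" "x = F i - F k" by (auto simp: difference_roots_def)
		have "x ~= 0" using F.difference_square[OF ik(1-3)] F.N_pos ik(4) by auto
		moreover have "x = orbit_average w (f i - f k)"
			using avg[of i] avg[of k] hf[of i] hf[of k] ik gn by (simp add: linear_diff[OF alin])
		moreover have "f i - f k : \<Phi>"
			unfolding roots_eq difference_roots_def mem_Collect_eq using ik gn by (intro exI[of _ i] exI[of _ k]) simp
		ultimately show "x : folded_roots \<Phi> w" by (auto simp: folded_roots_def)
	qed
	have fixed_span: "fixed_space w = span (difference_roots g F)"
	proof
		have "subspace (fixed_space w)"
			using lin by (auto simp: subspace_def fixed_space_def linear_add linear_scale linear_0)
		moreover have "difference_roots g F \<subseteq> fixed_space w"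
			unfolding fold[symmetric] using orbit_average_fixed[OF orth fo] by (auto simp: folded_roots_def fixed_space_def)
		ultimately show "span (difference_roots g F) \<subseteq> fixed_space w" by (intro span_minimal)
		show "fixed_space w \<subseteq> span (difference_roots g F)"
		proof
			fix x assume "x : fixed_space w"
			then have "orbit_average w x = x" by (intro orbit_average_eqI[OF orth fo]) (auto simp: fixed_space_def)
			moreover have "orbit_average w x : span (difference_roots g F)" if "x : span (difference_roots n f)" for x
				using that
			proof (induction rule: span_induct_alt)
				case base
				then show ?case by (simp add: linear_0[OF alin] span_zero)
			next
				case (step d b y)
				have "orbit_average w b : span (difference_roots g F)"
				proof (cases "orbit_average w b = 0")
					case False
					then have "orbit_average w b : folded_roots \<Phi> w" using step(1) by (auto simp: folded_roots_def roots_eq)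
					then show ?thesis unfolding fold by (rule span_base)
				qed (simp add: span_zero)
				then show ?case using step by (simp add: linear_add[OF alin] linear_scale[OF alin] span_add span_scale)
			qed
			moreover have "x : span (difference_roots n f)" using root_system by (simp add: roots_eq root_system_in_def)
			ultimately show "x : span (difference_roots g F)" by metis
		qed
	qed
	define P where "P k i = real k / real r * real (i div g)" for k i :: nat
	have Pmod: "P k i - P k (i mod n) : Ints" for k i
	proof -
		have "i div g = (i mod n + g * (r * (i div n))) div g" using nr by (simp flip: mult.assoc)
		also have "\<dots> = i mod n div g + r * (i div n)" using g0 by (simp add: add.commute)
		finally have "P k i - P k (i mod n) = real (k * (i div n))" using r1 by (simp add: P_def field_simps)
		then show ?thesis by (simp only: Ints_of_nat)
	qed
	have Padd: "P k (i + j) = P k i + real k / real r * real j'" for k i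
	proof -
		have "(i + j) div g = i div g + j'" using g0 jj by simp
		then show ?thesis by (simp add: P_def algebra_simps)
	qed
	have "EX p. ALL k. ALL i<n. ALL i'<n. f i \<bullet> p k - f i' \<bullet> p k = P k i - P k i'"
		by (intro choice allI prescribed_differences)
	then obtain p where p: "!!k i i'. i < n ==> i' < n ==> f i \<bullet> p k - f i' \<bullet> p k = P k i - P k i'" by blast
	have disp: "h (i + j) \<bullet> (t - w t) = h (i + j) \<bullet> t - h i \<bullet> t" for i t
		using displacement_inner[OF orth, of "h i" t] wh by simp
	have shifted: "EX i0<n. i = (i0 + j) mod n" if "i < n" for i
	proof (intro exI conjI)
		show "(i + (n - j)) mod n < n" using n0 by simp
		have "((i + (n - j)) mod n + j) mod n = (i + (n - j) + j) mod n" by (rule mod_add_left_eq)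
		then show "i = ((i + (n - j)) mod n + j) mod n" using jn that by simp
	qed
	have P1: "real r *R p k : coweights \<Phi>" for k
		unfolding lattice_iff
	proof (intro allI impI)
		fix i i' assume "i < n" "i' < n"
		then have "f i \<bullet> (real r *R p k) - f i' \<bullet> (real r *R p k) = real r * (P k i - P k i')"
			using p[of i i' k] by (simp flip: right_diff_distrib)
		also have "\<dots> = real k * real (i div g) - real k * real (i' div g)" using r1 by (simp add: P_def algebra_simps)
		finally show "f i \<bullet> (real r *R p k) - f i' \<bullet> (real r *R p k) : Ints" by simp
	qed
	have P2: "p k - w (p k) : coweights \<Phi>" for k
		unfolding lattice_iff
	proof (intro allI impI)
		fix i i' assume ii: "i < n" "i' < n"
		obtain a where a: "a < n" "i = (a + j) mod n" using shifted[OF ii(1)] by blast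
		obtain b where b: "b < n" "i' = (b + j) mod n" using shifted[OF ii(2)] by blast
		have "f i = h (a + j)" "f i' = h (b + j)" using a b by (simp_all add: h_def)
		then have "f i \<bullet> (p k - w (p k)) - f i' \<bullet> (p k - w (p k)) = (f i \<bullet> p k - f i' \<bullet> p k) - (f a \<bullet> p k - f b \<bullet> p k)"
			using disp[of a "p k"] disp[of b "p k"] hf[OF a(1)] hf[OF b(1)] by simp
		also have "\<dots> = (P k i - P k i') - (P k a - P k b)" using p ii a b by simp
		also have "\<dots> = (P k (b + j) - P k i') - (P k (a + j) - P k i)" by (simp add: Padd)
		also have "\<dots> : Ints" unfolding a(2) b(2) by (intro Ints_diff[OF Pmod Pmod])
		finally show "f i \<bullet> (p k - w (p k)) - f i' \<bullet> (p k - w (p k)) : Ints" .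
	qed
	have lam1: "(f g - f 0) \<bullet> z : Ints" if "z : coweights \<Phi>" for z
		using that gn n0 unfolding lattice_iff by (simp add: inner_diff_left)
	have lam2: "(f g - f 0) \<bullet> y = 0" if "w y = y" for y
		using fixed[THEN iffD1, OF that, THEN spec, of 0] gn n0 hf by (simp add: inner_diff_left)
	have lam3: "(f g - f 0) \<bullet> p k - real k / real r : Ints" for k
		using p[OF gn n0, of k] g0 by (simp add: inner_diff_left P_def)
	have cover: "EX k:totatives r. EX e z. w e = e & z : coweights \<Phi> & t = p k + e + z"
		if t: "t - w t : coweights \<Phi>" and reg: "ALL \<beta>:\<Phi>. \<beta> \<bullet> t ~: Ints" for t
	proof -
		define A where "A i = h i \<bullet> t" for i
		have A0: "A (i + j) - A i - (A j - A 0) : Ints" for i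
		proof -
			have "h (i + j) \<bullet> (t - w t) - h (0 + j) \<bullet> (t - w t) : Ints"
				using t n0 unfolding lattice_iff h_def by simp
			then show ?thesis unfolding disp by (simp add: A_def)
		qed
		define a where "a = real u * (A j - A 0)"
		have Ag: "A (i + g) - A i - a : Ints" for i
		proof -
			have "A (i + j * u) - A i - real u * (A j - A 0) : Ints" by (rule iterate_shift_mod[where A = A and j = j and a = "A j - A 0"]) (rule A0)
			then show ?thesis using hmul[of "i + g" v] by (simp add: a_def A_def uv add.assoc)
		qed
		have As: "A (i + g * s) - A i - real s * a : Ints" for i s by (rule iterate_shift_mod[where A = A and j = g and a = a]) (rule Ag)
		have "A (0 + g * r) = A 0" using hper(1)[of 0] nr by (simp add: A_def)
		then have "- (real r * a) : Ints" using As[of 0 r] by simp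
		then obtain bb :: int where bb: "real r * a = of_int bb" unfolding Ints_minus_iff by (auto elim: Ints_cases)
		define k where "k = nat (bb mod int r)"
		have kb: "int k = bb mod int r" using r1 by (simp add: k_def)
		have ak: "a - real k / real r = of_int (bb div int r)"
		proof -
			have "bb = int k + int r * (bb div int r)" unfolding kb by simp
			then have "real_of_int bb = real k + real r * of_int (bb div int r)"
				by (metis of_int_add of_int_mult of_int_of_nat_eq)
			then have "real r * a = real k + real r * of_int (bb div int r)" using bb by simp
			then show ?thesis using r1 by (simp add: field_simps)
		qed
		have kr: "k < r" using r1 kb by (metis of_nat_0_less_iff of_nat_less_iff fo(1) pos_mod_bound)
		have cop_k: "coprime k r"
		proof (rule ccontr)
			assume nc: "~ coprime k r"
			define d where "d = gcd k r"
			have d1: "1 < d" using nc fo(1) by (metis d_def coprime_iff_gcd_eq_1 gcd_pos_nat less_one linorder_neqE_nat not_gr0 zero_neq_one)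
			have dd: "d dvd k" "d dvd r" by (simp_all add: d_def)
			define s where "s = r div d"
			have s: "r = d * s" "0 < s" "s < r" using dd(2) d1 fo(1) by (auto simp: s_def)
			obtain k' where k': "k = d * k'" using dd(1) by blast
			have "real s * (real k / real r) = real k'" using s d1 by (simp add: k' field_simps)
			then have "real s * a = real s * of_int (bb div int r) + real k'" using ak by (simp add: algebra_simps)
			then have "real s * a : Ints" by simp
			then have "A (0 + g * s) - A 0 - real s * a + real s * a : Ints" by (intro Ints_add As)
			then have "A (g * s) - A 0 : Ints" by simp
			moreover have "g * s < n" "g * s ~= 0" using s g0 nr by simp_all
			ultimately show False using reg hf[of "g * s"] hf[of 0] n0 unfolding regular_iff A_def by metis
		qed
		have k: "k : totatives r" using cop_k kr r1 by (cases "k = 0") (auto simp: totatives_def)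
		obtain e where e: "!!i i'. i < n ==> i' < n ==> f i \<bullet> e - f i' \<bullet> e = A (i mod g) - A (i' mod g)"
			using prescribed_differences[of "%i. A (i mod g)"] by blast
		have "w e = e"
			unfolding fixed
		proof
			fix i
			have "(i + g) mod n mod g = i mod n mod g" using nr by (simp add: mod_mod_cancel)
			then have "f ((i + g) mod n) \<bullet> e - f (i mod n) \<bullet> e = 0" using e[of "(i + g) mod n" "i mod n"] n0 by simp
			then show "h (i + g) \<bullet> e = h i \<bullet> e" by (simp add: h_def)
		qed
		moreover have "t - p k - e : coweights \<Phi>"
		proof -
			have D: "A i - A (i mod g) - P k i : Ints" for i
			proof -
				have "A (i mod g + g * (i div g)) - A (i mod g) - real (i div g) * a + real (i div g) * of_int (bb div int r) : Ints"
					by (intro Ints_add As) simp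
				moreover have "real (i div g) * a = P k i + real (i div g) * of_int (bb div int r)"
					using ak by (simp add: P_def algebra_simps)
				ultimately show ?thesis by (simp add: algebra_simps)
			qed
			show ?thesis
				unfolding lattice_iff
			proof (intro allI impI)
				fix i i' assume ii: "i < n" "i' < n"
				have "f i \<bullet> (t - p k - e) - f i' \<bullet> (t - p k - e) =
					(f i \<bullet> t - f i' \<bullet> t) - (f i \<bullet> p k - f i' \<bullet> p k) - (f i \<bullet> e - f i' \<bullet> e)" by (simp add: inner_diff_right)
				also have "\<dots> = (A i - A i') - (P k i - P k i') - (A (i mod g) - A (i' mod g))"
					using p[OF ii] e[OF ii] hf ii by (simp add: A_def)
				also have "\<dots> = (A i - A (i mod g) - P k i) - (A i' - A (i' mod g) - P k i')" by simp
				also have "\<dots> : Ints" by (rule Ints_diff[OF D D])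
				finally show "f i \<bullet> (t - p k - e) - f i' \<bullet> (t - p k - e) : Ints" .
			qed
		qed
		moreover have "t = p k + e + (t - p k - e)" by simp
		ultimately show ?thesis using k by blast
	qed
	have regular: "(ALL \<beta>:\<Phi>. \<beta> \<bullet> (p k + y) ~: Ints) <-> (ALL \<beta>:difference_roots g F. real r * (\<beta> \<bullet> y) ~: Ints)"
		if k: "k : totatives r" and y: "w y = y" for k y
	proof -
		define Y where "Y i = h i \<bullet> y" for i
		have kc: "coprime k r" using k by (simp add: totatives_def)
		have Ymod: "f i \<bullet> y = Y (i mod g)" if "i < n" for i
			using fixed_mod[OF y, of i] hf[OF that] by (simp add: Y_def)
		have val: "f i \<bullet> (p k + y) - f i' \<bullet> (p k + y) = P k i - P k i' + (Y (i mod g) - Y (i' mod g))" if "i < n" "i' < n" for i i'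
			using p[OF that] Ymod[OF that(1)] Ymod[OF that(2)] by (simp add: inner_add_right)
		have rP: "real r * (P k i - P k i') : Ints" for i i'
		proof -
			have "real r * (P k i - P k i') = real k * real (i div g) - real k * real (i' div g)"
				using r1 by (simp add: P_def algebra_simps)
			then show ?thesis by simp
		qed
		have FY: "(F i - F i') \<bullet> y = Y i - Y i'" for i i' using F_inner[OF y] by (simp add: inner_diff_left Y_def)
		have R: "(ALL \<beta>:difference_roots g F. real r * (\<beta> \<bullet> y) ~: Ints) <->
				(ALL a<g. ALL b<g. a ~= b --> real r * (Y a - Y b) ~: Ints)"
			unfolding difference_roots_def FY[symmetric] by blast
		show ?thesis
			unfolding R regular_iff
		proof
			assume L: "ALL i<n. ALL i'<n. i ~= i' --> f i \<bullet> (p k + y) - f i' \<bullet> (p k + y) ~: Ints"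
			show "ALL a<g. ALL b<g. a ~= b --> real r * (Y a - Y b) ~: Ints"
			proof (intro allI impI notI)
				fix a b assume ab: "a < g" "b < g" "a ~= b" "real r * (Y a - Y b) : Ints"
				then obtain x :: int where x: "real r * (Y a - Y b) = of_int x" by (auto elim: Ints_cases)
				\<comment> \<open>Move \<open>a\<close> within its residue class so that the two shifts cancel modulo the integers.\<close>
				obtain k1 :: int where k1: "[int k * k1 = 1] (mod int r)"
					using cong_solve_coprime_int[of "int k" "int r"] kc by auto
				define s where "s = nat ((- x * k1) mod int r)"
				have s: "int s = (- x * k1) mod int r" "s < r"
				proof -
					show 1: "int s = (- x * k1) mod int r" using fo(1) by (simp add: s_def)
					have "(- x * k1) mod int r < int r" using fo(1) by (intro pos_mod_bound) simp
					then show "s < r" using 1 by linarith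
				qed
				have "[int k * int s + x = int k * (- x * k1) + x] (mod int r)"
					unfolding s(1) by (intro cong_add cong_mult cong_refl) (simp add: cong_def)
				also have "int k * (- x * k1) + x = - x * (int k * k1) + x" by (simp add: algebra_simps)
				also have "[- x * (int k * k1) + x = - x * 1 + x] (mod int r)" by (intro cong_add cong_mult cong_refl k1)
				finally have "int r dvd int k * int s + x" by (simp add: cong_0_iff)
				then obtain m where m: "int k * int s + x = int r * m" by blast
				define i where "i = a + g * s"
				have i: "i < n" "i div g = s" "i mod g = a" using idx[OF ab(1) s(2)] ab g0 by (simp_all add: i_def)
				have b: "b < n" "b div g = 0" "b mod g = b" using ab gn by auto
				have ib: "i ~= b" using i b ab by metis
				have "f i \<bullet> (p k + y) - f b \<bullet> (p k + y) = real k * real s / real r + (Y a - Y b)"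
					unfolding val[OF i(1) b(1)] i b by (simp add: P_def i b)
				also have "\<dots> = (real k * real s + real r * (Y a - Y b)) / real r" using fo(1) by (simp add: field_simps)
				also have "\<dots> = of_int (int k * int s + x) / real r" unfolding x by simp
				also have "\<dots> = of_int m" unfolding m using fo(1) by simp
				finally have "f i \<bullet> (p k + y) - f b \<bullet> (p k + y) : Ints" by (metis Ints_of_int)
				then show False using L i(1) b(1) ib by blast
			qed
		next
			assume R: "ALL a<g. ALL b<g. a ~= b --> real r * (Y a - Y b) ~: Ints"
			show "ALL i<n. ALL i'<n. i ~= i' --> f i \<bullet> (p k + y) - f i' \<bullet> (p k + y) ~: Ints"
			proof (intro allI impI notI)
				fix i i' assume ii: "i < n" "i' < n" "i ~= i'" "f i \<bullet> (p k + y) - f i' \<bullet> (p k + y) : Ints"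
				then have v: "P k i - P k i' + (Y (i mod g) - Y (i' mod g)) : Ints" using val[OF ii(1,2)] by simp
				show False
				proof (cases "i mod g = i' mod g")
					case False
					have "real r * (P k i - P k i' + (Y (i mod g) - Y (i' mod g))) - real r * (P k i - P k i') : Ints"
						using v by (intro Ints_diff rP) simp
					then have "real r * (Y (i mod g) - Y (i' mod g)) : Ints" by (simp add: algebra_simps)
					then show False using R False g0 by simp
				next
					case True
					then have "P k i - P k i' : Ints" using v by simp
					then obtain x :: int where "P k i - P k i' = of_int x" by (auto elim: Ints_cases)
					then have "real k * real (i div g) - real k * real (i' div g) = of_int x * real r"
						using fo(1) by (simp add: P_def field_simps)
					then have "of_int (int k * (int (i div g) - int (i' div g))) = (of_int (x * int r) :: real)"
						by (simp add: algebra_simps)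
					then have "int k * (int (i div g) - int (i' div g)) = x * int r" by (simp only: of_int_eq_iff)
					then have "int r dvd int k * (int (i div g) - int (i' div g))" by simp
					moreover have "coprime (int r) (int k)" using kc by (simp add: coprime_commute)
					ultimately have dv: "int r dvd int (i div g) - int (i' div g)" by (simp add: coprime_dvd_mult_right_iff)
					have "i div g < r" "i' div g < r" using ii nr g0 by (simp_all add: less_mult_imp_div_less mult.commute)
					then have "\<bar>int (i div g) - int (i' div g)\<bar> < int r" by auto
					then have "int (i div g) - int (i' div g) = 0" using dv zdvd_imp_le[of "int r" "\<bar>int (i div g) - int (i' div g)\<bar>"] by fastforce
					then have "i div g = i' div g" by simp
					then have "i = i'" using True by (metis div_mult_mod_eq)
					then show False using ii by simp
				qed
			qed
		qed
	qed
	have "folding_statement \<Phi> (Type_A l) j w"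
	proof (cases "g = 1")
		case True
		have e: "difference_roots g F = {}" using True by (auto simp: difference_roots_def)
		have t: "root_system_of_type (fixed_space w) {} Type_Empty"
			unfolding fixed_span e by (auto simp: root_system_of_type_def root_system_in_def reduced_roots_def
				bourbaki_simple_roots_def simple_roots_def independent_empty)
		have t': "root_system_of_type (fixed_space w) (folded_roots \<Phi> w) Type_Empty" using t fold e by simp
		show ?thesis
		proof (rule folding_statementI[OF root_system w fo order _ t' t refl P1 P2 lam1 lam2 lam3 cover])
			show "folding_table \<Phi> (folded_roots \<Phi> w) r (Type_A l) j Type_Empty {} Type_Empty 1"
				by (rule folding_table.A_coprime[OF l]) (use True in \<open>simp add: g_def n_def Suc_eq_plus1\<close>)
			show "(ALL \<beta>:\<Phi>. \<beta> \<bullet> (p k + y) ~: Ints) <-> (ALL \<beta>:{}. real 1 * (\<beta> \<bullet> y) ~: Ints)"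
				if "k : totatives r" "w y = y" for k y
				using regular[OF that] e by simp
		qed
	next
		case False
		then have g2: "2 <= g" using g0 by simp
		have t: "root_system_of_type (fixed_space w) (folded_roots \<Phi> w) (Type_A (g - 1))"
			unfolding fold fixed_span by (rule F.type_A[OF g2])
		show ?thesis
		proof (rule folding_statementI[OF root_system w fo order _ t t refl P1 P2 lam1 lam2 lam3 cover])
			show "folding_table \<Phi> (folded_roots \<Phi> w) r (Type_A l) j (Type_A (g - 1)) (folded_roots \<Phi> w) (Type_A (g - 1)) r"
				by (rule folding_table.A[OF l _ False refl]) (simp_all add: g_def n_def r_def Suc_eq_plus1)
			show "(ALL \<beta>:\<Phi>. \<beta> \<bullet> (p k + y) ~: Ints) <-> (ALL \<beta>:folded_roots \<Phi> w. real r * (\<beta> \<bullet> y) ~: Ints)"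
				if "k : totatives r" "w y = y" for k y
				using regular[OF that] fold by simp
		qed
	qed
	then show ?thesis using om by simp
qed

section \<open>Root systems given by coefficient lists\<close>

text \<open>
	Coefficient lists start with the coefficient of the first simple root, so the entry at position
	\<open>k\<close> belongs to \<open>b (Suc k)\<close>.
\<close>

definition lincomb :: "(nat => 'a::real_vector) => int list => 'a" where
	"lincomb b c = (\<Sum>k<length c. real_of_int (c ! k) *R b (Suc k))"

definition pairing :: "int list => int list => int" where
	"pairing r c = sum_list (map2 (*) r c)"

text \<open>
	Column \<open>k\<close> lists the Cartan integers of all simple roots with respect to \<open>b
	(Suc k)\<close>; pairing it with a coefficient list gives the Cartan integer of the linear
	combination.
\<close>

definition cartan_columns :: "root_type => int list list" where
	"cartan_columns T = map (%k. map (%i. cartan_matrix T (Suc i) (Suc k)) [0..<type_rank T]) [0..<type_rank T]"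

definition list_reflect :: "int list list => nat => int list => int list" where
	"list_reflect R k c = c[k := c ! k - pairing (R ! k) c]"

definition unit_list :: "nat => nat => int list" where
	"unit_list m k = (replicate m 0)[k := 1]"

text \<open>
	A decidable condition on a list of candidates for the positive roots: a simple reflection maps
	every member to a member, except the simple root itself.
\<close>

definition closed_root_list :: "int list list => int list list => bool" where
	"closed_root_list R P <->
		 (ALL c:set P. length c = length R & (ALL x:set c. 0 <= x) & (EX x:set c. x ~= 0)) &
		 (ALL k:set [0..<length R]. unit_list (length R) k : set P &
				(ALL c:set P. c = unit_list (length R) k | list_reflect R k c : set P))"

lemma pairing_sum: "length r = length c ==> pairing r c = (\<Sum>i<length c. r ! i * c ! i)"
	by (simp add: pairing_def sum_list_sum_nth atLeast0LessThan)

lemma lincomb_inner: "lincomb b c \<bullet> y = (\<Sum>k<length c. real_of_int (c ! k) * (b (Suc k) \<bullet> y))"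
	by (simp add: lincomb_def inner_sum_left)

lemma lincomb_update:
	assumes "k < length c"
	shows "lincomb b (c[k := x]) = lincomb b c + real_of_int (x - c ! k) *R b (Suc k)"
proof -
	have "lincomb b (c[k := x]) - lincomb b c =
			(\<Sum>i<length c. if i = k then real_of_int (x - c ! k) *R b (Suc k) else 0)"
		unfolding lincomb_def length_list_update sum_subtractf[symmetric]
		by (intro sum.cong refl) (auto simp: nth_list_update scaleR_left_diff_distrib)
	then show ?thesis using assms by (simp add: algebra_simps)
qed

lemma lincomb_unit: "k < m ==> lincomb b (unit_list m k) = b (Suc k)"
	by (simp add: unit_list_def lincomb_update) (simp add: lincomb_def)

lemma sum_list_update_int: "k < length c ==> sum_list (c[k := x]) = sum_list c + x - (c ! k :: int)"
	by (induction c arbitrary: k) (auto split: nat.split simp: nth_Cons)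

locale simple_lists =
	fixes T :: root_type and b :: "nat => 'a::euclidean_space"
	assumes cartan: "!!i k. i : {1..type_rank T} ==> k : {1..type_rank T} ==>
		cartan_integer (b i) (b k) = of_int (cartan_matrix T i k)"
begin

abbreviation "m \<equiv> type_rank T"
abbreviation "R \<equiv> cartan_columns T"

lemma cartan_lincomb:
	assumes "length c = m" "k < m"
	shows "cartan_integer (lincomb b c) (b (Suc k)) = of_int (pairing (R ! k) c)"
proof -
	have l: "length (R ! k) = length c" using assms by (simp add: cartan_columns_def)
	have "cartan_integer (lincomb b c) (b (Suc k)) = (\<Sum>i<m. real_of_int (c ! i) * cartan_integer (b (Suc i)) (b (Suc k)))"
		by (simp add: cartan_integer_def lincomb_inner assms(1) sum_distrib_left sum_divide_distrib mult_ac)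
	also have "\<dots> = (\<Sum>i<m. real_of_int (R ! k ! i * c ! i))"
		using cartan assms(2) by (intro sum.cong) (auto simp: cartan_columns_def)
	also have "\<dots> = of_int (pairing (R ! k) c)" unfolding pairing_sum[OF l] assms(1) by simp
	finally show ?thesis .
qed

lemma reflect_lincomb:
	assumes "length c = m" "k < m"
	shows "root_reflection (b (Suc k)) (lincomb b c) = lincomb b (list_reflect R k c)"
	using assms cartan_lincomb[OF assms] by (simp add: root_reflection_def list_reflect_def lincomb_update)

lemma length_reflect: "length (list_reflect R k c) = length c"
	by (simp add: list_reflect_def)

lemma word_lincomb:
	assumes "length c = m" "set ks \<subseteq> {..<m}"
	shows "reflection_word (map (%k. b (Suc k)) ks) (lincomb b c) = lincomb b (foldr (list_reflect R) ks c)"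
		"length (foldr (list_reflect R) ks c) = m"
	using assms(2)
proof (induction ks)
	case (Cons k ks)
	{ case 1 then show ?case using Cons reflect_lincomb[of "foldr (list_reflect R) ks c" k] by simp }
	{ case 2 then show ?case using Cons by (simp add: length_reflect) }
qed (use assms in simp_all)

lemma word_in_group: "set ks \<subseteq> {..<m} ==> reflection_word (map (%k. b (Suc k)) ks) : reflection_group (b ` {1..m})"
	by (intro reflection_word_in_group) auto

end

text \<open>
	Applying a word of simple reflections to a simple root gives a root whose coefficients can be
	computed.
\<close>

lemma minuscule_coefficient_le_one:
	assumes rs: "root_system_in V \<Phi>" "reduced_roots \<Phi>" "irreducible_roots \<Phi>" and b: "bourbaki_simple_roots T \<Phi> \<a>"
		and j: "j : minuscule_indices (type_rank T) \<Phi> \<a> - {0}"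
		and k: "k < type_rank T" "set ks \<subseteq> {..<type_rank T}"
		and c: "foldr (list_reflect (cartan_columns T)) ks (unit_list (type_rank T) k) = c" "ALL x:set c. 0 <= x"
	shows "c ! (j - 1) <= 1"
proof (rule ccontr)
	interpret simple_lists T \<a> by unfold_locales (use b in \<open>auto simp: bourbaki_simple_roots_def\<close>)
	have s: "simple_roots m \<Phi> \<a>" using b by (simp add: bourbaki_simple_roots_def)
	have jm: "j : {1..m}" using minuscule_index_range[of j m \<Phi> \<a>] j by blast
	have len: "length c = m" using word_lincomb(2)[of "unit_list m k" ks] k c(1) by (simp add: unit_list_def)
	have "lincomb \<a> c = reflection_word (map (%k. \<a> (Suc k)) ks) (\<a> (Suc k))"
		using word_lincomb(1)[of "unit_list m k" ks] k c(1) lincomb_unit[OF k(1), of \<a>] by (simp add: unit_list_def)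
	moreover have "\<a> (Suc k) : \<Phi>" "\<a> ` {1..m} \<subseteq> \<Phi>" using s k by (auto simp: simple_roots_def)
	ultimately have root: "lincomb \<a> c : \<Phi>"
		using reflection_group_roots[OF rs(1) _ word_in_group[OF k(2)], of "\<a> (Suc k)"] by simp
	assume "~ c ! (j - 1) <= 1"
	then have two: "2 <= c ! (j - 1)" by simp
	have "lincomb \<a> c - 2 *R \<a> j = lincomb \<a> (c[j - 1 := c ! (j - 1) - 2])"
		using lincomb_update[of "j - 1" c \<a> "c ! (j - 1) - 2"] jm len by auto
	also have "\<dots> : nat_cone m \<a>"
	proof -
		let ?c = "c[j - 1 := c ! (j - 1) - 2]"
		have "real_of_int (?c ! i) *R \<a> (Suc i) : nat_cone m \<a>" if "i < m" for i
		proof -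
			have "0 <= c ! i" using c(2) that len by simp
			then have "0 <= ?c ! i" using two that len jm by (cases "i = j - 1") auto
			then obtain n where "?c ! i = int n" using zero_le_imp_eq_int by blast
			then have "real_of_int (?c ! i) *R \<a> (Suc i) = (\<Sum>t<n. \<a> (Suc i))" by (simp add: sum_constant_scaleR)
			then show ?thesis using that by (auto intro!: nat_cone_sum nat_cone_base)
		qed
		then show ?thesis unfolding lincomb_def using len by (intro nat_cone_sum) auto
	qed
	finally have "lincomb \<a> c - 2 *R \<a> j : nat_cone m \<a>" .
	then show False using minuscule_no_coefficient_two[OF rs s _ _ root] j by blast
qed

locale root_list = simple_lists T b
	for T :: root_type and b :: "nat => 'a::euclidean_space" +
	fixes P :: "int list list"
	assumes closed: "closed_root_list (cartan_columns T) P"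
		and inj: "inj_on b {1..type_rank T}" and indep: "independent (b ` {1..type_rank T})"
begin

definition roots :: "'a set" where
	"roots = {\<beta>. EX c:set P. \<beta> = lincomb b c | \<beta> = - lincomb b c}"

lemma length_columns [simp]: "length R = m"
	by (simp add: cartan_columns_def)

lemma list_props:
	assumes "c : set P"
	shows "length c = m" "!!k. k < m ==> 0 <= c ! k" "0 < sum_list c"
		"!!k. k < m ==> c = unit_list m k | list_reflect R k c : set P"
proof -
	show l: "length c = m" and nn: "!!k. k < m ==> 0 <= c ! k"
		"!!k. k < m ==> c = unit_list m k | list_reflect R k c : set P"
		using closed assms by (auto simp: closed_root_list_def)
	obtain x where x: "x : set c" "x ~= 0" "0 <= x" using closed assms by (auto simp: closed_root_list_def)
	have "ALL x:set c. 0 <= x" using closed assms by (auto simp: closed_root_list_def)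
	then have "x <= sum_list c" using x(1) by (induction c) (auto intro: order_trans[OF _ add_increasing] sum_list_nonneg add_increasing2)
	then show "0 < sum_list c" using x by simp
qed

lemma unit_in: "k < m ==> unit_list m k : set P"
	using closed by (auto simp: closed_root_list_def)

lemma height_functional: "EX t. ALL c. length c = m --> lincomb b c \<bullet> t = of_int (sum_list c)"
proof -
	obtain t where t: "ALL i:{1..m}. b i \<bullet> t = 1" using exists_prescribed_coordinates[OF inj indep, of "%_. 1"] by blast
	then have "lincomb b c \<bullet> t = of_int (sum_list c)" if "length c = m" for c
		using that by (simp add: lincomb_inner sum_list_sum_nth atLeast0LessThan)
	then show ?thesis by blast
qed

lemma lincomb_nonzero: "c : set P ==> lincomb b c ~= 0"
	using height_functional list_props by (metis inner_zero_left less_numeral_extra(3) of_int_eq_0_iff)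

lemma basis_in_roots: "i : {1..m} ==> b i : roots"
	unfolding roots_def using unit_in[of "i - 1"] lincomb_unit[of "i - 1" m b]
	by (auto intro!: bexI[of _ "unit_list m (i - 1)"])

lemma uminus_roots: "\<beta> : roots ==> - \<beta> : roots"
	unfolding roots_def by force

lemma roots_nonzero: "0 ~: roots"
	unfolding roots_def using lincomb_nonzero by force

lemma simple_reflection_roots:
	assumes "i : {1..m}" "\<beta> : roots" shows "root_reflection (b i) \<beta> : roots"
proof -
	obtain k where k: "k < m" "i = Suc k" using assms(1) by (cases i) auto
	have pos: "root_reflection (b i) (lincomb b c) : roots" if c: "c : set P" for c
	proof (cases "c = unit_list m k")
		case True
		have "b i ~= 0" using basis_in_roots[OF assms(1)] roots_nonzero by auto
		then have "root_reflection (b i) (lincomb b c) = - b i"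
			using True k root_reflection_self by (simp add: lincomb_unit)
		then show ?thesis using uminus_roots[OF basis_in_roots[OF assms(1)]] by simp
	next
		case False
		then have "list_reflect R k c : set P" using list_props(4)[OF c k(1)] by blast
		then show ?thesis unfolding k(2) reflect_lincomb[OF list_props(1)[OF c] k(1)] roots_def by blast
	qed
	obtain c where "c : set P" "\<beta> = lincomb b c | \<beta> = - lincomb b c" using assms(2) by (auto simp: roots_def)
	then show ?thesis using pos[of c] uminus_roots linear_neg[OF linear_root_reflection] by metis
qed

abbreviation "G \<equiv> reflection_group (b ` {1..m})"

lemma group_roots: "w : G ==> \<beta> : roots ==> w \<beta> : roots"
	by (induction rule: reflection_group.induct) (auto intro: simple_reflection_roots)

text \<open>
	A positive vector \<open>x\<close> has a positive product with some simple root that occurs in it, because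
	\<open>x \<bullet> x > 0\<close>; reflecting there lowers the height until a simple root is reached.
\<close>

lemma generated:
	assumes "\<beta> : roots" shows "EX w:G. EX i:{1..m}. \<beta> = w (b i)"
proof -
	have pos: "EX w:G. EX i:{1..m}. lincomb b c = w (b i)" if "c : set P" for c
		using that
	proof (induction "nat (sum_list c)" arbitrary: c rule: less_induct)
		case less
		note c = list_props[OF less.prems]
		let ?x = "lincomb b c"
		have "0 < ?x \<bullet> ?x" using lincomb_nonzero[OF less.prems] by simp
		also have "?x \<bullet> ?x = (\<Sum>k<m. real_of_int (c ! k) * (b (Suc k) \<bullet> ?x))" by (simp add: lincomb_inner[of b c ?x] c(1))
		finally obtain k where k: "k < m" "0 < real_of_int (c ! k) * (b (Suc k) \<bullet> ?x)"
			by (metis (no_types, lifting) sum_nonpos not_less lessThan_iff)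
		have "0 < b (Suc k) \<bullet> ?x" using k c(2)[OF k(1)] by (simp add: zero_less_mult_iff)
		moreover have "b (Suc k) ~= 0" using basis_in_roots[of "Suc k"] roots_nonzero k by auto
		ultimately have "0 < cartan_integer ?x (b (Suc k))" by (simp add: cartan_integer_def inner_commute)
		then have p: "0 < pairing (R ! k) c" using cartan_lincomb[OF c(1) k(1)] by simp
		let ?d = "list_reflect R k c"
		have x_eq: "?x = root_reflection (b (Suc k)) (lincomb b ?d)"
			using reflect_lincomb[OF c(1) k(1)] by (metis root_reflection_involution)
		show ?case
		proof (cases "c = unit_list m k")
			case True
			then show ?thesis using lincomb_unit[OF k(1)] k(1) by (intro bexI[OF _ reflection_group.id] bexI[of _ "Suc k"]) auto
		next
			case False
			then have d: "?d : set P" using c(4)[OF k(1)] by blast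
			have "sum_list ?d = sum_list c - pairing (R ! k) c"
				using k(1) c(1) by (simp add: list_reflect_def sum_list_update_int)
			then have "nat (sum_list ?d) < nat (sum_list c)" using p c(3) by simp
			then obtain w i where w: "w : G" "i : {1..m}" "lincomb b ?d = w (b i)" using less.hyps d by blast
			have "root_reflection (b (Suc k)) \<circ> w : G" using w(1) k(1) by (intro reflection_group.step) auto
			moreover have "?x = (root_reflection (b (Suc k)) \<circ> w) (b i)" using x_eq w(3) by simp
			ultimately show ?thesis using w(2) by blast
		qed
	qed
	obtain c where c: "c : set P" "\<beta> = lincomb b c | \<beta> = - lincomb b c" using assms by (auto simp: roots_def)
	obtain w i where w: "w : G" "i : {1..m}" "lincomb b c = w (b i)" using pos[OF c(1)] by blast
	have "w \<circ> root_reflection (b i) : G" using w by (intro reflection_group_comp reflection_in_group) auto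
	moreover have "b i ~= 0" using basis_in_roots[OF w(2)] roots_nonzero by auto
	then have "(w \<circ> root_reflection (b i)) (b i) = - lincomb b c"
		using w(3) root_reflection_self[of "b i"] linear_neg[OF orthogonal_transformation_linear[OF reflection_group_orthogonal[OF w(1)]]] by simp
	ultimately show ?thesis using c(2) w by metis
qed

text \<open>
	Move the root to a simple one; coefficients of roots are integers.
\<close>

lemma integral_multiple:
	assumes "\<beta> : roots" "r *R \<beta> : roots" shows "r : Ints"
proof -
	obtain w i where w: "w : G" "i : {1..m}" "\<beta> = w (b i)" using generated[OF assms(1)] by blast
	obtain v where v: "v : G" "v \<circ> w = id" using reflection_group_inverse[OF w(1)] by blast
	have "v (r *R \<beta>) = r *R b i"
		using v w linear_scale[OF orthogonal_transformation_linear[OF reflection_group_orthogonal[OF v(1)]]]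
		by (metis comp_apply id_apply)
	then have "r *R b i : roots" using group_roots[OF v(1) assms(2)] by simp
	then obtain c where c: "c : set P" "r *R b i = lincomb b c | r *R b i = - lincomb b c" by (auto simp: roots_def)
	obtain t where t: "ALL c. length c = m --> lincomb b c \<bullet> t = of_int (sum_list c)" using height_functional by blast
	have cl: "lincomb b c \<bullet> t = of_int (sum_list c)" using t list_props(1)[OF c(1)] by blast
	have "i - 1 < m" "Suc (i - 1) = i" using w(2) by auto
	then have "lincomb b (unit_list m (i - 1)) = b i" using lincomb_unit[of "i - 1" m b] by simp
	moreover have "sum_list (unit_list m (i - 1)) = 1" using \<open>i - 1 < m\<close>
		by (simp add: unit_list_def sum_list_update_int sum_list_replicate)
	ultimately have "b i \<bullet> t = 1" using t[rule_format, of "unit_list m (i - 1)"] by (simp add: unit_list_def)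
	moreover have "lincomb b c \<bullet> t : Ints" "- lincomb b c \<bullet> t : Ints" using cl by simp_all
	then have "(r *R b i) \<bullet> t : Ints" using c(2) by metis
	ultimately show ?thesis by simp
qed

lemma roots_system: "root_system_in (span (b ` {1..m})) roots"
	unfolding root_system_in_def
proof (intro conjI ballI)
	have "roots = lincomb b ` set P \<union> (%c. - lincomb b c) ` set P" by (auto simp: roots_def)
	then show "finite roots" by simp
	have "lincomb b c : span (b ` {1..m})" if "c : set P" for c
		unfolding lincomb_def by (intro span_sum span_scale span_base) (use list_props(1)[OF that] in auto)
	then have "roots \<subseteq> span (b ` {1..m})" unfolding roots_def using span_neg by fastforce
	then show "span roots = span (b ` {1..m})"
		using basis_in_roots by (metis (no_types, lifting) image_subsetI span_mono span_span subset_antisym)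
	show "0 ~: roots" by (rule roots_nonzero)
	fix \<a> assume a: "\<a> : roots"
	obtain w i where w: "w : G" "i : {1..m}" "\<a> = w (b i)" using generated[OF a] by blast
	obtain v where v: "v : G" "w \<circ> v = id" using reflection_group_inverse[OF w(1)] by blast
	note orth = reflection_group_orthogonal[OF w(1)]
	have wv: "\<beta> = w (v \<beta>)" for \<beta> using v(2) by (metis comp_apply id_apply)
	have r: "root_reflection \<a> \<beta> : roots" if b: "\<beta> : roots" for \<beta>
	proof -
		have "root_reflection \<a> \<beta> = w (root_reflection (b i) (v \<beta>))"
			using root_reflection_conj[OF orth, of "b i" "v \<beta>"] wv[of \<beta>] w(3) by simp
		then show ?thesis using group_roots[OF w(1)] group_roots[OF v(1) b] simple_reflection_roots[OF w(2)] by simp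
	qed
	show "root_reflection \<a> ` roots = roots"
	proof
		show "roots \<subseteq> root_reflection \<a> ` roots"
			using r by (metis image_eqI root_reflection_involution subsetI)
	qed (use r in blast)
	fix \<beta> assume b: "\<beta> : roots"
	have "cartan_integer \<beta> \<a> = cartan_integer (v \<beta>) (b i)"
		using cartan_integer_orthogonal[OF orth, of "v \<beta>" "b i"] wv[of \<beta>] w(3) by simp
	moreover obtain c where c: "c : set P" "v \<beta> = lincomb b c | v \<beta> = - lincomb b c"
		using group_roots[OF v(1) b] by (auto simp: roots_def)
	moreover have "cartan_integer (lincomb b c) (b i) : Ints"
		using cartan_lincomb[OF list_props(1)[OF c(1)], of "i - 1"] w(2) by auto
	moreover have "cartan_integer (- x) y = - cartan_integer x y" for x y :: 'a by (simp add: cartan_integer_def)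
	ultimately show "cartan_integer \<beta> \<a> : Ints" by auto
qed

text \<open>
	If both \<open>r\<close> and \<open>1 / r\<close> are integers, then \<open>r\<close> is 1 or
	-1.
\<close>

lemma roots_reduced: "reduced_roots roots"
	unfolding reduced_roots_def
proof (intro ballI allI impI)
	fix \<a> and r :: real assume a: "\<a> : roots" "r *R \<a> : roots"
	have r0: "r ~= 0" using a(2) roots_nonzero by auto
	have "r : Ints" by (rule integral_multiple[OF a])
	moreover have "1 / r : Ints" by (rule integral_multiple[OF a(2)]) (use a r0 in simp)
	ultimately obtain x y :: int where xy: "r = of_int x" "1 / r = of_int y" by (auto elim!: Ints_cases)
	then have "real_of_int (x * y) = 1" using r0 by (simp add: field_simps)
	then have "x * y = 1" by linarith
	then have "x = 1 | x = -1" by (metis zmult_eq_1_iff)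
	then show "r = 1 | r = -1" using xy by auto
qed

lemma roots_simple: "simple_roots m roots b"
proof -
	have eq: "lincomb b c = (\<Sum>i=1..m. real (nat (c ! (i - 1))) *R b i)" if c: "c : set P" for c
	proof -
		have "(\<Sum>i=1..m. real (nat (c ! (i - 1))) *R b i) = (\<Sum>k<m. real (nat (c ! k)) *R b (Suc k))"
			by (rule sum.reindex_bij_witness[of _ Suc "%i. i - 1"]) auto
		then show ?thesis using list_props(1,2)[OF c] by (simp add: lincomb_def)
	qed
	have "EX c :: nat => nat. \<beta> = (\<Sum>i=1..m. real (c i) *R b i) | \<beta> = - (\<Sum>i=1..m. real (c i) *R b i)"
		if \<beta>: "\<beta> : roots" for \<beta>
	proof -
		obtain c where c: "c : set P" "\<beta> = lincomb b c | \<beta> = - lincomb b c" using \<beta> by (auto simp: roots_def)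
		show ?thesis using c(2) unfolding eq[OF c(1)] by (rule exI[where x = "%i. nat (c ! (i - 1))"])
	qed
	moreover have "b ` {1..m} \<subseteq> roots" using basis_in_roots by blast
	ultimately show ?thesis unfolding simple_roots_def using inj indep by simp
qed

lemma roots_type: "(!!n. T ~= Type_BC n) ==> root_system_of_type (span (b ` {1..m})) roots T"
	unfolding root_system_of_type_def bourbaki_simple_roots_def
	using roots_system roots_reduced roots_simple cartan by blast

lemma roots_ball: "(!!x. p (- x) = p x) ==> (ALL \<beta>:roots. p (\<beta> \<bullet> y)) <-> (ALL c:set P. p (lincomb b c \<bullet> y))"
	unfolding roots_def by (auto simp del: inner_minus_left simp: inner_minus_left)

end

section \<open>Types E6 and E7\<close>

definition project_list :: "int list list => int list => int list" where
	"project_list A c = map (%r. pairing r c) A"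

text \<open>
	The finite facts behind the folding: the matrix \<open>A\<close> projects roots to roots or to \<open>0\<close>, the factor
	\<open>s d \<in> {1, n}\<close> turns a folded root into its dual root, and the residues modulo \<open>n\<close> of the linear
	form \<open>r\<close> on the roots above \<open>d\<close> are exactly those killed by \<open>s d\<close>, while \<open>r\<close> does not vanish
	modulo \<open>n\<close> on the roots above \<open>0\<close>.
\<close>

definition folds_onto :: "nat => int list list => int list => (int list => int) => int list list => int list list => bool" where
	"folds_onto n A r s P Q <->
		 (ALL c:set P. let d = project_list A c in
				if ALL x:set d. x = 0 then ~ int n dvd pairing r c
				else if d : set Q then int n dvd s d * pairing r c
				else map uminus d : set Q & int n dvd s (map uminus d) * pairing r c) &
		 (ALL d:set Q. (s d = 1 | s d = int n) & (ALL x:set [0..<n]. int n dvd s d * int x -->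
				(EX c:set P. let e = project_list A c in
					 e = d & int n dvd pairing r c - int x | map uminus e = d & int n dvd pairing r c + int x)))"

lemma folds_onto_project:
	assumes "folds_onto n A r s P Q" "c : set P"
	shows "(ALL x:set (project_list A c). x = 0) & ~ int n dvd pairing r c |
		project_list A c : set Q & int n dvd s (project_list A c) * pairing r c |
		map uminus (project_list A c) : set Q & int n dvd s (map uminus (project_list A c)) * pairing r c"
proof -
	have *: "X & X' | Y & Y' | Z" if "if X then X' else if Y then Y' else Z" for X X' Y Y' Z
		using that by (cases X; cases Y) simp_all
	note f = conjunct1[OF assms(1)[unfolded folds_onto_def Let_def]]
	show ?thesis by (rule *[OF bspec[OF f assms(2)]])
qed

lemma folds_onto_lift:
	assumes "folds_onto n A r s P Q" "d : set Q"
	shows "s d = 1 | s d = int n"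
		"x < n ==> int n dvd s d * int x ==> EX c:set P. project_list A c = d & int n dvd pairing r c - int x |
			map uminus (project_list A c) = d & int n dvd pairing r c + int x"
proof -
	note f = bspec[OF conjunct2[OF assms(1)[unfolded folds_onto_def Let_def]] assms(2)]
	show "s d = 1 | s d = int n" by (rule conjunct1[OF f])
	assume x: "x < n" "int n dvd s d * int x"
	have "x : set [0..<n]" using x(1) by simp
	from bspec[OF conjunct2[OF f] this] x(2)
	show "EX c:set P. project_list A c = d & int n dvd pairing r c - int x |
			map uminus (project_list A c) = d & int n dvd pairing r c + int x" by (rule mp)
qed

lemma lincomb_zero: "ALL x:set c. x = 0 ==> lincomb b c = 0"
	unfolding lincomb_def by (intro sum.neutral) auto

lemma lincomb_in_span: "length c = m ==> lincomb b c : span (b ` {1..m})"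
	unfolding lincomb_def by (rule span_sum, rule span_scale, rule span_base) auto

lemma lincomb_uminus: "lincomb b (map uminus c) = - lincomb b c"
	by (simp add: lincomb_def sum_negf)

lemma lincomb_project:
	assumes A: "!!r. r : set A ==> length r = length c"
		and proj: "!!k. k < length c ==> a (Suc k) \<bullet> y = lincomb b (map (%r. r ! k) A) \<bullet> y"
	shows "lincomb b (project_list A c) \<bullet> y = lincomb a c \<bullet> y"
proof -
	have "lincomb a c \<bullet> y = (\<Sum>k<length c. \<Sum>j<length A. real_of_int (A ! j ! k * c ! k) * (b (Suc j) \<bullet> y))"
		using proj by (simp add: lincomb_inner sum_distrib_left mult_ac)
	also have "\<dots> = (\<Sum>j<length A. \<Sum>k<length c. real_of_int (A ! j ! k * c ! k) * (b (Suc j) \<bullet> y))"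
		by (rule sum.swap)
	also have "\<dots> = (\<Sum>j<length A. real_of_int (pairing (A ! j) c) * (b (Suc j) \<bullet> y))"
		using A by (intro sum.cong refl) (simp add: pairing_sum sum_distrib_right)
	also have "\<dots> = lincomb b (project_list A c) \<bullet> y" by (simp add: lincomb_inner project_list_def)
	finally show ?thesis by simp
qed

text \<open>
	The lists \<open>P\<close>, \<open>Q\<close>, \<open>Q\'\<close> describe the root system, its
	folding and the dual of the folding, with bases \<open>\<alpha>\<close>, \<open>b\<close> and
	\<open>b\'\<close>.
\<close>

locale list_folding =
	A: root_list T \<a> P + B: root_list T' b Q + B': root_list T'' b' Q'
	for T T' T'' :: root_type and \<a> b b' :: "nat => 'a::euclidean_space" and P Q Q' :: "int list list" +
	fixes \<Phi> :: "'a set" and w :: "'a => 'a" and n :: nat and A :: "int list list" and r :: "int list"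
		and s :: "int list => int"
	assumes full: "span (\<a> ` {1..type_rank T}) = UNIV" and roots_eq: "\<Phi> = A.roots"
		and orth: "orthogonal_transformation w" and n: "0 < n" "w ^^ n = id"
		and A: "length A = type_rank T'" "!!a. a : set A ==> length a = type_rank T" and r: "length r = type_rank T"
		and proj: "!!y k. w y = y ==> k < type_rank T ==>
			\<a> (Suc k) \<bullet> y = lincomb b (map (%a. a ! k) A) \<bullet> y"
		and b_fixed: "!!i. i : {1..type_rank T'} ==> w (b i) = b i"
		and folds: "folds_onto n A r s P Q"
		and dual: "(%d. of_int (s d) *R lincomb b d) ` set Q = lincomb b' ` set Q'"
begin

lemma project_inner: "w y = y ==> c : set P ==> lincomb b (project_list A c) \<bullet> y = lincomb \<a> c \<bullet> y"
	by (rule lincomb_project) (use A proj A.list_props(1) in auto)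

lemma span_fixed: assumes "x : span (b ` {1..type_rank T'})" shows "w x = x"
	using assms
proof (induction rule: span_induct_alt)
	case (step c x y)
	then obtain i where "i : {1..type_rank T'}" "x = b i" by blast
	then show ?case using step b_fixed[of i]
		by (simp add: linear_add[OF orthogonal_transformation_linear[OF orth]] linear_scale[OF orthogonal_transformation_linear[OF orth]])
qed (simp add: linear_0 orthogonal_transformation_linear[OF orth])

lemma lincomb_fixed: "length c = type_rank T' ==> w (lincomb b c) = lincomb b c"
	by (rule span_fixed) (rule lincomb_in_span)

lemma average_lincomb: "c : set P ==> orbit_average w (lincomb \<a> c) = lincomb b (project_list A c)"
	by (rule orbit_average_eqI[OF orth n]) (simp_all add: lincomb_fixed project_list_def A project_inner[unfolded project_list_def])

lemma average_uminus: "orbit_average w (- x) = - orbit_average w x"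
	by (rule linear_neg[OF orbit_average_linear[OF orth n]])

lemma projected:
	assumes "c : set P"
	obtains "lincomb b (project_list A c) = 0" "~ int n dvd pairing r c"
	| d where "d : set Q" "int n dvd s d * pairing r c"
			"lincomb b (project_list A c) = lincomb b d | lincomb b (project_list A c) = - lincomb b d"
proof -
	let ?d = "project_list A c"
	consider "ALL x:set ?d. x = 0" "~ int n dvd pairing r c" | "?d : set Q" "int n dvd s ?d * pairing r c"
		| "map uminus ?d : set Q" "int n dvd s (map uminus ?d) * pairing r c"
		using folds_onto_project[OF folds assms] by blast
	then show ?thesis
	proof cases
		case 3
		then show ?thesis using that(2)[OF 3] by (simp add: lincomb_uminus)
	qed (use that lincomb_zero in auto)
qed

lemma lifted:
	assumes "d : set Q" "x < n" "int n dvd s d * int x"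
	shows "EX c:set P. lincomb b (project_list A c) = lincomb b d & int n dvd pairing r c - int x |
		lincomb b (project_list A c) = - lincomb b d & int n dvd pairing r c + int x"
proof -
	obtain c where c: "c : set P" "project_list A c = d & int n dvd pairing r c - int x |
			map uminus (project_list A c) = d & int n dvd pairing r c + int x"
		using folds_onto_lift(2)[OF folds assms] by blast
	then show ?thesis using lincomb_uminus[of b "project_list A c"] by (intro bexI[OF _ c(1)]) auto
qed

lemma folded: "folded_roots \<Phi> w = B.roots"
proof
	show "folded_roots \<Phi> w \<subseteq> B.roots"
	proof
		fix x assume "x : folded_roots \<Phi> w"
		then obtain c where c: "c : set P" "x = orbit_average w (lincomb \<a> c) | x = - orbit_average w (lincomb \<a> c)" "x ~= 0"
			by (auto simp: folded_roots_def roots_eq A.roots_def average_uminus)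
		from c(1) show "x : B.roots"
			by (cases rule: projected) (use c average_lincomb[OF c(1)] in \<open>auto simp: B.roots_def\<close>)
	qed
	show "B.roots \<subseteq> folded_roots \<Phi> w"
	proof
		fix x assume x: "x : B.roots"
		then obtain d where d: "d : set Q" "x = lincomb b d | x = - lincomb b d" by (auto simp: B.roots_def)
		have "EX c:set P. lincomb b (project_list A c) = lincomb b d | lincomb b (project_list A c) = - lincomb b d"
			using lifted[OF d(1) n(1)] by auto
		then obtain c where c: "c : set P" "orbit_average w (lincomb \<a> c) = lincomb b d | orbit_average w (lincomb \<a> c) = - lincomb b d"
			using average_lincomb by metis
		have "lincomb \<a> c : \<Phi>" "- lincomb \<a> c : \<Phi>" using c(1) by (auto simp: roots_eq A.roots_def)
		moreover have "x = orbit_average w (lincomb \<a> c) | x = orbit_average w (- lincomb \<a> c)"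
			using c(2) d(2) by (auto simp: average_uminus)
		moreover have "x ~= 0" using x B.roots_nonzero by auto
		ultimately show "x : folded_roots \<Phi> w" unfolding folded_roots_def by blast
	qed
qed

lemma fixed_span: "fixed_space w = span (b ` {1..type_rank T'})"
proof
	show "span (b ` {1..type_rank T'}) \<subseteq> fixed_space w" using span_fixed by (auto simp: fixed_space_def)
	have av: "orbit_average w (\<a> i) : span (b ` {1..type_rank T'})" if i: "i : {1..type_rank T}" for i
	proof -
		have k: "i - 1 < type_rank T" "Suc (i - 1) = i" using i by auto
		have "orbit_average w (\<a> i) = lincomb b (project_list A (unit_list (type_rank T) (i - 1)))"
			using average_lincomb[OF A.unit_in[OF k(1)]] lincomb_unit[OF k(1), of \<a>] k(2) by simp
		then show ?thesis using lincomb_in_span[of "project_list A (unit_list (type_rank T) (i - 1))" "type_rank T'" b] A(1)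
			by (simp add: project_list_def)
	qed
	show "fixed_space w \<subseteq> span (b ` {1..type_rank T'})"
	proof
		fix x assume "x : fixed_space w"
		then have "orbit_average w x = x" by (intro orbit_average_eqI[OF orth n]) (auto simp: fixed_space_def)
		moreover have "orbit_average w z : span (b ` {1..type_rank T'})" if "z : span (\<a> ` {1..type_rank T})" for z
			using that
		proof (induction rule: span_induct_alt)
			case (step c x y)
			then have "c *R orbit_average w x + orbit_average w y : span (b ` {1..type_rank T'})"
				using av by (blast intro: span_add span_scale)
			then show ?case by (simp add: linear_add[OF orbit_average_linear[OF orth n]] linear_scale[OF orbit_average_linear[OF orth n]])
		qed (simp add: linear_0[OF orbit_average_linear[OF orth n]] span_zero)
		ultimately show "x : span (b ` {1..type_rank T'})" using full by (metis UNIV_I)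
	qed
qed

lemma dual_regular: "(ALL \<beta>:B'.roots. \<beta> \<bullet> y ~: Ints) <-> (ALL d:set Q. of_int (s d) * (lincomb b d \<bullet> y) ~: Ints)"
proof -
	have "(ALL \<beta>:B'.roots. \<beta> \<bullet> y ~: Ints) <-> (ALL \<gamma>:lincomb b' ` set Q'. \<gamma> \<bullet> y ~: Ints)"
		using B'.roots_ball[where p = "%x. x ~: Ints"] by (simp add: Ints_minus_iff)
	then show ?thesis unfolding dual[symmetric] by simp
qed

lemma regular:
	assumes k: "coprime k n" and p: "!!i. i < type_rank T ==> \<a> (Suc i) \<bullet> p = real k * of_int (r ! i) / real n"
		and y: "w y = y"
	shows "(ALL \<beta>:\<Phi>. \<beta> \<bullet> (p + y) ~: Ints) <-> (ALL \<beta>:B'.roots. \<beta> \<bullet> y ~: Ints)"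
proof -
	let ?L = "%d. lincomb b d \<bullet> y"
	have rn: "real n ~= 0" using n by simp
	have val: "lincomb \<a> c \<bullet> (p + y) = of_int (int k * pairing r c) / real n + ?L (project_list A c)" if c: "c : set P" for c
	proof -
		have l: "length r = length c" using r A.list_props(1)[OF c] by simp
		have "lincomb \<a> c \<bullet> p = (\<Sum>i<length c. real k / real n * of_int (r ! i * c ! i))"
			unfolding lincomb_inner using p A.list_props(1)[OF c] by (intro sum.cong) (auto simp: mult_ac)
		also have "\<dots> = of_int (int k * pairing r c) / real n"
			unfolding pairing_sum[OF l] by (simp add: sum_distrib_left sum_divide_distrib mult_ac)
		finally show ?thesis using project_inner[OF y c] by (simp add: inner_add_right)
	qed
	have int_div: "of_int z / real n : Ints" if "int n dvd z" for z
		using that rn by (auto elim!: dvdE)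
	have div_int: "int n dvd z" if zi: "of_int z / real n : Ints" for z
	proof -
		obtain u :: int where "of_int z / real n = of_int u" using zi by (auto elim: Ints_cases)
		then have "real_of_int z = of_int (int n * u)" using rn by (simp add: field_simps)
		then have "z = int n * u" by (simp only: of_int_eq_iff)
		then show ?thesis by simp
	qed
	have kn: "coprime (int n) (int k)" using k by (simp add: coprime_commute)
	have "(ALL \<beta>:\<Phi>. \<beta> \<bullet> (p + y) ~: Ints) <-> (ALL c:set P. lincomb \<a> c \<bullet> (p + y) ~: Ints)"
		unfolding roots_eq by (rule A.roots_ball[where p = "%x. x ~: Ints"]) (simp add: Ints_minus_iff)
	also have "\<dots> <-> (ALL d:set Q. of_int (s d) * ?L d ~: Ints)"
	proof (intro iffI ballI notI)
		fix d assume R: "ALL c:set P. lincomb \<a> c \<bullet> (p + y) ~: Ints" and d: "d : set Q" "of_int (s d) * ?L d : Ints"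
		have sd: "s d = 1 | s d = int n" by (rule folds_onto_lift(1)[OF folds d(1)])
		then have "real n * ?L d : Ints" using d(2) by auto
		then obtain u :: int where u: "real n * ?L d = of_int u" by (auto elim: Ints_cases)
		then have Ld: "?L d = of_int u / real n" using rn by (simp add: field_simps)
		obtain k1 :: int where k1: "[int k * k1 = 1] (mod int n)"
			using cong_solve_coprime_int[of "int k" "int n"] k by auto
		define x where "x = nat ((- u * k1) mod int n)"
		have x: "int x = (- u * k1) mod int n" "x < n"
		proof -
			show 1: "int x = (- u * k1) mod int n" using n(1) by (simp add: x_def)
			have "(- u * k1) mod int n < int n" using n(1) by (intro pos_mod_bound) simp
			then show "x < n" using 1 by linarith
		qed
		have "[int k * int x + u = int k * (- u * k1) + u] (mod int n)"
			unfolding x(1) by (intro cong_add cong_mult cong_refl) (simp add: cong_def)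
		also have "int k * (- u * k1) + u = - u * (int k * k1) + u" by (simp add: algebra_simps)
		also have "[- u * (int k * k1) + u = - u * 1 + u] (mod int n)" by (intro cong_add cong_mult cong_refl k1)
		finally have kx: "int n dvd int k * int x + u" by (simp add: cong_0_iff)
		have "int n dvd s d * int x"
		proof (cases "s d = int n")
			case False
			then have "of_int u / real n : Ints" using sd d(2) Ld by simp
			then have "int n dvd u" by (rule div_int)
			then have "int n dvd int k * int x" using kx by (metis dvd_add_left_iff)
			then show ?thesis using kn by (simp add: coprime_dvd_mult_right_iff)
		qed simp
		then obtain c where c: "c : set P" "lincomb b (project_list A c) = lincomb b d & int n dvd pairing r c - int x |
				lincomb b (project_list A c) = - lincomb b d & int n dvd pairing r c + int x"
			using lifted[OF d(1) x(2)] by blast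
		from c(2) show False
		proof
			assume 1: "lincomb b (project_list A c) = lincomb b d & int n dvd pairing r c - int x"
			have "int n dvd int k * (pairing r c - int x) + (int k * int x + u)" by (rule dvd_add[OF dvd_mult[OF conjunct2[OF 1]] kx])
			then have "int n dvd int k * pairing r c + u" by (simp add: algebra_simps)
			then have "of_int (int k * pairing r c + u) / real n : Ints" by (rule int_div)
			then show False using R c(1) val[OF c(1)] 1 Ld by (auto simp: add_divide_distrib)
		next
			assume 2: "lincomb b (project_list A c) = - lincomb b d & int n dvd pairing r c + int x"
			have "int n dvd int k * (pairing r c + int x) - (int k * int x + u)" by (rule dvd_diff[OF dvd_mult[OF conjunct2[OF 2]] kx])
			then have "int n dvd int k * pairing r c - u" by (simp add: algebra_simps)
			then have "of_int (int k * pairing r c - u) / real n : Ints" by (rule int_div)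
			then show False using R c(1) val[OF c(1)] 2 Ld by (auto simp: diff_divide_distrib)
		qed
	next
		fix c assume R: "ALL d:set Q. of_int (s d) * ?L d ~: Ints" and c: "c : set P" "lincomb \<a> c \<bullet> (p + y) : Ints"
		from c(1) show False
		proof (cases rule: projected)
			case 1
			then have "of_int (int k * pairing r c) / real n : Ints" using c(2) val[OF c(1)] by simp
			then have "int n dvd int k * pairing r c" by (rule div_int)
			then show False using 1(2) kn by (simp add: coprime_dvd_mult_right_iff)
		next
			case (2 d)
			have "of_int (s d) * (lincomb \<a> c \<bullet> (p + y)) - of_int (int k * (s d * pairing r c)) / real n : Ints"
				by (rule Ints_diff[OF Ints_mult[OF Ints_of_int c(2)] int_div[OF dvd_mult[OF 2(2)]]])
			then have "of_int (s d) * ?L (project_list A c) : Ints" unfolding val[OF c(1)] by (simp add: algebra_simps)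
			then have "of_int (s d) * ?L d : Ints" using 2(3) by (auto simp: Ints_minus_iff)
			then show False using R 2(1) by blast
		qed
	qed
	also have "\<dots> <-> (ALL \<beta>:B'.roots. \<beta> \<bullet> y ~: Ints)" by (rule dual_regular[symmetric])
	finally show ?thesis .
qed

end

lemma type_E_gram:
	assumes rs: "root_system_in V \<Phi>" and b: "bourbaki_simple_roots (Type_E l) \<Phi> \<a>" and l: "4 <= l"
		and ik: "i : {1..l}" "k : {1..l}"
	shows "\<a> i \<bullet> \<a> k = \<a> 4 \<bullet> \<a> 4 / 2 * of_int (cartan_matrix (Type_E l) i k)"
proof -
	note inner = bourbaki_inner[OF rs b]
	have adj: "\<a> i \<bullet> \<a> i = \<a> k \<bullet> \<a> k"
		if "cartan_matrix (Type_E l) i k = -1" "cartan_matrix (Type_E l) k i = -1" "i : {1..l}" "k : {1..l}" for i k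
		using inner[of i k] inner[of k i] that by (simp add: inner_commute)
	have up: "\<a> k \<bullet> \<a> k = \<a> 4 \<bullet> \<a> 4" if "4 <= k" "k <= l" for k
		using that
	proof (induction k rule: dec_induct)
		case (step k)
		then show ?case using adj[of k "Suc k"] by (auto simp: simply_laced_matrix_def)
	qed simp
	have low: "\<a> 3 \<bullet> \<a> 3 = \<a> 4 \<bullet> \<a> 4" "\<a> 2 \<bullet> \<a> 2 = \<a> 4 \<bullet> \<a> 4" "\<a> 1 \<bullet> \<a> 1 = \<a> 3 \<bullet> \<a> 3"
		using l by (auto intro!: adj simp: simply_laced_matrix_def)
	have kk: "\<a> k \<bullet> \<a> k = \<a> 4 \<bullet> \<a> 4"
	proof (cases "4 <= k")
		case False
		then have "k = 1 | k = 2 | k = 3" using ik(2) by auto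
		then show ?thesis using low by auto
	next
		case True
		then show ?thesis using up[OF True] ik(2) by simp
	qed
	have half: "x = y / 2 * c" if "2 * x = c * y" for x y c :: real using that by (simp add: field_simps)
	show ?thesis by (rule half) (use inner[of i k, unfolded type_rank.simps, OF ik] in \<open>simp only: kk\<close>)
qed

definition "roots_E6 = ([[1,0,0,0,0,0], [0,1,0,0,0,0], [0,0,1,0,0,0], [0,0,0,1,0,0], [0,0,0,0,1,0], [0,0,0,0,0,1],
		 [1,0,1,0,0,0], [0,1,0,1,0,0], [0,0,1,1,0,0], [0,0,0,1,1,0], [0,0,0,0,1,1], [1,0,1,1,0,0],
		 [0,1,1,1,0,0], [0,1,0,1,1,0], [0,0,1,1,1,0], [0,0,0,1,1,1], [1,1,1,1,0,0], [1,0,1,1,1,0],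
		 [0,1,1,1,1,0], [0,1,0,1,1,1], [0,0,1,1,1,1], [1,1,1,1,1,0], [1,0,1,1,1,1], [0,1,1,2,1,0],
		 [0,1,1,1,1,1], [1,1,1,2,1,0], [1,1,1,1,1,1], [0,1,1,2,1,1], [1,1,2,2,1,0], [1,1,1,2,1,1],
		 [0,1,1,2,2,1], [1,1,2,2,1,1], [1,1,1,2,2,1], [1,1,2,2,2,1], [1,1,2,3,2,1], [1,2,2,3,2,1]] :: int list list)"

definition "roots_E7 = ([[1,0,0,0,0,0,0], [0,1,0,0,0,0,0], [0,0,1,0,0,0,0], [0,0,0,1,0,0,0], [0,0,0,0,1,0,0],
		 [0,0,0,0,0,1,0], [0,0,0,0,0,0,1], [1,0,1,0,0,0,0], [0,1,0,1,0,0,0], [0,0,1,1,0,0,0],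
		 [0,0,0,1,1,0,0], [0,0,0,0,1,1,0], [0,0,0,0,0,1,1], [1,0,1,1,0,0,0], [0,1,1,1,0,0,0],
		 [0,1,0,1,1,0,0], [0,0,1,1,1,0,0], [0,0,0,1,1,1,0], [0,0,0,0,1,1,1], [1,1,1,1,0,0,0],
		 [1,0,1,1,1,0,0], [0,1,1,1,1,0,0], [0,1,0,1,1,1,0], [0,0,1,1,1,1,0], [0,0,0,1,1,1,1],
		 [1,1,1,1,1,0,0], [1,0,1,1,1,1,0], [0,1,1,2,1,0,0], [0,1,1,1,1,1,0], [0,1,0,1,1,1,1],
		 [0,0,1,1,1,1,1], [1,1,1,2,1,0,0], [1,1,1,1,1,1,0], [1,0,1,1,1,1,1], [0,1,1,2,1,1,0],
		 [0,1,1,1,1,1,1], [1,1,2,2,1,0,0], [1,1,1,2,1,1,0], [1,1,1,1,1,1,1], [0,1,1,2,2,1,0],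
		 [0,1,1,2,1,1,1], [1,1,2,2,1,1,0], [1,1,1,2,2,1,0], [1,1,1,2,1,1,1], [0,1,1,2,2,1,1],
		 [1,1,2,2,2,1,0], [1,1,2,2,1,1,1], [1,1,1,2,2,1,1], [0,1,1,2,2,2,1], [1,1,2,3,2,1,0],
		 [1,1,2,2,2,1,1], [1,1,1,2,2,2,1], [1,2,2,3,2,1,0], [1,1,2,3,2,1,1], [1,1,2,2,2,2,1],
		 [1,2,2,3,2,1,1], [1,1,2,3,2,2,1], [1,2,2,3,2,2,1], [1,1,2,3,3,2,1], [1,2,2,3,3,2,1],
		 [1,2,2,4,3,2,1], [1,2,3,4,3,2,1], [2,2,3,4,3,2,1]] :: int list list)"

definition "roots_F4 = ([[1,0,0,0], [0,1,0,0], [0,0,1,0], [0,0,0,1], [1,1,0,0], [0,1,1,0], [0,0,1,1], [1,1,1,0],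
		 [0,1,2,0], [0,1,1,1], [1,1,2,0], [1,1,1,1], [0,1,2,1], [1,2,2,0], [1,1,2,1], [0,1,2,2],
		 [1,2,2,1], [1,1,2,2], [1,2,3,1], [1,2,2,2], [1,2,3,2], [1,2,4,2], [1,3,4,2], [2,3,4,2]] :: int list list)"

definition "roots_G2 = ([[1,0], [0,1], [1,1], [2,1], [3,1], [3,2]] :: int list list)"

lemma cartan_columns:
	"cartan_columns (Type_E 6) = [[2,0,-1,0,0,0], [0,2,0,-1,0,0], [-1,0,2,-1,0,0], [0,-1,-1,2,-1,0], [0,0,0,-1,2,-1], [0,0,0,0,-1,2]]"
	"cartan_columns (Type_E 7) = [[2,0,-1,0,0,0,0], [0,2,0,-1,0,0,0], [-1,0,2,-1,0,0,0], [0,-1,-1,2,-1,0,0], [0,0,0,-1,2,-1,0], [0,0,0,0,-1,2,-1], [0,0,0,0,0,-1,2]]"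
	"cartan_columns (Type_E 8) = [[2,0,-1,0,0,0,0,0], [0,2,0,-1,0,0,0,0], [-1,0,2,-1,0,0,0,0], [0,-1,-1,2,-1,0,0,0], [0,0,0,-1,2,-1,0,0], [0,0,0,0,-1,2,-1,0], [0,0,0,0,0,-1,2,-1], [0,0,0,0,0,0,-1,2]]"
	"cartan_columns Type_F4 = [[2,-1,0,0], [-1,2,-1,0], [0,-2,2,-1], [0,0,-1,2]]"
	"cartan_columns Type_G2 = [[2,-3], [-1,2]]"
	by (simp_all add: cartan_columns_def simply_laced_matrix_def path_matrix_eq upt_rec)

lemma closed_roots:
	"closed_root_list (cartan_columns (Type_E 6)) roots_E6"
	"closed_root_list (cartan_columns (Type_E 7)) roots_E7"
	"closed_root_list (cartan_columns Type_F4) roots_F4"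
	"closed_root_list (cartan_columns Type_G2) roots_G2"
	unfolding cartan_columns by code_simp+

lemma highest_words:
	"foldr (list_reflect (cartan_columns (Type_E 6))) [1,3,2,0,4,3,1,2,3,4] (unit_list 6 5) = [1,2,2,3,2,1]"
	"foldr (list_reflect (cartan_columns (Type_E 7))) [0,2,3,1,4,3,2,0,5,4,3,1,2,3,4,5] (unit_list 7 6) = [2,2,3,4,3,2,1]"
	"foldr (list_reflect (cartan_columns (Type_E 8))) [7,6,5,4,3,1,2,0,3,2,4,3,1,5,4,3,2,0,6,5,4,3,1,2,3,4,5,6] (unit_list 8 7) = [2,3,4,6,5,4,3,2]"
	"foldr (list_reflect (cartan_columns Type_F4)) [0,1,2,1,0,3,2] (unit_list 4 1) = [2,3,4,2]"
	"foldr (list_reflect (cartan_columns Type_G2)) [1,0] (unit_list 2 1) = [3,2]"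
	unfolding cartan_columns
	by (simp_all add: list_reflect_def pairing_def unit_list_def numeral_eq_Suc One_nat_def upt_rec)

lemma nth_Cons_1: "(x # xs) ! 1 = xs ! 0"
	by (simp add: One_nat_def)

lemma lincomb_Nil: "lincomb b [] = 0"
	by (simp add: lincomb_def)

lemma lincomb_Cons: "lincomb b (x # c) = real_of_int x *R b 1 + lincomb (b \<circ> Suc) c"
	unfolding lincomb_def length_Cons sum.lessThan_Suc_shift by (simp add: One_nat_def)

lemmas lincomb_simps = lincomb_Nil lincomb_Cons

lemma totatives_3: "totatives 3 = {1,2}"
proof -
	have "{0<..3::nat} = {1,2,3}" by auto
	moreover have "coprime (2::nat) 3" by (simp add: coprime_iff_gcd_eq_1 gcd_non_0_nat)
	ultimately show ?thesis unfolding totatives_def by auto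
qed

text \<open>
	The remainder of \<open>3 x\<close> modulo 3 is 1 or 2.
\<close>

lemma third_integer_cases:
	assumes "3 * (x::real) : Ints" "x ~: Ints" shows "EX k:{1,2::nat}. x - real k / 3 : Ints"
proof -
	obtain a where a: "3 * x = of_int a" using assms(1) by (auto elim: Ints_cases)
	have "a = 3 * (a div 3) + a mod 3" by simp
	then have "real_of_int a = 3 * of_int (a div 3) + of_int (a mod 3)"
		by (metis of_int_add of_int_mult of_int_numeral)
	then have x: "x = of_int (a div 3) + of_int (a mod 3) / 3" using a by simp
	have "0 <= a mod 3" "a mod 3 < 3" by simp_all
	then consider "a mod 3 = 0" | "a mod 3 = 1" | "a mod 3 = 2" by linarith
	then show ?thesis
	proof cases
		case 1
		then show ?thesis using x assms(2) by simp
	next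
		case 2
		then show ?thesis using x by (intro bexI[of _ 1]) auto
	next
		case 3
		then show ?thesis using x by (intro bexI[of _ 2]) auto
	qed
qed

definition quadratic_form :: "int list list => int list => int" where
	"quadratic_form G d = pairing (project_list G d) d"

lemma lincomb_norm:
	assumes l: "length d = n" "length G = n" "!!g. g : set G ==> length g = n"
		and gram: "!!i k. i < n ==> k < n ==> b (Suc i) \<bullet> b (Suc k) = u * of_int (G ! i ! k)"
	shows "lincomb b d \<bullet> lincomb b d = u * of_int (quadratic_form G d)"
proof -
	have e: "b (Suc i) \<bullet> lincomb b d = u * of_int (pairing (G ! i) d)" if "i < n" for i
	proof -
		have lg: "length (G ! i) = length d" using l that by simp
		have "lincomb b d \<bullet> b (Suc i) = (\<Sum>k<n. u * of_int (G ! i ! k * d ! k))"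
			unfolding lincomb_inner l(1) using gram[OF that] by (intro sum.cong) (auto simp: inner_commute)
		also have "\<dots> = u * of_int (pairing (G ! i) d)" unfolding pairing_sum[OF lg] l(1) by (simp add: sum_distrib_left)
		finally show ?thesis by (simp add: inner_commute)
	qed
	have lp: "length (project_list G d) = length d" using l by (simp add: project_list_def)
	have "lincomb b d \<bullet> lincomb b d = (\<Sum>i<n. of_int (d ! i) * (u * of_int (pairing (G ! i) d)))"
		unfolding lincomb_inner[of b d "lincomb b d"] l(1) using e by (intro sum.cong) auto
	also have "\<dots> = u * of_int (quadratic_form G d)"
		unfolding quadratic_form_def pairing_sum[OF lp] l(1) using l by (simp add: project_list_def sum_distrib_left mult_ac)
	finally show ?thesis .
qed

lemma cartan_columns_nth:
	"i : {1..type_rank T} ==> k : {1..type_rank T} ==> cartan_columns T ! (k - 1) ! (i - 1) = cartan_matrix T i k"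
	by (auto simp: cartan_columns_def)

lemma gram_cartan:
	assumes u: "0 < u" and gram: "!!i k. i < type_rank T ==> k < type_rank T ==> b (Suc i) \<bullet> b (Suc k) = u * of_int (G ! i ! k)"
		and G: "ALL i:set [0..<type_rank T]. ALL k:set [0..<type_rank T]. G ! k ! k ~= 0 & 2 * G ! i ! k = cartan_columns T ! k ! i * G ! k ! k"
		and ik: "i : {1..type_rank T}" "k : {1..type_rank T}"
	shows "cartan_integer (b i) (b k) = of_int (cartan_matrix T i k)"
proof -
	define i' k' where "i' = i - 1" and "k' = k - 1"
	have lt: "i' < type_rank T" "k' < type_rank T" and Suc: "Suc i' = i" "Suc k' = k"
		using ik unfolding i'_def k'_def atLeastAtMost_iff by linarith+
	have g: "G ! k' ! k' ~= 0" "2 * G ! i' ! k' = cartan_matrix T i k * G ! k' ! k'"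
		using G lt cartan_columns_nth[OF ik] by (auto simp: i'_def k'_def)
	have "cartan_integer (b i) (b k) = real_of_int (2 * G ! i' ! k') / real_of_int (G ! k' ! k')"
		using gram[OF lt] gram[OF lt(2,2)] u by (simp add: cartan_integer_def Suc)
	also have "\<dots> = of_int (cartan_matrix T i k)" unfolding g(2) using g(1) by simp
	finally show ?thesis .
qed

context root_list
begin

lemma roots_unique:
	assumes "root_system_in V \<Phi>" "reduced_roots \<Phi>" "simple_roots m \<Phi> b"
	shows "\<Phi> = roots"
	using simple_system_roots_unique[OF simple_roots_system[OF assms] simple_roots_system[OF roots_system roots_reduced roots_simple]] .

lemma lattice_iff: "z : coweight_lattice UNIV roots <-> (ALL i:{1..m}. b i \<bullet> z : Ints)"
proof
	assume "ALL i:{1..m}. b i \<bullet> z : Ints"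
	then have "lincomb b c \<bullet> z : Ints" if "c : set P" for c
		unfolding lincomb_inner using list_props(1)[OF that] by (intro Ints_sum Ints_mult) auto
	then show "z : coweight_lattice UNIV roots"
		by (auto simp: coweight_lattice_def roots_def)
qed (use basis_in_roots in \<open>auto simp: coweight_lattice_def\<close>)

lemma root_norm:
	assumes "!!i. i : {1..m} ==> b i \<bullet> b i = N" "\<beta> : roots" shows "\<beta> \<bullet> \<beta> = N"
proof -
	obtain w i where w: "w : G" "i : {1..m}" "\<beta> = w (b i)" using generated[OF assms(2)] by blast
	then show ?thesis using assms(1) reflection_group_orthogonal[OF w(1)] by (simp add: orthogonal_transformation_def)
qed

end

lemma root_list_of_type:
	assumes rs: "root_system_in UNIV \<Phi>" "reduced_roots \<Phi>" and b: "bourbaki_simple_roots T \<Phi> \<a>"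
		and P: "closed_root_list (cartan_columns T) P"
	shows "root_list T \<a> P" "\<Phi> = root_list.roots \<a> P" "span (\<a> ` {1..type_rank T}) = UNIV"
proof -
	have s: "simple_roots (type_rank T) \<Phi> \<a>" using b by (simp add: bourbaki_simple_roots_def)
	show R: "root_list T \<a> P"
		by unfold_locales (use b s P in \<open>auto simp: bourbaki_simple_roots_def simple_roots_def\<close>)
	interpret root_list T \<a> P by (rule R)
	show e: "\<Phi> = roots" by (rule roots_unique[OF rs s])
	show "span (\<a> ` {1..m}) = UNIV"
		using rs(1) roots_system unfolding e root_system_in_def by simp
qed

lemma (in list_folding) dual_eq:
	assumes N: "0 < N" "!!\<beta>. \<beta> : \<Phi> ==> \<beta> \<bullet> \<beta> = 2 * N"
		and norm: "!!d. d : set Q ==> lincomb b d \<bullet> lincomb b d * of_int (s d) = 2 * N"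
	shows "dual_roots \<Phi> (folded_roots \<Phi> w) = B'.roots"
proof -
	have "\<Phi> ~= {}"
	proof
		assume "\<Phi> = {}"
		then have "{1..type_rank T} = {}" using A.basis_in_roots roots_eq by blast
		then have "(UNIV :: 'a set) = {0}" using full by simp
		then show False using nonzero_Basis SOME_Basis by (metis UNIV_I singletonD)
	qed
	then have "(%\<a>. \<a> \<bullet> \<a>) ` \<Phi> = {2 * N}" using N(2) by force
	then have ni: "normalized_inner \<Phi> \<beta> \<beta> = \<beta> \<bullet> \<beta> / N" for \<beta> using N(1) by (simp add: normalized_inner_def)
	have sd: "2 / normalized_inner \<Phi> \<beta> \<beta> = of_int (s d)"
		if "d : set Q" "\<beta> = lincomb b d | \<beta> = - lincomb b d" for d \<beta>
	proof -
		have "\<beta> \<bullet> \<beta> * of_int (s d) = 2 * N" using norm[OF that(1)] that(2) by auto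
		moreover then have "\<beta> \<bullet> \<beta> ~= 0" using N(1) by auto
		ultimately show ?thesis using N(1) unfolding ni by (simp add: field_simps)
	qed
	have dl: "EX e:set Q'. of_int (s d) *R lincomb b d = lincomb b' e" if "d : set Q" for d using dual that by blast
	have dl': "EX d:set Q. of_int (s d) *R lincomb b d = lincomb b' e" if "e : set Q'" for e using dual that by force
	show ?thesis
		unfolding folded
	proof (rule set_eqI, rule iffI)
		fix x assume "x : dual_roots \<Phi> B.roots"
		then obtain \<beta> d where x: "x = (2 / normalized_inner \<Phi> \<beta> \<beta>) *R \<beta>" "d : set Q" "\<beta> = lincomb b d | \<beta> = - lincomb b d"
			by (auto simp: dual_roots_def B.roots_def)
		obtain e where "e : set Q'" "of_int (s d) *R lincomb b d = lincomb b' e" using dl[OF x(2)] by blast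
		moreover have "x = of_int (s d) *R \<beta>" using x(1) sd[OF x(2,3)] by simp
		ultimately show "x : B'.roots" unfolding B'.roots_def using x(3) by auto
	next
		fix x assume "x : B'.roots"
		then obtain e where e: "e : set Q'" "x = lincomb b' e | x = - lincomb b' e" by (auto simp: B'.roots_def)
		obtain d where d: "d : set Q" "of_int (s d) *R lincomb b d = lincomb b' e" using dl'[OF e(1)] by blast
		have "EX \<beta>. (\<beta> = lincomb b d | \<beta> = - lincomb b d) & x = of_int (s d) *R \<beta>"
			using e(2) d(2) by (metis scaleR_minus_right)
		then obtain \<beta> where \<beta>: "\<beta> = lincomb b d | \<beta> = - lincomb b d" "x = of_int (s d) *R \<beta>" by blast
		have "\<beta> : B.roots" using \<beta>(1) d(1) by (auto simp: B.roots_def)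
		moreover have "x = (2 / normalized_inner \<Phi> \<beta> \<beta>) *R \<beta>" using sd[OF d(1) \<beta>(1)] \<beta>(2) by simp
		ultimately show "x : dual_roots \<Phi> B.roots" unfolding dual_roots_def by blast
	qed
qed

definition "gram_F4 = ([[4,-2,0,0], [-2,4,-2,0], [0,-2,2,-1], [0,0,-1,2]] :: int list list)"

definition "gram_G2 = ([[2,-3], [-3,6]] :: int list list)"

text \<open>
	The dual of a folded root is its multiple by the squared length of the long roots over its own,
	which is 1 or the order of \<open>\<omega>\<close>.
\<close>

definition "dual_scale_F4 d = 4 div quadratic_form gram_F4 d"

definition "dual_scale_G2 d = 6 div quadratic_form gram_G2 d"

lemma gram_F4_cartan: "ALL i:set [0..<type_rank Type_F4]. ALL k:set [0..<type_rank Type_F4].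
		gram_F4 ! k ! k ~= 0 & 2 * gram_F4 ! i ! k = cartan_columns Type_F4 ! k ! i * gram_F4 ! k ! k"
	unfolding cartan_columns by code_simp

lemma gram_G2_cartan: "ALL i:set [0..<type_rank Type_G2]. ALL k:set [0..<type_rank Type_G2].
		gram_G2 ! k ! k ~= 0 & 2 * gram_G2 ! i ! k = cartan_columns Type_G2 ! k ! i * gram_G2 ! k ! k"
	unfolding cartan_columns by code_simp

lemma folds_E7:
	"folds_onto 2 [[0,1,0,0,0,0,-1], [0,0,0,1,0,0,-2], [0,0,1,0,1,0,-3], [1,0,0,0,0,1,-2]]
		 [0,0,0,0,0,0,1] dual_scale_F4 roots_E7 roots_F4"
	by code_simp

lemma folds_E6:
	"folds_onto 3 [[-2,1,1,0,1,-2], [-1,0,0,1,0,-1]] [1,0,0,0,0,1] dual_scale_G2 roots_E6 roots_G2"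
	by code_simp

lemma dual_F4:
	"set (map (%d. map ((*) (dual_scale_F4 d)) d) roots_F4) = set (map (%d. [d ! 3, d ! 2,2 * d ! 1,2 * d ! 0]) roots_F4)"
	"ALL d:set roots_F4. quadratic_form gram_F4 d * dual_scale_F4 d = 4"
	by code_simp+

lemma dual_G2:
	"set (map (%d. map ((*) (dual_scale_G2 d)) d) roots_G2) = set (map (%d. [3 * d ! 1, d ! 0]) roots_G2)"
	"ALL d:set roots_G2. quadratic_form gram_G2 d * dual_scale_G2 d = 6"
	by code_simp+

text \<open>
	Reduced words for \<open>\<omega>\<close>, with reflections numbered from 0.
\<close>

definition "word_E7 = ([6,5,4,3,2,1,3,4,5,6,0,2,3,4,5,1,3,4,2,3,0,2,1,3,4,5,6] :: nat list)"

definition "word_E6 = ([5,4,3,2,1,3,4,5,0,2,3,4,1,3,2,0] :: nat list)"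

lemma map_upt_expand:
	"map F [0..<7] = [F 0, F 1, F 2, F 3, F 4, F 5, F 6]" "map F [0..<6] = [F 0, F 1, F 2, F 3, F 4, F 5]"
	by (simp_all add: upt_rec numeral_eq_Suc One_nat_def)

lemma word_images:
	"map (%k. foldr (list_reflect (cartan_columns (Type_E 7))) word_E7 (unit_list 7 k)) [0..<7] =
		[[0,0,0,0,0,1,0], [0,1,0,0,0,0,0], [0,0,0,0,1,0,0], [0,0,0,1,0,0,0],
		 [0,0,1,0,0,0,0], [1,0,0,0,0,0,0], [-2,-2,-3,-4,-3,-2,-1]]"
	"map (%k. foldr (list_reflect (cartan_columns (Type_E 6))) word_E6 (unit_list 6 k)) [0..<6] =
		[[-1,-2,-2,-3,-2,-1], [0,0,0,0,1,0], [0,1,0,0,0,0], [0,0,0,1,0,0],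
		 [0,0,1,0,0,0], [1,0,0,0,0,0]]"
	unfolding map_upt_expand cartan_columns word_E7_def word_E6_def
	by (simp_all add: list_reflect_def pairing_def unit_list_def numeral_eq_Suc One_nat_def upt_rec)

lemma lincomb_scale: "lincomb b (map ((*) x) c) = of_int x *R lincomb b c"
	by (simp add: lincomb_def scaleR_sum_right)

lemma lincomb_in_cone:
	assumes "length c = m" "ALL x:set c. 0 <= x" shows "lincomb \<a> c : nat_cone m \<a>"
proof -
	have "real_of_int (c ! i) *R \<a> (Suc i) : nat_cone m \<a>" if "i < m" for i
	proof -
		have "0 <= c ! i" using assms that by simp
		then obtain n where "c ! i = int n" using zero_le_imp_eq_int by blast
		then have "real_of_int (c ! i) *R \<a> (Suc i) = (\<Sum>t<n. \<a> (Suc i))" by (simp add: sum_constant_scaleR)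
		then show ?thesis using that by (auto intro!: nat_cone_sum nat_cone_base)
	qed
	then show ?thesis unfolding lincomb_def using assms(1) by (intro nat_cone_sum) auto
qed

text \<open>
	The automorphism of the extended diagram exchanges \<open>\<alpha>\<^sub>7\<close> with the
	lowest root, \<open>\<alpha>\<^sub>1\<close> with \<open>\<alpha>\<^sub>6\<close> and
	\<open>\<alpha>\<^sub>3\<close> with \<open>\<alpha>\<^sub>5\<close>.  The fixed nodes
	\<open>\<alpha>\<^sub>2, \<alpha>\<^sub>4\<close> and the averages of \<open>\<alpha>\<^sub>3,
	\<alpha>\<^sub>5\<close> and of \<open>\<alpha>\<^sub>1, \<alpha>\<^sub>6\<close> form a basis
	of type \<open>F\<^sub>4\<close>; \<open>p\<close> is half of the last fundamental coweight.
\<close>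

lemma folding_statement_E7:
	assumes rs: "root_system_in UNIV \<Phi>" "reduced_roots \<Phi>" and bo: "bourbaki_simple_roots (Type_E 7) \<Phi> \<a>"
	shows "folding_statement \<Phi> (Type_E 7) 7 (omega 7 \<Phi> \<a> 7)"
proof -
	note R = root_list_of_type[OF rs bo closed_roots(2)]
	interpret A: root_list "Type_E 7" \<a> roots_E7 by (rule R(1))
	have s: "simple_roots 7 \<Phi> \<a>" using bo by (simp add: bourbaki_simple_roots_def)
	define N where "N = \<a> 4 \<bullet> \<a> 4 / 2"
	have N: "0 < N" using bourbaki_nonzero(1)[OF rs(1) bo, of 4] by (simp add: N_def)
	have gram: "\<a> i \<bullet> \<a> k = N * of_int (cartan_matrix (Type_E 7) i k)" if "i : {1..7}" "k : {1..7}" for i k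
		unfolding N_def by (rule type_E_gram[OF rs(1) bo _ that]) simp
	have g: "\<a> i \<bullet> \<a> k = N * of_int ([[2,0,-1,0,0,0,0], [0,2,0,-1,0,0,0], [-1,0,2,-1,0,0,0], [0,-1,-1,2,-1,0,0], [0,0,0,-1,2,-1,0], [0,0,0,0,-1,2,-1], [0,0,0,0,0,-1,2]] ! (k - 1) ! (i - 1))"
		if "i : {1..7}" "k : {1..7}" for i k
		using gram[OF that] cartan_columns_nth[of i "Type_E 7" k] that unfolding cartan_columns type_rank.simps by metis
	note inj' = A.inj[simplified] and indep' = A.indep[simplified]
	have span: "span (\<a> ` {1..7}) = UNIV" using R(3) by simp
	have seven: "i = 1 | i = 2 | i = 3 | i = 4 | i = 5 | i = 6 | i = 7" if "i : {1..7}" for i :: nat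
		using that unfolding atLeastAtMost_iff by linarith
	define w where "w = reflection_word (map (%k. \<a> (Suc k)) word_E7)"
	have ks: "set word_E7 \<subseteq> {..<type_rank (Type_E 7)}" by (simp add: word_E7_def)
	have wG: "w : reflection_group (\<a> ` {1..7})" using A.word_in_group[OF ks] by (simp add: w_def)
	have w: "w : weyl_group \<Phi>" by (rule reflection_group_mono[OF _ wG]) (use s in \<open>simp add: simple_roots_def\<close>)
	have orth: "orthogonal_transformation w" by (rule reflection_group_orthogonal[OF w])
	have lin: "linear w" using orth by (rule orthogonal_transformation_linear)
	have img: "w (\<a> (Suc k)) = lincomb \<a> (map (%k. foldr (list_reflect (cartan_columns (Type_E 7))) word_E7 (unit_list 7 k)) [0..<7] ! k)"
		if "k < 7" for k
		using A.word_lincomb(1)[of "unit_list 7 k", OF _ ks] that lincomb_unit[OF that, of \<a>] by (simp add: w_def unit_list_def)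
	have w\<a>: "w (\<a> 1) = \<a> 6" "w (\<a> 2) = \<a> 2" "w (\<a> 3) = \<a> 5" "w (\<a> 4) = \<a> 4" "w (\<a> 5) = \<a> 3" "w (\<a> 6) = \<a> 1"
		"w (\<a> 7) = - (2 *R \<a> 1 + 2 *R \<a> 2 + 3 *R \<a> 3 + 4 *R \<a> 4 + 3 *R \<a> 5 + 2 *R \<a> 6 + \<a> 7)"
		using img[of 0] img[of 1] img[of 2] img[of 3] img[of 4] img[of 5] img[of 6] unfolding word_images
		by (simp_all add: lincomb_simps nth_Cons_1 One_nat_def[symmetric] algebra_simps)
	have ww: "w (w x) = x" for x
	proof -
		have "(w \<circ> w) x = id x"
		proof (rule linear_eq_on_span[of "w \<circ> w" id "\<a> ` {1..7}"])
			fix x assume "x : \<a> ` {1..7}"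
			then obtain i where "i : {1..7}" "x = \<a> i" by blast
			then show "(w \<circ> w) x = id x"
				using seven[of i] by (auto simp: w\<a> linear_diff[OF lin] linear_neg[OF lin] linear_add[OF lin] linear_scale[OF lin] algebra_simps)
		qed (auto simp: linear_compose lin linear_id[unfolded id_def] id_def span)
		then show ?thesis by simp
	qed
	have fo: "0 < (2::nat)" "w ^^ 2 = id" using ww by (auto simp: fun_eq_iff numeral_2_eq_2)
	have "\<a> 1 ~= \<a> 6" using inj_onD[OF inj', of 1 6] by auto
	then have order: "map_order w = 2" by (intro map_order_involution[OF ww, of "\<a> 1"]) (simp add: w\<a>)
	have om: "omega 7 \<Phi> \<a> 7 = w"
	proof (rule omega_eqI[OF rs s _ w])
		fix i :: nat assume i: "i : {1..7}"
		show "(EX k:{1..7} - {7}. w (\<a> i) = \<a> k) | - w (\<a> i) - \<a> 7 : nat_cone 7 \<a>"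
		proof (cases "i = 7")
			case True
			have "- w (\<a> i) - \<a> 7 = lincomb \<a> [2,2,3,4,3,2,0]"
				unfolding True w\<a> by (simp add: lincomb_simps algebra_simps)
			also have "\<dots> : nat_cone 7 \<a>" by (rule lincomb_in_cone) auto
			finally show ?thesis by blast
		next
			case False
			have "1 : {1..7::nat} - {7}" "2 : {1..7::nat} - {7}" "3 : {1..7::nat} - {7}" "4 : {1..7::nat} - {7}"
				"5 : {1..7::nat} - {7}" "6 : {1..7::nat} - {7}" by auto
			then show ?thesis using seven[OF i] False w\<a> by metis
		qed
	qed simp
	define b where "b i = (if i = 1 then \<a> 2 else if i = 2 then \<a> 4 else if i = 3 then (1 / 2) *R (\<a> 3 + \<a> 5)
		else (1 / 2) *R (\<a> 1 + \<a> 6))" for i :: nat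
	define b' where "b' i = (if i = 1 then \<a> 1 + \<a> 6 else if i = 2 then \<a> 3 + \<a> 5 else if i = 3 then \<a> 4 else \<a> 2)" for i :: nat
	have b: "b 1 = \<a> 2" "b 2 = \<a> 4" "b 3 = (1 / 2) *R (\<a> 3 + \<a> 5)" "b 4 = (1 / 2) *R (\<a> 1 + \<a> 6)"
		and b': "b' 1 = \<a> 1 + \<a> 6" "b' 2 = \<a> 3 + \<a> 5" "b' 3 = \<a> 4" "b' 4 = \<a> 2"
		by (simp_all add: b_def b'_def)
	have four: "i = 1 | i = 2 | i = 3 | i = 4" if "i : {1..4}" for i :: nat
		using that unfolding atLeastAtMost_iff by linarith
	have bg: "b (Suc i) \<bullet> b (Suc k) = N / 2 * of_int (gram_F4 ! i ! k)" "b' (Suc i) \<bullet> b' (Suc k) = N * of_int (gram_F4 ! i ! k)"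
		if "i < type_rank Type_F4" "k < type_rank Type_F4" for i k
	proof -
		have "i = 0 | i = 1 | i = 2 | i = 3" "k = 0 | k = 1 | k = 2 | k = 3" using that by auto
		then show "b (Suc i) \<bullet> b (Suc k) = N / 2 * of_int (gram_F4 ! i ! k)" "b' (Suc i) \<bullet> b' (Suc k) = N * of_int (gram_F4 ! i ! k)"
			by (elim disjE; simp add: b b' gram_F4_def g nth_Cons_1 One_nat_def[symmetric] inner_add_left inner_add_right)+
	qed
	have bb: "cartan_integer (b i) (b k) = of_int (cartan_matrix Type_F4 i k)"
		"cartan_integer (b' i) (b' k) = of_int (cartan_matrix Type_F4 i k)"
		if "i : {1..type_rank Type_F4}" "k : {1..type_rank Type_F4}" for i k
		using gram_cartan[OF _ bg(1) gram_F4_cartan that] gram_cartan[OF _ bg(2) gram_F4_cartan that] N by simp_all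
	have "EX d. ALL k::nat. ALL i:{1..7}. \<a> i \<bullet> d k = (if k = 1 then (if i = 2 then 1 else 0) else if k = 2 then (if i = 4 then 1 else 0)
			else if k = 3 then (if i = 3 then 2 else 0) else (if i = 1 then 2 else 0))"
		by (intro choice allI exists_prescribed_coordinates[OF inj' indep'])
	then obtain d :: "nat => 'a" where d: "!!k i. i : {1..7} ==> \<a> i \<bullet> d k = (if k = 1 then (if i = 2 then 1 else 0) else if k = 2 then (if i = 4 then 1 else 0)
			else if k = 3 then (if i = 3 then 2 else 0) else (if i = 1 then 2 else 0))" by blast
	define d' where "d' k = (if k = 1 then (1 / 2) *R d 4 else if k = 2 then (1 / 2) *R d 3 else if k = 3 then d 2 else d 1)" for k :: nat
	have bd: "b i \<bullet> d k = (if i = k then 1 else 0)" "b' i \<bullet> d' k = (if i = k then 1 else 0)"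
		if "i : {1..4}" "k : {1..4}" for i k
		using four[OF that(1)] four[OF that(2)]
		by (elim disjE; simp add: b b' d'_def d inner_add_left)+
	have B: "root_list Type_F4 b roots_F4"
		by unfold_locales
			(use closed_roots(3) bb(1) dual_family_independent[of "{1..4}" b d, OF bd(1)] in simp_all)
	have B': "root_list Type_F4 b' roots_F4"
		by unfold_locales
			(use closed_roots(3) bb(2) dual_family_independent[of "{1..4}" b' d', OF bd(2)] in simp_all)
	let ?A = "[[0,1,0,0,0,0,-1], [0,0,0,1,0,0,-2], [0,0,1,0,1,0,-3], [1,0,0,0,0,1,-2]] :: int list list"
	let ?r = "[0,0,0,0,0,0,1] :: int list"
	have fixed: "w y = y <-> \<a> 6 \<bullet> y = \<a> 1 \<bullet> y & \<a> 5 \<bullet> y = \<a> 3 \<bullet> y &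
			\<a> 1 \<bullet> y * 4 + 2 * (\<a> 2 \<bullet> y) + 6 * (\<a> 3 \<bullet> y) + 4 * (\<a> 4 \<bullet> y) + 2 * (\<a> 7 \<bullet> y) = 0" for y
	proof -
		have "{1..7::nat} = {1,2,3,4,5,6,7}" using seven by auto
		then show ?thesis
			unfolding fixed_iff_inner[OF orth span] by (auto simp: w\<a> inner_add_left inner_diff_left)
	qed
	have F4_length: "ALL d:set roots_F4. length d = 4" by (simp add: roots_F4_def)
	have length4: "EX x1 x2 x3 x4. d = [x1, x2, x3, x4]" if "d : set roots_F4" for d
		using F4_length that by (auto simp: length_Suc_conv numeral_eq_Suc)
	interpret list_folding "Type_E 7" Type_F4 Type_F4 \<a> b b' roots_E7 roots_F4 roots_F4 \<Phi> w 2 ?A ?r dual_scale_F4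
	proof (intro list_folding.intro list_folding_axioms.intro R(1) B B' R(3) R(2) orth fo folds_E7)
		show "\<a> (Suc k) \<bullet> y = lincomb b (map (%a. a ! k) ?A) \<bullet> y" if y: "w y = y" and k: "k < type_rank (Type_E 7)" for y k
		proof -
			have "k = 0 | k = 1 | k = 2 | k = 3 | k = 4 | k = 5 | k = 6" using k by auto
			then show ?thesis using y unfolding fixed
				by (elim disjE) (simp_all add: lincomb_simps b nth_Cons_1 inner_add_left inner_diff_left One_nat_def[symmetric])
		qed
		show "w (b i) = b i" if "i : {1..type_rank Type_F4}" for i
			using four[of i] that by (auto simp: b w\<a> linear_add[OF lin] linear_scale[OF lin] add.commute)
		have "(%d. of_int (dual_scale_F4 d) *R lincomb b d) ` set roots_F4 = lincomb b ` set (map (%d. map ((*) (dual_scale_F4 d)) d) roots_F4)"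
			by (simp add: image_image lincomb_scale)
		also have "\<dots> = lincomb b' ` set roots_F4"
			unfolding dual_F4(1) unfolding set_map image_image
		proof (intro image_cong refl)
			fix d assume "d : set roots_F4"
			then obtain x1 x2 x3 x4 where "d = [x1, x2, x3, x4]" using length4 by blast
			then show "lincomb b [d ! 3, d ! 2,2 * d ! 1,2 * d ! 0] = lincomb b' d"
				by (simp add: lincomb_simps b b' nth_Cons_1 algebra_simps)
		qed
		finally show "(%d. of_int (dual_scale_F4 d) *R lincomb b d) ` set roots_F4 = lincomb b' ` set roots_F4" .
	qed auto
	have norm: "\<beta> \<bullet> \<beta> = 2 * N" if "\<beta> : \<Phi>" for \<beta>
		by (rule A.root_norm) (use that R(2) gram in \<open>auto simp: simply_laced_matrix_def\<close>)
	have dual_norm: "lincomb b d \<bullet> lincomb b d * of_int (dual_scale_F4 d) = 2 * N" if d: "d : set roots_F4" for d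
	proof -
		have "lincomb b d \<bullet> lincomb b d = N / 2 * of_int (quadratic_form gram_F4 d)"
			by (rule lincomb_norm[where n = "type_rank Type_F4"]) (use bg(1) d F4_length in \<open>auto simp: gram_F4_def\<close>)
		then have "lincomb b d \<bullet> lincomb b d * of_int (dual_scale_F4 d) = N / 2 * of_int (quadratic_form gram_F4 d * dual_scale_F4 d)" by simp
		then show ?thesis using dual_F4(2) d by simp
	qed
	have dual_roots: "dual_roots \<Phi> (folded_roots \<Phi> w) = B'.roots" by (rule dual_eq[OF N norm dual_norm])
	have span_b': "fixed_space w = span (b' ` {1..4})"
	proof -
		have e: "b' 1 = 2 *R b 4" "b' 2 = 2 *R b 3" "b' 3 = 1 *R b 2" "b' 4 = 1 *R b 1"
			and e': "b 1 = 1 *R b' 4" "b 2 = 1 *R b' 3" "b 3 = (1 / 2) *R b' 2" "b 4 = (1 / 2) *R b' 1"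
			by (simp_all add: b b')
		have sc: "x *R b i : span (b ` {1..4})" "x *R b' i : span (b' ` {1..4})" if "i : {1..4}" for x i
			using that by (auto intro!: span_scale intro: span_base)
		have "b' i : span (b ` {1..4})" "b i : span (b' ` {1..4})" if i: "i : {1..4}" for i
		proof -
			show "b' i : span (b ` {1..4})" using four[OF i] by (elim disjE) (simp_all only: e, (rule sc(1), simp)+)
			show "b i : span (b' ` {1..4})" using four[OF i] by (elim disjE) (simp_all only: e', (rule sc(2), simp)+)
		qed
		then have "span (b ` {1..4}) = span (b' ` {1..4})" unfolding span_eq by blast
		then show ?thesis using fixed_span by simp
	qed
	obtain p where p: "!!i. i : {1..7} ==> \<a> i \<bullet> p = (if i = 7 then 1 / 2 else 0)"
		using exists_prescribed_coordinates[OF inj' indep', of "%i. if i = 7 then 1 / 2 else 0"] by blast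
	have Z: "z : coweights \<Phi> <-> \<a> 1 \<bullet> z : Ints & \<a> 2 \<bullet> z : Ints & \<a> 3 \<bullet> z : Ints & \<a> 4 \<bullet> z : Ints &
			\<a> 5 \<bullet> z : Ints & \<a> 6 \<bullet> z : Ints & \<a> 7 \<bullet> z : Ints" for z
	proof -
		have "{1..7::nat} = {1,2,3,4,5,6,7}" using seven by auto
		then show ?thesis unfolding R(2) A.lattice_iff by simp
	qed
	have disp: "\<a> 6 \<bullet> (t - w t) = \<a> 6 \<bullet> t - \<a> 1 \<bullet> t" "\<a> 1 \<bullet> (t - w t) = \<a> 1 \<bullet> t - \<a> 6 \<bullet> t"
		"\<a> 5 \<bullet> (t - w t) = \<a> 5 \<bullet> t - \<a> 3 \<bullet> t" "\<a> 3 \<bullet> (t - w t) = \<a> 3 \<bullet> t - \<a> 5 \<bullet> t"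
		"\<a> 2 \<bullet> (t - w t) = 0" "\<a> 4 \<bullet> (t - w t) = 0"
		"w (\<a> 7) \<bullet> (t - w t) = w (\<a> 7) \<bullet> t - \<a> 7 \<bullet> t" for t
		using displacement_inner[OF orth, of "\<a> 1" t] displacement_inner[OF orth, of "\<a> 6" t]
			displacement_inner[OF orth, of "\<a> 3" t] displacement_inner[OF orth, of "\<a> 5" t]
			displacement_inner[OF orth, of "\<a> 2" t] displacement_inner[OF orth, of "\<a> 4" t]
			displacement_inner[OF orth, of "\<a> 7" t] by (simp_all add: w\<a>(1-6))
	have wl: "w (\<a> 7) \<bullet> z = - (2 * (\<a> 1 \<bullet> z) + 2 * (\<a> 2 \<bullet> z) + 3 * (\<a> 3 \<bullet> z) + 4 * (\<a> 4 \<bullet> z) +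
			3 * (\<a> 5 \<bullet> z) + 2 * (\<a> 6 \<bullet> z) + \<a> 7 \<bullet> z)" for z
		by (simp add: w\<a>(7) inner_add_left inner_diff_left)
	define lam where "lam = lincomb \<a> [1,1,2,2,1,1,1]"
	have lam_in: "lam : \<Phi>" unfolding R(2) A.roots_def lam_def by (auto simp: roots_E7_def)
	have lam: "lam \<bullet> z = \<a> 1 \<bullet> z + \<a> 2 \<bullet> z + 2 * (\<a> 3 \<bullet> z) + 2 * (\<a> 4 \<bullet> z) + \<a> 5 \<bullet> z + \<a> 6 \<bullet> z + \<a> 7 \<bullet> z" for z
		by (simp add: lam_def lincomb_simps inner_add_left)
	have "folding_statement \<Phi> (Type_E 7) 7 w"
	proof (rule folding_statementI[OF rs(1) w fo order folding_table.E7 _ _ refl, where p = "%_. p" and lam = lam])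
		show "root_system_of_type (fixed_space w) (folded_roots \<Phi> w) Type_F4"
			unfolding folded fixed_span by (rule B.roots_type) simp
		show "root_system_of_type (fixed_space w) (dual_roots \<Phi> (folded_roots \<Phi> w)) Type_F4"
			unfolding dual_roots span_b' using B'.roots_type by simp
		show "real 2 *R p : coweights \<Phi>" unfolding Z using p by simp
		show "p - w p : coweights \<Phi>"
		proof -
			have "\<a> 7 \<bullet> (p - w p) = 1"
				using disp(7)[of p] disp(1-6)[of p] p by (simp add: wl)
			then show ?thesis unfolding Z disp using p by simp
		qed
		show "lam \<bullet> z : Ints" if "z : coweights \<Phi>" for z
			using that lam_in by (simp add: coweight_lattice_def)
		show "lam \<bullet> y = 0" if "w y = y" for y using that unfolding fixed lam by simp
		show "lam \<bullet> p - real k / real 2 : Ints" if "k : totatives 2" for k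
			using that p by (simp add: totatives_2 lam)
		show "(ALL \<beta>:\<Phi>. \<beta> \<bullet> (p + y) ~: Ints) <-> (ALL \<beta>:dual_roots \<Phi> (folded_roots \<Phi> w). real 1 * (\<beta> \<bullet> y) ~: Ints)"
			if "k : totatives 2" "w y = y" for k y
		proof -
			have "\<a> (Suc i) \<bullet> p = real 1 * of_int (?r ! i) / real 2" if "i < type_rank (Type_E 7)" for i
			proof -
				have "i = 0 | i = 1 | i = 2 | i = 3 | i = 4 | i = 5 | i = 6" using that by auto
				then show ?thesis using p by (elim disjE) (simp_all add: nth_Cons_1 One_nat_def[symmetric])
			qed
			then show ?thesis unfolding dual_roots using regular[of 1 p y] \<open>w y = y\<close> by simp
		qed
		show "EX k:totatives 2. EX e z. w e = e & z : coweights \<Phi> & t = p + e + z"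
			if t: "t - w t : coweights \<Phi>" and reg: "ALL \<beta>:\<Phi>. \<beta> \<bullet> t ~: Ints" for t
		proof -
			let ?a = "%i. \<a> i \<bullet> t"
			have i1: "?a 6 - ?a 1 : Ints" "?a 5 - ?a 3 : Ints" using t unfolding Z disp by blast+
			have i1': "?a 1 - ?a 6 : Ints" "?a 3 - ?a 5 : Ints" using t unfolding Z disp by blast+
			have "w (\<a> 7) \<bullet> (t - w t) : Ints"
				using t unfolding Z wl by (intro Ints_minus Ints_add Ints_mult) auto
			then have "w (\<a> 7) \<bullet> t - ?a 7 : Ints" unfolding disp .
			then have "- (w (\<a> 7) \<bullet> t - ?a 7) + (?a 3 - ?a 5) : Ints" using i1' by (intro Ints_add Ints_minus)
			moreover have "- (w (\<a> 7) \<bullet> t - ?a 7) + (?a 3 - ?a 5) = 2 * (lam \<bullet> t)" by (simp add: wl lam)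
			ultimately have "2 * (lam \<bullet> t) : Ints" by simp
			moreover have "lam \<bullet> t ~: Ints" using reg lam_in by blast
			ultimately have half: "lam \<bullet> t + 1 / 2 : Ints" using half_integer_iff by blast
			obtain e where e: "!!i. i : {1..7} ==> \<a> i \<bullet> e = (if i = 1 | i = 6 then ?a 1 else if i = 3 | i = 5 then ?a 3
					else if i = 4 then ?a 4 else if i = 7 then ?a 7 - 1 / 2 else - (?a 7 - 1 / 2 + 2 * ?a 1 + 3 * ?a 3 + 2 * ?a 4))"
				using exists_prescribed_coordinates[OF inj' indep', of "%i. if i = 1 | i = 6 then ?a 1 else if i = 3 | i = 5 then ?a 3
					else if i = 4 then ?a 4 else if i = 7 then ?a 7 - 1 / 2 else - (?a 7 - 1 / 2 + 2 * ?a 1 + 3 * ?a 3 + 2 * ?a 4)"] by blast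
			have "w e = e" unfolding fixed by (simp add: e)
			moreover have "t - p - e : coweights \<Phi>"
			proof -
				have "\<a> 2 \<bullet> (t - p - e) = (lam \<bullet> t + 1 / 2) - 1 + (?a 1 - ?a 6) + (?a 3 - ?a 5)"
					by (simp add: lam e p inner_diff_right)
				also have "\<dots> : Ints" by (rule Ints_add[OF Ints_add[OF Ints_diff[OF half Ints_1] i1'(1)] i1'(2)])
				finally show ?thesis unfolding Z using i1 by (simp add: e p inner_diff_right)
			qed
			moreover have "t = p + e + (t - p - e)" by simp
			ultimately show ?thesis by (metis totatives_2 singletonI)
		qed
	qed
	then show ?thesis using om by simp
qed


text \<open>
	The three legs of the extended diagram are rotated.  The fixed node and the average of its
	neighbours form a basis of type \<open>G\<^sub>2\<close>; \<open>p k\<close> is \<open>k /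
	3\<close> times the sum of the first and the last fundamental coweight.
\<close>

lemma folding_statement_E6:
	assumes rs: "root_system_in UNIV \<Phi>" "reduced_roots \<Phi>" and bo: "bourbaki_simple_roots (Type_E 6) \<Phi> \<a>" and j: "j : {1,6}"
	shows "folding_statement \<Phi> (Type_E 6) j (omega 6 \<Phi> \<a> 6)"
proof -
	note R = root_list_of_type[OF rs bo closed_roots(1)]
	interpret A: root_list "Type_E 6" \<a> roots_E6 by (rule R(1))
	have s: "simple_roots 6 \<Phi> \<a>" using bo by (simp add: bourbaki_simple_roots_def)
	define N where "N = \<a> 4 \<bullet> \<a> 4 / 2"
	have N: "0 < N" using bourbaki_nonzero(1)[OF rs(1) bo, of 4] by (simp add: N_def)
	have gram: "\<a> i \<bullet> \<a> k = N * of_int (cartan_matrix (Type_E 6) i k)" if "i : {1..6}" "k : {1..6}" for i k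
		unfolding N_def by (rule type_E_gram[OF rs(1) bo _ that]) simp
	have g: "\<a> i \<bullet> \<a> k = N * of_int ([[2,0,-1,0,0,0], [0,2,0,-1,0,0], [-1,0,2,-1,0,0], [0,-1,-1,2,-1,0], [0,0,0,-1,2,-1], [0,0,0,0,-1,2]] ! (k - 1) ! (i - 1))"
		if "i : {1..6}" "k : {1..6}" for i k
		using gram[OF that] cartan_columns_nth[of i "Type_E 6" k] that unfolding cartan_columns type_rank.simps by metis
	note inj' = A.inj[simplified] and indep' = A.indep[simplified]
	have span: "span (\<a> ` {1..6}) = UNIV" using R(3) by simp
	have six: "i = 1 | i = 2 | i = 3 | i = 4 | i = 5 | i = 6" if "i : {1..6}" for i :: nat
		using that unfolding atLeastAtMost_iff by linarith
	define w where "w = reflection_word (map (%k. \<a> (Suc k)) word_E6)"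
	have ks: "set word_E6 \<subseteq> {..<type_rank (Type_E 6)}" by (simp add: word_E6_def)
	have wG: "w : reflection_group (\<a> ` {1..6})" using A.word_in_group[OF ks] by (simp add: w_def)
	have w: "w : weyl_group \<Phi>" by (rule reflection_group_mono[OF _ wG]) (use s in \<open>simp add: simple_roots_def\<close>)
	have orth: "orthogonal_transformation w" by (rule reflection_group_orthogonal[OF w])
	have lin: "linear w" using orth by (rule orthogonal_transformation_linear)
	have img: "w (\<a> (Suc k)) = lincomb \<a> (map (%k. foldr (list_reflect (cartan_columns (Type_E 6))) word_E6 (unit_list 6 k)) [0..<6] ! k)"
		if "k < 6" for k
		using A.word_lincomb(1)[of "unit_list 6 k", OF _ ks] that lincomb_unit[OF that, of \<a>] by (simp add: w_def unit_list_def)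
	have w\<a>: "w (\<a> 2) = \<a> 5" "w (\<a> 3) = \<a> 2" "w (\<a> 4) = \<a> 4" "w (\<a> 5) = \<a> 3" "w (\<a> 6) = \<a> 1"
		"w (\<a> 1) = - (\<a> 1 + 2 *R \<a> 2 + 2 *R \<a> 3 + 3 *R \<a> 4 + 2 *R \<a> 5 + \<a> 6)"
		using img[of 0] img[of 1] img[of 2] img[of 3] img[of 4] img[of 5] unfolding word_images
		by (simp_all add: lincomb_simps nth_Cons_1 One_nat_def[symmetric] algebra_simps)
	have www: "w (w (w x)) = x" for x
	proof -
		have "(w \<circ> (w \<circ> w)) x = id x"
		proof (rule linear_eq_on_span[of "w \<circ> (w \<circ> w)" id "\<a> ` {1..6}"])
			fix x assume "x : \<a> ` {1..6}"
			then obtain i where "i : {1..6}" "x = \<a> i" by blast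
			then show "(w \<circ> (w \<circ> w)) x = id x"
				using six[of i] by (auto simp: w\<a> linear_diff[OF lin] linear_neg[OF lin] linear_add[OF lin] linear_scale[OF lin] algebra_simps)
		qed (auto simp: linear_compose lin linear_id[unfolded id_def] id_def span)
		then show ?thesis by simp
	qed
	have pow: "(w ^^ 2) x = w (w x)" "(w ^^ 3) x = w (w (w x))" for x
		unfolding numeral_2_eq_2 numeral_3_eq_3 funpow.simps by simp_all
	have fo: "0 < (3::nat)" "w ^^ 3 = id" using www pow by (auto simp: fun_eq_iff)
	have ne: "\<a> 5 ~= \<a> 3" "\<a> 5 ~= \<a> 2" using inj_onD[OF inj', of 5 3] inj_onD[OF inj', of 5 2] by auto
	have order: "map_order w = 3"
	proof (rule map_order_eqI[OF fo])
		fix k :: nat assume "0 < k" "k < 3"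
		then have "k = 1 | k = 2" by linarith
		then have "(w ^^ k) (\<a> 5) ~= \<a> 5" using pow(1) w\<a> ne by (auto simp: One_nat_def)
		then show "w ^^ k ~= id" by auto
	qed
	have om: "omega 6 \<Phi> \<a> 6 = w"
	proof (rule omega_eqI[OF rs s _ w])
		fix i :: nat assume i: "i : {1..6}"
		show "(EX k:{1..6} - {6}. w (\<a> i) = \<a> k) | - w (\<a> i) - \<a> 6 : nat_cone 6 \<a>"
		proof (cases "i = 1")
			case True
			have "- w (\<a> i) - \<a> 6 = lincomb \<a> [1,2,2,3,2,0]"
				unfolding True w\<a> by (simp add: lincomb_simps algebra_simps)
			also have "\<dots> : nat_cone 6 \<a>" by (rule lincomb_in_cone) auto
			finally show ?thesis by blast
		next
			case False
			have "1 : {1..6::nat} - {6}" "2 : {1..6::nat} - {6}" "3 : {1..6::nat} - {6}" "4 : {1..6::nat} - {6}"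
				"5 : {1..6::nat} - {6}" by auto
			then show ?thesis using six[OF i] False w\<a> by metis
		qed
	qed simp
	define b where "b i = (if i = 1 then (1 / 3) *R (\<a> 2 + \<a> 3 + \<a> 5) else \<a> 4)" for i :: nat
	define b' where "b' i = (if i = 1 then \<a> 4 else \<a> 2 + \<a> 3 + \<a> 5)" for i :: nat
	have b: "b 1 = (1 / 3) *R (\<a> 2 + \<a> 3 + \<a> 5)" "b 2 = \<a> 4" and b': "b' 1 = \<a> 4" "b' 2 = \<a> 2 + \<a> 3 + \<a> 5"
		by (simp_all add: b_def b'_def)
	have two: "i = 1 | i = 2" if "i : {1..2}" for i :: nat
		using that unfolding atLeastAtMost_iff by linarith
	have bg: "b (Suc i) \<bullet> b (Suc k) = N / 3 * of_int (gram_G2 ! i ! k)" "b' (Suc i) \<bullet> b' (Suc k) = N * of_int (gram_G2 ! i ! k)"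
		if "i < type_rank Type_G2" "k < type_rank Type_G2" for i k
	proof -
		have "i = 0 | i = 1" "k = 0 | k = 1" using that by auto
		then show "b (Suc i) \<bullet> b (Suc k) = N / 3 * of_int (gram_G2 ! i ! k)" "b' (Suc i) \<bullet> b' (Suc k) = N * of_int (gram_G2 ! i ! k)"
			by (elim disjE; simp add: b b' gram_G2_def g nth_Cons_1 One_nat_def[symmetric] inner_add_left inner_add_right)+
	qed
	have bb: "cartan_integer (b i) (b k) = of_int (cartan_matrix Type_G2 i k)"
		"cartan_integer (b' i) (b' k) = of_int (cartan_matrix Type_G2 i k)"
		if "i : {1..type_rank Type_G2}" "k : {1..type_rank Type_G2}" for i k
		using gram_cartan[OF _ bg(1) gram_G2_cartan that] gram_cartan[OF _ bg(2) gram_G2_cartan that] N by simp_all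
	have "EX d. ALL k::nat. ALL i:{1..6}. \<a> i \<bullet> d k = (if k = 1 then (if i = 2 then 3 else 0) else (if i = 4 then 1 else 0))"
		by (intro choice allI exists_prescribed_coordinates[OF inj' indep'])
	then obtain d :: "nat => 'a" where d: "!!k i. i : {1..6} ==> \<a> i \<bullet> d k = (if k = 1 then (if i = 2 then 3 else 0) else (if i = 4 then 1 else 0))"
		by blast
	define d' where "d' k = (if k = 1 then d 2 else (1 / 3) *R d 1)" for k :: nat
	have bd: "b i \<bullet> d k = (if i = k then 1 else 0)" "b' i \<bullet> d' k = (if i = k then 1 else 0)"
		if "i : {1..2}" "k : {1..2}" for i k
		using two[OF that(1)] two[OF that(2)]
		by (elim disjE; simp add: b b' d'_def d inner_add_left)+
	have B: "root_list Type_G2 b roots_G2"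
		by unfold_locales
			(use closed_roots(4) bb(1) dual_family_independent[of "{1..2}" b d, OF bd(1)] in simp_all)
	have B': "root_list Type_G2 b' roots_G2"
		by unfold_locales
			(use closed_roots(4) bb(2) dual_family_independent[of "{1..2}" b' d', OF bd(2)] in simp_all)
	let ?A = "[[-2,1,1,0,1,-2], [-1,0,0,1,0,-1]] :: int list list"
	let ?r = "[1,0,0,0,0,1] :: int list"
	have wl: "w (\<a> 1) \<bullet> z = - (\<a> 1 \<bullet> z + 2 * (\<a> 2 \<bullet> z) + 2 * (\<a> 3 \<bullet> z) + 3 * (\<a> 4 \<bullet> z) +
			2 * (\<a> 5 \<bullet> z) + \<a> 6 \<bullet> z)" for z
		by (simp add: w\<a>(6) inner_add_left inner_diff_left)
	have fixed: "w y = y <-> \<a> 6 \<bullet> y = \<a> 1 \<bullet> y & \<a> 3 \<bullet> y = \<a> 2 \<bullet> y & \<a> 5 \<bullet> y = \<a> 2 \<bullet> y &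
			\<a> 1 \<bullet> y + 2 * (\<a> 2 \<bullet> y) + \<a> 4 \<bullet> y = 0" for y
	proof -
		have "{1..6::nat} = {1,2,3,4,5,6}" using six by auto
		then have "w y = y <-> w (\<a> 1) \<bullet> y = \<a> 1 \<bullet> y & w (\<a> 2) \<bullet> y = \<a> 2 \<bullet> y & w (\<a> 3) \<bullet> y = \<a> 3 \<bullet> y &
				w (\<a> 4) \<bullet> y = \<a> 4 \<bullet> y & w (\<a> 5) \<bullet> y = \<a> 5 \<bullet> y & w (\<a> 6) \<bullet> y = \<a> 6 \<bullet> y"
			unfolding fixed_iff_inner[OF orth span] by (simp only: image_insert image_empty ball_simps simp_thms)
		then show ?thesis unfolding wl w\<a>(1-5) by (simp only:) (intro iffI conjI; elim conjE; linarith)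
	qed
	have G2_length: "ALL d:set roots_G2. length d = 2" by (simp add: roots_G2_def)
	have length2: "EX x1 x2. d = [x1, x2]" if "d : set roots_G2" for d
		using G2_length that by (auto simp: length_Suc_conv numeral_eq_Suc)
	interpret list_folding "Type_E 6" Type_G2 Type_G2 \<a> b b' roots_E6 roots_G2 roots_G2 \<Phi> w 3 ?A ?r dual_scale_G2
	proof (intro list_folding.intro list_folding_axioms.intro R(1) B B' R(3) R(2) orth fo folds_E6)
		show "\<a> (Suc k) \<bullet> y = lincomb b (map (%a. a ! k) ?A) \<bullet> y" if y: "w y = y" and k: "k < type_rank (Type_E 6)" for y k
		proof -
			have "k = 0 | k = 1 | k = 2 | k = 3 | k = 4 | k = 5" using k by auto
			then show ?thesis using y unfolding fixed
				by (elim disjE) (simp_all add: lincomb_simps b nth_Cons_1 inner_add_left inner_diff_left One_nat_def[symmetric])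
		qed
		show "w (b i) = b i" if "i : {1..type_rank Type_G2}" for i
			using two[of i] that by (auto simp: b w\<a> linear_add[OF lin] linear_scale[OF lin] add.commute)
		have "(%d. of_int (dual_scale_G2 d) *R lincomb b d) ` set roots_G2 = lincomb b ` set (map (%d. map ((*) (dual_scale_G2 d)) d) roots_G2)"
			by (simp add: image_image lincomb_scale)
		also have "\<dots> = lincomb b' ` set roots_G2"
			unfolding dual_G2(1) unfolding set_map image_image
		proof (intro image_cong refl)
			fix d assume "d : set roots_G2"
			then obtain x1 x2 where "d = [x1, x2]" using length2 by blast
			then show "lincomb b [3 * d ! 1, d ! 0] = lincomb b' d"
				by (simp add: lincomb_simps b b' nth_Cons_1 algebra_simps)
		qed
		finally show "(%d. of_int (dual_scale_G2 d) *R lincomb b d) ` set roots_G2 = lincomb b' ` set roots_G2" .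
	qed auto
	have norm: "\<beta> \<bullet> \<beta> = 2 * N" if "\<beta> : \<Phi>" for \<beta>
		by (rule A.root_norm) (use that R(2) gram in \<open>auto simp: simply_laced_matrix_def\<close>)
	have dual_norm: "lincomb b d \<bullet> lincomb b d * of_int (dual_scale_G2 d) = 2 * N" if d: "d : set roots_G2" for d
	proof -
		have "lincomb b d \<bullet> lincomb b d = N / 3 * of_int (quadratic_form gram_G2 d)"
			by (rule lincomb_norm[where n = "type_rank Type_G2"]) (use bg(1) d G2_length in \<open>auto simp: gram_G2_def\<close>)
		then have "lincomb b d \<bullet> lincomb b d * of_int (dual_scale_G2 d) = N / 3 * of_int (quadratic_form gram_G2 d * dual_scale_G2 d)" by simp
		then show ?thesis using dual_G2(2) d by simp
	qed
	have dual_roots: "dual_roots \<Phi> (folded_roots \<Phi> w) = B'.roots" by (rule dual_eq[OF N norm dual_norm])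
	have span_b': "fixed_space w = span (b' ` {1..2})"
	proof -
		have e: "b' 1 = 1 *R b 2" "b' 2 = 3 *R b 1" and e': "b 1 = (1 / 3) *R b' 2" "b 2 = 1 *R b' 1"
			by (simp_all add: b b')
		have sc: "x *R b i : span (b ` {1..2})" "x *R b' i : span (b' ` {1..2})" if "i : {1..2}" for x i
			using that by (auto intro!: span_scale intro: span_base)
		have "b' i : span (b ` {1..2})" "b i : span (b' ` {1..2})" if i: "i : {1..2}" for i
		proof -
			show "b' i : span (b ` {1..2})" using two[OF i] by (elim disjE) (simp_all only: e, (rule sc(1), simp)+)
			show "b i : span (b' ` {1..2})" using two[OF i] by (elim disjE) (simp_all only: e', (rule sc(2), simp)+)
		qed
		then have "span (b ` {1..2}) = span (b' ` {1..2})" unfolding span_eq by blast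
		then show ?thesis using fixed_span by simp
	qed
	have "EX p. ALL k. ALL i:{1..6}. \<a> i \<bullet> p k = (if i = 1 | i = 6 then real k / 3 else 0)"
		by (intro choice allI exists_prescribed_coordinates[OF inj' indep'])
	then obtain p :: "nat => 'a" where p: "!!k i. i : {1..6} ==> \<a> i \<bullet> p k = (if i = 1 | i = 6 then real k / 3 else 0)" by blast
	have Z: "z : coweights \<Phi> <-> \<a> 1 \<bullet> z : Ints & \<a> 2 \<bullet> z : Ints & \<a> 3 \<bullet> z : Ints & \<a> 4 \<bullet> z : Ints &
			\<a> 5 \<bullet> z : Ints & \<a> 6 \<bullet> z : Ints" for z
	proof -
		have "{1..6::nat} = {1,2,3,4,5,6}" using six by auto
		then show ?thesis unfolding R(2) A.lattice_iff by simp
	qed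
	have disp: "\<a> 1 \<bullet> (t - w t) = \<a> 1 \<bullet> t - \<a> 6 \<bullet> t" "\<a> 5 \<bullet> (t - w t) = \<a> 5 \<bullet> t - \<a> 2 \<bullet> t"
		"\<a> 2 \<bullet> (t - w t) = \<a> 2 \<bullet> t - \<a> 3 \<bullet> t" "\<a> 3 \<bullet> (t - w t) = \<a> 3 \<bullet> t - \<a> 5 \<bullet> t" "\<a> 4 \<bullet> (t - w t) = 0"
		"w (\<a> 1) \<bullet> (t - w t) = w (\<a> 1) \<bullet> t - \<a> 1 \<bullet> t" for t
		using displacement_inner[OF orth, of "\<a> 1" t] displacement_inner[OF orth, of "\<a> 6" t]
			displacement_inner[OF orth, of "\<a> 3" t] displacement_inner[OF orth, of "\<a> 5" t]
			displacement_inner[OF orth, of "\<a> 2" t] displacement_inner[OF orth, of "\<a> 4" t] by (simp_all add: w\<a>(1-5))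
	define lam where "lam = lincomb \<a> [1,0,1,1,1,0]"
	have lam_in: "lam : \<Phi>" unfolding R(2) A.roots_def lam_def by (auto simp: roots_E6_def)
	have lam: "lam \<bullet> z = \<a> 1 \<bullet> z + \<a> 3 \<bullet> z + \<a> 4 \<bullet> z + \<a> 5 \<bullet> z" for z
		by (simp add: lam_def lincomb_simps inner_add_left)
	have "folding_statement \<Phi> (Type_E 6) j w"
	proof (rule folding_statementI[OF rs(1) w fo order folding_table.E6[OF j] _ _ refl, where p = p and lam = lam])
		show "root_system_of_type (fixed_space w) (folded_roots \<Phi> w) Type_G2"
			unfolding folded fixed_span by (rule B.roots_type) simp
		show "root_system_of_type (fixed_space w) (dual_roots \<Phi> (folded_roots \<Phi> w)) Type_G2"
			unfolding dual_roots span_b' using B'.roots_type by simp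
		show "real 3 *R p k : coweights \<Phi>" for k unfolding Z using p by simp
		show "p k - w (p k) : coweights \<Phi>" for k
		proof -
			have "\<a> 6 \<bullet> (p k - w (p k)) = real k"
				using disp(6)[of "p k"] disp(1-5)[of "p k"] p by (simp add: wl)
			then show ?thesis unfolding Z disp using p by simp
		qed
		show "lam \<bullet> z : Ints" if "z : coweights \<Phi>" for z
			using that lam_in by (simp add: coweight_lattice_def)
		show "lam \<bullet> y = 0" if "w y = y" for y using that unfolding fixed lam by simp
		show "lam \<bullet> p k - real k / real 3 : Ints" for k
			using p by (simp add: lam)
		show "(ALL \<beta>:\<Phi>. \<beta> \<bullet> (p k + y) ~: Ints) <-> (ALL \<beta>:dual_roots \<Phi> (folded_roots \<Phi> w). real 1 * (\<beta> \<bullet> y) ~: Ints)"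
			if "k : totatives 3" "w y = y" for k y
		proof -
			have "\<a> (Suc i) \<bullet> p k = real k * of_int (?r ! i) / real 3" if "i < type_rank (Type_E 6)" for i
			proof -
				have "i = 0 | i = 1 | i = 2 | i = 3 | i = 4 | i = 5" using that by auto
				then show ?thesis using p by (elim disjE) (simp_all add: nth_Cons_1 One_nat_def[symmetric])
			qed
			then show ?thesis unfolding dual_roots using regular[of k "p k" y] \<open>w y = y\<close> \<open>k : totatives 3\<close> by (simp add: totatives_def)
		qed
		show "EX k:totatives 3. EX e z. w e = e & z : coweights \<Phi> & t = p k + e + z"
			if t: "t - w t : coweights \<Phi>" and reg: "ALL \<beta>:\<Phi>. \<beta> \<bullet> t ~: Ints" for t
		proof -
			let ?a = "%i. \<a> i \<bullet> t"
			have i1: "?a 1 - ?a 6 : Ints" "?a 5 - ?a 2 : Ints" "?a 2 - ?a 3 : Ints" "?a 3 - ?a 5 : Ints"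
				using t unfolding Z disp by blast+
			have "w (\<a> 1) \<bullet> (t - w t) : Ints"
				using t unfolding Z wl by (intro Ints_minus Ints_add Ints_mult) auto
			then have "w (\<a> 1) \<bullet> t - ?a 1 : Ints" unfolding disp .
			note wi = this
			have "- (w (\<a> 1) \<bullet> t - ?a 1) + (?a 1 - ?a 6) + (?a 5 - ?a 2) - (?a 2 - ?a 3) : Ints"
				by (rule Ints_diff[OF Ints_add[OF Ints_add[OF Ints_minus[OF wi] i1(1)] i1(2)] i1(3)])
			moreover have "- (w (\<a> 1) \<bullet> t - ?a 1) + (?a 1 - ?a 6) + (?a 5 - ?a 2) - (?a 2 - ?a 3) = 3 * (lam \<bullet> t)"
				by (simp add: wl lam)
			ultimately have "3 * (lam \<bullet> t) : Ints" by simp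
			moreover have "lam \<bullet> t ~: Ints" using reg lam_in by blast
			ultimately have "EX k:{1,2::nat}. lam \<bullet> t - real k / 3 : Ints" by (rule third_integer_cases)
			then obtain k :: nat where k: "k : {1,2}" "lam \<bullet> t - real k / 3 : Ints" by (rule bexE)
			obtain e where e: "!!i. i : {1..6} ==> \<a> i \<bullet> e = (if i = 1 | i = 6 then ?a 1 - real k / 3
					else if i = 4 then - (?a 1 - real k / 3 + 2 * ?a 3) else ?a 3)"
				using exists_prescribed_coordinates[OF inj' indep', of "%i. if i = 1 | i = 6 then ?a 1 - real k / 3
					else if i = 4 then - (?a 1 - real k / 3 + 2 * ?a 3) else ?a 3"] by blast
			have "w e = e" unfolding fixed by (simp add: e)
			moreover have "t - p k - e : coweights \<Phi>"
			proof -
				have "\<a> 4 \<bullet> (t - p k - e) = (lam \<bullet> t - real k / 3) + (?a 3 - ?a 5)"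
					by (simp add: lam e p inner_diff_right)
				also have "\<dots> : Ints" using k(2) i1(4) by (rule Ints_add)
				finally have "\<a> 4 \<bullet> (t - p k - e) : Ints" .
				moreover have "\<a> 6 \<bullet> (t - p k - e) = - (?a 1 - ?a 6)" "\<a> 5 \<bullet> (t - p k - e) = - (?a 3 - ?a 5)"
					by (simp_all add: e p inner_diff_right)
				ultimately show ?thesis unfolding Z using i1 Ints_minus[OF i1(1)] Ints_minus[OF i1(4)] by (simp add: e p inner_diff_right)
			qed
			moreover have "t = p k + e + (t - p k - e)" by simp
			moreover have "k : totatives 3" using k(1) by (simp add: totatives_3)
			ultimately show ?thesis by blast
		qed
	qed
	then show ?thesis using om by simp
qed

section \<open>Diagram automorphisms\<close>

lemma bourbaki_relabel:
	assumes b: "bourbaki_simple_roots T \<Phi> \<a>" and \<sigma>: "bij_betw \<sigma> {1..type_rank T} {1..type_rank T}"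
		and C: "!!i k. i : {1..type_rank T} ==> k : {1..type_rank T} ==> cartan_matrix T (\<sigma> i) (\<sigma> k) = cartan_matrix T i k"
	shows "bourbaki_simple_roots T \<Phi> (\<a> \<circ> \<sigma>)"
proof -
	let ?I = "{1..type_rank T}"
	have img: "\<sigma> ` ?I = ?I" and inj: "inj_on \<sigma> ?I" using \<sigma> by (auto simp: bij_betw_def)
	have s: "simple_roots (type_rank T) \<Phi> \<a>" using b by (simp add: bourbaki_simple_roots_def)
	have img': "(\<a> \<circ> \<sigma>) ` ?I = \<a> ` ?I" using img by (metis image_comp)
	have sum: "(\<Sum>i\<in>?I. real (c i) *R \<a> i) = (\<Sum>i\<in>?I. real ((c \<circ> \<sigma>) i) *R (\<a> \<circ> \<sigma>) i)" for c :: "nat => nat"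
		using sum.reindex_bij_betw[OF \<sigma>, of "%i. real (c i) *R \<a> i"] by simp
	have "simple_roots (type_rank T) \<Phi> (\<a> \<circ> \<sigma>)"
		unfolding simple_roots_def img'
	proof (intro conjI ballI)
		show "\<a> ` ?I \<subseteq> \<Phi>" "independent (\<a> ` ?I)" using s by (auto simp: simple_roots_def)
		show "inj_on (\<a> \<circ> \<sigma>) ?I" by (rule comp_inj_on[OF inj]) (use s img in \<open>simp add: simple_roots_def\<close>)
		fix \<beta> assume "\<beta> : \<Phi>"
		then obtain c :: "nat => nat" where "\<beta> = (\<Sum>i\<in>?I. real (c i) *R \<a> i) | \<beta> = - (\<Sum>i\<in>?I. real (c i) *R \<a> i)"
			using s unfolding simple_roots_def by blast
		then show "EX c :: nat => nat. \<beta> = (\<Sum>i\<in>?I. real (c i) *R (\<a> \<circ> \<sigma>) i) | \<beta> = - (\<Sum>i\<in>?I. real (c i) *R (\<a> \<circ> \<sigma>) i)"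
			unfolding sum by blast
	qed
	moreover have "\<sigma> i : ?I" if "i : ?I" for i using img that by blast
	ultimately show ?thesis using b C unfolding bourbaki_simple_roots_def by simp
qed

lemma omega_relabel:
	assumes \<sigma>: "bij_betw \<sigma> {1..l} {1..l}" and j: "j : {1..l}"
	shows "omega l \<Phi> (\<a> \<circ> \<sigma>) j = omega l \<Phi> \<a> (\<sigma> j)"
proof -
	have img: "\<sigma> ` {1..l} = {1..l}" and inj: "inj_on \<sigma> {1..l}" using \<sigma> by (auto simp: bij_betw_def)
	have "\<sigma> ` ({1..l} - {j}) = {1..l} - {\<sigma> j}" using inj_on_image_set_diff[OF inj, of "{1..l}" "{j}"] j img by simp
	then have "(\<a> \<circ> \<sigma>) ` ({1..l} - {j}) = \<a> ` ({1..l} - {\<sigma> j})" by (metis image_comp)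
	moreover have "(\<a> \<circ> \<sigma>) ` {1..l} = \<a> ` {1..l}" using img by (metis image_comp)
	moreover have "\<sigma> j : {1..l}" using j img by blast
	then have "j ~= 0" "\<sigma> j ~= 0" using j by auto
	ultimately show ?thesis by (simp add: omega_def Let_def)
qed

lemma bij_betw_involution: "(!!i. i : A ==> \<sigma> i : A & \<sigma> (\<sigma> i) = i) ==> bij_betw \<sigma> A A"
	by (rule bij_betw_byWitness[where f' = \<sigma>]) auto

text \<open>
	Interchange the labels of the two end nodes of the fork.
\<close>

lemma type_D_swap:
	assumes b: "bourbaki_simple_roots (Type_D l) \<Phi> \<a>" and l: "4 <= l"
	obtains \<a>' where "bourbaki_simple_roots (Type_D l) \<Phi> \<a>'" "omega l \<Phi> \<a>' l = omega l \<Phi> \<a> (l - 1)"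
proof -
	define m where "m = l - 2"
	have m: "l = m + 2" "2 <= m" using l by (simp_all add: m_def)
	define \<sigma> where "\<sigma> i = (if i = m + 1 then m + 2 else if i = m + 2 then m + 1 else i)" for i
	have \<sigma>: "bij_betw \<sigma> {1..l} {1..l}" by (rule bij_betw_involution) (auto simp: \<sigma>_def m(1))
	\<comment> \<open>The diagram consists of the path \<open>1, \<dots>, l - 2\<close> and two further nodes joined to its end.\<close>
	define near where "near i k <-> (i <= m & k <= m & k = Suc i) | (i = m & (k = m + 1 | k = m + 2))" for i k
	have edge: "(i, k) : {(i, Suc i) |i. i + 2 <= l} \<union> {(l - 2, l)} <-> near i k" for i k
	proof -
		have "(i, k) : {(i, Suc i) |i. i + 2 <= l} \<union> {(l - 2, l)} <-> (k = Suc i & i <= m) | (i = m & k = m + 2)"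
			using m(1) by auto
		also have "\<dots> <-> near i k"
		proof (cases "i <= m")
			case True
			then consider "i < m" | "i = m" by linarith
			then show ?thesis by cases (auto simp: near_def)
		qed (simp add: near_def)
		finally show ?thesis .
	qed
	have low: "\<sigma> x <= m <-> x <= m" "\<sigma> x = m <-> x = m" "x <= m ==> \<sigma> x = x"
		"\<sigma> x = m + 1 | \<sigma> x = m + 2 <-> x = m + 1 | x = m + 2" for x by (auto simp: \<sigma>_def)
	have near_\<sigma>: "near (\<sigma> i) (\<sigma> k) <-> near i k" for i k
	proof (cases "i <= m & k <= m")
		case True
		then show ?thesis by (simp add: low(3))
	next
		case False
		then have "near (\<sigma> i) (\<sigma> k) <-> \<sigma> i = m & (\<sigma> k = m + 1 | \<sigma> k = m + 2)"
			"near i k <-> i = m & (k = m + 1 | k = m + 2)" using low(1)[of i] low(1)[of k] unfolding near_def by blast+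
		then show ?thesis unfolding low(2,4) by blast
	qed
	have eq: "\<sigma> i = \<sigma> k <-> i = k" if "i : {1..l}" "k : {1..l}" for i k
		using bij_betw_imp_inj_on[OF \<sigma>] that by (meson inj_onD)
	have "bourbaki_simple_roots (Type_D l) \<Phi> (\<a> \<circ> \<sigma>)"
	proof (rule bourbaki_relabel[OF b])
		fix i k assume "i : {1..type_rank (Type_D l)}" "k : {1..type_rank (Type_D l)}"
		then have "\<sigma> i = \<sigma> k <-> i = k" using eq by simp
		then show "cartan_matrix (Type_D l) (\<sigma> i) (\<sigma> k) = cartan_matrix (Type_D l) i k"
			unfolding cartan_matrix.simps simply_laced_matrix_def edge near_\<sigma> by (simp only:)
	qed (use \<sigma> in simp)
	moreover have "\<sigma> l = l - 1" using m by (simp add: \<sigma>_def)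
	then have "omega l \<Phi> (\<a> \<circ> \<sigma>) l = omega l \<Phi> \<a> (l - 1)" using omega_relabel[OF \<sigma>, of l] l by simp
	ultimately show ?thesis using that by blast
qed

text \<open>
	Reflect the diagram.
\<close>

lemma type_E6_swap:
	assumes b: "bourbaki_simple_roots (Type_E 6) \<Phi> \<a>"
	obtains \<a>' where "bourbaki_simple_roots (Type_E 6) \<Phi> \<a>'" "omega 6 \<Phi> \<a>' 6 = omega 6 \<Phi> \<a> 1"
proof -
	define \<sigma> :: "nat => nat" where
		"\<sigma> i = (if i = 1 then 6 else if i = 6 then 1 else if i = 3 then 5 else if i = 5 then 3 else i)" for i
	have \<sigma>: "bij_betw \<sigma> {1..6} {1..6}" by (rule bij_betw_involution) (auto simp: \<sigma>_def)
	have "bourbaki_simple_roots (Type_E 6) \<Phi> (\<a> \<circ> \<sigma>)"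
	proof (rule bourbaki_relabel[OF b])
		fix i k assume "i : {1..type_rank (Type_E 6)}" "k : {1..type_rank (Type_E 6)}"
		then have "1 <= i" "i <= 6" "1 <= k" "k <= 6" by auto
		then have "i = 1 | i = 2 | i = 3 | i = 4 | i = 5 | i = 6" "k = 1 | k = 2 | k = 3 | k = 4 | k = 5 | k = 6" by linarith+
		then show "cartan_matrix (Type_E 6) (\<sigma> i) (\<sigma> k) = cartan_matrix (Type_E 6) i k"
			by (elim disjE; simp add: \<sigma>_def simply_laced_matrix_def)
	qed (use \<sigma> in simp)
	moreover have "omega 6 \<Phi> (\<a> \<circ> \<sigma>) 6 = omega 6 \<Phi> \<a> 1" using omega_relabel[OF \<sigma>, of 6] by (simp add: \<sigma>_def)
	ultimately show ?thesis using that by blast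
qed

section \<open>The theorem\<close>

lemma bourbaki_rank:
	assumes "root_system_in UNIV (\<Phi> :: 'a::euclidean_space set)" "bourbaki_simple_roots T \<Phi> \<a>"
	shows "type_rank T = DIM('a)"
proof -
	let ?S = "\<a> ` {1..type_rank T}"
	have s: "simple_roots (type_rank T) \<Phi> \<a>" using assms(2) by (simp add: bourbaki_simple_roots_def)
	have "(\<Sum>i=1..type_rank T. real (c i) *R \<a> i) : span ?S" for c :: "nat => nat"
		by (rule span_sum, rule span_scale, rule span_base) auto
	then have "x : span ?S" if "x : nat_cone (type_rank T) \<a>" for x
		using that unfolding nat_cone_def by blast
	then have "\<Phi> \<subseteq> span ?S" using simple_roots_cone[OF s] span_neg[of _ ?S] by (metis minus_minus subsetI)
	then have "span ?S = UNIV" using assms(1) span_mono[of \<Phi> "span ?S"] unfolding span_span root_system_in_def by auto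
	then have "DIM('a) = card ?S" using s dim_span[of ?S] dim_eq_card_independent[of ?S] by (simp add: simple_roots_def)
	then show ?thesis using s by (simp add: simple_roots_def card_image)
qed

lemma folding_statement_holds:
	assumes rs: "root_system_in UNIV (\<Phi> :: 'a::euclidean_space set)" "reduced_roots \<Phi>" "irreducible_roots \<Phi>"
		and T: "irreducible_reduced_type T" and b: "bourbaki_simple_roots T \<Phi> \<a>"
		and j: "j : minuscule_indices (type_rank T) \<Phi> \<a> - {0}"
	shows "folding_statement \<Phi> T j (omega (type_rank T) \<Phi> \<a> j)"
proof -
	have jr: "j : {1..type_rank T}" using minuscule_index_range[of j _ \<Phi> \<a>] j by blast
	have coeff: "c ! (j - 1) <= 1"
		if "T = T'" "type_rank T' = n" "k < n" "set ks \<subseteq> {..<n}"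
			"foldr (list_reflect (cartan_columns T')) ks (unit_list n k) = c" "ALL x:set c. 0 <= x" for T' n k ks c
		using minuscule_coefficient_le_one[OF rs b j, of k ks c] that by simp
	show ?thesis
	proof (cases T)
		case (Type_A l)
		then show ?thesis using folding_statement_A[of \<Phi> l \<a> j] rs b jr T by simp
	next
		case (Type_B l)
		then show ?thesis using folding_statement_B[of \<Phi> l \<a> j] rs b j T by simp
	next
		case (Type_C l)
		then show ?thesis using folding_statement_C[of \<Phi> l \<a> j] rs b j T by simp
	next
		case (Type_D l)
		then have l: "4 <= l" and bD: "bourbaki_simple_roots (Type_D l) \<Phi> \<a>" using T b by auto
		have last: "folding_statement \<Phi> (Type_D l) j (omega l \<Phi> \<a>' l)"
			if "bourbaki_simple_roots (Type_D l) \<Phi> \<a>'" "j : {l - 1, l}" for \<a>'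
		proof (cases "even l")
			case True
			then show ?thesis using folding_statement_D_even[of \<Phi> l \<a>' j] rs that l by simp
		next
			case False
			then have "5 <= l" using l by (cases "l = 4") auto
			then show ?thesis using folding_statement_D_odd[of \<Phi> l \<a>' j] rs that False by simp
		qed
		consider "j = 1" | "j = l - 1" | "j = l" using minuscule_D[of \<Phi> l \<a> j] rs bD l j Type_D by auto
		then show ?thesis
		proof cases
			case 1
			then show ?thesis using folding_statement_D_vector[of \<Phi> l \<a>] rs bD l Type_D by simp
		next
			case 2
			obtain \<a>' where "bourbaki_simple_roots (Type_D l) \<Phi> \<a>'" "omega l \<Phi> \<a>' l = omega l \<Phi> \<a> (l - 1)"
				by (rule type_D_swap[OF bD l])
			then show ?thesis using last[of \<a>'] 2 Type_D by simp
		next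
			case 3
			then show ?thesis using last[OF bD] Type_D by simp
		qed
	next
		case (Type_E l)
		then consider "l = 6" | "l = 7" | "l = 8" using T by auto
		then show ?thesis
		proof cases
			case 1
			have "[1,2,2,3,2,1] ! (j - 1) <= (1 :: int)"
				by (rule coeff[OF _ _ _ _ highest_words(1)]) (use 1 Type_E in auto)
			moreover have "j = 1 | j = 2 | j = 3 | j = 4 | j = 5 | j = 6" using jr 1 Type_E by auto
			ultimately have j6: "j = 1 | j = 6" by (auto simp: nth_Cons_1)
			have b6: "bourbaki_simple_roots (Type_E 6) \<Phi> \<a>" using b 1 Type_E by simp
			from j6 show ?thesis
			proof
				assume j1: "j = 1"
				obtain \<a>' where "bourbaki_simple_roots (Type_E 6) \<Phi> \<a>'" "omega 6 \<Phi> \<a>' 6 = omega 6 \<Phi> \<a> 1"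
					by (rule type_E6_swap[OF b6])
				then show ?thesis using folding_statement_E6[of \<Phi> \<a>' j] rs 1 Type_E j1 by simp
			next
				assume "j = 6"
				then show ?thesis using folding_statement_E6[of \<Phi> \<a> j] rs b6 1 Type_E by simp
			qed
		next
			case 2
			have "[2,2,3,4,3,2,1] ! (j - 1) <= (1 :: int)"
				by (rule coeff[OF _ _ _ _ highest_words(2)]) (use 2 Type_E in auto)
			moreover have "j = 1 | j = 2 | j = 3 | j = 4 | j = 5 | j = 6 | j = 7" using jr 2 Type_E by auto
			ultimately have "j = 7" by (auto simp: nth_Cons_1)
			then show ?thesis using folding_statement_E7[of \<Phi> \<a>] rs b 2 Type_E by simp
		next
			case 3
			have "[2,3,4,6,5,4,3,2] ! (j - 1) <= (1 :: int)"
				by (rule coeff[OF _ _ _ _ highest_words(3)]) (use 3 Type_E in auto)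
			moreover have "j = 1 | j = 2 | j = 3 | j = 4 | j = 5 | j = 6 | j = 7 | j = 8" using jr 3 Type_E by auto
			ultimately show ?thesis by (auto simp: nth_Cons_1)
		qed
	next
		case Type_F4
		have "[2,3,4,2] ! (j - 1) <= (1 :: int)"
			by (rule coeff[OF _ _ _ _ highest_words(4)]) (use Type_F4 in auto)
		moreover have "j = 1 | j = 2 | j = 3 | j = 4" using jr Type_F4 by auto
		ultimately show ?thesis by (auto simp: nth_Cons_1)
	next
		case Type_G2
		have "[3,2] ! (j - 1) <= (1 :: int)"
			by (rule coeff[OF _ _ _ _ highest_words(5)]) (use Type_G2 in auto)
		moreover have "j = 1 | j = 2" using jr Type_G2 by auto
		ultimately show ?thesis by (auto simp: nth_Cons_1)
	qed (use T in auto)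
qed

theorem theorem1p2:
  fixes \<Phi> :: "'a::euclidean_space set" and \<alpha> :: "nat \<Rightarrow> 'a" and T :: root_type
    and l j :: nat and \<omega> :: "'a \<Rightarrow> 'a" and \<Psi> M :: "'a set"
  assumes "root_system_in UNIV \<Phi>" and "reduced_roots \<Phi>" and "irreducible_roots \<Phi>"
    and "l = DIM('a)"
    and "irreducible_reduced_type T" and "bourbaki_simple_roots T \<Phi> \<alpha>"
    and "j \<in> minuscule_indices l \<Phi> \<alpha> - {0}"
    and "\<omega> = omega l \<Phi> \<alpha> j"
    and "\<Psi> = folded_roots \<Phi> \<omega>"
    and "M = coweight_lattice (fixed_space \<omega>) \<Psi>"
  shows "\<exists>T\<^sub>r\<^sub>e \<Phi>' T' d.
    folding_table \<Phi> \<Psi> (map_order \<omega>) T j T\<^sub>r\<^sub>e \<Phi>' T' d \<and>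
    root_system_of_type (fixed_space \<omega>) \<Psi> T\<^sub>r\<^sub>e \<and>
    root_system_of_type (fixed_space \<omega>) \<Phi>' T' \<and>
    (\<forall>q>0. int (perm_character \<Phi> q \<omega>) =
       c_factor (map_order \<omega>) q * int (chi_quasi (scaled (real d) \<Phi>') M q))"
proof -
  have "l = type_rank T" using bourbaki_rank assms(1,4,6) by metis
  then have "folding_statement \<Phi> T j \<omega>" using folding_statement_holds assms by blast
  then show ?thesis unfolding folding_statement_def assms(9,10) .
qed

end
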